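(* Let $s>0$ and $m,n\in\mathbf{R}$. (i) If $t\in\mathbf{R}$ and $a\in G^{m,s}$ then $b(x,\xi)=e^{it\langle D_x,D_\xi\rangle}a(x,\xi)\in G^{m,s}$, and the map $a\mapsto b$ is continuous on $G^{m,s}$. (ii) If $a\in G^{m,s}$ and $b\in G^{n,s}$ then the Weyl product satisfies $a\# b\in G^{m+n,s}$, and the Weyl product is continuous as a bilinear map $$\#:G^{m,s}\times G^{n,s}\to G^{m+n,s}.$$
   Context: Set $\mu_s(x,\xi)=1+|x|+|\xi|^{1/s}$ for $s>0$. Anisotropic Shubin symbols: for $s>0$, $m\in\mathbf{R}$, $G^{m,s}$ is the space of $a\in C^\infty(\mathbf{R}^{2d})$ such that for all $\alpha,\beta\in\mathbf{N}^d$ there is $C_{\alpha,\beta}>0$ with $|\partial_x^\alpha\partial_\xi^\beta a(x,\xi)|\leq C_{\alpha,\beta}\,\mu_s(x,\xi)^{m-|\alpha|-s|\beta|}$ for all $(x,\xi)\in\mathbf{R}^{2d}$. It is a Fréchet space with the seminorms, $j\in\mathbf{N}$, $$\|a\|_j=\max_{|\alpha+\beta|\leq j}\ \sup_{(x,\xi)\in\mathbf{R}^{2d}}\mu_s(x,\xi)^{-m+|\alpha|+s|\beta|}\left|\partial_x^\alpha\partial_\xi^\beta a(x,\xi)\right|.$$ The operator $e^{it\langle D_x,D_\xi\rangle}$ is the Fourier multiplier operator on $\mathscr{S}'(\mathbf{R}^{2d})$ with symbol $e^{it\langle x,\xi\rangle}$, that is $e^{it\langle D_x,D_\xi\rangle}a=\mathscr{F}^{-1}(e^{it\langle\cdot,\cdot\rangle}\widehat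 a)$, where $\mathscr{F}f(\zeta)=\widehat f(\zeta)=(2\pi)^{-d}\int_{\mathbf{R}^{2d}}f(z)e^{-i\langle z,\zeta\rangle}\,dz$ on $\mathbf{R}^{2d}$. Weyl quantization: $a^w(x,D)f(x) = (2\pi)^{-d}\int_{\mathbf{R}^{2d}} e^{i\langle x-y,\xi\rangle} a\left(\frac{x+y}{2},\xi\right) f(y)\,dy\,d\xi$ for $f\in\mathscr{S}(\mathbf{R}^d)$ (oscillatory integral); it acts continuously on $\mathscr{S}(\mathbf{R}^d)$ for $a \in G^{m,s}$. The Weyl product $a\# b$ is the symbol corresponding to operator composition: $(a\# b)^w(x,D)=a^w(x,D)\,b^w(x,D)$. *)

theory Defs
  imports "HOL-Analysis.Analysis"
begin

text \<open>
  Phase space is \<open>(real^'d) \<times> (real^'d)\<close>, with points \<open>(x, \<xi>)\<close>; the dimension is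
  \<open>d = CARD('d)\<close>.
\<close>

type_synonym 'd phase = "(real^'d) \<times> (real^'d)"


section \<open>Smooth functions and partial derivatives\<close>

definition dir_deriv :: "'a::euclidean_space \<Rightarrow> ('a \<Rightarrow> complex) \<Rightarrow> 'a \<Rightarrow> complex" where
  "dir_deriv v f = (\<lambda>z. frechet_derivative f (at z) v)"

definition iter_deriv :: "'a::euclidean_space list \<Rightarrow> ('a \<Rightarrow> complex) \<Rightarrow> 'a \<Rightarrow> complex" where
  "iter_deriv vs f = foldr dir_deriv vs f"

primrec C_k :: "nat \<Rightarrow> ('a::euclidean_space \<Rightarrow> complex) \<Rightarrow> bool" where
  "C_k 0 f \<longleftrightarrow> continuous_on UNIV f"
| "C_k (Suc k) f \<longleftrightarrow> (\<forall>z. f differentiable (at z)) \<and> (\<forall>v. C_k k (dir_deriv v f))"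

definition smooth :: "('a::euclidean_space \<Rightarrow> complex) \<Rightarrow> bool" where
  "smooth f \<longleftrightarrow> (\<forall>k. C_k k f)"

text \<open>
  A multi-index is an element of \<open>nat^'d\<close>. The finite type \<open>'d\<close> carries no order, so an
  enumeration of it is fixed in order to write down the iterated partial derivative; for smooth
  functions the derivative does not depend on this choice.
\<close>

definition coords :: "'d::finite list" where
  "coords = (SOME is. distinct is \<and> set is = UNIV)"

definition mi_length :: "nat^'d \<Rightarrow> nat" where
  "mi_length \<alpha> = (\<Sum>i\<in>UNIV. \<alpha> $ i)"

definition partial ::
    "nat^'d \<Rightarrow> nat^'d \<Rightarrow> ('d::finite phase \<Rightarrow> complex) \<Rightarrow> 'd phase \<Rightarrow> complex" where
  "partial \<alpha> \<beta> a =
     iter_deriv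
       (concat (map (\<lambda>i. replicate (\<alpha> $ i) (axis i 1, 0)) coords) @
        concat (map (\<lambda>i. replicate (\<beta> $ i) (0, axis i 1)) coords)) a"


section \<open>Anisotropic Shubin symbols\<close>

definition mu :: "real \<Rightarrow> 'd::finite phase \<Rightarrow> real" where
  "mu s = (\<lambda>(x, \<xi>). 1 + norm x + norm \<xi> powr (1 / s))"

definition shubin :: "real \<Rightarrow> real \<Rightarrow> ('d::finite phase \<Rightarrow> complex) set" where
  "shubin m s =
     {a. smooth a \<and>
         (\<forall>\<alpha> \<beta>. \<exists>C>0. \<forall>z. cmod (partial \<alpha> \<beta> a z)
            \<le> C * mu s z powr (m - real (mi_length \<alpha>) - s * real (mi_length \<beta>)))}"

definition shubin_seminorm ::
    "real \<Rightarrow> real \<Rightarrow> nat \<Rightarrow> ('d::finite phase \<Rightarrow> complex) \<Rightarrow> real" where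
  "shubin_seminorm m s j a =
     Max ((\<lambda>(\<alpha>, \<beta>). SUP z. mu s z powr (- m + real (mi_length \<alpha>) + s * real (mi_length \<beta>))
                              * cmod (partial \<alpha> \<beta> a z))
          ` {(\<alpha>, \<beta>). mi_length (\<alpha> + \<beta>) \<le> j})"

text \<open>
  The locally convex topology of the seminorms, with all balls as a subbase. The carrier of this
  topology is \<open>shubin m s\<close>.
\<close>

definition shubin_topology ::
    "real \<Rightarrow> real \<Rightarrow> ('d::finite phase \<Rightarrow> complex) topology" where
  "shubin_topology m s =
     topology_generated_by
       {{b \<in> shubin m s. shubin_seminorm m s j (\<lambda>z. b z - a z) < r} | a j r.
          a \<in> shubin m s \<and> 0 < r}"


section \<open>Schwartz functions and Fourier multipliers on tempered distributions\<close>

definition schwartz :: "('a::euclidean_space \<Rightarrow> complex) set" where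
  "schwartz =
     {f. smooth f \<and>
         (\<forall>k. \<forall>vs \<in> lists Basis. \<exists>C. \<forall>z. norm z ^ k * cmod (iter_deriv vs f z) \<le> C)}"

definition fourier :: "('d::finite phase \<Rightarrow> complex) \<Rightarrow> 'd phase \<Rightarrow> complex" where
  "fourier f \<zeta> =
     of_real (1 / (2 * pi) ^ CARD('d)) * (LINT z|lborel. f z * cis (- (z \<bullet> \<zeta>)))"

definition inv_fourier :: "('d::finite phase \<Rightarrow> complex) \<Rightarrow> 'd phase \<Rightarrow> complex" where
  "inv_fourier f z =
     of_real (1 / (2 * pi) ^ CARD('d)) * (LINT \<zeta>|lborel. f \<zeta> * cis (z \<bullet> \<zeta>))"

text \<open>
  A tempered distribution is represented by its bilinear pairing \<open>\<phi> \<mapsto> \<langle>u, \<phi>\<rangle>\<close> with Schwartz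
  functions, made \<open>undefined\<close> outside \<open>schwartz\<close>, so that equality of distributions is equality in
  HOL. The operations are the usual transposes and make sense for every functional on \<open>schwartz\<close>;
  they preserve continuity and linearity.
\<close>

type_synonym 'd distr = "('d phase \<Rightarrow> complex) \<Rightarrow> complex"

definition distr_of :: "('d::finite phase \<Rightarrow> complex) \<Rightarrow> 'd distr" where
  "distr_of a = (\<lambda>\<phi>\<in>schwartz. LINT z|lborel. a z * \<phi> z)"

definition fourier_distr :: "'d::finite distr \<Rightarrow> 'd distr" where
  "fourier_distr u = (\<lambda>\<phi>\<in>schwartz. u (fourier \<phi>))"

definition inv_fourier_distr :: "'d::finite distr \<Rightarrow> 'd distr" where
  "inv_fourier_distr u = (\<lambda>\<phi>\<in>schwartz. u (inv_fourier \<phi>))"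

definition mult_distr :: "('d::finite phase \<Rightarrow> complex) \<Rightarrow> 'd distr \<Rightarrow> 'd distr" where
  "mult_distr g u = (\<lambda>\<phi>\<in>schwartz. u (\<lambda>z. g z * \<phi> z))"

definition exp_itD :: "real \<Rightarrow> 'd::finite distr \<Rightarrow> 'd distr" where
  "exp_itD t u = inv_fourier_distr (mult_distr (\<lambda>(x, \<xi>). cis (t * (x \<bullet> \<xi>))) (fourier_distr u))"


section \<open>Weyl quantization and the Weyl product\<close>

text \<open>
  Oscillatory integrals are regularized by an arbitrary Schwartz cutoff in all integration
  variables; the limit must exist and be the same for every cutoff.
\<close>

definition has_osc_integral :: "('a::euclidean_space \<Rightarrow> complex) \<Rightarrow> complex \<Rightarrow> bool" where
  "has_osc_integral F I \<longleftrightarrow>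
     (\<forall>\<psi>\<in>schwartz. \<psi> 0 = 1 \<longrightarrow>
        (\<forall>\<epsilon>>0. integrable lborel (\<lambda>z. \<psi> (\<epsilon> *\<^sub>R z) * F z)) \<and>
        ((\<lambda>\<epsilon>. LINT z|lborel. \<psi> (\<epsilon> *\<^sub>R z) * F z) \<longlongrightarrow> I) (at_right 0))"

definition osc_integral :: "('a::euclidean_space \<Rightarrow> complex) \<Rightarrow> complex" where
  "osc_integral F = (THE I. has_osc_integral F I)"

definition weyl ::
    "('d::finite phase \<Rightarrow> complex) \<Rightarrow> (real^'d \<Rightarrow> complex) \<Rightarrow> real^'d \<Rightarrow> complex" where
  "weyl a f x =
     of_real (1 / (2 * pi) ^ CARD('d)) *
     osc_integral (\<lambda>(y, \<xi>). cis ((x - y) \<bullet> \<xi>) * a ((1 / 2) *\<^sub>R (x + y), \<xi>) * f y)"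

text \<open>
  The symbol of the composition is sought among the anisotropic Shubin symbols of all orders and
  all anisotropy parameters, so that the product does not depend on the classes in which \<open>a\<close> and
  \<open>b\<close> are considered.
\<close>

definition weyl_product ::
    "('d::finite phase \<Rightarrow> complex) \<Rightarrow> ('d phase \<Rightarrow> complex) \<Rightarrow> 'd phase \<Rightarrow> complex" where
  "weyl_product a b =
     (THE c. (\<exists>k r. 0 < r \<and> c \<in> shubin k r) \<and>
             (\<forall>f\<in>schwartz. weyl c f = weyl a (weyl b f)))"

definition bilinear_on ::
    "('a \<Rightarrow> complex) set \<Rightarrow> ('b \<Rightarrow> complex) set \<Rightarrow>
     (('a \<Rightarrow> complex) \<Rightarrow> ('b \<Rightarrow> complex) \<Rightarrow> 'c \<Rightarrow> complex) \<Rightarrow> bool" where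
  "bilinear_on A B P \<longleftrightarrow>
     (\<forall>a\<in>A. \<forall>a'\<in>A. \<forall>b\<in>B. P (\<lambda>z. a z + a' z) b = (\<lambda>z. P a b z + P a' b z)) \<and>
     (\<forall>a\<in>A. \<forall>b\<in>B. \<forall>b'\<in>B. P a (\<lambda>z. b z + b' z) = (\<lambda>z. P a b z + P a b' z)) \<and>
     (\<forall>c. \<forall>a\<in>A. \<forall>b\<in>B. P (\<lambda>z. c * a z) b = (\<lambda>z. c * P a b z)) \<and>
     (\<forall>c. \<forall>a\<in>A. \<forall>b\<in>B. P a (\<lambda>z. c * b z) = (\<lambda>z. c * P a b z))"

end

theory Submission
  imports Defs "HOL-Probability.Probability"
begin

text \<open>
  Both parts of the theorem concern one kind of integral. Let \<open>B\<close> be an invertible symmetric linear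
  map of a Euclidean space, let \<open>L\<close> and \<open>L'\<close> be linear maps from that space into phase space, and
  let \<open>twist L L' a b z\<close> be the oscillatory integral of
  \<open>exp (i (u \<bullet> B u) / 2) a (z + L u) b (z + L' u)\<close> over \<open>u\<close>, divided by that of
  \<open>exp (i (u \<bullet> B u) / 2)\<close>. The multiplier \<open>exp (i t \<langle>D\<^sub>x, D\<^sub>\<xi>\<rangle>)\<close> with \<open>t \<noteq> 0\<close> is convolution with a
  chirp: it is the twist with \<open>b = 1\<close>, \<open>L = id\<close> and phase \<open>- (x \<bullet> \<xi>) / t\<close>. The Weyl product is the
  twist over pairs of phase space points with \<open>L = fst\<close>, \<open>L' = snd\<close> and phase
  \<open>2 (y \<bullet> \<eta>' - y' \<bullet> \<eta>)\<close>.

  Such integrals converge by integration by parts. With \<open>J = B\<inverse>\<close>, multiplying the chirp by \<open>u \<bullet> b\<close>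
  amounts to differentiating it along \<open>J b\<close>, up to the factor \<open>- i\<close>. Inserting
  \<open>1 = (1 + \<Sum>\<^sub>b (u \<bullet> b)\<^sup>2) / (1 + u \<bullet> u)\<close> and moving one derivative per summand to the amplitude
  replaces an amplitude \<open>a\<close> by \<open>lower a\<close>, which grows one power slower (\<open>integral_phase_lower\<close>).
  This works for amplitudes whose growth exponent does not increase under differentiation; they
  are called tempered below, and Shubin symbols are tempered. After finitely many steps the
  integral is absolutely convergent and bounded by finitely many weighted sup norms of the
  amplitude (\<open>osc_bound\<close>). The same representation gives continuity under bounded pointwise
  convergence (\<open>osc_tendsto\<close>), differentiation under the integral
  (\<open>osc_param_has_derivative\<close>) and Fubini for superpositions (\<open>osc_superposition\<close>).

  The weight is moderate, \<open>\<mu>(z + w)\<^sup>m \<le> C \<mu>(z)\<^sup>m (1 + |w|)\<^sup>M\<close> (\<open>mu_peetre\<close>). So the amplitude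
  \<open>a (z + L u) b (z + L' u)\<close> is bounded, with its derivatives, by seminorms of \<open>a\<close> and \<open>b\<close> times
  \<open>\<mu>(z)\<^sup>m\<^sup>+\<^sup>n\<close> times a power of \<open>1 + |u|\<close>, and the twist is \<open>O(\<mu>(z)\<^sup>m\<^sup>+\<^sup>n)\<close>. Derivatives in \<open>z\<close> fall on
  one of the factors and lower its order by the required amount. This is \<open>twist_shubin\<close>: twists map
  \<open>G\<^sup>m\<^sup>,\<^sup>s \<times> G\<^sup>n\<^sup>,\<^sup>s\<close> to \<open>G\<^sup>m\<^sup>+\<^sup>n\<^sup>,\<^sup>s\<close> with bounds on the seminorms, which yields both continuity claims.

  The two operations are recognized as twists by testing on exponentials. Completing the square
  evaluates the oscillatory integral of an exponential up to the factor \<open>\<integral> exp (i (u \<bullet> B u) / 2) du\<close>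
  (\<open>osc_exponential\<close>), which cancels in the definition of the twist and only has to be nonzero
  (\<open>osc_one_nonzero\<close>). Fourier inversion writes a Schwartz symbol as a superposition of
  exponentials, so that the twist of the first kind becomes a multiplier (\<open>twist_Fourier\<close>); the
  Weyl operator of an exponential is a phase space shift, and the composition law of these shifts
  turns the second kind into operator composition (\<open>weyl_moyal_schwartz\<close>). General symbols are
  limits of Schwartz symbols under Gaussian cutoffs, and both sides are continuous along such limits
  (\<open>multiplier_tempered_symbol\<close>, \<open>weyl_moyal\<close>).

  Finally, the Weyl product is the symbol of the composition, hence a symbol must be determined by
  its operator (\<open>weyl_symbol_unique\<close>). Pairing the operator of \<open>d\<close> with two Gaussian wave packets
  gives, by a suitable choice of their centres and frequencies, the value of the Fourier transform of
  \<open>d(z) exp (- z \<bullet> z)\<close> at any prescribed point; if all pairings vanish, so does \<open>d\<close>.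
\<close>

section \<open>Smooth functions\<close>

lemma dir_deriv_eq: "(f has_derivative f') (at z) \<Longrightarrow> dir_deriv v f z = f' v"
  unfolding dir_deriv_def using frechet_derivative_at by metis

lemma has_derivative_dir_deriv:
  "f differentiable (at z) \<Longrightarrow> (f has_derivative (\<lambda>v. dir_deriv v f z)) (at z)"
  unfolding dir_deriv_def using frechet_derivative_works by auto

lemma iter_deriv_Nil [simp]: "iter_deriv [] f = f"
  and iter_deriv_Cons [simp]: "iter_deriv (v # vs) f = dir_deriv v (iter_deriv vs f)"
  and iter_deriv_append: "iter_deriv (vs @ us) f = iter_deriv vs (iter_deriv us f)"
  by (simp_all add: iter_deriv_def)

lemma C_k_SucD: "C_k (Suc k) f \<Longrightarrow> C_k k f"
proof (induction k arbitrary: f)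
  case 0
  then show ?case
    by (auto intro!: differentiable_imp_continuous_on simp: differentiable_on_def
        intro: differentiable_at_withinI)
qed auto

lemma smooth_iff:
  "smooth f \<longleftrightarrow> (\<forall>z. f differentiable (at z)) \<and> (\<forall>v. smooth (dir_deriv v f))"
proof
  assume f: "smooth f"
  then have "C_k (Suc k) f" for k by (simp add: smooth_def)
  then show "(\<forall>z. f differentiable (at z)) \<and> (\<forall>v. smooth (dir_deriv v f))"
    unfolding smooth_def by auto
next
  assume f: "(\<forall>z. f differentiable (at z)) \<and> (\<forall>v. smooth (dir_deriv v f))"
  then have "C_k (Suc k) f" for k by (simp add: smooth_def)
  then show "smooth f" unfolding smooth_def using C_k_SucD by blast
qed

lemma smooth_differentiable: "smooth f \<Longrightarrow> f differentiable (at z)"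
  and smooth_dir_deriv: "smooth f \<Longrightarrow> smooth (dir_deriv v f)"
  using smooth_iff by blast+

lemma smooth_iter_deriv: "smooth f \<Longrightarrow> smooth (iter_deriv vs f)"
  by (induction vs) (auto intro: smooth_dir_deriv)

lemma smooth_has_derivative: "smooth f \<Longrightarrow> (f has_derivative (\<lambda>v. dir_deriv v f z)) (at z)"
  by (rule has_derivative_dir_deriv) (rule smooth_differentiable)

lemma smooth_continuous_on: "smooth f \<Longrightarrow> continuous_on S f"
  unfolding smooth_def by (metis C_k.simps(1) continuous_on_subset subset_UNIV)

lemma smooth_borel_measurable: "smooth f \<Longrightarrow> f \<in> borel_measurable borel"
  by (intro borel_measurable_continuous_onI smooth_continuous_on)

lemma C_k_add: "C_k k f \<Longrightarrow> C_k k g \<Longrightarrow> C_k k (\<lambda>z. f z + g z)"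
proof (induction k arbitrary: f g)
  case 0
  then show ?case by (auto intro: continuous_intros)
next
  case (Suc k)
  have "dir_deriv v (\<lambda>z. f z + g z) = (\<lambda>z. dir_deriv v f z + dir_deriv v g z)" for v
    using Suc.prems by (auto intro!: ext dir_deriv_eq has_derivative_add has_derivative_dir_deriv)
  then show ?case using Suc by auto
qed

lemma C_k_mult: "C_k k f \<Longrightarrow> C_k k g \<Longrightarrow> C_k k (\<lambda>z. f z * g z)"
proof (induction k arbitrary: f g)
  case 0
  then show ?case by (auto intro: continuous_intros)
next
  case (Suc k)
  have "dir_deriv v (\<lambda>z. f z * g z) = (\<lambda>z. f z * dir_deriv v g z + dir_deriv v f z * g z)" for v
    using Suc.prems by (auto intro!: ext dir_deriv_eq has_derivative_mult has_derivative_dir_deriv)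
  moreover have "C_k k f" "C_k k g" using Suc.prems C_k_SucD by blast+
  ultimately show ?case using Suc by (auto intro!: C_k_add)
qed

lemma smooth_add: "smooth f \<Longrightarrow> smooth g \<Longrightarrow> smooth (\<lambda>z. f z + g z)"
  and smooth_mult: "smooth f \<Longrightarrow> smooth g \<Longrightarrow> smooth (\<lambda>z. f z * g z)"
  unfolding smooth_def by (blast intro: C_k_add C_k_mult)+

lemma dir_deriv_const: "dir_deriv v (\<lambda>z. c) = (\<lambda>z. 0)"
  by (auto intro!: ext dir_deriv_eq)

lemma smooth_const: "smooth (\<lambda>z. c)"
  unfolding smooth_def
proof
  fix k show "C_k k (\<lambda>z. c)"
    by (induction k arbitrary: c) (auto simp: dir_deriv_const)
qed

lemma smooth_cmult: "smooth f \<Longrightarrow> smooth (\<lambda>z. c * f z)"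
  by (intro smooth_mult smooth_const)

lemma dir_deriv_add:
  "smooth f \<Longrightarrow> smooth g \<Longrightarrow> dir_deriv v (\<lambda>z. f z + g z) = (\<lambda>z. dir_deriv v f z + dir_deriv v g z)"
  by (auto intro!: ext dir_deriv_eq has_derivative_add smooth_has_derivative)

lemma dir_deriv_mult:
  "smooth f \<Longrightarrow> smooth g \<Longrightarrow>
    dir_deriv v (\<lambda>z. f z * g z) = (\<lambda>z. dir_deriv v f z * g z + f z * dir_deriv v g z)"
  by (rule ext, rule trans, rule dir_deriv_eq, rule has_derivative_mult)
    (auto intro!: smooth_has_derivative)

lemma dir_deriv_cmult: "smooth f \<Longrightarrow> dir_deriv v (\<lambda>z. c * f z) = (\<lambda>z. c * dir_deriv v f z)"
  by (simp add: dir_deriv_mult smooth_const dir_deriv_const)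

lemma dir_deriv_sum:
  "(\<And>i. i \<in> I \<Longrightarrow> smooth (f i)) \<Longrightarrow>
    dir_deriv v (\<lambda>z. \<Sum>i\<in>I. f i z) = (\<lambda>z. \<Sum>i\<in>I. dir_deriv v (f i) z)"
  by (auto intro!: ext dir_deriv_eq has_derivative_sum smooth_has_derivative)

lemma dir_deriv_linear:
  assumes "smooth f"
  shows "linear (\<lambda>v. dir_deriv v f z)"
  using smooth_has_derivative[OF assms] has_derivative_linear by blast

lemma dir_deriv_scaleR: "smooth f \<Longrightarrow> dir_deriv (c *\<^sub>R v) f = (\<lambda>z. of_real c * dir_deriv v f z)"
  by (rule ext) (simp add: linear_scale[OF dir_deriv_linear] scaleR_conv_of_real)

lemma dir_deriv_zero: "smooth f \<Longrightarrow> dir_deriv 0 f = (\<lambda>z. 0)"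
  by (rule ext) (simp add: linear_0[OF dir_deriv_linear])

lemma dir_deriv_plus: "smooth f \<Longrightarrow> dir_deriv (u + v) f = (\<lambda>z. dir_deriv u f z + dir_deriv v f z)"
  by (rule ext) (simp add: linear_add[OF dir_deriv_linear])

lemma iter_deriv_add:
  "smooth f \<Longrightarrow> smooth g \<Longrightarrow>
    iter_deriv vs (\<lambda>z. f z + g z) = (\<lambda>z. iter_deriv vs f z + iter_deriv vs g z)"
  by (induction vs) (auto simp: dir_deriv_add smooth_iter_deriv)

lemma iter_deriv_cmult:
  "smooth f \<Longrightarrow> iter_deriv vs (\<lambda>z. c * f z) = (\<lambda>z. c * iter_deriv vs f z)"
  by (induction vs) (auto simp: dir_deriv_cmult smooth_iter_deriv)

lemma iter_deriv_sum:
  "(\<And>i. i \<in> I \<Longrightarrow> smooth (f i)) \<Longrightarrow>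
    iter_deriv vs (\<lambda>z. \<Sum>i\<in>I. f i z) = (\<lambda>z. \<Sum>i\<in>I. iter_deriv vs (f i) z)"
  by (induction vs) (auto simp: dir_deriv_sum smooth_iter_deriv)

lemma iter_deriv_zero: "iter_deriv vs (\<lambda>z. 0) = (\<lambda>z. 0)"
  by (induction vs) (auto simp: dir_deriv_const)

lemma iter_deriv_const: "vs \<noteq> [] \<Longrightarrow> iter_deriv vs (\<lambda>z. c) = (\<lambda>z. 0)"
  by (induction vs rule: rev_induct) (auto simp: dir_deriv_const iter_deriv_append iter_deriv_zero)

lemma smooth_diff:
  assumes "smooth f" "smooth g" shows "smooth (\<lambda>z. f z - g z)"
  using smooth_add[OF assms(1) smooth_cmult[OF assms(2), of "-1"]] by simp

lemma iter_deriv_diff: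
  assumes "smooth f" "smooth g"
  shows "iter_deriv vs (\<lambda>z. f z - g z) = (\<lambda>z. iter_deriv vs f z - iter_deriv vs g z)"
  using iter_deriv_add[OF assms(1) smooth_cmult[OF assms(2), of "-1"], of vs]
  unfolding iter_deriv_cmult[OF assms(2)] by simp

lemma has_derivative_affine_compose:
  assumes "bounded_linear L" "(f has_derivative f') (at (c + L z))"
  shows "((\<lambda>z. f (c + L z)) has_derivative (\<lambda>v. f' (L v))) (at z)"
proof -
  have "((\<lambda>z. c + L z) has_derivative L) (at z)"
    using assms(1) by (auto intro!: derivative_eq_intros bounded_linear_imp_has_derivative)
  from has_derivative_compose[OF this assms(2)] show ?thesis .
qed

lemma C_k_affine:
  assumes L: "bounded_linear L"
  shows "C_k k f \<Longrightarrow> C_k k (\<lambda>z. f (c + L z))"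
proof (induction k arbitrary: f)
  case 0
  then show ?case
    by (auto intro!: continuous_on_compose2[of UNIV f] continuous_intros
        bounded_linear.continuous_on[OF L])
next
  case (Suc k)
  have *: "((\<lambda>z. f (c + L z)) has_derivative (\<lambda>v. dir_deriv (L v) f (c + L z))) (at z)" for z
    using Suc.prems by (intro has_derivative_affine_compose[OF L] has_derivative_dir_deriv) auto
  have "dir_deriv v (\<lambda>z. f (c + L z)) = (\<lambda>z. dir_deriv (L v) f (c + L z))" for v
    using dir_deriv_eq[OF *] by auto
  then show ?case using Suc * by (auto simp: differentiable_def)
qed

lemma smooth_affine: "bounded_linear L \<Longrightarrow> smooth f \<Longrightarrow> smooth (\<lambda>z. f (c + L z))"
  unfolding smooth_def using C_k_affine by blast

lemma dir_deriv_affine: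
  assumes "bounded_linear L" "smooth f"
  shows "dir_deriv v (\<lambda>z. f (c + L z)) = (\<lambda>z. dir_deriv (L v) f (c + L z))"
  using dir_deriv_eq[OF has_derivative_affine_compose[OF assms(1) smooth_has_derivative[OF assms(2)]]]
  by auto

lemma iter_deriv_affine:
  assumes "bounded_linear L" "smooth f"
  shows "iter_deriv vs (\<lambda>z. f (c + L z)) = (\<lambda>z. iter_deriv (map L vs) f (c + L z))"
  by (induction vs) (auto simp: dir_deriv_affine[OF assms(1)] smooth_iter_deriv assms(2))

lemma smooth_translate: "smooth f \<Longrightarrow> smooth (\<lambda>z. f (c + z))"
  using smooth_affine[OF bounded_linear_ident] by blast

lemma iter_deriv_translate: "smooth f \<Longrightarrow> iter_deriv vs (\<lambda>z. f (c + z)) = (\<lambda>z. iter_deriv vs f (c + z))"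
  using iter_deriv_affine[OF bounded_linear_ident, of f vs c] by simp

lemma dir_deriv_inner: "dir_deriv v (\<lambda>z. of_real (z \<bullet> b)) = (\<lambda>z. of_real (v \<bullet> b))"
  by (auto intro!: ext dir_deriv_eq derivative_eq_intros)

lemma smooth_inner: "smooth (\<lambda>z. of_real (z \<bullet> b))"
  by (subst smooth_iff)
    (auto simp: dir_deriv_inner smooth_const differentiable_def intro!: derivative_eq_intros)

lemma smooth_C_k: "smooth f \<Longrightarrow> C_k k f"
  by (simp add: smooth_def)

text \<open>Smoothness by bootstrapping: if the derivative is an expression in \<open>f\<close> itself that preserves
  \<open>C_k\<close>, then \<open>f\<close> gains one order of smoothness after the other. The Gaussian, exponentials and
  chirps satisfy such a first order differential equation.\<close>

lemma smooth_of_derivative: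
  assumes d: "\<And>z. (f has_derivative (\<lambda>v. F v z)) (at z)" and F: "\<And>k v. C_k k f \<Longrightarrow> C_k k (F v)"
  shows "smooth f"
  unfolding smooth_def
proof
  fix k show "C_k k f"
  proof (induction k)
    case 0
    have "isCont f z" for z using has_derivative_continuous[OF d] .
    then show ?case by (simp add: continuous_on_eq_continuous_at)
  next
    case (Suc k)
    have "dir_deriv v f = F v" for v by (rule ext) (rule dir_deriv_eq[OF d])
    moreover have "f differentiable (at z)" for z unfolding differentiable_def using d by blast
    ultimately show ?case using F[OF Suc] by simp
  qed
qed

subsection \<open>Symmetry of derivatives\<close>

text \<open>The mean value inequality for \<open>t \<mapsto> f (x + t v) - t c\<close>. With \<open>c\<close> the derivative at \<open>x\<close> it bounds
  the remainder of the linear approximation; with \<open>c = 0\<close> it bounds the increment.\<close>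

lemma dir_deriv_increment_bound:
  assumes d: "\<And>z. f differentiable (at z)" and h: "0 \<le> h"
    and B: "\<And>t. 0 \<le> t \<Longrightarrow> t \<le> h \<Longrightarrow> cmod (dir_deriv v f (x + t *\<^sub>R v) - c) \<le> B"
  shows "cmod (f (x + h *\<^sub>R v) - f x - of_real h * c) \<le> B * h"
proof -
  define k where "k t = f (x + t *\<^sub>R v) - of_real t * c" for t :: real
  have "((\<lambda>t. f (x + t *\<^sub>R v)) has_derivative (\<lambda>s. dir_deriv (s *\<^sub>R v) f (x + t *\<^sub>R v))) (at t)" for t
    by (rule has_derivative_affine_compose[of "\<lambda>t. t *\<^sub>R v"])
      (auto intro!: has_derivative_dir_deriv d bounded_linear_scaleR_left)
  then have kd: "(k has_derivative (\<lambda>s. dir_deriv (s *\<^sub>R v) f (x + t *\<^sub>R v) - of_real s * c)) (at t)" for t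
    unfolding k_def by (auto intro!: derivative_eq_intros)
  have lin: "dir_deriv (s *\<^sub>R v) f z = of_real s * dir_deriv v f z" for s z
    using linear_scale[OF has_derivative_linear[OF has_derivative_dir_deriv[OF d]]]
    by (auto simp: scaleR_conv_of_real)
  have "norm (k h - k 0) \<le> B * norm (h - 0)"
  proof (rule differentiable_bound[of "{0..h}" k])
    fix t assume t: "t \<in> {0..h}"
    show "(k has_derivative (\<lambda>s. dir_deriv (s *\<^sub>R v) f (x + t *\<^sub>R v) - of_real s * c)) (at t within {0..h})"
      using kd by (rule has_derivative_at_withinI)
    have "norm (dir_deriv (s *\<^sub>R v) f (x + t *\<^sub>R v) - of_real s * c) \<le> B * norm s" for s
    proof -
      have "dir_deriv (s *\<^sub>R v) f (x + t *\<^sub>R v) - of_real s * c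
          = of_real s * (dir_deriv v f (x + t *\<^sub>R v) - c)"
        by (simp add: lin algebra_simps)
      then show ?thesis
        using mult_right_mono[OF B[of t], of "\<bar>s\<bar>"] t by (simp add: norm_mult mult.commute)
    qed
    then show "onorm (\<lambda>s. dir_deriv (s *\<^sub>R v) f (x + t *\<^sub>R v) - of_real s * c) \<le> B"
      by (rule onorm_bound[rotated]) (use B[of 0] h norm_ge_zero order_trans in blast)
  qed (use h in auto)
  moreover have "k h - k 0 = f (x + h *\<^sub>R v) - f x - of_real h * c" by (simp add: k_def)
  ultimately show ?thesis using h by simp
qed

text \<open>The second difference \<open>f(z+hu+hv) - f(z+hu) - f(z+hv) + f(z)\<close> is symmetric in \<open>u\<close> and
  \<open>v\<close>, and by two applications of the mean value inequality it differs from
  \<open>h\<^sup>2 \<partial>\<^sub>v\<partial>\<^sub>u f(z)\<close> by \<open>o(h\<^sup>2)\<close>.\<close>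

lemma second_difference:
  assumes f: "smooth f" and e: "0 < e"
  shows "\<exists>d>0. \<forall>h. 0 < h \<and> h < d \<longrightarrow>
    cmod (f (z + h *\<^sub>R u + h *\<^sub>R v) - f (z + h *\<^sub>R u) - f (z + h *\<^sub>R v) + f z
       - of_real (h^2) * dir_deriv v (dir_deriv u f) z) \<le> e * h^2"
proof -
  define G where "G = dir_deriv v (dir_deriv u f)"
  have "continuous_on UNIV G"
    unfolding G_def by (intro smooth_continuous_on smooth_dir_deriv f)
  then have "isCont G z" by (simp add: continuous_on_eq_continuous_at)
  then obtain r where r: "r > 0" "\<And>w. dist w z < r \<Longrightarrow> dist (G w) (G z) < e"
    using e unfolding continuous_at_eps_delta by blast
  define d where "d = r / (norm u + norm v + 1)"
  have d: "d > 0" unfolding d_def using r by (simp add: add_nonneg_pos)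
  show ?thesis
  proof (intro exI conjI allI impI)
    show "d > 0" by fact
    fix h assume h: "0 < h \<and> h < d"
    have near: "cmod (G (z + s *\<^sub>R u + t *\<^sub>R v) - G z) \<le> e"
      if "0 \<le> s" "s \<le> h" "0 \<le> t" "t \<le> h" for s t
    proof -
      have "norm (s *\<^sub>R u + t *\<^sub>R v) \<le> h * norm u + h * norm v"
        using that by (intro norm_triangle_le add_mono) (auto intro!: mult_right_mono)
      also have "\<dots> < d * (norm u + norm v + 1)"
      proof -
        have "h * (norm u + norm v) \<le> d * (norm u + norm v)"
          using h by (intro mult_right_mono) auto
        then show ?thesis using d by (simp add: algebra_simps)
      qed
      also have "\<dots> = r"
        unfolding d_def using norm_ge_zero[of u] norm_ge_zero[of v]
        by (simp add: add_nonneg_eq_0_iff)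
      finally have "dist (z + s *\<^sub>R u + t *\<^sub>R v) z < r" by (simp add: dist_norm)
      from r(2)[OF this] show ?thesis by (simp add: dist_norm)
    qed
    define g where "g x = f (x + h *\<^sub>R v) - f x" for x
    have fs: "smooth (\<lambda>x. f (x + h *\<^sub>R v))" using smooth_translate[OF f, of "h *\<^sub>R v"] by (simp add: add.commute)
    have gs: "smooth g" unfolding g_def by (intro smooth_diff f fs)
    have gd: "dir_deriv u g x = dir_deriv u f (x + h *\<^sub>R v) - dir_deriv u f x" for x
      using iter_deriv_diff[OF fs f, of "[u]"] iter_deriv_translate[OF f, of "[u]" "h *\<^sub>R v"]
      unfolding g_def by (simp add: add.commute[of _ "h *\<^sub>R v"])
    have "cmod (g (z + h *\<^sub>R u) - g z - of_real h * (of_real h * G z)) \<le> (e * h) * h"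
    proof (rule dir_deriv_increment_bound)
      fix t assume t: "0 \<le> t" "t \<le> h"
      have "cmod (dir_deriv u f (z + t *\<^sub>R u + h *\<^sub>R v) - dir_deriv u f (z + t *\<^sub>R u)
          - of_real h * G z) \<le> e * h"
        by (rule dir_deriv_increment_bound)
          (use near t h in \<open>auto simp: smooth_differentiable smooth_dir_deriv f G_def\<close>)
      then show "cmod (dir_deriv u g (z + t *\<^sub>R u) - of_real h * G z) \<le> e * h"
        by (simp add: gd)
    qed (use h gs smooth_differentiable in auto)
    then show "cmod (f (z + h *\<^sub>R u + h *\<^sub>R v) - f (z + h *\<^sub>R u) - f (z + h *\<^sub>R v) + f z
       - of_real (h^2) * dir_deriv v (dir_deriv u f) z) \<le> e * h^2"
      by (simp add: g_def G_def power2_eq_square algebra_simps)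
  qed
qed

theorem dir_deriv_commute:
  assumes f: "smooth f"
  shows "dir_deriv u (dir_deriv v f) = dir_deriv v (dir_deriv u f)"
proof
  fix z
  let ?a = "dir_deriv u (dir_deriv v f) z" and ?b = "dir_deriv v (dir_deriv u f) z"
  have "cmod (?a - ?b) \<le> 2 * e" if e: "e > 0" for e
  proof -
    obtain d1 where d1: "d1 > 0" "\<And>h. 0 < h \<and> h < d1 \<Longrightarrow>
        cmod (f (z + h *\<^sub>R u + h *\<^sub>R v) - f (z + h *\<^sub>R u) - f (z + h *\<^sub>R v) + f z
       - of_real (h^2) * ?b) \<le> e * h^2"
      using second_difference[OF f e, of z u v] by blast
    obtain d2 where d2: "d2 > 0" "\<And>h. 0 < h \<and> h < d2 \<Longrightarrow>
        cmod (f (z + h *\<^sub>R v + h *\<^sub>R u) - f (z + h *\<^sub>R v) - f (z + h *\<^sub>R u) + f z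
       - of_real (h^2) * ?a) \<le> e * h^2"
      using second_difference[OF f e, of z v u] by blast
    define h where "h = min d1 d2 / 2"
    have h: "0 < h" "h < d1" "h < d2" unfolding h_def using d1 d2 by auto
    define D where "D = f (z + h *\<^sub>R u + h *\<^sub>R v) - f (z + h *\<^sub>R u) - f (z + h *\<^sub>R v) + f z"
    have "cmod (D - of_real (h^2) * ?b) \<le> e * h^2" using d1(2)[of h] h by (simp add: D_def)
    moreover have "cmod (D - of_real (h^2) * ?a) \<le> e * h^2"
      using d2(2)[of h] h by (simp add: D_def algebra_simps)
    ultimately have "cmod ((D - of_real (h^2) * ?b) - (D - of_real (h^2) * ?a)) \<le> 2 * e * h^2"
      using norm_triangle_ineq4[of "D - of_real (h^2) * ?b" "D - of_real (h^2) * ?a"] by linarith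
    moreover have "(D - of_real (h^2) * ?b) - (D - of_real (h^2) * ?a) = of_real (h^2) * (?a - ?b)"
      by (simp add: algebra_simps)
    ultimately have "h^2 * cmod (?a - ?b) \<le> h^2 * (2 * e)" by (simp add: norm_mult norm_power mult_ac)
    then show ?thesis using h by simp
  qed
  from this[of "cmod (?a - ?b) / 4"] show "?a = ?b" by (cases "?a = ?b") auto
qed

lemma iter_deriv_dir_deriv:
  "smooth f \<Longrightarrow> iter_deriv vs (dir_deriv v f) = dir_deriv v (iter_deriv vs f)"
proof (induction vs)
  case (Cons a vs)
  then show ?case using dir_deriv_commute[OF smooth_iter_deriv[OF Cons.prems]] by simp
qed simp

text \<open>An iterated partial derivative fixes an enumeration of the coordinates; this lemma removes the
  dependence on it.\<close>

lemma iter_deriv_mset_eq: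
  "smooth f \<Longrightarrow> mset us = mset vs \<Longrightarrow> iter_deriv us f = iter_deriv vs f"
proof (induction us arbitrary: vs)
  case (Cons a us)
  then obtain v1 v2 where v: "vs = v1 @ a # v2" by (metis list.set_intros(1) set_mset_mset split_list)
  then have "iter_deriv us f = iter_deriv (v1 @ v2) f" using Cons by auto
  moreover have "iter_deriv vs f = dir_deriv a (iter_deriv (v1 @ v2) f)"
    using v Cons.prems(1)
    by (simp add: iter_deriv_append iter_deriv_dir_deriv[OF smooth_iter_deriv])
  ultimately show ?case by simp
qed simp

section \<open>Functions with bounded derivatives\<close>

text \<open>Derivatives are taken along arbitrary vectors of norm at most one, rather than along a
  basis, so that the estimates survive composition with linear maps.\<close>

definition bnd :: "nat \<Rightarrow> ('a::euclidean_space \<Rightarrow> real) \<Rightarrow> ('a \<Rightarrow> complex) \<Rightarrow> bool" where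
  "bnd N W f \<longleftrightarrow> smooth f \<and>
    (\<forall>vs z. length vs \<le> N \<longrightarrow> (\<forall>v\<in>set vs. norm v \<le> 1) \<longrightarrow> cmod (iter_deriv vs f z) \<le> W z)"

lemma bnd_smooth: "bnd N W f \<Longrightarrow> smooth f"
  and bndD: "bnd N W f \<Longrightarrow> length vs \<le> N \<Longrightarrow> (\<And>v. v \<in> set vs \<Longrightarrow> norm v \<le> 1)
    \<Longrightarrow> cmod (iter_deriv vs f z) \<le> W z"
  by (auto simp: bnd_def)

lemma bnd_value: "bnd N W f \<Longrightarrow> cmod (f z) \<le> W z"
  using bndD[of N W f "[]"] by simp

lemma bnd_nonneg: "bnd N W f \<Longrightarrow> 0 \<le> W z"
  using bnd_value norm_ge_zero order_trans by blast

lemma bnd_mono: "bnd N W f \<Longrightarrow> N' \<le> N \<Longrightarrow> (\<And>z. W z \<le> W' z) \<Longrightarrow> bnd N' W' f"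
  unfolding bnd_def by (meson order_trans)

lemma bnd_0: "bnd 0 W f \<longleftrightarrow> smooth f \<and> (\<forall>z. cmod (f z) \<le> W z)"
  by (auto simp: bnd_def)

lemma bnd_Suc:
  "bnd (Suc N) W f \<longleftrightarrow> smooth f \<and> (\<forall>z. cmod (f z) \<le> W z) \<and> (\<forall>v. norm v \<le> 1 \<longrightarrow> bnd N W (dir_deriv v f))"
proof (intro iffI conjI allI impI)
  assume f: "bnd (Suc N) W f"
  then show "smooth f" "\<And>z. cmod (f z) \<le> W z" by (auto simp: bnd_smooth bnd_value)
  fix v :: 'a assume v: "norm v \<le> 1"
  show "bnd N W (dir_deriv v f)"
    unfolding bnd_def
  proof (intro conjI allI impI)
    show "smooth (dir_deriv v f)" using f bnd_smooth smooth_dir_deriv by blast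
    fix vs :: "'a list" and z assume "length vs \<le> N" "\<forall>v\<in>set vs. norm v \<le> 1"
    then show "cmod (iter_deriv vs (dir_deriv v f) z) \<le> W z"
      using bndD[OF f, of "vs @ [v]" z] v by (auto simp: iter_deriv_append)
  qed
next
  assume f: "smooth f \<and> (\<forall>z. cmod (f z) \<le> W z) \<and> (\<forall>v. norm v \<le> 1 \<longrightarrow> bnd N W (dir_deriv v f))"
  show "bnd (Suc N) W f" unfolding bnd_def
  proof (intro conjI allI impI)
    show "smooth f" using f by auto
    fix vs :: "'a list" and z assume *: "length vs \<le> Suc N" "\<forall>v\<in>set vs. norm v \<le> 1"
    show "cmod (iter_deriv vs f z) \<le> W z"
    proof (cases vs rule: rev_cases)
      case (snoc us u)
      then have "bnd N W (dir_deriv u f)" using f * by auto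
      from bndD[OF this, of us z] show ?thesis using snoc * by (simp add: iter_deriv_append)
    qed (use f in simp)
  qed
qed

lemma bnd_dir_deriv: "bnd (Suc N) W f \<Longrightarrow> norm v \<le> 1 \<Longrightarrow> bnd N W (dir_deriv v f)"
  by (simp add: bnd_Suc)

lemma bnd_add:
  assumes "bnd N W f" "bnd N V g" shows "bnd N (\<lambda>z. W z + V z) (\<lambda>z. f z + g z)"
  unfolding bnd_def
  using assms bnd_smooth[OF assms(1)] bnd_smooth[OF assms(2)]
  by (auto simp: iter_deriv_add smooth_add intro!: norm_triangle_le add_mono intro: bndD)

lemma bnd_cmult:
  assumes "bnd N W f" shows "bnd N (\<lambda>z. cmod c * W z) (\<lambda>z. c * f z)"
  unfolding bnd_def
  using assms bnd_smooth[OF assms(1)]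
  by (auto simp: iter_deriv_cmult smooth_cmult norm_mult intro!: mult_left_mono intro: bndD)

lemma bnd_zero: "(\<And>z. 0 \<le> W z) \<Longrightarrow> bnd N W (\<lambda>z. 0)"
  by (auto simp: bnd_def smooth_const iter_deriv_zero)

lemma bnd_const: "bnd N (\<lambda>z. cmod c) (\<lambda>z. c)"
  by (induction N) (auto simp: bnd_0 bnd_Suc smooth_const dir_deriv_const bnd_zero)

lemma bnd_sum:
  "(\<And>i. i \<in> I \<Longrightarrow> bnd N (W i) (f i)) \<Longrightarrow> bnd N (\<lambda>z. \<Sum>i\<in>I. W i z) (\<lambda>z. \<Sum>i\<in>I. f i z)"
  by (induction I rule: infinite_finite_induct) (auto intro: bnd_zero bnd_add)

lemma bnd_mult:
  "bnd N W f \<Longrightarrow> bnd N V g \<Longrightarrow> bnd N (\<lambda>z. 2^N * (W z * V z)) (\<lambda>z. f z * g z)"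
proof (induction N arbitrary: f g)
  case 0
  then show ?case
    by (auto simp: bnd_0 smooth_mult norm_mult intro!: mult_mono) (metis norm_ge_zero order_trans)
next
  case (Suc N)
  have s: "smooth f" "smooth g" using Suc.prems bnd_smooth by auto
  show ?case unfolding bnd_Suc
  proof (intro conjI allI impI)
    show "smooth (\<lambda>z. f z * g z)" using s smooth_mult by blast
    fix z
    have "cmod (f z * g z) \<le> W z * V z"
      unfolding norm_mult using Suc.prems
      by (intro mult_mono) (auto intro: bnd_value bnd_nonneg)
    also have "\<dots> \<le> 2^Suc N * (W z * V z)"
      using bnd_nonneg[OF Suc.prems(1), of z] bnd_nonneg[OF Suc.prems(2), of z]
        one_le_power[of "2::real" "Suc N"] mult_right_mono[of 1 "2^Suc N" "W z * V z"] by simp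
    finally show "cmod (f z * g z) \<le> 2^Suc N * (W z * V z)" .
  next
    fix v :: 'a assume v: "norm v \<le> 1"
    have lo: "bnd N W f" "bnd N V g" using Suc.prems bnd_mono[of "Suc N"] by fastforce+
    have "bnd N (\<lambda>z. 2^N * (W z * V z) + 2^N * (W z * V z))
        (\<lambda>z. dir_deriv v f z * g z + f z * dir_deriv v g z)"
      using Suc lo v by (intro bnd_add Suc.IH) (auto intro: bnd_dir_deriv)
    then show "bnd N (\<lambda>z. 2^Suc N * (W z * V z)) (dir_deriv v (\<lambda>z. f z * g z))"
      using s by (simp add: dir_deriv_mult algebra_simps)
  qed
qed

lemma bnd_scale_dir:
  assumes f: "bnd (Suc N) W f"
  shows "bnd N (\<lambda>z. norm v * W z) (dir_deriv v f)"
proof (cases "v = 0")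
  case True
  then show ?thesis using f bnd_smooth dir_deriv_zero bnd_zero by fastforce
next
  case False
  then have v: "v = norm v *\<^sub>R (v /\<^sub>R norm v)" by simp
  have "bnd N W (dir_deriv (v /\<^sub>R norm v) f)"
    by (rule bnd_dir_deriv[OF f]) (use False in simp)
  from bnd_cmult[OF this, of "of_real (norm v)"] show ?thesis
    using dir_deriv_scaleR[OF bnd_smooth[OF f], of "norm v" "v /\<^sub>R norm v"] False by (simp add: v[symmetric])
qed

text \<open>Each differentiation of \<open>f (c + L z)\<close> produces one application of \<open>L\<close> to the direction, hence one
  factor \<open>B\<close>.\<close>

lemma bnd_affine:
  assumes L: "bounded_linear L" and B: "\<And>v. norm (L v) \<le> B * norm v" "1 \<le> B"
  shows "bnd N W f \<Longrightarrow> bnd N (\<lambda>z. B^N * W (c + L z)) (\<lambda>z. f (c + L z))"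
proof (induction N arbitrary: f)
  case 0
  then show ?case by (auto simp: bnd_0 intro: smooth_affine[OF L])
next
  case (Suc N)
  have s: "smooth f" using Suc.prems bnd_smooth by auto
  have B0: "0 \<le> B" using B by simp
  show ?case unfolding bnd_Suc
  proof (intro conjI allI impI)
    show "smooth (\<lambda>z. f (c + L z))" using s smooth_affine[OF L] by blast
    show "cmod (f (c + L z)) \<le> B^Suc N * W (c + L z)" for z
      using bnd_value[OF Suc.prems, of "c + L z"] bnd_nonneg[OF Suc.prems, of "c + L z"]
        one_le_power[OF B(2), of "Suc N"] mult_right_mono[of 1 "B^Suc N" "W (c + L z)"] by simp
    fix v :: 'a assume v: "norm v \<le> 1"
    have Lv: "norm (L v) \<le> B" using B(1)[of v] mult_left_mono[OF v B0] by simp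
    have "bnd N (\<lambda>z. B * W z) (dir_deriv (L v) f)"
      by (rule bnd_mono[OF bnd_scale_dir[OF Suc.prems]])
        (auto intro!: mult_right_mono Lv bnd_nonneg[OF Suc.prems])
    then have 1: "bnd N (\<lambda>z. W z) (\<lambda>z. of_real (1/B) * dir_deriv (L v) f z)"
      using bnd_cmult[of N "\<lambda>z. B * W z" "dir_deriv (L v) f" "of_real (1/B)"] B(2)
      by (simp add: norm_divide)
    have "bnd N (\<lambda>z. B * (B^N * W (c + L z))) (\<lambda>z. of_real B * (of_real (1/B) * dir_deriv (L v) f (c + L z)))"
      using bnd_cmult[OF Suc.IH[OF 1], of "of_real B"] B0 by simp
    then show "bnd N (\<lambda>z. B^Suc N * W (c + L z)) (dir_deriv v (\<lambda>z. f (c + L z)))"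
      using B(2) by (simp add: dir_deriv_affine[OF L s] algebra_simps)
  qed
qed

lemma bnd_translate: "bnd N W f \<Longrightarrow> bnd N (\<lambda>z. W (c + z)) (\<lambda>z. f (c + z))"
  using bnd_affine[OF bounded_linear_ident, of 1] by simp


section \<open>Polynomial weights and tempered functions\<close>

lemma inverse_Suc_tendsto: "(\<lambda>k. 1 / real (Suc k)) \<longlonglongrightarrow> 0"
  using LIMSEQ_inverse_real_of_nat by (simp add: inverse_eq_divide del: of_nat_Suc)

lemma bounded_linear_bound:
  assumes "bounded_linear L"
  obtains B where "1 \<le> B" "\<And>v. norm (L v) \<le> B * norm v"
proof
  show "1 \<le> max 1 (onorm L)" by simp
  show "norm (L v) \<le> max 1 (onorm L) * norm v" for v
    using onorm[OF assms, of v] mult_right_mono[of "onorm L" "max 1 (onorm L)" "norm v"] by auto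
qed

definition wt :: "real \<Rightarrow> 'a::real_normed_vector \<Rightarrow> real" where
  "wt M z = (1 + norm z) powr M"

lemma wt_pos [simp]: "0 < wt M z"
  using norm_ge_zero[of z] unfolding wt_def by (subst powr_gt_zero) linarith

lemma wt_nonneg [simp]: "0 \<le> wt M z" using wt_pos less_imp_le by blast

lemma wt_add: "wt (M + M') z = wt M z * wt M' z"
  by (simp add: wt_def powr_add)

lemma wt_0 [simp]: "wt 0 z = 1"
  using norm_ge_zero[of z] by (simp add: wt_def add_nonneg_eq_0_iff)

lemma wt_mono: "M \<le> M' \<Longrightarrow> wt M z \<le> wt M' z"
  unfolding wt_def by (rule powr_mono) auto

lemma wt_ge_1: "0 \<le> M \<Longrightarrow> 1 \<le> wt M z"
  using wt_mono[of 0 M z] by simp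

lemma wt_1: "wt 1 z = 1 + norm z"
  by (simp add: wt_def add_nonneg_nonneg)

lemma wt_of_nat: "wt (real n) z = (1 + norm z)^n"
  unfolding wt_def by (rule powr_realpow) (simp add: add_pos_nonneg)

lemma wt_norm_mono: "0 \<le> M \<Longrightarrow> norm z \<le> norm w \<Longrightarrow> wt M z \<le> wt M w"
  unfolding wt_def by (rule powr_mono2) auto

lemma one_plus_le_mult:
  assumes "0 \<le> a" "0 \<le> b" "c \<le> a + b" shows "1 + c \<le> (1 + a) * (1 + b :: real)"
  using assms mult_nonneg_nonneg[OF assms(1,2)] unfolding distrib_left distrib_right by linarith

text \<open>Peetre's inequality. For negative exponents it is the inequality for positive ones, read with
  \<open>z = (z + w) - w\<close>.\<close>

lemma wt_peetre: "wt M (z + w) \<le> wt M z * wt \<bar>M\<bar> w"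
proof (cases "0 \<le> M")
  case True
  have "1 + norm (z + w) \<le> (1 + norm z) * (1 + norm w)"
    by (intro one_plus_le_mult norm_triangle_ineq) auto
  then have "(1 + norm (z + w)) powr M \<le> ((1 + norm z) * (1 + norm w)) powr M"
    using True by (intro powr_mono2) auto
  then show ?thesis using True by (simp add: wt_def powr_mult)
next
  case False
  have "1 + norm z \<le> (1 + norm (z + w)) * (1 + norm w)"
    using norm_triangle_ineq4[of "z + w" w] by (intro one_plus_le_mult) auto
  then have "(1 + norm z) powr (-M) \<le> ((1 + norm (z + w)) * (1 + norm w)) powr (-M)"
    using False by (intro powr_mono2) auto
  then have "wt (-M) z \<le> wt (-M) (z + w) * wt \<bar>M\<bar> w"
    using False by (simp add: wt_def powr_mult)
  then have "wt M (z + w) * (wt M z * wt (-M) z) \<le> wt M (z + w) * (wt M z * (wt (-M) (z + w) * wt \<bar>M\<bar> w))"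
    by (intro mult_left_mono) auto
  moreover have "wt M x * wt (-M) x = 1" for x :: 'a using wt_add[of M "-M" x] by simp
  ultimately show ?thesis by (metis (no_types, lifting) mult.assoc mult.commute mult.right_neutral)
qed

lemma wt_Pair_le: "0 \<le> M \<Longrightarrow> wt M (x, u) \<le> wt M x * wt M u"
proof -
  assume M: "0 \<le> M"
  have "wt M ((x, 0) + (0, u)) \<le> wt M (x, 0::'b) * wt \<bar>M\<bar> (0::'a, u)" by (rule wt_peetre)
  then show ?thesis using M by (simp add: wt_def norm_Pair)
qed

lemma wt_minus: "wt (- M) z = inverse (wt M z)"
  by (simp add: wt_def powr_minus)

lemma wt_Pair_ge: "0 \<le> M \<Longrightarrow> wt (- M) x * wt (- M) u \<le> wt (- M) (x, u)"
  unfolding wt_minus inverse_mult_distrib[symmetric] by (intro le_imp_inverse_le wt_Pair_le wt_pos)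

lemma wt_linear_le:
  assumes "norm (L z) \<le> B * norm z" "1 \<le> B" "0 \<le> M"
  shows "wt M (L z) \<le> B powr M * wt M z"
proof -
  have "1 + norm (L z) \<le> B * (1 + norm z)" using assms by (simp add: algebra_simps)
  then have "(1 + norm (L z)) powr M \<le> (B * (1 + norm z)) powr M"
    using assms by (intro powr_mono2) auto
  then show ?thesis using assms by (simp add: wt_def powr_mult)
qed

lemma continuous_on_wt: "continuous_on S (wt M)"
  unfolding wt_def
  by (intro continuous_intros continuous_on_powr ballI) (auto simp: add_nonneg_eq_0_iff)

lemma wt_measurable [measurable]: "wt M \<in> borel_measurable borel"
  by (intro borel_measurable_continuous_onI continuous_on_wt)

text \<open>The growth exponent of a tempered function may not increase with differentiation; this is
  what makes oscillatory integrals against quadratic phases converge.\<close>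

definition tempered :: "real \<Rightarrow> ('a::euclidean_space \<Rightarrow> complex) \<Rightarrow> bool" where
  "tempered M f \<longleftrightarrow> (\<forall>N. \<exists>C. bnd N (\<lambda>z. C * wt M z) f)"

lemma bnd_wt_nonneg: "bnd N (\<lambda>z. C * wt M z) f \<Longrightarrow> 0 \<le> C"
  using bnd_nonneg[of N "\<lambda>z. C * wt M z" f 0] wt_pos[of M 0]
  by (metis mult_less_0_iff not_le)

lemma temperedE:
  assumes "tempered M f"
  obtains C where "0 \<le> C" "bnd N (\<lambda>z. C * wt M z) f"
  using assms bnd_wt_nonneg unfolding tempered_def by blast

lemma tempered_smooth: "tempered M f \<Longrightarrow> smooth f"
  unfolding tempered_def using bnd_smooth by blast

lemma bnd_wt_mono:
  assumes "bnd N (\<lambda>z. C * wt M z) f" "M \<le> M'" shows "bnd N (\<lambda>z. C * wt M' z) f"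
  by (rule bnd_mono[OF assms(1)]) (use bnd_wt_nonneg[OF assms(1)] wt_mono[OF assms(2)] in \<open>auto intro: mult_left_mono\<close>)

lemma bnd_le: "bnd N W f \<Longrightarrow> N' \<le> N \<Longrightarrow> bnd N' W f"
  by (rule bnd_mono) auto

lemma tempered_mono: "tempered M f \<Longrightarrow> M \<le> M' \<Longrightarrow> tempered M' f"
  unfolding tempered_def using bnd_wt_mono by blast

lemma tempered_add: "tempered M f \<Longrightarrow> tempered M g \<Longrightarrow> tempered M (\<lambda>z. f z + g z)"
  unfolding tempered_def
proof
  fix N assume "\<forall>N. \<exists>C. bnd N (\<lambda>z. C * wt M z) f" "\<forall>N. \<exists>C. bnd N (\<lambda>z. C * wt M z) g"
  then obtain C D where "bnd N (\<lambda>z. C * wt M z) f" "bnd N (\<lambda>z. D * wt M z) g" by blast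
  from bnd_add[OF this] show "\<exists>C. bnd N (\<lambda>z. C * wt M z) (\<lambda>z. f z + g z)"
    by (intro exI[of _ "C + D"]) (simp add: algebra_simps)
qed

lemma bnd_wt_cmult: "bnd N (\<lambda>z. C * wt M z) f \<Longrightarrow> bnd N (\<lambda>z. (cmod c * C) * wt M z) (\<lambda>z. c * f z)"
  using bnd_cmult[of N "\<lambda>z. C * wt M z" f c] by (simp add: mult.assoc)

lemma tempered_cmult: "tempered M f \<Longrightarrow> tempered M (\<lambda>z. c * f z)"
  unfolding tempered_def using bnd_wt_cmult by blast

lemma bnd_wt_mult:
  assumes "bnd N (\<lambda>z. C * wt M z) f" "bnd N (\<lambda>z. C' * wt M' z) g"
  shows "bnd N (\<lambda>z. (2^N * C * C') * wt (M + M') z) (\<lambda>z. f z * g z)"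
  using bnd_mult[OF assms] by (simp add: wt_add mult_ac)

lemma tempered_mult: "tempered M f \<Longrightarrow> tempered M' g \<Longrightarrow> tempered (M + M') (\<lambda>z. f z * g z)"
  unfolding tempered_def using bnd_wt_mult by blast

lemma tempered_zero: "tempered M (\<lambda>z. 0)"
  unfolding tempered_def by (auto intro!: exI[of _ 1] bnd_zero)

lemma tempered_const: "tempered 0 (\<lambda>z. c)"
  unfolding tempered_def using bnd_const by fastforce

lemma tempered_dir_deriv:
  assumes "tempered M f" shows "tempered M (dir_deriv v f)"
  unfolding tempered_def
proof
  fix N
  obtain C where "bnd (Suc N) (\<lambda>z. C * wt M z) f" using assms unfolding tempered_def by blast
  from bnd_scale_dir[OF this, of v] show "\<exists>C. bnd N (\<lambda>z. C * wt M z) (dir_deriv v f)"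
    by (intro exI[of _ "norm v * C"]) (simp add: mult_ac)
qed

lemma tempered_iter_deriv: "tempered M f \<Longrightarrow> tempered M (iter_deriv vs f)"
  by (induction vs) (auto intro: tempered_dir_deriv)

lemma bnd_wt_affine:
  assumes f: "bnd N (\<lambda>z. C * wt M z) f"
    and L: "bounded_linear L" "\<And>v. norm (L v) \<le> B * norm v" "1 \<le> B" and M: "0 \<le> M"
  shows "bnd N (\<lambda>z. (B^N * C * wt M c * B powr M) * wt M z) (\<lambda>z. f (c + L z))"
proof (rule bnd_mono[OF bnd_affine[OF L f]])
  fix z
  have "wt M (c + L z) \<le> wt M c * (B powr M * wt M z)"
    using wt_peetre[of M c "L z"] M
      mult_left_mono[OF wt_linear_le[where L = L and z = z, OF L(2) L(3) M] wt_nonneg[of M c]]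
    by linarith
  then show "B^N * (C * wt M (c + L z)) \<le> (B^N * C * wt M c * B powr M) * wt M z"
    using mult_left_mono[of "wt M (c + L z)" "wt M c * (B powr M * wt M z)" "B^N * C"]
      bnd_wt_nonneg[OF f] L(3) by (simp add: mult_ac)
qed auto

lemma tempered_affine:
  assumes f: "tempered M f" and L: "bounded_linear L" and M: "0 \<le> M"
  shows "tempered M (\<lambda>z. f (c + L z))"
proof -
  obtain B where "1 \<le> B" "\<And>v. norm (L v) \<le> B * norm v" using bounded_linear_bound[OF L] by blast
  then show ?thesis using f bnd_wt_affine[OF _ L _ _ M] unfolding tempered_def by blast
qed

lemma bnd_wt_translate:
  assumes f: "bnd N (\<lambda>z. C * wt M z) f"
  shows "bnd N (\<lambda>z. (C * wt \<bar>M\<bar> c) * wt M z) (\<lambda>z. f (c + z))"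
  by (rule bnd_mono[OF bnd_translate[OF f]])
    (use wt_peetre[of M _ c] bnd_wt_nonneg[OF f] in \<open>auto simp: mult_ac add.commute intro!: mult_left_mono\<close>)

lemma tempered_translate: "tempered M f \<Longrightarrow> tempered M (\<lambda>z. f (c + z))"
  unfolding tempered_def using bnd_wt_translate by blast

lemma tempered_value:
  assumes "tempered M f" obtains C where "0 \<le> C" "\<And>z. cmod (f z) \<le> C * wt M z"
proof -
  obtain C where "0 \<le> C" "bnd 0 (\<lambda>z. C * wt M z) f" using temperedE[OF assms] by blast
  then show thesis using that[of C] bnd_value by fast
qed

lemma bnd_inner: "norm b \<le> 1 \<Longrightarrow> bnd N (wt 1) (\<lambda>z. of_real (z \<bullet> b))"
proof (induction N)
  case 0
  have "\<bar>z \<bullet> b\<bar> \<le> wt 1 z" for z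
    using Cauchy_Schwarz_ineq2[of z b] mult_left_mono[OF 0, of "norm z"] by (simp add: wt_1)
  then show ?case by (auto simp: bnd_0 smooth_inner)
next
  case (Suc N)
  have le: "\<bar>z \<bullet> b\<bar> \<le> wt 1 z" for z
    using Cauchy_Schwarz_ineq2[of z b] mult_left_mono[OF Suc.prems, of "norm z"] by (simp add: wt_1)
  have "bnd N (wt 1) (\<lambda>z. complex_of_real (v \<bullet> b))" if v: "norm v \<le> 1" for v
  proof (rule bnd_mono[OF bnd_const])
    fix z
    have "\<bar>v \<bullet> b\<bar> \<le> 1"
      using Cauchy_Schwarz_ineq2[of v b] mult_mono[OF v Suc.prems] by simp
    then show "cmod (complex_of_real (v \<bullet> b)) \<le> wt 1 z" using wt_ge_1[of 1 z] by simp
  qed auto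
  then show ?case by (auto simp: bnd_Suc smooth_inner dir_deriv_inner le)
qed

lemma bnd_inner_scaled: "bnd N (\<lambda>z. norm b * wt 1 z) (\<lambda>z. of_real (z \<bullet> b))"
proof (cases "b = 0")
  case False
  then have "bnd N (wt 1) (\<lambda>z. of_real (z \<bullet> (b /\<^sub>R norm b)))" by (intro bnd_inner) simp
  from bnd_cmult[OF this, of "of_real (norm b)"] show ?thesis
    using False by (simp add: mult.assoc[symmetric])
qed (auto intro: bnd_zero)

lemma tempered_inner: "tempered 1 (\<lambda>z. of_real (z \<bullet> b))"
  unfolding tempered_def using bnd_inner_scaled by blast

subsection \<open>Schwartz functions\<close>

text \<open>Expanding the innermost direction in the basis gives \<open>DIM('a)\<close> terms with coefficients at most one.\<close>

lemma iter_deriv_basis_bound: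
  assumes "smooth f"
    and "\<And>vs. vs \<in> lists Basis \<Longrightarrow> length vs = n \<Longrightarrow> cmod (iter_deriv vs f z) \<le> K"
    and "length us = n" "\<And>v. v \<in> set us \<Longrightarrow> norm v \<le> 1"
  shows "cmod (iter_deriv us (f :: 'a::euclidean_space \<Rightarrow> complex) z) \<le> real DIM('a)^n * K"
  using assms
proof (induction n arbitrary: f us)
  case 0
  then show ?case using "0.prems"(2)[of "[]"] by simp
next
  case (Suc n)
  obtain ws v where us: "us = ws @ [v]" using Suc.prems(3) by (metis length_Suc_conv_rev)
  have v: "norm v \<le> 1" using Suc.prems us by auto
  have "dir_deriv v f x = (\<Sum>b\<in>Basis. of_real (v \<bullet> b) * dir_deriv b f x)" for x
  proof -
    have "dir_deriv v f x = dir_deriv (\<Sum>b\<in>Basis. (v \<bullet> b) *\<^sub>R b) f x" by (simp add: euclidean_representation)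
    also have "\<dots> = (\<Sum>b\<in>Basis. dir_deriv ((v \<bullet> b) *\<^sub>R b) f x)"
      by (rule linear_sum[OF dir_deriv_linear[OF Suc.prems(1)]])
    finally show ?thesis by (simp add: dir_deriv_scaleR[OF Suc.prems(1)])
  qed
  then have "dir_deriv v f = (\<lambda>x. \<Sum>b\<in>Basis. of_real (v \<bullet> b) * dir_deriv b f x)" by auto
  then have "iter_deriv us f z = (\<Sum>b\<in>Basis. of_real (v \<bullet> b) * iter_deriv ws (dir_deriv b f) z)"
    using Suc.prems(1)
    by (simp add: us iter_deriv_append iter_deriv_sum iter_deriv_cmult smooth_cmult smooth_dir_deriv)
  also have "cmod \<dots> \<le> (\<Sum>b\<in>(Basis::'a set). real DIM('a)^n * K)"
  proof (rule sum_norm_le)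
    fix b :: 'a assume b: "b \<in> Basis"
    have "cmod (iter_deriv ws (dir_deriv b f) z) \<le> real DIM('a)^n * K"
    proof (rule Suc.IH)
      fix vs :: "'a list" assume "vs \<in> lists Basis" "length vs = n"
      then show "cmod (iter_deriv vs (dir_deriv b f) z) \<le> K"
        using Suc.prems(2)[of "vs @ [b]"] b by (simp add: iter_deriv_append)
    qed (use Suc.prems us in \<open>auto intro: smooth_dir_deriv\<close>)
    moreover have "\<bar>v \<bullet> b\<bar> \<le> 1" using Basis_le_norm[OF b, of v] v by linarith
    ultimately show "cmod (of_real (v \<bullet> b) * iter_deriv ws (dir_deriv b f) z) \<le> real DIM('a)^n * K"
      unfolding norm_mult using mult_mono[of "\<bar>v \<bullet> b\<bar>" 1] by fastforce
  qed
  finally show ?case by simp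
qed

lemma bnd_of_basis:
  assumes "smooth f"
    and "\<And>vs z. vs \<in> lists Basis \<Longrightarrow> length vs \<le> N \<Longrightarrow> cmod (iter_deriv vs f z) \<le> W z"
  shows "bnd N (\<lambda>z. real DIM('a)^N * W z) (f :: 'a::euclidean_space \<Rightarrow> complex)"
  unfolding bnd_def
proof (intro conjI allI impI)
  fix us :: "'a list" and z assume us: "length us \<le> N" "\<forall>v\<in>set us. norm v \<le> 1"
  have W: "0 \<le> W z" using assms(2)[of "[]" z] norm_ge_zero order_trans by (simp, blast)
  have D: "(1::real) \<le> real DIM('a)" using DIM_positive[where 'a='a] by linarith
  have "cmod (iter_deriv us f z) \<le> real DIM('a)^(length us) * W z"
    by (rule iter_deriv_basis_bound) (use assms us in auto)
  also have "\<dots> \<le> real DIM('a)^N * W z"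
    by (intro mult_right_mono power_increasing us D W)
  finally show "cmod (iter_deriv us f z) \<le> real DIM('a)^N * W z" .
qed (rule assms)

lemma finite_lists_Basis: "finite {vs \<in> lists (Basis::'a::euclidean_space set). length vs \<le> N}"
  using finite_lists_length_le[OF finite_Basis, of N] by (simp add: lists_eq_set)

text \<open>Schwartz functions are the functions that are tempered for every exponent. In
  this description, closure under derivatives and under products with tempered functions is
  immediate.\<close>

lemma schwartz_iff:
  fixes f :: "'a::euclidean_space \<Rightarrow> complex"
  shows "f \<in> schwartz \<longleftrightarrow> (\<forall>M. tempered M f)"
proof
  assume f: "f \<in> schwartz"
  then have s: "smooth f" by (simp add: schwartz_def)
  have one: "\<exists>C. \<forall>z. cmod (iter_deriv vs f z) \<le> C * wt M z" if vs: "vs \<in> lists Basis" for vs M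
  proof -
    define n where "n = nat \<lceil>-M\<rceil>"
    have n: "- real n \<le> M" unfolding n_def by linarith
    have "\<exists>C. \<forall>z. norm z ^ k * cmod (iter_deriv vs f z) \<le> C" for k
      using f vs by (auto simp: schwartz_def)
    then obtain D where D: "\<And>k z. norm z ^ k * cmod (iter_deriv vs f z) \<le> D k" by metis
    have "cmod (iter_deriv vs f z) \<le> (\<Sum>k\<le>n. real (n choose k) * D k) * wt M z" for z
    proof -
      have "(1 + norm z)^n * cmod (iter_deriv vs f z)
          = (\<Sum>k\<le>n. real (n choose k) * (norm z ^ k * cmod (iter_deriv vs f z)))"
        using binomial_ring[of "norm z" 1 n]
        by (simp add: sum_distrib_left mult_ac add.commute)
      also have "\<dots> \<le> (\<Sum>k\<le>n. real (n choose k) * D k)"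
        by (intro sum_mono mult_left_mono D) auto
      finally have "wt (real n) z * cmod (iter_deriv vs f z) \<le> (\<Sum>k\<le>n. real (n choose k) * D k)" (is "_ \<le> ?S")
        by (simp add: wt_of_nat)
      then have "wt (- real n) z * (wt (real n) z * cmod (iter_deriv vs f z)) \<le> wt (- real n) z * ?S"
        by (intro mult_left_mono) auto
      moreover have "wt (- real n) z * wt (real n) z = 1" using wt_add[of "- real n" "real n" z] by simp
      ultimately have 1: "cmod (iter_deriv vs f z) \<le> wt (- real n) z * ?S"
        by (simp add: mult.assoc[symmetric])
      then have "0 \<le> ?S" using norm_ge_zero order_trans wt_pos[of "- real n" z]
        by (meson zero_le_mult_iff not_le order_less_le_trans)
      then show ?thesis using 1 mult_right_mono[OF wt_mono[OF n, of z], of ?S]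
        by (simp add: mult.commute)
    qed
    then show ?thesis by blast
  qed
  show "\<forall>M. tempered M f" unfolding tempered_def
  proof (intro allI)
    fix M :: real and N :: nat
    obtain C where C: "\<And>vs z. vs \<in> lists Basis \<Longrightarrow> cmod (iter_deriv vs f z) \<le> C vs * wt M z"
      using one[of _ M] by metis
    let ?L = "{vs \<in> lists (Basis::'a set). length vs \<le> N}"
    define D where "D = (\<Sum>vs\<in>?L. \<bar>C vs\<bar>)"
    have "bnd N (\<lambda>z. real DIM('a)^N * (D * wt M z)) f"
    proof (rule bnd_of_basis[OF s])
      fix vs :: "'a list" and z :: 'a assume vs: "vs \<in> lists Basis" "length vs \<le> N"
      have "\<bar>C vs\<bar> \<le> D" unfolding D_def
        by (rule member_le_sum) (use vs finite_lists_Basis in auto)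
      then have "C vs * wt M z \<le> D * wt M z" by (intro mult_right_mono) auto
      then show "cmod (iter_deriv vs f z) \<le> D * wt M z" using C[OF vs(1), of z] by linarith
    qed
    then show "\<exists>C. bnd N (\<lambda>z. C * wt M z) f" by (simp add: mult.assoc[symmetric]) blast
  qed
next
  assume f: "\<forall>M. tempered M f"
  show "f \<in> schwartz" unfolding schwartz_def
  proof (intro CollectI conjI allI ballI)
    show "smooth f" using f tempered_smooth by blast
    fix k and vs :: "'a list"
    obtain C where C: "\<And>z. cmod (iter_deriv vs f z) \<le> C * wt (- real k) z"
      using tempered_value[OF tempered_iter_deriv[OF f[rule_format, of "- real k"]]] by blast
    have "norm z ^ k * cmod (iter_deriv vs f z) \<le> C" for z
    proof -
      have "norm z ^ k \<le> wt (real k) z" unfolding wt_of_nat by (rule power_mono) auto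
      then have "norm z ^ k * cmod (iter_deriv vs f z) \<le> wt (real k) z * (C * wt (- real k) z)"
        by (intro mult_mono C) auto
      also have "\<dots> = C" using wt_add[of "real k" "- real k" z] by simp
      finally show ?thesis .
    qed
    then show "\<exists>C. \<forall>z. norm z ^ k * cmod (iter_deriv vs f z) \<le> C" by blast
  qed
qed

lemma schwartz_tempered: "f \<in> schwartz \<Longrightarrow> tempered M f"
  by (simp add: schwartz_iff)

lemma schwartz_smooth: "f \<in> schwartz \<Longrightarrow> smooth f"
  by (simp add: schwartz_def)

lemma schwartz_mult_tempered:
  assumes "f \<in> schwartz" "tempered M g" shows "(\<lambda>z. f z * g z) \<in> schwartz"
  unfolding schwartz_iff
proof
  fix M' show "tempered M' (\<lambda>z. f z * g z)"
    using tempered_mult[OF schwartz_tempered[OF assms(1), of "M' - M"] assms(2)] by simp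
qed

lemma schwartz_dir_deriv: "f \<in> schwartz \<Longrightarrow> dir_deriv v f \<in> schwartz"
  by (simp add: schwartz_iff tempered_dir_deriv)

lemma schwartz_cmult: "f \<in> schwartz \<Longrightarrow> (\<lambda>z. c * f z) \<in> schwartz"
  by (simp add: schwartz_iff tempered_cmult)

lemma schwartz_translate: "f \<in> schwartz \<Longrightarrow> (\<lambda>z. f (c + z)) \<in> schwartz"
  by (simp add: schwartz_iff tempered_translate)

text \<open>The lower bound on \<open>L\<close> is what keeps the decay: \<open>1 + |z| \<le> B (1 + |L z|)\<close>.\<close>

lemma schwartz_affine_iso:
  assumes f: "f \<in> schwartz" and L: "bounded_linear L" and inv: "\<And>v. norm v \<le> B * norm (L v)" "1 \<le> B"
  shows "(\<lambda>z. f (c + L z)) \<in> schwartz"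
proof -
  have *: "(\<lambda>z. f (L z)) \<in> schwartz" if f: "f \<in> schwartz" for f
    unfolding schwartz_iff tempered_def
  proof (intro allI)
    fix M :: real and N
    define m where "m = - \<bar>M\<bar>"
    obtain C where C: "bnd N (\<lambda>z. C * wt m z) f" "0 \<le> C"
      using temperedE[OF schwartz_tempered[OF f]] by metis
    obtain B' where B': "\<And>v. norm (L v) \<le> B' * norm v" "1 \<le> B'" using bounded_linear_bound[OF L] by blast
    have w: "wt m (L z) \<le> B powr (-m) * wt m z" for z
    proof -
      have "1 + norm z \<le> B * (1 + norm (L z))" using inv(1)[of z] inv(2) by (simp add: algebra_simps)
      then have "(1 + norm z) powr (-m) \<le> (B * (1 + norm (L z))) powr (-m)"
        by (intro powr_mono2) (auto simp: m_def)
      then have "wt (-m) z \<le> B powr (-m) * wt (-m) (L z)" using inv(2) by (simp add: wt_def powr_mult)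
      then have "wt (-m) z * (wt m z * wt m (L z)) \<le> B powr (-m) * wt (-m) (L z) * (wt m z * wt m (L z))"
        by (intro mult_right_mono) auto
      moreover have "wt (-m) z * wt m z = 1" using wt_add[of "-m" m z] by simp
      moreover have "wt (-m) (L z) * wt m (L z) = 1" using wt_add[of "-m" m "L z"] by simp
      ultimately show ?thesis
        by (metis (no_types, opaque_lifting) mult.assoc mult.commute mult.right_neutral)
    qed
    have "bnd N (\<lambda>z. (B'^N * C * B powr (-m)) * wt m z) (\<lambda>z. f (0 + L z))"
    proof (rule bnd_mono[OF bnd_affine[OF L B'(1) B'(2) C(1)]])
      fix z
      show "B' ^ N * (C * wt m (0 + L z)) \<le> (B'^N * C * B powr (-m)) * wt m z"
        using mult_left_mono[OF w[of z], of "B'^N * C"] C(2) B'(2) by (simp add: mult_ac)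
    qed auto
    then have "bnd N (\<lambda>z. (B'^N * C * B powr (-m)) * wt M z) (\<lambda>z. f (L z))"
      using bnd_wt_mono[of N "B'^N * C * B powr (-m)" m "\<lambda>z. f (L z)" M] by (simp add: m_def)
    then show "\<exists>C. bnd N (\<lambda>z. C * wt M z) (\<lambda>z. f (L z))" by blast
  qed
  show ?thesis using *[OF schwartz_translate[OF f, of c]] .
qed

lemma schwartz_scale:
  assumes f: "f \<in> schwartz" and c: "c \<noteq> 0" shows "(\<lambda>z. f (c *\<^sub>R z)) \<in> schwartz"
proof -
  have "norm v \<le> max 1 (1 / \<bar>c\<bar>) * norm (c *\<^sub>R v)" for v :: 'a
  proof -
    have "1 \<le> max 1 (1 / \<bar>c\<bar>) * \<bar>c\<bar>" using c by (auto simp: max_def field_simps)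
    from mult_right_mono[OF this norm_ge_zero[of v]] show ?thesis by (simp add: mult.assoc)
  qed
  from schwartz_affine_iso[OF f bounded_linear_scaleR_right this, of 0] show ?thesis by simp
qed

subsection \<open>The bracket, the Gaussian and exponentials\<close>

text \<open>The smooth substitute for the weight of exponent \<open>-2\<close> by which amplitudes are multiplied before
  integrating by parts.\<close>

definition bracket_inv :: "'a::euclidean_space \<Rightarrow> complex" where
  "bracket_inv z = of_real (1 / (1 + z \<bullet> z))"

lemma one_plus_inner_pos: "0 < 1 + z \<bullet> (z::'a::real_inner)"
  by (simp add: add_pos_nonneg)

lemma bracket_inv_has_derivative:
  "(bracket_inv has_derivative (\<lambda>v. - 2 * (of_real (z \<bullet> v) * (bracket_inv z * bracket_inv z)))) (at z)"
proof -
  have *: "(1 + z \<bullet> z) \<noteq> 0" using one_plus_inner_pos[of z] by linarith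
  have "((\<lambda>z. 1 + z \<bullet> z) has_derivative (\<lambda>v. z \<bullet> v + v \<bullet> z)) (at z)"
    by (auto intro!: derivative_eq_intros)
  from has_derivative_of_real[OF Deriv.has_derivative_inverse[OF * this]]
  have "((\<lambda>z. complex_of_real (inverse (1 + z \<bullet> z))) has_derivative
    (\<lambda>v. of_real (- (inverse (1 + z \<bullet> z) * (z \<bullet> v + v \<bullet> z) * inverse (1 + z \<bullet> z))))) (at z)" .
  then show ?thesis
    unfolding bracket_inv_def by (simp add: inverse_eq_divide inner_commute algebra_simps)
qed

lemma dir_deriv_bracket_inv:
  "dir_deriv v bracket_inv = (\<lambda>z. - 2 * (of_real (z \<bullet> v) * (bracket_inv z * bracket_inv z)))"
  by (rule ext) (rule dir_deriv_eq[OF bracket_inv_has_derivative])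

lemma smooth_bracket_inv: "smooth bracket_inv"
  by (rule smooth_of_derivative[OF bracket_inv_has_derivative])
    (intro C_k_mult smooth_C_k[OF smooth_const] smooth_C_k[OF smooth_inner]; assumption)

lemma bracket_inv_le: "cmod (bracket_inv z) \<le> 2 * wt (-2) z"
proof -
  have "(1 + norm z)^2 \<le> 2 * (1 + z \<bullet> z)"
    using sum_squares_ge_zero[of "1 - norm z" 0]
    by (simp add: power2_eq_square algebra_simps dot_square_norm)
  moreover have "1 / A \<le> 2 / B" if "0 < A" "0 < B" "B \<le> 2 * A" for A B :: real
    using that by (simp add: field_simps)
  moreover have "1 + norm z \<noteq> 0" using norm_ge_zero[of z] by linarith
  then have "0 < (1 + norm z)^2" by simp
  ultimately have "1 / (1 + z \<bullet> z) \<le> 2 / (1 + norm z)^2"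
    using one_plus_inner_pos[of z] by blast
  also have "\<dots> = 2 * wt (-2) z"
    by (simp add: wt_def powr_minus powr_realpow[of _ 2, simplified] divide_inverse add_pos_nonneg)
  finally show ?thesis using one_plus_inner_pos[of z] unfolding bracket_inv_def norm_of_real by simp
qed

text \<open>The derivative of \<open>(1 + z \<bullet> z)\<inverse>\<close> is a product of \<open>z \<bullet> v\<close>, of growth 1, and two copies of the
  function itself, so that the exponents \<open>1 - 2 - 2 \<le> -2\<close> close the induction.\<close>

lemma tempered_bracket_inv: "tempered (-2) (bracket_inv :: 'a::euclidean_space \<Rightarrow> complex)"
  unfolding tempered_def
proof
  fix N show "\<exists>C. bnd N (\<lambda>z. C * wt (-2) z) (bracket_inv :: 'a \<Rightarrow> complex)"
  proof (induction N)
    case 0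
    then show ?case using bracket_inv_le by (auto simp: bnd_0 smooth_bracket_inv)
  next
    case (Suc N)
    then obtain C where C: "bnd N (\<lambda>z. C * wt (-2) z) (bracket_inv :: 'a \<Rightarrow> complex)" by blast
    define D where "D = 2 * (2^N * 1 * (2^N * C * C))"
    have D: "bnd N (\<lambda>z. D * wt (-2) z) (dir_deriv v bracket_inv)" if v: "norm v \<le> 1" for v :: 'a
    proof -
      have "bnd N (\<lambda>z. 1 * wt 1 z) (\<lambda>z. complex_of_real (z \<bullet> v))" using bnd_inner[OF v] by simp
      from bnd_wt_cmult[OF bnd_wt_mult[OF this bnd_wt_mult[OF C C]], of "-2"]
      have "bnd N (\<lambda>z. D * wt (-3) z) (dir_deriv v bracket_inv)"
        by (simp add: dir_deriv_bracket_inv D_def)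
      then show ?thesis by (rule bnd_wt_mono) simp
    qed
    have "bnd (Suc N) (\<lambda>z. max 2 D * wt (-2) z) (bracket_inv :: 'a \<Rightarrow> complex)"
      unfolding bnd_Suc
    proof (intro conjI allI impI)
      show "cmod (bracket_inv z) \<le> max 2 D * wt (-2) z" for z :: 'a
        by (rule order_trans[OF bracket_inv_le]) (auto intro: mult_right_mono)
      show "bnd N (\<lambda>z. max 2 D * wt (-2) z) (dir_deriv v bracket_inv)" if v: "norm v \<le> 1" for v :: 'a
        by (rule bnd_mono[OF D[OF v]]) (auto intro: mult_right_mono)
    qed (rule smooth_bracket_inv)
    then show ?case by blast
  qed
qed

definition gauss :: "'a::euclidean_space \<Rightarrow> complex" where
  "gauss z = of_real (exp (- (z \<bullet> z) / 2))"

lemma gauss_0 [simp]: "gauss 0 = 1" by (simp add: gauss_def)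

lemma gauss_has_derivative:
  "(gauss has_derivative (\<lambda>v. - 1 * (of_real (z \<bullet> v) * gauss z))) (at z)"
  unfolding gauss_def
  by (auto intro!: derivative_eq_intros ext simp: inner_commute scaleR_conv_of_real)

lemma dir_deriv_gauss: "dir_deriv v gauss = (\<lambda>z. - 1 * (of_real (z \<bullet> v) * gauss z))"
  by (rule ext) (rule dir_deriv_eq[OF gauss_has_derivative])

lemma smooth_gauss: "smooth gauss"
  by (rule smooth_of_derivative[OF gauss_has_derivative])
    (intro C_k_mult smooth_C_k[OF smooth_const] smooth_C_k[OF smooth_inner]; assumption)

text \<open>One term \<open>y\<^sup>n / n!\<close> of the exponential series bounds \<open>exp (- y)\<close> by a multiple of \<open>y\<^sup>-\<^sup>n\<close>. Taking
  \<open>y = (1 + z \<bullet> z) / 2\<close> rather than \<open>(z \<bullet> z) / 2\<close> costs a factor \<open>exp (1/2)\<close> and makes \<open>y\<close> comparable to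
  the square of \<open>1 + |z|\<close>.\<close>

lemma gauss_le: "\<exists>C. \<forall>z::'a::euclidean_space. cmod (gauss z) \<le> C * wt M z"
proof -
  define n where "n = nat \<lceil>\<bar>M\<bar>\<rceil>"
  have n: "- real (2 * n) \<le> M" unfolding n_def by linarith
  have "cmod (gauss z) \<le> (exp (1/2) * (fact n * 4^n)) * wt M z" for z :: 'a
  proof -
    define y where "y = (1 + z \<bullet> z) / 2"
    have y: "y > 0" using one_plus_inner_pos[of z] by (simp add: y_def)
    have "y^n / fact n \<le> exp y"
    proof -
      have "(\<Sum>k\<in>{n}. y^k /\<^sub>R fact k) \<le> (\<Sum>k. y^k /\<^sub>R fact k)"
        by (rule sum_le_suminf[OF summable_exp_generic]) (use y in auto)
      then show ?thesis by (simp add: exp_def divide_inverse mult.commute)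
    qed
    moreover have "(1 + norm z)^2 \<le> 4 * y"
      using sum_squares_ge_zero[of "1 - norm z" 0]
      by (simp add: y_def power2_eq_square algebra_simps dot_square_norm)
    then have "((1 + norm z)^2)^n \<le> (4 * y)^n" by (rule power_mono) simp
    then have "(1 + norm z)^(2*n) \<le> 4^n * y^n" by (simp add: power_mult power_mult_distrib)
    ultimately have "(1 + norm z)^(2*n) \<le> 4^n * (fact n * exp y)"
      by (smt (verit) fact_gt_zero mult_left_mono pos_divide_le_eq zero_le_power mult.commute)
    then have "wt (real (2*n)) z * exp (-y) \<le> 4^n * (fact n * exp y) * exp (-y)"
      unfolding wt_of_nat by (intro mult_right_mono) auto
    then have "wt (real (2*n)) z * exp (-y) \<le> fact n * 4^n"
      by (simp add: mult.assoc exp_minus) (simp add: mult.commute)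
    then have "wt (- real (2*n)) z * (wt (real (2*n)) z * exp (-y)) \<le> wt (- real (2*n)) z * (fact n * 4^n)"
      by (intro mult_left_mono) auto
    moreover have "wt (- real (2*n)) z * wt (real (2*n)) z = 1"
      using wt_add[of "- real (2*n)" "real (2*n)" z] by simp
    ultimately have "exp (-y) \<le> wt (- real (2*n)) z * (fact n * 4^n)"
      by (metis mult.assoc mult_1)
    also have "\<dots> \<le> wt M z * (fact n * 4^n)" using n by (intro mult_right_mono wt_mono) auto
    finally have "exp (-y) \<le> wt M z * (fact n * 4^n)" .
    moreover have "cmod (gauss z) = exp (1/2) * exp (-y)"
      by (simp add: gauss_def y_def exp_add[symmetric] field_simps)
    ultimately show ?thesis by (simp add: mult_ac)
  qed
  then show ?thesis by blast
qed

text \<open>The derivative of the Gaussian costs one power of the weight; starting the induction from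
  arbitrarily fast decay absorbs it.\<close>

lemma gauss_schwartz: "gauss \<in> schwartz"
proof -
  have "\<exists>C. bnd N (\<lambda>z. C * wt M z) (gauss :: 'a \<Rightarrow> complex)" for N M
  proof (induction N arbitrary: M)
    case 0
    then show ?case using gauss_le[of M] by (auto simp: bnd_0 smooth_gauss)
  next
    case (Suc N)
    obtain D where D0: "bnd N (\<lambda>z. D * wt (M - 1) z) (gauss :: 'a \<Rightarrow> complex)" using Suc.IH by blast
    obtain C where C: "\<And>z::'a. cmod (gauss z) \<le> C * wt M z" using gauss_le[of M] by blast
    have D: "bnd N (\<lambda>z. (2^N * 1 * D) * wt M z) (dir_deriv v gauss)" if v: "norm v \<le> 1" for v :: 'a
    proof -
      have "bnd N (\<lambda>z. 1 * wt 1 z) (\<lambda>z. complex_of_real (z \<bullet> v))" using bnd_inner[OF v] by simp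
      from bnd_wt_cmult[OF bnd_wt_mult[OF this D0], of "-1"] show ?thesis by (simp add: dir_deriv_gauss)
    qed
    have "bnd (Suc N) (\<lambda>z. max C (2^N * 1 * D) * wt M z) (gauss :: 'a \<Rightarrow> complex)"
      unfolding bnd_Suc
    proof (intro conjI allI impI)
      show "cmod (gauss z) \<le> max C (2^N * 1 * D) * wt M z" for z :: 'a
        by (rule order_trans[OF C]) (auto intro: mult_right_mono)
      show "bnd N (\<lambda>z. max C (2^N * 1 * D) * wt M z) (dir_deriv v gauss)" if v: "norm v \<le> 1" for v :: 'a
        by (rule bnd_mono[OF D[OF v]]) (auto intro: mult_right_mono)
    qed (rule smooth_gauss)
    then show ?case by blast
  qed
  then show ?thesis by (simp add: schwartz_iff tempered_def)
qed


definition exponential :: "'a::euclidean_space \<Rightarrow> 'a \<Rightarrow> complex" where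
  "exponential \<zeta> z = cis (\<zeta> \<bullet> z)"

lemma norm_exponential [simp]: "cmod (exponential \<zeta> z) = 1"
  by (simp add: exponential_def)

lemma exponential_has_derivative:
  "(exponential \<zeta> has_derivative (\<lambda>v. (\<i> * of_real (v \<bullet> \<zeta>)) * exponential \<zeta> z)) (at z)"
  unfolding exponential_def by (auto intro!: derivative_eq_intros simp: scaleR_conv_of_real inner_commute mult_ac)

lemma dir_deriv_exponential:
  "dir_deriv v (exponential \<zeta>) = (\<lambda>z. (\<i> * of_real (v \<bullet> \<zeta>)) * exponential \<zeta> z)"
  by (rule ext) (rule dir_deriv_eq[OF exponential_has_derivative])

lemma smooth_exponential: "smooth (exponential \<zeta>)"
  by (rule smooth_of_derivative[OF exponential_has_derivative])
    (intro C_k_mult smooth_C_k[OF smooth_const]; assumption)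

text \<open>Derivatives up to order \<open>N\<close> cost a power of the frequency, not of \<open>z\<close>. The dependence on \<open>\<zeta>\<close> is
  recorded because superpositions integrate over \<open>\<zeta>\<close> against rapidly decreasing coefficients.\<close>

lemma bnd_exponential: "bnd N (\<lambda>z. wt (real N) \<zeta>) (exponential \<zeta>)"
proof (induction N)
  case 0
  show ?case by (simp add: bnd_0 smooth_exponential)
next
  case (Suc N)
  show ?case unfolding bnd_Suc
  proof (intro conjI allI impI)
    show "cmod (exponential \<zeta> z) \<le> wt (real (Suc N)) \<zeta>" for z
      using wt_ge_1[of "real (Suc N)" \<zeta>] by simp
    fix v :: 'a assume v: "norm v \<le> 1"
    have "\<bar>v \<bullet> \<zeta>\<bar> \<le> 1 + norm \<zeta>"
      using Cauchy_Schwarz_ineq2[of v \<zeta>] mult_right_mono[OF v norm_ge_zero[of \<zeta>]] by simp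
    then have "cmod (\<i> * of_real (v \<bullet> \<zeta>)) * wt (real N) \<zeta> \<le> wt (real (Suc N)) \<zeta>"
      unfolding wt_of_nat by (simp add: norm_mult mult_right_mono)
    then show "bnd N (\<lambda>z. wt (real (Suc N)) \<zeta>) (dir_deriv v (exponential \<zeta>))"
      unfolding dir_deriv_exponential by (intro bnd_mono[OF bnd_cmult[OF Suc]]) auto
  qed (rule smooth_exponential)
qed

lemma tempered_exponential: "tempered 0 (exponential \<zeta>)"
  unfolding tempered_def
proof
  fix N show "\<exists>C. bnd N (\<lambda>z. C * wt 0 z) (exponential \<zeta>)"
    using bnd_exponential[of N \<zeta>] by (intro exI[of _ "wt (real N) \<zeta>"]) simp
qed

section \<open>Integration over Euclidean space\<close>

lemma lborel_product:
  fixes f :: "'a::euclidean_space \<Rightarrow> real \<Rightarrow> 'c::{real_normed_field,banach,second_countable_topology}"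
  assumes f: "\<And>b. b \<in> Basis \<Longrightarrow> integrable lborel (f b)"
  shows "integrable lborel (\<lambda>z. \<Prod>b\<in>Basis. f b (z \<bullet> b))"
    and "(LINT z|lborel. (\<Prod>b\<in>Basis. f b (z \<bullet> b))) = (\<Prod>b\<in>Basis. LINT x|lborel. f b x)"
proof -
  interpret product_sigma_finite "\<lambda>b::'a. lborel :: real measure" ..
  let ?S = "\<lambda>g::'a \<Rightarrow> real. \<Sum>b\<in>Basis. g b *\<^sub>R b"
  have [measurable]: "f b \<in> borel_measurable borel" if "b \<in> Basis" for b
    using f[OF that] by (auto dest: borel_measurable_integrable)
  have m: "?S \<in> measurable (\<Pi>\<^sub>M b\<in>Basis. lborel) borel" by measurable
  have g: "(\<lambda>z. \<Prod>b\<in>Basis. f b (z \<bullet> b)) \<in> borel_measurable borel"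
    by (intro borel_measurable_prod) measurable
  have e: "(\<Prod>b\<in>Basis. f b (?S x \<bullet> b)) = (\<Prod>b\<in>Basis. f b (x b))" for x :: "'a \<Rightarrow> real"
    by (intro prod.cong refl) (simp add: inner_sum_left inner_Basis if_distrib cong: if_cong)
  show "integrable lborel (\<lambda>z. \<Prod>b\<in>Basis. f b (z \<bullet> b))"
    unfolding lborel_eq[where 'a='a] integrable_distr_eq[OF m g] e
    by (rule product_integrable_prod) (use f in auto)
  show "(LINT z|lborel. (\<Prod>b\<in>Basis. f b (z \<bullet> b))) = (\<Prod>b\<in>Basis. LINT x|lborel. f b x)"
    unfolding lborel_eq[where 'a='a] integral_distr[OF m g] e
    by (rule product_integral_prod) (use f in auto)
qed

lemma integrable_inverse_square: "integrable lborel (\<lambda>x::real. 1 / (1 + x^2))"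
proof -
  have "einterval (-\<infinity>) \<infinity> = (UNIV :: real set)" by (auto simp: einterval_def)
  then show ?thesis
    using integrable_inverse_1_plus_square by (simp add: set_integrable_def divide_inverse)
qed

text \<open>The exponent \<open>-2 DIM('a)\<close> allows a comparison with the product of the integrable
  functions \<open>1 / (1 + x\<^sub>b\<^sup>2)\<close> of the coordinates, since \<open>(1 + |z|)\<^sup>2 \<ge> 1 + x\<^sub>b\<^sup>2\<close> for each of them.\<close>

lemma integrable_wt:
  assumes M: "M \<le> - 2 * real DIM('a)"
  shows "integrable lborel (wt M :: 'a::euclidean_space \<Rightarrow> real)"
proof (rule Bochner_Integration.integrable_bound[OF lborel_product(1)])
  show "integrable lborel (\<lambda>x::real. 1 / (1 + x^2))" by (rule integrable_inverse_square)
  show "AE z in lborel. norm (wt M z) \<le> norm (\<Prod>b\<in>(Basis::'a set). 1 / (1 + (z \<bullet> b)^2))"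
  proof (rule AE_I2)
    fix z :: 'a
    have pos: "0 < 1 + norm z" using norm_ge_zero[of z] by linarith
    have one: "inverse ((1 + norm z)^2) \<le> 1 / (1 + (z \<bullet> b)^2)" if "b \<in> Basis" for b
    proof -
      have "(z \<bullet> b)^2 \<le> (norm z)^2" using Basis_le_norm[OF that, of z] by (metis abs_norm_cancel abs_le_square_iff)
      moreover have "(1 + norm z)^2 = 1 + 2 * norm z + (norm z)^2"
        by (simp add: power2_eq_square algebra_simps)
      ultimately have "1 + (z \<bullet> b)^2 \<le> (1 + norm z)^2"
        using norm_ge_zero[of z] by linarith
      moreover have "0 < 1 + (z \<bullet> b)^2" by (simp add: add_pos_nonneg)
      ultimately show ?thesis by (simp add: inverse_eq_divide frac_le)
    qed
    have "wt M z \<le> wt (- real (2 * DIM('a))) z" by (rule wt_mono) (use M in simp)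
    also have "\<dots> = (\<Prod>b\<in>(Basis::'a set). inverse ((1 + norm z)^2))"
      using pos by (simp add: wt_def powr_minus powr_realpow[of _ "2 * DIM('a)", simplified] power_mult power_inverse)
    also have "\<dots> \<le> (\<Prod>b\<in>(Basis::'a set). 1 / (1 + (z \<bullet> b)^2))"
      by (rule prod_mono) (use one pos in auto)
    finally show "norm (wt M z) \<le> norm (\<Prod>b\<in>(Basis::'a set). 1 / (1 + (z \<bullet> b)^2))" by simp
  qed
qed simp

lemma integrable_wt_bound:
  fixes f :: "'a::euclidean_space \<Rightarrow> 'b::{banach,second_countable_topology}"
  assumes "f \<in> borel_measurable borel" "\<And>z. norm (f z) \<le> C * wt M z" "M \<le> - 2 * real DIM('a)"
  shows "integrable lborel f"
proof (rule Bochner_Integration.integrable_bound[OF integrable_mult_right[OF integrable_wt[OF assms(3)]]])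
  show "AE z in lborel. norm (f z) \<le> norm (C * wt M z)"
    using assms(2) by (intro AE_I2) (smt (verit) real_norm_def)
qed (use assms(1) in simp)

lemma tempered_integrable:
  assumes "tempered M f" "M \<le> - 2 * real DIM('a)"
  shows "integrable lborel (f :: 'a::euclidean_space \<Rightarrow> complex)"
  using tempered_value[OF assms(1)] smooth_borel_measurable[OF tempered_smooth[OF assms(1)]] assms(2)
    integrable_wt_bound by metis

lemma schwartz_integrable: "f \<in> schwartz \<Longrightarrow> integrable lborel f"
  using tempered_integrable schwartz_tempered by blast

lemma lborel_integral_translate:
  fixes f :: "'a::euclidean_space \<Rightarrow> 'b::{banach,second_countable_topology}"
  assumes "f \<in> borel_measurable borel"
  shows "(LINT z|lborel. f (c + z)) = (LINT z|lborel. f z)"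
    and "integrable lborel (\<lambda>z. f (c + z)) \<longleftrightarrow> integrable lborel f"
proof -
  have m: "(+) c \<in> measurable lborel borel" by simp
  show "(LINT z|lborel. f (c + z)) = (LINT z|lborel. f z)"
    using integral_distr[OF m assms] by (simp add: lborel_distr_plus)
  show "integrable lborel (\<lambda>z. f (c + z)) \<longleftrightarrow> integrable lborel f"
    using integrable_distr_eq[OF m assms] by (simp add: lborel_distr_plus)
qed

lemma lborel_integral_scale:
  fixes f :: "'a::euclidean_space \<Rightarrow> complex"
  assumes "f \<in> borel_measurable borel" "0 < c"
  shows "(LINT z|lborel. f z) = of_real (c ^ DIM('a)) * (LINT z|lborel. f (c *\<^sub>R z))"
proof -
  have "(LINT z|lborel. f z) = (LINT z|density (distr lborel borel (\<lambda>x. 0 + c *\<^sub>R x)) (\<lambda>_. ennreal (\<bar>c\<bar>^DIM('a))). f z)"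
    using lborel_affine[of c "0::'a"] assms by simp
  also have "\<dots> = (LINT z|distr lborel borel (\<lambda>x. 0 + c *\<^sub>R x). (\<bar>c\<bar>^DIM('a)) *\<^sub>R f z)"
    by (rule integral_density) (use assms in auto)
  also have "\<dots> = (LINT z|lborel. (\<bar>c\<bar>^DIM('a)) *\<^sub>R f (c *\<^sub>R z))"
    using assms by (subst integral_distr) auto
  finally show ?thesis using assms by (simp add: scaleR_conv_of_real)
qed

text \<open>The integral of a translate does not depend on the translation, hence its derivative, the
  integral of a directional derivative, vanishes.\<close>

lemma integral_dir_deriv_eq_0:
  fixes f :: "'a::euclidean_space \<Rightarrow> complex"
  assumes f: "bnd 1 (\<lambda>z. C * wt M z) f" and M: "M \<le> - 2 * real DIM('a)"
  shows "integrable lborel (dir_deriv v f)" "(LINT z|lborel. dir_deriv v f z) = 0"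
proof -
  have s: "smooth f" using f bnd_smooth by blast
  have C: "0 \<le> C" using f bnd_wt_nonneg by blast
  have "bnd 0 (\<lambda>z. norm v * (C * wt M z)) (dir_deriv v f)" using bnd_scale_dir f by fastforce
  then have d: "cmod (dir_deriv v f z) \<le> (norm v * C) * wt M z" for z
    using bnd_value[of 0 "\<lambda>z. norm v * (C * wt M z)" "dir_deriv v f" z] by (simp add: mult.assoc)
  have dm: "dir_deriv v f \<in> borel_measurable borel" by (intro smooth_borel_measurable smooth_dir_deriv s)
  show "integrable lborel (dir_deriv v f)" by (rule integrable_wt_bound[OF dm d M])
  have fm: "f \<in> borel_measurable borel" by (rule smooth_borel_measurable[OF s])
  have fi: "integrable lborel f" by (rule integrable_wt_bound[OF fm bnd_value[OF f] M])
  define Q where "Q k z = (f (z + (1 / real (Suc k)) *\<^sub>R v) - f z) * of_real (real (Suc k))" for k z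
  have fti: "integrable lborel (\<lambda>z. f (z + c))" for c
    using lborel_integral_translate(2)[OF fm, of c] fi by (simp add: add.commute)
  have Q0: "(LINT z|lborel. Q k z) = 0" for k
    unfolding Q_def
    using lborel_integral_translate(1)[OF fm, of "(1 / real (Suc k)) *\<^sub>R v"]
    by (simp add: fi fti add.commute)
  define K where "K = norm v * C * wt \<bar>M\<bar> v"
  have "(\<lambda>k. LINT z|lborel. Q k z) \<longlonglongrightarrow> (LINT z|lborel. dir_deriv v f z)"
  proof (rule integral_dominated_convergence)
    show "integrable lborel (\<lambda>z::'a. K * wt M z)" by (intro integrable_mult_right integrable_wt M)
    show "AE z in lborel. (\<lambda>k. Q k z) \<longlonglongrightarrow> dir_deriv v f z"
    proof (rule AE_I2)
      fix z
      have "((\<lambda>t. f (z + t *\<^sub>R v)) has_derivative (\<lambda>s. dir_deriv (s *\<^sub>R v) f (z + 0 *\<^sub>R v))) (at 0)"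
        by (rule has_derivative_affine_compose[of "\<lambda>t. t *\<^sub>R v"])
          (auto intro!: smooth_has_derivative s bounded_linear_scaleR_left)
      then have "((\<lambda>t. cmod (f (z + t *\<^sub>R v) - f z - of_real t * dir_deriv v f z) / norm t) \<longlongrightarrow> 0) (at 0)"
        unfolding has_derivative_at by (simp add: dir_deriv_scaleR[OF s])
      moreover have "\<forall>\<^sub>F t in at 0. cmod (f (z + t *\<^sub>R v) - f z - of_real t * dir_deriv v f z) / norm t
          = cmod ((f (z + t *\<^sub>R v) - f z) /\<^sub>R t - dir_deriv v f z)"
      proof (rule eventually_mono[OF eventually_neq_at_within[of 0]])
        fix t :: real assume "t \<noteq> 0"
        then have "(f (z + t *\<^sub>R v) - f z) /\<^sub>R t - dir_deriv v f z
            = (f (z + t *\<^sub>R v) - f z - of_real t * dir_deriv v f z) /\<^sub>R t"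
          by (simp add: scaleR_conv_of_real field_simps)
        then show "cmod (f (z + t *\<^sub>R v) - f z - of_real t * dir_deriv v f z) / norm t
          = cmod ((f (z + t *\<^sub>R v) - f z) /\<^sub>R t - dir_deriv v f z)"
          by (simp add: divide_inverse mult.commute)
      qed
      ultimately have "((\<lambda>t. cmod ((f (z + t *\<^sub>R v) - f z) /\<^sub>R t - dir_deriv v f z)) \<longlongrightarrow> 0) (at 0)"
        by (rule Lim_transform_eventually)
      then have *: "((\<lambda>t. (f (z + t *\<^sub>R v) - f z) /\<^sub>R t) \<longlongrightarrow> dir_deriv v f z) (at 0)"
        by (simp add: tendsto_norm_zero_iff LIM_zero_iff)
      have "filterlim (\<lambda>k. 1 / real (Suc k)) (at 0) sequentially"
        by (rule filterlim_atI) (use inverse_Suc_tendsto in \<open>auto simp del: of_nat_Suc\<close>)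
      from filterlim_compose[OF * this] show "(\<lambda>k. Q k z) \<longlonglongrightarrow> dir_deriv v f z"
        by (simp add: Q_def scaleR_conv_of_real mult.commute divide_inverse)
    qed
    fix k
    show "AE z in lborel. norm (Q k z) \<le> K * wt M z"
    proof (rule AE_I2)
      fix z
      let ?h = "1 / real (Suc k)"
      have "cmod (f (z + ?h *\<^sub>R v) - f z - of_real ?h * 0) \<le> (K * wt M z) * ?h"
      proof (rule dir_deriv_increment_bound)
        fix t assume t: "0 \<le> t" "t \<le> ?h"
        have "?h \<le> 1" by simp
        then have t1: "t \<le> 1" using t by linarith
        have "cmod (dir_deriv v f (z + t *\<^sub>R v)) \<le> (norm v * C) * wt M (z + t *\<^sub>R v)" by (rule d)
        also have "\<dots> \<le> (norm v * C) * (wt M z * wt \<bar>M\<bar> (t *\<^sub>R v))"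
          by (intro mult_left_mono wt_peetre) (use C in auto)
        also have "\<dots> \<le> (norm v * C) * (wt M z * wt \<bar>M\<bar> v)"
          by (intro mult_left_mono wt_norm_mono) (use C t t1 in \<open>auto intro: mult_left_le_one_le\<close>)
        finally show "cmod (dir_deriv v f (z + t *\<^sub>R v) - 0) \<le> K * wt M z"
          by (simp add: K_def mult_ac)
      qed (use s smooth_differentiable in auto)
      then show "norm (Q k z) \<le> K * wt M z"
        unfolding Q_def norm_mult norm_of_real
        by (simp add: pos_le_divide_eq del: of_nat_Suc)
    qed
    show "Q k \<in> borel_measurable lborel"
      unfolding Q_def using fm fti[THEN borel_measurable_integrable] by measurable
  qed (use dm in simp)
  then show "(LINT z|lborel. dir_deriv v f z) = 0" unfolding Q0 using LIMSEQ_unique tendsto_const by metis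
qed

section \<open>Convergence of tempered functions\<close>

text \<open>Pointwise convergence of all derivatives: limits will be taken under integrals by dominated
  convergence.\<close>

definition dconv :: "(nat \<Rightarrow> 'a::euclidean_space \<Rightarrow> complex) \<Rightarrow> ('a \<Rightarrow> complex) \<Rightarrow> bool" where
  "dconv f g \<longleftrightarrow> (\<forall>k. smooth (f k)) \<and> smooth g \<and>
    (\<forall>vs z. (\<lambda>k. iter_deriv vs (f k) z) \<longlonglongrightarrow> iter_deriv vs g z)"

lemma dconv_smooth: "dconv f g \<Longrightarrow> smooth (f k)" "dconv f g \<Longrightarrow> smooth g"
  and dconvD: "dconv f g \<Longrightarrow> (\<lambda>k. iter_deriv vs (f k) z) \<longlonglongrightarrow> iter_deriv vs g z"
  by (auto simp: dconv_def)

lemma dconv_value: "dconv f g \<Longrightarrow> (\<lambda>k. f k z) \<longlonglongrightarrow> g z"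
  using dconvD[of f g "[]"] by simp

lemma dconv_dir_deriv: "dconv f g \<Longrightarrow> dconv (\<lambda>k. dir_deriv v (f k)) (dir_deriv v g)"
  using dconvD[of f g "vs @ [v]" for vs]
  by (auto simp: dconv_def smooth_dir_deriv iter_deriv_append)

lemma dconv_const: "smooth f \<Longrightarrow> dconv (\<lambda>k. f) f"
  by (auto simp: dconv_def)

lemma dconv_add: "dconv f g \<Longrightarrow> dconv f' g' \<Longrightarrow> dconv (\<lambda>k z. f k z + f' k z) (\<lambda>z. g z + g' z)"
  by (auto simp: dconv_def smooth_add iter_deriv_add intro!: tendsto_add)

lemma dconv_cmult: "dconv f g \<Longrightarrow> dconv (\<lambda>k z. c * f k z) (\<lambda>z. c * g z)"
  by (auto simp: dconv_def smooth_cmult iter_deriv_cmult intro!: tendsto_mult)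

lemma dconv_sum:
  "(\<And>i. i \<in> I \<Longrightarrow> dconv (f i) (g i)) \<Longrightarrow> dconv (\<lambda>k z. \<Sum>i\<in>I. f i k z) (\<lambda>z. \<Sum>i\<in>I. g i z)"
  by (induction I rule: infinite_finite_induct) (auto intro: dconv_add dconv_const smooth_const)

lemma dconv_mult:
  assumes "dconv f g" "dconv f' g'" shows "dconv (\<lambda>k z. f k z * f' k z) (\<lambda>z. g z * g' z)"
proof -
  have "(\<lambda>k. iter_deriv vs (\<lambda>z. f k z * f' k z) z) \<longlonglongrightarrow> iter_deriv vs (\<lambda>z. g z * g' z) z" for vs z
    using assms
  proof (induction vs arbitrary: f g f' g' rule: rev_induct)
    case Nil
    then show ?case using tendsto_mult[OF dconv_value[OF Nil(1)] dconv_value[OF Nil(2)]] by simp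
  next
    case (snoc v vs)
    note s = dconv_smooth[OF snoc.prems(1)] dconv_smooth[OF snoc.prems(2)]
    have "(\<lambda>k. iter_deriv vs (\<lambda>z. dir_deriv v (f k) z * f' k z) z
          + iter_deriv vs (\<lambda>z. f k z * dir_deriv v (f' k) z) z)
        \<longlonglongrightarrow> iter_deriv vs (\<lambda>z. dir_deriv v g z * g' z) z + iter_deriv vs (\<lambda>z. g z * dir_deriv v g' z) z"
      using snoc.prems by (intro tendsto_add snoc.IH dconv_dir_deriv)
    then show ?case using s
      by (simp add: iter_deriv_append dir_deriv_mult iter_deriv_add smooth_mult smooth_dir_deriv)
  qed
  then show ?thesis using assms by (auto simp: dconv_def intro: smooth_mult)
qed

lemma dconv_affine:
  assumes "dconv f g" "bounded_linear L" shows "dconv (\<lambda>k z. f k (c + L z)) (\<lambda>z. g (c + L z))"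
  using assms by (auto simp: dconv_def iter_deriv_affine[OF assms(2)] intro: smooth_affine)

lemma bnd_limit:
  fixes g :: "'a::euclidean_space \<Rightarrow> complex"
  assumes "dconv f g" "\<And>k. bnd N W (f k)" shows "bnd N W g"
  unfolding bnd_def
proof (intro conjI allI impI)
  show "smooth g" using assms dconv_smooth by blast
  fix vs :: "'a list" and z assume "length vs \<le> N" "\<forall>v\<in>set vs. norm v \<le> 1"
  then show "cmod (iter_deriv vs g z) \<le> W z"
    using bndD[OF assms(2)] by (intro LIMSEQ_le_const2[OF tendsto_norm[OF dconvD[OF assms(1)]]]) auto
qed

text \<open>The mode of convergence under which oscillatory integrals are continuous: all derivatives converge
  pointwise, and they are dominated by one weight uniformly in the sequence. Convergence in the
  weighted sup norms would be too strong: the cutoffs of a function need not converge in these norms.\<close>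

definition tconv :: "real \<Rightarrow> (nat \<Rightarrow> 'a::euclidean_space \<Rightarrow> complex) \<Rightarrow> ('a \<Rightarrow> complex) \<Rightarrow> bool" where
  "tconv M f g \<longleftrightarrow> dconv f g \<and> (\<forall>N. \<exists>K. \<forall>k. bnd N (\<lambda>z. K * wt M z) (f k))"

lemma tconv_dconv: "tconv M f g \<Longrightarrow> dconv f g"
  by (simp add: tconv_def)

lemma tconvE:
  assumes "tconv M f g" obtains K where "0 \<le> K" "\<And>k. bnd N (\<lambda>z. K * wt M z) (f k)"
  using assms bnd_wt_nonneg unfolding tconv_def by blast

lemma tconv_tempered: "tconv M f g \<Longrightarrow> tempered M (f k)"
  unfolding tconv_def tempered_def by blast

lemma tconv_tempered_limit: "tconv M f g \<Longrightarrow> tempered M g"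
  unfolding tconv_def tempered_def using bnd_limit by blast

lemma tconv_const: "tempered M f \<Longrightarrow> tconv M (\<lambda>k. f) f"
  using dconv_const[OF tempered_smooth] by (auto simp: tconv_def tempered_def)

lemma tconv_mult:
  assumes "tconv M f g" "tconv M' f' g'"
  shows "tconv (M + M') (\<lambda>k z. f k z * f' k z) (\<lambda>z. g z * g' z)"
  unfolding tconv_def
proof (intro conjI allI)
  show "dconv (\<lambda>k z. f k z * f' k z) (\<lambda>z. g z * g' z)"
    by (rule dconv_mult) (use assms tconv_dconv in blast)+
  fix N
  obtain K K' where "\<And>k. bnd N (\<lambda>z. K * wt M z) (f k)" "\<And>k. bnd N (\<lambda>z. K' * wt M' z) (f' k)"
    using tconvE[OF assms(1)] tconvE[OF assms(2)] by metis
  from bnd_wt_mult[OF this] show "\<exists>K. \<forall>k. bnd N (\<lambda>z. K * wt (M + M') z) (\<lambda>z. f k z * f' k z)"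
    by blast
qed

lemma tconv_dir_deriv:
  assumes "tconv M f g" shows "tconv M (\<lambda>k. dir_deriv v (f k)) (dir_deriv v g)"
  unfolding tconv_def
proof (intro conjI allI)
  show "dconv (\<lambda>k. dir_deriv v (f k)) (dir_deriv v g)" using assms tconv_dconv dconv_dir_deriv by blast
  fix N
  obtain K where "\<And>k. bnd (Suc N) (\<lambda>z. K * wt M z) (f k)" using tconvE[OF assms] by metis
  then have "\<And>k. bnd N (\<lambda>z. (norm v * K) * wt M z) (dir_deriv v (f k))"
    using bnd_scale_dir[of N "\<lambda>z. K * wt M z" _ v] by (simp add: mult.assoc)
  then show "\<exists>K. \<forall>k. bnd N (\<lambda>z. K * wt M z) (dir_deriv v (f k))" by blast
qed

lemma tconv_affine:
  assumes f: "tconv M f g" and L: "bounded_linear L" and M: "0 \<le> M"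
  shows "tconv M (\<lambda>k z. f k (c + L z)) (\<lambda>z. g (c + L z))"
  unfolding tconv_def
proof (intro conjI allI)
  show "dconv (\<lambda>k z. f k (c + L z)) (\<lambda>z. g (c + L z))" using f L tconv_dconv dconv_affine by blast
  fix N
  obtain K where K: "\<And>k. bnd N (\<lambda>z. K * wt M z) (f k)" using tconvE[OF f] by metis
  obtain B where "1 \<le> B" "\<And>v. norm (L v) \<le> B * norm v" using bounded_linear_bound[OF L] by blast
  then show "\<exists>K. \<forall>k. bnd N (\<lambda>z. K * wt M z) (\<lambda>z. f k (c + L z))"
    using bnd_wt_affine[OF K L _ _ M] by blast
qed

lemma tconv_translate:
  assumes f: "tconv M f g" shows "tconv M (\<lambda>k z. f k (c + z)) (\<lambda>z. g (c + z))"
  using dconv_affine[OF tconv_dconv[OF f] bounded_linear_ident, of c] f bnd_wt_translate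
  unfolding tconv_def by blast

lemma iter_deriv_map_scaleR:
  "smooth f \<Longrightarrow> iter_deriv (map (\<lambda>v. c *\<^sub>R v) vs) f = (\<lambda>z. of_real (c ^ length vs) * iter_deriv vs f z)"
  by (induction vs)
    (auto simp: dir_deriv_scaleR smooth_iter_deriv dir_deriv_cmult smooth_cmult mult.assoc
      simp del: of_real_power)

text \<open>Cutoffs \<open>\<psi>(\<epsilon> z)\<close> tend to 1 in this sense: derivatives of positive order carry a factor \<open>\<epsilon>\<close> and tend
  to 0, while all of them stay bounded. Hence every tempered function is a limit of Schwartz
  functions.\<close>

lemma tconv_cutoff:
  assumes psi: "\<psi> \<in> schwartz" "\<psi> 0 = 1" and e: "e \<longlonglongrightarrow> 0"
  shows "tconv 0 (\<lambda>k z. \<psi> (e k *\<^sub>R z)) (\<lambda>z. 1)"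
proof -
  have s: "smooth \<psi>" using psi schwartz_smooth by blast
  have L: "bounded_linear (\<lambda>v. e k *\<^sub>R v)" for k by (rule bounded_linear_scaleR_right)
  have it: "iter_deriv vs (\<lambda>z. \<psi> (e k *\<^sub>R z)) z = of_real (e k ^ length vs) * iter_deriv vs \<psi> (e k *\<^sub>R z)" for vs k z
    using iter_deriv_affine[OF L s, of vs 0 k] by (simp add: iter_deriv_map_scaleR[OF s])
  have lim: "(\<lambda>k. iter_deriv vs (\<lambda>z. \<psi> (e k *\<^sub>R z)) z) \<longlonglongrightarrow> iter_deriv vs (\<lambda>z. 1) z" for vs z
  proof -
    have "isCont (iter_deriv vs \<psi>) 0"
      using smooth_continuous_on[OF smooth_iter_deriv[OF s], of UNIV] by (simp add: continuous_on_eq_continuous_at)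
    moreover have "(\<lambda>k. e k *\<^sub>R z) \<longlonglongrightarrow> 0" using tendsto_scaleR[OF e tendsto_const, of z] by simp
    ultimately have "(\<lambda>k. iter_deriv vs \<psi> (e k *\<^sub>R z)) \<longlonglongrightarrow> iter_deriv vs \<psi> 0" by (rule isCont_tendsto_compose)
    then have "(\<lambda>k. of_real (e k ^ length vs) * iter_deriv vs \<psi> (e k *\<^sub>R z)) \<longlonglongrightarrow> of_real (0 ^ length vs) * iter_deriv vs \<psi> 0"
      by (intro tendsto_intros e)
    then show ?thesis using psi(2) by (cases "vs = []") (auto simp: it iter_deriv_const power_0_left)
  qed
  obtain b where b: "\<And>k. \<bar>e k\<bar> \<le> b" using convergent_imp_Bseq[OF convergentI[OF e]] by (auto simp: Bseq_def)
  define B where "B = max 1 b"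
  have eB: "\<bar>e k\<bar> \<le> B" "1 \<le> B" for k using b[of k] by (auto simp: B_def)
  show ?thesis unfolding tconv_def dconv_def
  proof (intro conjI allI)
    show "smooth (\<lambda>z. \<psi> (e k *\<^sub>R z))" for k using smooth_affine[OF L s, of 0 k] by simp
    show "smooth (\<lambda>z::'a. 1)" by (rule smooth_const)
    fix N
    obtain C where C: "bnd N (\<lambda>z. C * wt 0 z) \<psi>" using temperedE[OF schwartz_tempered[OF psi(1)]] by metis
    have "bnd N (\<lambda>z. (B^N * C) * wt 0 z) (\<lambda>z. \<psi> (e k *\<^sub>R z))" for k
      using bnd_affine[OF L _ eB(2) C, of k 0] eB(1)[of k] by (simp add: mult_right_mono)
    then show "\<exists>K. \<forall>k. bnd N (\<lambda>z. K * wt 0 z) (\<lambda>z. \<psi> (e k *\<^sub>R z))" by blast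
  qed (rule lim)
qed


section \<open>Oscillatory integrals with a nondegenerate quadratic phase\<close>

text \<open>The Gaussian is an admissible cutoff, so limits over all cutoffs are determined by a single one.\<close>

lemma has_osc_integral_unique:
  assumes "has_osc_integral F I" shows "osc_integral F = I"
  unfolding osc_integral_def
proof (rule the_equality[where P = "has_osc_integral F"])
  show "has_osc_integral F I" by fact
  fix I' assume "has_osc_integral F I'"
  then have "((\<lambda>e. LINT z|lborel. gauss (e *\<^sub>R z) * F z) \<longlongrightarrow> I') (at_right 0)"
    using gauss_schwartz by (auto simp: has_osc_integral_def)
  moreover have "((\<lambda>e. LINT z|lborel. gauss (e *\<^sub>R z) * F z) \<longlongrightarrow> I) (at_right 0)"
    using assms gauss_schwartz by (auto simp: has_osc_integral_def)
  ultimately show "I' = I" by (rule tendsto_unique[rotated]) simp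
qed

text \<open>A nondegenerate quadratic form \<open>u \<bullet> B u\<close>. The map \<open>J\<close>, a right inverse and hence the inverse of \<open>B\<close>,
  turns multiplication by \<open>u \<bullet> v\<close> into the derivative of the phase along \<open>J v\<close>, because the derivative
  of the phase along \<open>w\<close> contains the factor \<open>u \<bullet> B w\<close>.\<close>

locale chirp =
  fixes B J :: "'a::euclidean_space \<Rightarrow> 'a"
  assumes linear_B: "linear B" and sym_B: "x \<bullet> B y = B x \<bullet> y" and B_J: "B (J v) = v"
begin

definition phase :: "'a \<Rightarrow> complex" where
  "phase u = cis ((u \<bullet> B u) / 2)"

lemma norm_phase [simp]: "cmod (phase u) = 1" by (simp add: phase_def)

lemma phase_has_derivative:
  "(phase has_derivative (\<lambda>v. \<i> * (of_real (u \<bullet> B v) * phase u))) (at u)"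
proof -
  have bl: "bounded_linear B" using linear_B linear_conv_bounded_linear by blast
  have "((\<lambda>u. (u \<bullet> B u) / 2) has_derivative (\<lambda>v. (u \<bullet> B v + v \<bullet> B u) / 2)) (at u)"
    by (auto intro!: derivative_eq_intros bounded_linear.has_derivative[OF bl])
  moreover have "(u \<bullet> B v + v \<bullet> B u) / 2 = u \<bullet> B v" for v
    using sym_B[of v u] by (simp add: inner_commute)
  ultimately have "((\<lambda>u. (u \<bullet> B u) / 2) has_derivative (\<lambda>v. u \<bullet> B v)) (at u)" by simp
  from has_derivative_cis[OF this] show ?thesis
    unfolding phase_def by (simp add: scaleR_conv_of_real mult_ac)
qed

lemma dir_deriv_phase: "dir_deriv v phase = (\<lambda>u. \<i> * (of_real (u \<bullet> B v) * phase u))"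
  by (rule ext) (rule dir_deriv_eq[OF phase_has_derivative])

lemma smooth_phase: "smooth phase"
  by (rule smooth_of_derivative[OF phase_has_derivative])
    (intro C_k_mult smooth_C_k[OF smooth_const] smooth_C_k[OF smooth_inner]; assumption)

lemma phase_measurable [measurable]: "phase \<in> borel_measurable borel"
  by (rule smooth_borel_measurable[OF smooth_phase])

lemma bnd_phase: "\<exists>C. bnd N (\<lambda>z. C * wt (real N) z) phase"
proof (induction N)
  case 0
  show ?case by (rule exI[of _ 1]) (simp add: bnd_0 smooth_phase)
next
  case (Suc N)
  then obtain C where C: "bnd N (\<lambda>z. C * wt (real N) z) phase" by blast
  have bl: "bounded_linear B" using linear_B linear_conv_bounded_linear by blast
  define D where "D = 2^N * onorm B * C"
  have D: "bnd N (\<lambda>z. D * wt (real (Suc N)) z) (dir_deriv v phase)" if v: "norm v \<le> 1" for v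
  proof -
    have "norm (B v) \<le> onorm B"
      using onorm[OF bl, of v] mult_left_mono[OF v onorm_pos_le[OF bl]] by simp
    then have "bnd N (\<lambda>z. onorm B * wt 1 z) (\<lambda>z. complex_of_real (z \<bullet> B v))"
      by (intro bnd_mono[OF bnd_inner_scaled]) (auto intro: mult_right_mono)
    from bnd_wt_cmult[OF bnd_wt_mult[OF this C], of \<i>] show ?thesis
      by (simp add: dir_deriv_phase D_def add.commute)
  qed
  have "bnd (Suc N) (\<lambda>z. max 1 D * wt (real (Suc N)) z) phase"
    unfolding bnd_Suc
  proof (intro conjI allI impI)
    show "cmod (phase z) \<le> max 1 D * wt (real (Suc N)) z" for z
      using mult_mono[of 1 "max 1 D" 1 "wt (real (Suc N)) z"] wt_ge_1[of "real (Suc N)" z] by simp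
    show "bnd N (\<lambda>z. max 1 D * wt (real (Suc N)) z) (dir_deriv v phase)" if v: "norm v \<le> 1" for v
      by (rule bnd_mono[OF D[OF v]]) (auto intro!: mult_right_mono)
  qed (rule smooth_phase)
  then show ?case by blast
qed

text \<open>Each derivative of the chirp costs a power of the weight (\<open>bnd_phase\<close>), which the decay of a
  Schwartz function absorbs.\<close>

lemma schwartz_phase_mult:
  assumes f: "f \<in> schwartz" shows "(\<lambda>z. phase z * f z) \<in> schwartz"
  unfolding schwartz_iff tempered_def
proof (intro allI)
  fix M N
  obtain C where "bnd N (\<lambda>z. C * wt (real N) z) phase" using bnd_phase by blast
  moreover obtain D where "bnd N (\<lambda>z. D * wt (M - real N) z) f"
    using temperedE[OF schwartz_tempered[OF f]] by metis
  ultimately have "bnd N (\<lambda>z. (2^N * C * D) * wt (real N + (M - real N)) z) (\<lambda>z. phase z * f z)"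
    by (rule bnd_wt_mult)
  then show "\<exists>C. bnd N (\<lambda>z. C * wt M z) (\<lambda>z. phase z * f z)" by auto
qed

subsection \<open>Integration by parts\<close>

text \<open>The transposed form of the first order operator that reproduces the chirp: the chirp equals
  \<open>(1 + u \<bullet> u)\<inverse> (1 - i \<Sum>\<^sub>b (u \<bullet> b) \<partial>\<^sub>J\<^sub>b)\<close> applied to itself.\<close>

definition lower :: "('a \<Rightarrow> complex) \<Rightarrow> 'a \<Rightarrow> complex" where
  "lower a = (\<lambda>u. bracket_inv u * a u +
     (\<Sum>b\<in>Basis. \<i> * dir_deriv (J b) (\<lambda>u. of_real (u \<bullet> b) * (bracket_inv u * a u)) u))"

text \<open>The bracket gains two powers, the coordinate \<open>u \<bullet> b\<close> loses one, and the derivative costs nothing in a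
  bound on all derivatives: the net gain is one power for one derivative.\<close>

lemma bnd_lower:
  "\<exists>c\<ge>0. \<forall>K M a. bnd (Suc N) (\<lambda>u. K * wt M u) a \<longrightarrow> bnd N (\<lambda>u. (c * K) * wt (M - 1) u) (lower a)"
proof -
  obtain C where C: "0 \<le> C" "bnd (Suc N) (\<lambda>z. C * wt (-2) z) (bracket_inv :: 'a \<Rightarrow> complex)"
    using temperedE[OF tempered_bracket_inv] by metis
  define c1 where "c1 = 2^Suc N * C"
  define cb where "cb b = norm (J b) * (2^Suc N * norm b * c1)" for b
  define c where "c = c1 + (\<Sum>b\<in>Basis. cb b)"
  have nn: "0 \<le> c1" "0 \<le> cb b" for b by (auto simp: c1_def cb_def C)
  show ?thesis
  proof (intro exI[of _ c] conjI allI impI)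
    show "0 \<le> c" unfolding c_def using nn by (intro add_nonneg_nonneg sum_nonneg) auto
    fix K M :: real and a :: "'a \<Rightarrow> complex" assume a: "bnd (Suc N) (\<lambda>u. K * wt M u) a"
    have h: "bnd (Suc N) (\<lambda>z. (c1 * K) * wt (-2 + M) z) (\<lambda>u. bracket_inv u * a u)"
      using bnd_wt_mult[OF C(2) a] by (simp add: c1_def)
    have 1: "bnd N (\<lambda>z. (c1 * K) * wt (M - 1) z) (\<lambda>u. bracket_inv u * a u)"
      by (rule bnd_wt_mono[OF bnd_le[OF h]]) auto
    have 2: "bnd N (\<lambda>z. (cb b * K) * wt (M - 1) z)
        (\<lambda>u. \<i> * dir_deriv (J b) (\<lambda>u. of_real (u \<bullet> b) * (bracket_inv u * a u)) u)" for b
    proof -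
      have "bnd N (\<lambda>z. norm (J b) * ((2 ^ Suc N * norm b * (c1 * K)) * wt (1 + (- 2 + M)) z))
        (dir_deriv (J b) (\<lambda>u. of_real (u \<bullet> b) * (bracket_inv u * a u)))"
        by (rule bnd_scale_dir[OF bnd_wt_mult[OF bnd_inner_scaled h]])
      from bnd_cmult[OF this, of \<i>] show ?thesis by (simp add: cb_def mult_ac add.commute)
    qed
    have "bnd N (\<lambda>z. (c1 * K) * wt (M - 1) z + (\<Sum>b\<in>Basis. (cb b * K) * wt (M - 1) z)) (lower a)"
      unfolding lower_def by (intro bnd_add 1 bnd_sum 2)
    then show "bnd N (\<lambda>u. (c * K) * wt (M - 1) u) (lower a)"
      by (simp add: c_def sum_distrib_right distrib_right)
  qed
qed

lemma tempered_lower: "tempered M a \<Longrightarrow> tempered (M - 1) (lower a)"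
  unfolding tempered_def using bnd_lower by meson

lemma bnd_lower_iter:
  "\<exists>c\<ge>0. \<forall>K M a. bnd (n + N) (\<lambda>u. K * wt M u) a \<longrightarrow>
     bnd N (\<lambda>u. (c * K) * wt (M - real n) u) ((lower ^^ n) a)"
proof (induction n arbitrary: N)
  case 0
  show ?case by (rule exI[of _ 1]) simp
next
  case (Suc n)
  obtain c where c: "c \<ge> 0" "\<And>K M a. bnd (n + Suc N) (\<lambda>u. K * wt M u) a \<Longrightarrow>
     bnd (Suc N) (\<lambda>u. (c * K) * wt (M - real n) u) ((lower ^^ n) a)" using Suc by metis
  obtain d where d: "d \<ge> 0" "\<And>K M a. bnd (Suc N) (\<lambda>u. K * wt M u) a \<Longrightarrow> bnd N (\<lambda>u. (d * K) * wt (M - 1) u) (lower a)"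
    using bnd_lower by metis
  show ?case
  proof (intro exI[of _ "d * c"] conjI allI impI)
    show "0 \<le> d * c" using c d by simp
    fix K M :: real and a :: "'a \<Rightarrow> complex" assume "bnd (Suc n + N) (\<lambda>u. K * wt M u) a"
    then have "bnd (n + Suc N) (\<lambda>u. K * wt M u) a" by simp
    from d(2)[OF c(2)[OF this]] show "bnd N (\<lambda>u. d * c * K * wt (M - real (Suc n)) u) ((lower ^^ Suc n) a)"
      by (simp add: mult.assoc algebra_simps)
  qed
qed

lemma tempered_lower_iter: "tempered M a \<Longrightarrow> tempered (M - real n) ((lower ^^ n) a)"
proof (induction n)
  case (Suc n)
  then show ?case using tempered_lower[of "M - real n"] by (simp add: algebra_simps)
qed simp

lemma dconv_lower: "dconv f g \<Longrightarrow> dconv (\<lambda>k. lower (f k)) (lower g)"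
  unfolding lower_def
  by (intro dconv_add dconv_sum dconv_cmult dconv_dir_deriv dconv_mult dconv_const
      smooth_bracket_inv smooth_inner)

lemma dconv_lower_iter: "dconv f g \<Longrightarrow> dconv (\<lambda>k. (lower ^^ n) (f k)) ((lower ^^ n) g)"
  by (induction n) (auto intro: dconv_lower)

text \<open>The integral of the derivative along \<open>J b\<close> of the chirp times \<open>(u \<bullet> b) a / (1 + u \<bullet> u)\<close> vanishes. By the
  product rule this trades a factor \<open>u \<bullet> b\<close> for a derivative of the amplitude.\<close>

lemma integral_phase_lower:
  assumes a: "tempered M a" and M: "M \<le> - 2 * real DIM('a)"
  shows "(LINT u|lborel. phase u * a u) = (LINT u|lborel. phase u * lower a u)"
proof -
  define g where "g b u = of_real (u \<bullet> b) * (bracket_inv u * a u)" for b u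
  define X where "X b = (\<lambda>u. phase u * (of_real (u \<bullet> b) * g b u))" for b
  define Y where "Y b = (\<lambda>u. phase u * dir_deriv (J b) (g b) u)" for b
  have ha: "tempered (M - 2) (\<lambda>u. bracket_inv u * a u)"
    using tempered_mult[OF tempered_bracket_inv a] by simp
  have g: "tempered (M - 1) (g b)" for b
    unfolding g_def using tempered_mult[OF tempered_inner[of b] ha] by (simp add: add.commute)
  have ug: "tempered M (\<lambda>u. of_real (u \<bullet> b) * g b u)" for b
    using tempered_mult[OF tempered_inner[of b] g[of b]] by simp
  have gs: "smooth (g b)" for b using g tempered_smooth by blast
  have phi: "integrable lborel (\<lambda>u. phase u * f u)" if "tempered M' f" "M' \<le> M" for f M'
  proof -
    have "integrable lborel f"
      using that(2) M by (intro tempered_integrable[OF that(1)]) linarith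
    then show ?thesis
      by (rule Bochner_Integration.integrable_bound)
        (use smooth_borel_measurable[OF tempered_smooth[OF that(1)]] in \<open>auto simp: norm_mult\<close>)
  qed
  have Xi: "integrable lborel (X b)" for b unfolding X_def by (rule phi[OF ug]) simp
  have Yi: "integrable lborel (Y b)" for b unfolding Y_def by (rule phi[OF tempered_dir_deriv[OF g]]) simp
  have hi: "integrable lborel (\<lambda>u. phase u * (bracket_inv u * a u))" by (rule phi[OF ha]) simp
  \<comment> \<open>Differentiating the chirp along \<open>J b\<close> produces \<open>\<i> (u \<bullet> B (J b)) = \<i> (u \<bullet> b)\<close>.\<close>
  have XY: "(LINT u|lborel. X b u) = \<i> * (LINT u|lborel. Y b u)" for b
  proof -
    obtain C where C: "bnd 1 (\<lambda>z. C * wt (real 1) z) phase" using bnd_phase by blast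
    obtain D where D: "bnd 1 (\<lambda>z. D * wt (M - 1) z) (g b)" using temperedE[OF g] by metis
    have "bnd 1 (\<lambda>z. (2^1 * C * D) * wt M z) (\<lambda>u. phase u * g b u)"
      using bnd_wt_mult[OF C D] by simp
    note ibp = integral_dir_deriv_eq_0(2)[OF this M, of "J b"]
    have "dir_deriv (J b) (\<lambda>u. phase u * g b u) = (\<lambda>u. \<i> * X b u + Y b u)"
      by (simp add: dir_deriv_mult smooth_phase gs dir_deriv_phase B_J X_def Y_def mult_ac)
    then have "\<i> * (LINT u|lborel. X b u) + (LINT u|lborel. Y b u) = 0" using ibp Xi Yi by simp
    then show ?thesis by (metis add.inverse_inverse add_eq_0_iff2 complex_i_mult_minus mult_minus_right)
  qed
  \<comment> \<open>The partition \<open>1 = (1 + \<Sum>\<^sub>b (u \<bullet> b)\<^sup>2) / (1 + u \<bullet> u)\<close>, applied to \<open>a\<close>.\<close>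
  have key: "a u = bracket_inv u * a u + (\<Sum>b\<in>Basis. of_real (u \<bullet> b) * g b u)" for u
  proof -
    have "(\<Sum>b\<in>Basis. complex_of_real (u \<bullet> b) * g b u) = of_real (u \<bullet> u) * (bracket_inv u * a u)"
      unfolding g_def euclidean_inner[of u u] by (simp add: sum_distrib_left mult_ac)
    moreover have "bracket_inv u * of_real (1 + u \<bullet> u) = 1"
      unfolding bracket_inv_def of_real_mult[symmetric] using one_plus_inner_pos[of u] by simp
    then have "bracket_inv u * (1 + of_real (u \<bullet> u)) * a u = a u" by simp
    ultimately show ?thesis by (simp add: algebra_simps)
  qed
  have "(LINT u|lborel. phase u * a u)
      = (LINT u|lborel. phase u * (bracket_inv u * a u) + (\<Sum>b\<in>Basis. X b u))"
    by (subst key) (simp add: X_def distrib_left sum_distrib_left)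
  also have "\<dots> = (LINT u|lborel. phase u * (bracket_inv u * a u)) + (\<Sum>b\<in>Basis. LINT u|lborel. X b u)"
    using Xi hi by simp
  also have "\<dots> = (LINT u|lborel. phase u * (bracket_inv u * a u)) + (\<Sum>b\<in>Basis. LINT u|lborel. \<i> * Y b u)"
    by (simp add: XY)
  also have "\<dots> = (LINT u|lborel. phase u * (bracket_inv u * a u) + (\<Sum>b\<in>Basis. \<i> * Y b u))"
    using Yi hi by simp
  also have "\<dots> = (LINT u|lborel. phase u * lower a u)"
    by (simp add: lower_def Y_def g_def[abs_def] distrib_left sum_distrib_left mult_ac)
  finally show ?thesis .
qed

lemma integral_phase_lower_iter:
  assumes a: "tempered M a" and M: "M \<le> - 2 * real DIM('a)"
  shows "(LINT u|lborel. phase u * a u) = (LINT u|lborel. phase u * (lower ^^ n) a u)"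
proof (induction n)
  case (Suc n)
  have "(LINT u|lborel. phase u * (lower ^^ n) a u) = (LINT u|lborel. phase u * lower ((lower ^^ n) a) u)"
    by (rule integral_phase_lower[OF tempered_lower_iter[OF a]]) (use M in simp)
  then show ?case using Suc by simp
qed simp

text \<open>Once the weight has been lowered to an integrable one, the uniform bounds of \<open>tconv\<close> give a dominating
  function.\<close>

lemma tendsto_integral_lower_iter:
  assumes f: "tconv M f g" and n: "M - real n \<le> - 2 * real DIM('a)"
  shows "(\<lambda>k. LINT u|lborel. phase u * (lower ^^ n) (f k) u) \<longlonglongrightarrow> (LINT u|lborel. phase u * (lower ^^ n) g u)"
proof -
  have d: "dconv (\<lambda>k. (lower ^^ n) (f k)) ((lower ^^ n) g)"
    by (rule dconv_lower_iter[OF tconv_dconv[OF f]])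
  note s = smooth_borel_measurable[OF dconv_smooth(1)[OF d]] smooth_borel_measurable[OF dconv_smooth(2)[OF d]]
  obtain K where K: "\<And>k. bnd (n + 0) (\<lambda>z. K * wt M z) (f k)" using tconvE[OF f] by metis
  obtain c where c: "\<And>K M a. bnd (n + 0) (\<lambda>u. K * wt M u) a \<Longrightarrow>
     bnd 0 (\<lambda>u. (c * K) * wt (M - real n) u) ((lower ^^ n) a)" using bnd_lower_iter by metis
  show ?thesis
  proof (rule integral_dominated_convergence)
    show "integrable lborel (\<lambda>u::'a. (c * K) * wt (M - real n) u)"
      by (intro integrable_mult_right integrable_wt n)
    show "AE u in lborel. (\<lambda>k. phase u * (lower ^^ n) (f k) u) \<longlonglongrightarrow> phase u * (lower ^^ n) g u"
      by (intro AE_I2 tendsto_mult tendsto_const dconv_value[OF d])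
    show "AE u in lborel. norm (phase u * (lower ^^ n) (f k) u) \<le> (c * K) * wt (M - real n) u" for k
      using bnd_value[OF c[OF K]] by (simp add: norm_mult)
  qed (use s in measurable)
qed

subsection \<open>The oscillatory integral\<close>

definition osc :: "('a \<Rightarrow> complex) \<Rightarrow> complex" where
  "osc a = osc_integral (\<lambda>u. phase u * a u)"

text \<open>For every cutoff the amplitude is a Schwartz function, where lowering does not change the integral;
  the lowered integrals converge as the cutoff is removed. The phase may be centred at any
  point \<open>p\<close>, since a cutoff around 0 is as good as one around \<open>p\<close>; this makes translation of the
  integration variable available for oscillatory integrals.\<close>

lemma has_osc_integral_lower:
  assumes a: "tempered M a" and n: "M - real n \<le> - 2 * real DIM('a)"
  shows "has_osc_integral (\<lambda>u. phase (u - p) * a u)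
    (LINT u|lborel. phase u * (lower ^^ n) (\<lambda>u. a (p + u)) u)"
  unfolding has_osc_integral_def
proof (intro ballI impI conjI allI)
  fix \<psi> :: "'a \<Rightarrow> complex" assume psi: "\<psi> \<in> schwartz" "\<psi> 0 = 1"
  have am: "a \<in> borel_measurable borel" by (rule smooth_borel_measurable[OF tempered_smooth[OF a]])
  have pm: "\<psi> \<in> borel_measurable borel" by (rule smooth_borel_measurable[OF schwartz_smooth[OF psi(1)]])
  have sch: "(\<lambda>u. \<psi> (e *\<^sub>R u)) \<in> schwartz" if e: "0 < e" for e
    by (rule schwartz_scale[OF psi(1)]) (use e in simp)
  show "integrable lborel (\<lambda>z. \<psi> (e *\<^sub>R z) * (phase (z - p) * a z))" if e: "0 < e" for e
  proof (rule Bochner_Integration.integrable_bound[OF schwartz_integrable[OF schwartz_mult_tempered[OF sch[OF e] a]]])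
    show "(\<lambda>z. \<psi> (e *\<^sub>R z) * (phase (z - p) * a z)) \<in> borel_measurable lborel"
      using am pm by measurable
  qed (simp add: norm_mult)
  let ?I = "\<lambda>e. LINT z|lborel. \<psi> (e *\<^sub>R z) * (phase (z - p) * a z)"
  show "(?I \<longlongrightarrow> (LINT u|lborel. phase u * (lower ^^ n) (\<lambda>u. a (p + u)) u)) (at_right 0)"
    unfolding tendsto_at_iff_sequentially
  proof (intro allI impI)
    fix X :: "nat \<Rightarrow> real" assume X0: "\<forall>i. X i \<in> {0<..} - {0}" and X: "X \<longlonglongrightarrow> 0"
    have Xp: "0 < X k" for k using X0 by auto
    define f where "f k u = \<psi> (X k *\<^sub>R u) * a u" for k u
    have fsch: "f k \<in> schwartz" for k unfolding f_def by (rule schwartz_mult_tempered[OF sch[OF Xp] a])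
    have M0: "tconv M f a"
      using tconv_mult[OF tconv_cutoff[OF psi X] tconv_const[OF a]] by (simp add: f_def[abs_def])
    have tc: "tconv M (\<lambda>k u. f k (p + u)) (\<lambda>u. a (p + u))" by (rule tconv_translate[OF M0])
    have "?I (X k) = (LINT u|lborel. phase u * (lower ^^ n) (\<lambda>u. f k (p + u)) u)" for k
    proof -
      have "?I (X k) = (LINT z|lborel. phase (z - p) * f k z)" by (simp add: f_def mult_ac)
      also have "\<dots> = (LINT z|lborel. phase (p + z - p) * f k (p + z))"
        by (rule lborel_integral_translate(1)[symmetric]) (use am pm in \<open>unfold f_def, measurable\<close>)
      also have "\<dots> = (LINT z|lborel. phase z * f k (p + z))" by simp
      also have "\<dots> = (LINT u|lborel. phase u * (lower ^^ n) (\<lambda>u. f k (p + u)) u)"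
        by (rule integral_phase_lower_iter[OF schwartz_tempered[OF schwartz_translate[OF fsch]] order_refl])
      finally show ?thesis .
    qed
    then show "(?I \<circ> X) \<longlonglongrightarrow> (LINT u|lborel. phase u * (lower ^^ n) (\<lambda>u. a (p + u)) u)"
      using tendsto_integral_lower_iter[OF tc n] by (simp add: o_def)
  qed
qed

lemma osc_eq_lower:
  assumes "tempered M a" "M - real n \<le> - 2 * real DIM('a)"
  shows "osc a = (LINT u|lborel. phase u * (lower ^^ n) a u)"
  using has_osc_integral_unique[OF has_osc_integral_lower[OF assms, of 0]] by (simp add: osc_def)

lemma obtain_lower_order: obtains n :: nat where "M - real n \<le> - 2 * real DIM('a)"
  using real_arch_simple[of "M + 2 * real DIM('a)"] by (auto simp: algebra_simps)

lemma has_osc_integral_osc: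
  assumes a: "tempered M a"
  shows "has_osc_integral (\<lambda>u. phase (u - p) * a u) (osc (\<lambda>u. a (p + u)))"
proof -
  obtain n where n: "M - real n \<le> - 2 * real DIM('a)" by (rule obtain_lower_order)
  show ?thesis
    using has_osc_integral_lower[OF a n, of p] osc_eq_lower[OF tempered_translate[OF a] n, of p] by simp
qed

lemma osc_integrable:
  assumes "tempered M a" "M \<le> - 2 * real DIM('a)"
  shows "osc a = (LINT u|lborel. phase u * a u)"
  using osc_eq_lower[of M a 0] assms by simp

text \<open>The quantitative content of the integration by parts: finitely many derivatives of the amplitude,
  measured in its own weight, control the integral.\<close>

lemma osc_bound:
  "\<exists>N c. 0 \<le> c \<and> (\<forall>a K. tempered M a \<longrightarrow> bnd N (\<lambda>u. K * wt M u) a \<longrightarrow> cmod (osc a) \<le> c * K)"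
proof -
  obtain n where n: "M - real n \<le> - 2 * real DIM('a)" by (rule obtain_lower_order)
  obtain c where c: "0 \<le> c" "\<And>K M a. bnd (n + 0) (\<lambda>u. K * wt M u) a \<Longrightarrow>
     bnd 0 (\<lambda>u. (c * K) * wt (M - real n) u) ((lower ^^ n) a)" using bnd_lower_iter by metis
  define W where "W = (LINT u|lborel. wt (M - real n) (u::'a))"
  have W: "0 \<le> W" unfolding W_def by (intro integral_nonneg_AE) auto
  show ?thesis
  proof (intro exI[of _ "n + 0"] exI[of _ "c * W"] conjI allI impI)
    show "0 \<le> c * W" using W c(1) by simp
    fix a :: "'a \<Rightarrow> complex" and K assume a: "tempered M a" "bnd (n + 0) (\<lambda>u. K * wt M u) a"
    note m = smooth_borel_measurable[OF tempered_smooth[OF tempered_lower_iter[OF a(1), of n]]]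
    have b: "cmod (phase u * (lower ^^ n) a u) \<le> (c * K) * wt (M - real n) u" for u
      using bnd_value[OF c(2)[OF a(2)]] by (simp add: norm_mult)
    have "cmod (osc a) \<le> (LINT u|lborel. (c * K) * wt (M - real n) (u::'a))"
      unfolding osc_eq_lower[OF a(1) n]
    proof (rule Bochner_Integration.integral_norm_bound_integral)
      show "integrable lborel (\<lambda>u. phase u * (lower ^^ n) a u)"
        by (rule integrable_wt_bound[OF _ b n]) (use m in measurable)
      show "integrable lborel (\<lambda>u::'a. (c * K) * wt (M - real n) u)"
        by (intro integrable_mult_right integrable_wt n)
    qed (rule b)
    then show "cmod (osc a) \<le> c * W * K" by (simp add: W_def mult_ac)
  qed
qed

lemma osc_tendsto:
  assumes f: "tconv M f g" shows "(\<lambda>k. osc (f k)) \<longlonglongrightarrow> osc g"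
proof -
  obtain n where n: "M - real n \<le> - 2 * real DIM('a)" by (rule obtain_lower_order)
  show ?thesis
    using tendsto_integral_lower_iter[OF f n]
    by (simp add: osc_eq_lower[OF tconv_tempered[OF f] n] osc_eq_lower[OF tconv_tempered_limit[OF f] n])
qed

lemma gauss_cutoff:
  assumes a: "tempered M a"
  shows "tconv M (\<lambda>k u. gauss ((1 / real (Suc k)) *\<^sub>R u) * a u) a"
  using tconv_mult[OF tconv_cutoff[OF gauss_schwartz gauss_0 inverse_Suc_tendsto] tconv_const[OF a]]
  by (simp del: of_nat_Suc)

end


section \<open>The Fourier transform of Schwartz functions\<close>

definition ft :: "('a::euclidean_space \<Rightarrow> complex) \<Rightarrow> 'a \<Rightarrow> complex" where
  "ft f \<zeta> = (LINT z|lborel. f z * cis (- (z \<bullet> \<zeta>)))"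

lemma schwartz_measurable: "f \<in> schwartz \<Longrightarrow> f \<in> borel_measurable borel"
  by (intro smooth_borel_measurable schwartz_smooth)

lemma cis_measurable [measurable]: "cis \<in> borel_measurable borel"
  by (intro borel_measurable_continuous_onI continuous_intros)

lemma integrable_mult_unimodular:
  fixes f g :: "'a::euclidean_space \<Rightarrow> complex"
  assumes "integrable lborel f" "g \<in> borel_measurable borel" "\<And>z. cmod (g z) = 1"
  shows "integrable lborel (\<lambda>z. f z * g z)"
  by (rule Bochner_Integration.integrable_bound[OF assms(1)])
    (use assms borel_measurable_integrable[OF assms(1)] in \<open>auto simp: norm_mult\<close>)

lemma ft_integrable: "f \<in> schwartz \<Longrightarrow> integrable lborel (\<lambda>z. f z * cis (z \<bullet> \<zeta>))"
  "f \<in> schwartz \<Longrightarrow> integrable lborel (\<lambda>z. f z * cis (- (z \<bullet> \<zeta>)))"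
  by (intro integrable_mult_unimodular schwartz_integrable; simp)+

lemma ft_add: "f \<in> schwartz \<Longrightarrow> g \<in> schwartz \<Longrightarrow> ft (\<lambda>z. f z + g z) \<zeta> = ft f \<zeta> + ft g \<zeta>"
  unfolding ft_def by (simp add: distrib_right ft_integrable)

lemma ft_cmult: "ft (\<lambda>z. c * f z) \<zeta> = c * ft f \<zeta>"
  unfolding ft_def by (simp add: mult.assoc)

lemma schwartz_inner_mult: "f \<in> schwartz \<Longrightarrow> (\<lambda>z. c * (of_real (z \<bullet> v) * f z)) \<in> schwartz"
  using schwartz_cmult[OF schwartz_mult_tempered[OF _ tempered_inner]] by (simp add: mult.commute[of "of_real _"])

text \<open>The remainder of \<open>exp (- i z \<bullet> \<zeta>)\<close> is quadratic in the increment with a factor \<open>|z|\<^sup>2\<close>, which a Schwartz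
  function absorbs.\<close>

lemma ft_has_derivative:
  fixes f :: "'a::euclidean_space \<Rightarrow> complex"
  assumes f: "f \<in> schwartz"
  shows "(ft f has_derivative (\<lambda>v. ft (\<lambda>z. - \<i> * (of_real (z \<bullet> v) * f z)) \<zeta>)) (at \<zeta>)"
proof -
  let ?D = "\<lambda>v. ft (\<lambda>z. - \<i> * (of_real (z \<bullet> v) * f z)) \<zeta>"
  have sch: "(\<lambda>z. - \<i> * (of_real (z \<bullet> v) * f z)) \<in> schwartz" for v by (rule schwartz_inner_mult[OF f])
  have lin: "linear ?D"
  proof
    fix v w :: 'a and r :: real
    show "?D (v + w) = ?D v + ?D w"
      using ft_add[OF sch[of v] sch[of w], of \<zeta>] by (simp add: inner_add_right algebra_simps)
    show "?D (r *\<^sub>R v) = r *\<^sub>R ?D v"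
      using ft_cmult[of "of_real r" "\<lambda>z. - \<i> * (of_real (z \<bullet> v) * f z)" \<zeta>]
      by (simp add: scaleR_conv_of_real mult_ac)
  qed
  define K where "K = (LINT z|lborel. wt 2 z * cmod (f z))"
  have Ki: "integrable lborel (\<lambda>z. wt 2 z * cmod (f z))"
  proof -
    obtain C where C: "0 \<le> C" "\<And>z. cmod (f z) \<le> C * wt (- 2 * real DIM('a) - 2) z"
      using tempered_value[OF schwartz_tempered[OF f]] by metis
    have "norm (wt 2 z * cmod (f z)) \<le> C * wt (- 2 * real DIM('a)) z" for z
      using mult_left_mono[OF C(2)[of z], of "wt 2 z"] wt_add[of "- 2 * real DIM('a) - 2" 2 z]
      by (simp add: mult_ac)
    then show ?thesis by (rule integrable_wt_bound[rotated]) (use schwartz_measurable[OF f] in auto)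
  qed
  have K0: "0 \<le> K" unfolding K_def by (intro integral_nonneg_AE) auto
  have est: "cmod (ft f y - ft f \<zeta> - ?D (y - \<zeta>)) \<le> K * (norm (y - \<zeta>))^2" for y
  proof -
    define q where "q z = f z * (cis (- (z \<bullet> y)) - cis (- (z \<bullet> \<zeta>))
        - \<i> * of_real (- (z \<bullet> (y - \<zeta>))) * cis (- (z \<bullet> \<zeta>)))" for z
    have q: "q z = f z * cis (- (z \<bullet> y)) - f z * cis (- (z \<bullet> \<zeta>))
        - (- \<i> * (of_real (z \<bullet> (y - \<zeta>)) * f z)) * cis (- (z \<bullet> \<zeta>))" for z
      by (simp add: q_def algebra_simps)
    have qi: "integrable lborel q"
      unfolding q by (intro Bochner_Integration.integrable_diff ft_integrable f sch)
    have e: "ft f y - ft f \<zeta> - ?D (y - \<zeta>) = (LINT z|lborel. q z)"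
      unfolding q ft_def by (simp only: Bochner_Integration.integral_diff Bochner_Integration.integrable_diff ft_integrable f sch)
    have qb: "cmod (q z) \<le> (wt 2 z * cmod (f z)) * (norm (y - \<zeta>))^2" for z
    proof -
      define x where "x = - (z \<bullet> (y - \<zeta>))"
      have xb: "\<bar>x\<bar> \<le> norm z * norm (y - \<zeta>)" unfolding x_def using Cauchy_Schwarz_ineq2[of z "y - \<zeta>"] by simp
      have "cmod (iexp x - (1 + \<i> * of_real x)) \<le> \<bar>x\<bar>^2 / 2"
        using iexp_approx1[of x 1] by (simp add: numeral_2_eq_2)
      moreover have "q z = f z * (cis (- (z \<bullet> \<zeta>)) * (iexp x - (1 + \<i> * of_real x)))"
      proof -
        have "cis (- (z \<bullet> y)) = cis (- (z \<bullet> \<zeta>)) * iexp x"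
          unfolding cis_conv_exp[symmetric] cis_mult x_def by (simp add: inner_diff_right)
        then show ?thesis unfolding q_def x_def[symmetric] by (simp add: algebra_simps)
      qed
      then have "cmod (q z) = cmod (f z) * cmod (iexp x - (1 + \<i> * of_real x))"
        by (simp only: norm_mult norm_cis mult_1_left)
      ultimately have "cmod (q z) \<le> cmod (f z) * (\<bar>x\<bar>^2 / 2)"
        by (simp only: mult_left_mono norm_ge_zero)
      also have "\<dots> \<le> cmod (f z) * ((norm z * norm (y - \<zeta>))^2)"
      proof (rule mult_left_mono)
        have "\<bar>x\<bar>^2 \<le> (norm z * norm (y - \<zeta>))^2" by (rule power_mono[OF xb]) simp
        then show "\<bar>x\<bar>\<^sup>2 / 2 \<le> (norm z * norm (y - \<zeta>))\<^sup>2" using zero_le_power2[of "\<bar>x\<bar>"] by linarith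
      qed simp
      also have "\<dots> \<le> cmod (f z) * (wt 2 z * (norm (y - \<zeta>))^2)"
      proof -
        have "(norm z)^2 \<le> (1 + norm z)^2" by (rule power_mono) auto
        also have "\<dots> = wt 2 z" using wt_of_nat[of 2 z] by simp
        finally show ?thesis by (intro mult_left_mono) (auto simp: power_mult_distrib intro: mult_right_mono)
      qed
      finally show ?thesis by (simp add: mult_ac)
    qed
    have "cmod (LINT z|lborel. q z) \<le> (LINT z|lborel. (wt 2 z * cmod (f z)) * (norm (y - \<zeta>))^2)"
      by (rule Bochner_Integration.integral_norm_bound_integral[OF qi]) (use Ki qb in auto)
    then show ?thesis unfolding e K_def using Ki by simp
  qed
  show ?thesis
  proof (rule has_derivativeI_sandwich[where e = 1 and H = "\<lambda>y. K * norm (y - \<zeta>)"])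
    show "bounded_linear ?D" using lin linear_conv_bounded_linear by blast
    fix y assume "y \<noteq> \<zeta>"
    then show "norm (ft f y - ft f \<zeta> - ?D (y - \<zeta>)) / norm (y - \<zeta>) \<le> K * norm (y - \<zeta>)"
      using est[of y] by (simp add: pos_divide_le_eq power2_eq_square mult_ac)
  next
    show "((\<lambda>y. K * norm (y - \<zeta>)) \<longlongrightarrow> 0) (at \<zeta>)" by (auto intro!: tendsto_eq_intros)
  qed simp
qed

lemma dir_deriv_ft:
  "f \<in> schwartz \<Longrightarrow> dir_deriv v (ft f) = ft (\<lambda>z. - \<i> * (of_real (z \<bullet> v) * f z))"
  by (rule ext) (rule dir_deriv_eq[OF ft_has_derivative])

lemma ft_bounded:
  assumes "f \<in> schwartz" shows "\<exists>C. \<forall>\<zeta>. cmod (ft f \<zeta>) \<le> C"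
proof (intro exI allI)
  fix \<zeta>
  show "cmod (ft f \<zeta>) \<le> (LINT z|lborel. cmod (f z))"
    unfolding ft_def
    by (rule order_trans[OF integral_norm_bound]) (simp add: norm_mult)
qed

text \<open>Integration by parts against \<open>exp (- i z \<bullet> \<zeta>)\<close>. Iterated, it yields the decay of the transform.\<close>

lemma inner_mult_ft:
  assumes f: "f \<in> schwartz"
  shows "of_real (\<zeta> \<bullet> v) * ft f \<zeta> = - \<i> * ft (dir_deriv v f) \<zeta>"
proof -
  define E where "E = exponential (- \<zeta>)"
  have E: "E z = cis (- (z \<bullet> \<zeta>))" for z by (simp add: E_def exponential_def inner_commute)
  have d: "dir_deriv v (\<lambda>z. f z * E z) = (\<lambda>z. dir_deriv v f z * E z + (- \<i> * of_real (v \<bullet> \<zeta>)) * (f z * E z))"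
    unfolding E_def
    by (simp add: dir_deriv_mult schwartz_smooth[OF f] smooth_exponential dir_deriv_exponential mult_ac)
  have "tempered (- 2 * real DIM('a)) (\<lambda>z. f z * E z)"
    using tempered_mult[OF schwartz_tempered[OF f, of "- 2 * real DIM('a)"] tempered_exponential[of "- \<zeta>"]] by (simp add: E_def)
  then obtain C where "bnd 1 (\<lambda>z. C * wt (- 2 * real DIM('a)) z) (\<lambda>z. f z * E z)"
    using temperedE by metis
  from integral_dir_deriv_eq_0(2)[OF this order_refl, of v]
  have "(LINT z|lborel. dir_deriv v f z * E z + (- \<i> * of_real (v \<bullet> \<zeta>)) * (f z * E z)) = 0" by (simp only: d)
  then have "ft (dir_deriv v f) \<zeta> + (- \<i> * of_real (v \<bullet> \<zeta>)) * ft f \<zeta> = 0"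
    using ft_integrable(2)[OF f, of \<zeta>] ft_integrable(2)[OF schwartz_dir_deriv[OF f], of v \<zeta>]
    by (simp add: ft_def E mult.assoc)
  then have "\<i> * (of_real (v \<bullet> \<zeta>) * ft f \<zeta>) = ft (dir_deriv v f) \<zeta>"
    by (simp add: algebra_simps)
  then show ?thesis by (metis (no_types, lifting) complex_i_mult_minus inner_commute mult_minus_left mult.assoc minus_minus)
qed

lemma ft_decay: "f \<in> schwartz \<Longrightarrow> \<exists>C. \<forall>\<zeta>. norm \<zeta> ^ k * cmod (ft f \<zeta>) \<le> C"
proof (induction k arbitrary: f)
  case 0
  then show ?case using ft_bounded by simp
next
  case (Suc k)
  have "\<exists>C. \<forall>\<zeta>. norm \<zeta> ^ k * cmod (ft (dir_deriv b f) \<zeta>) \<le> C" for b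
    by (rule Suc.IH[OF schwartz_dir_deriv[OF Suc.prems]])
  then obtain C where C: "\<And>b \<zeta>. norm \<zeta> ^ k * cmod (ft (dir_deriv b f) \<zeta>) \<le> C b" by metis
  have "norm \<zeta> ^ Suc k * cmod (ft f \<zeta>) \<le> (\<Sum>b\<in>Basis. C b)" for \<zeta>
  proof -
    have "norm \<zeta> ^ Suc k * cmod (ft f \<zeta>) \<le> norm \<zeta> ^ k * cmod (ft f \<zeta>) * (\<Sum>b\<in>Basis. \<bar>\<zeta> \<bullet> b\<bar>)"
      using mult_left_mono[OF norm_le_l1[of \<zeta>], of "norm \<zeta> ^ k * cmod (ft f \<zeta>)"] by (simp add: mult_ac)
    also have "\<dots> = (\<Sum>b\<in>Basis. norm \<zeta> ^ k * cmod (of_real (\<zeta> \<bullet> b) * ft f \<zeta>))"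
      by (simp add: sum_distrib_left norm_mult mult_ac)
    also have "\<dots> = (\<Sum>b\<in>Basis. norm \<zeta> ^ k * cmod (ft (dir_deriv b f) \<zeta>))"
      by (simp add: inner_mult_ft[OF Suc.prems] norm_mult)
    also have "\<dots> \<le> (\<Sum>b\<in>Basis. C b)" by (intro sum_mono C)
    finally show ?thesis .
  qed
  then show ?case by blast
qed

lemma ft_schwartz:
  assumes f: "f \<in> schwartz" shows "ft f \<in> schwartz"
proof -
  have "C_k k (ft f)" if "f \<in> schwartz" for k and f :: "'a \<Rightarrow> complex"
    using that
  proof (induction k arbitrary: f)
    case 0
    have "isCont (ft f) z" for z using has_derivative_continuous[OF ft_has_derivative[OF 0]] .
    then show ?case by (simp add: continuous_on_eq_continuous_at)
  next
    case (Suc k)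
    have "ft f differentiable (at z)" for z
      unfolding differentiable_def using ft_has_derivative[OF Suc.prems] by blast
    then show ?case using Suc.IH[OF schwartz_inner_mult[OF Suc.prems, of "- \<i>"]]
      by (simp only: C_k.simps dir_deriv_ft[OF Suc.prems]) simp
  qed
  then have s: "smooth (ft f)" using f by (simp add: smooth_def)
  have it: "\<exists>g\<in>schwartz. iter_deriv vs (ft f) = ft g" for vs
  proof (induction vs)
    case Nil then show ?case using f by auto
  next
    case (Cons v vs)
    then obtain g where g: "g \<in> schwartz" "iter_deriv vs (ft f) = ft g" by blast
    show ?case
    proof
      show "(\<lambda>z. - \<i> * (of_real (z \<bullet> v) * g z)) \<in> schwartz" by (rule schwartz_inner_mult[OF g(1)])
      show "iter_deriv (v # vs) (ft f) = ft (\<lambda>z. - \<i> * (of_real (z \<bullet> v) * g z))"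
        using dir_deriv_ft[OF g(1), of v] g(2) by simp
    qed
  qed
  show ?thesis unfolding schwartz_def using s it ft_decay by (auto) (metis it ft_decay)
qed

subsection \<open>Gaussian integrals and Fourier inversion\<close>

text \<open>The characteristic function of the standard normal distribution.\<close>

lemma gauss_line_integral:
  "integrable lborel (\<lambda>x::real. of_real (exp (- (x^2) / 2)) * cis (x * t))"
  "(LINT x|lborel. of_real (exp (- (x^2) / 2)) * cis (x * t)) = of_real (sqrt (2 * pi) * exp (- (t^2) / 2))"
proof -
  have i: "integrable lborel (\<lambda>x::real. exp (- (x^2) / 2))"
    using integrable_mult_right[OF integrable_normal_density[of 1 0], of "sqrt (2 * pi)"]
    by (simp add: normal_density_def)
  then show "integrable lborel (\<lambda>x::real. of_real (exp (- (x^2) / 2)) * cis (x * t))"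
    by (intro integrable_mult_unimodular) auto
  have "complex_of_real (exp (- (t^2) / 2)) = (LINT x|std_normal_distribution. iexp (t * x))"
    using char_std_normal_distribution by (simp add: char_def fun_eq_iff)
  also have "\<dots> = (LINT x|lborel. std_normal_density x *\<^sub>R iexp (t * x))"
    by (rule integral_density) (auto simp: normal_density_nonneg)
  also have "\<dots> = (LINT x|lborel. of_real (1 / sqrt (2 * pi)) * (of_real (exp (- (x^2) / 2)) * cis (x * t)))"
    by (simp add: normal_density_def scaleR_conv_of_real cis_conv_exp mult_ac)
  finally have "complex_of_real (exp (- (t^2) / 2)) = of_real (1 / sqrt (2 * pi)) * (LINT x|lborel. (of_real (exp (- (x^2) / 2)) * cis (x * t)))"
    by simp
  moreover have "complex_of_real (sqrt (2 * pi)) * of_real (1 / sqrt (2 * pi)) = 1"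
    unfolding of_real_mult[symmetric] by simp
  ultimately have "(LINT x|lborel. of_real (exp (- (x^2) / 2)) * cis (x * t)) = of_real (sqrt (2 * pi)) * of_real (exp (- (t^2) / 2))"
    by (simp only: mult.assoc[symmetric] mult_1_left)
  then show "(LINT x|lborel. of_real (exp (- (x^2) / 2)) * cis (x * t)) = of_real (sqrt (2 * pi) * exp (- (t^2) / 2))"
    by (simp only: of_real_mult)
qed

definition gauss_mass :: "'a::euclidean_space itself \<Rightarrow> real" where
  "gauss_mass _ = sqrt (2 * pi) ^ DIM('a)"

lemma gauss_mass_pos: "0 < gauss_mass TYPE('a::euclidean_space)"
  by (simp add: gauss_mass_def)

lemma gauss_mass_square: "gauss_mass TYPE('a::euclidean_space) * gauss_mass TYPE('a) = (2 * pi) ^ DIM('a)"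
  unfolding gauss_mass_def power_mult_distrib[symmetric] by simp

lemma gauss_char_integral:
  fixes w :: "'a::euclidean_space"
  shows "(LINT z|lborel. gauss z * cis (z \<bullet> w)) = of_real (gauss_mass TYPE('a)) * gauss w"
proof -
  have exp_inner: "exp (- (z \<bullet> z) / 2) = (\<Prod>b\<in>Basis. exp (- ((z \<bullet> b)^2) / 2))" for z :: 'a
  proof -
    have "z \<bullet> z = (\<Sum>b\<in>Basis. (z \<bullet> b)^2)"
      using euclidean_inner[of z z] by (simp only: power2_eq_square)
    then have "- (z \<bullet> z) / 2 = (\<Sum>b\<in>Basis. - ((z \<bullet> b)^2) / 2)"
      by (simp only: sum_negf[symmetric] sum_divide_distrib)
    then show ?thesis by (simp only: exp_sum[OF finite_Basis])
  qed
  have ex: "gauss z * cis (z \<bullet> w) = (\<Prod>b\<in>Basis. of_real (exp (- ((z \<bullet> b)^2) / 2)) * cis ((z \<bullet> b) * (w \<bullet> b)))" for z :: 'a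
  proof -
    have "cis (\<Sum>b\<in>I. g b) = (\<Prod>b\<in>I. cis (g b))" if "finite I" for I :: "'a set" and g
      using that by induction (auto simp: cis_mult[symmetric])
    then have c: "cis (z \<bullet> w) = (\<Prod>b\<in>Basis. cis ((z \<bullet> b) * (w \<bullet> b)))"
      by (subst euclidean_inner) simp
    have "gauss z = (\<Prod>b\<in>Basis. of_real (exp (- ((z \<bullet> b)^2) / 2)))"
      unfolding gauss_def exp_inner by simp
    then show ?thesis unfolding c prod.distrib by simp
  qed
  have "(LINT z|lborel. gauss z * cis (z \<bullet> w)) = (\<Prod>b\<in>Basis. of_real (sqrt (2 * pi) * exp (- ((w \<bullet> b)^2) / 2)))"
    unfolding ex
    by (subst lborel_product(2)[where f = "\<lambda>b x. of_real (exp (- (x^2) / 2)) * cis (x * (w \<bullet> b))"])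
      (rule gauss_line_integral(1), simp only: gauss_line_integral(2))
  also have "\<dots> = of_real (gauss_mass TYPE('a)) * of_real (\<Prod>b\<in>Basis. exp (- ((w \<bullet> b)^2) / 2))"
    by (simp add: prod.distrib gauss_mass_def)
  also have "(\<Prod>b\<in>Basis. exp (- ((w \<bullet> b)^2) / 2)) = exp (- (w \<bullet> w) / 2)"
    by (rule exp_inner[symmetric])
  finally show ?thesis by (simp add: gauss_def)
qed

lemma gauss_integral: "(LINT z|lborel. gauss (z::'a::euclidean_space)) = of_real (gauss_mass TYPE('a))"
  using gauss_char_integral[of "0::'a"] by simp

lemma gauss_scaled_char_integral:
  fixes w :: "'a::euclidean_space"
  assumes e: "0 < e"
  shows "of_real (e ^ DIM('a)) * (LINT z|lborel. gauss (e *\<^sub>R z) * cis (z \<bullet> w))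
     = of_real (gauss_mass TYPE('a)) * gauss (w /\<^sub>R e)"
proof -
  have "(LINT z|lborel. gauss z * cis (z \<bullet> (w /\<^sub>R e)))
      = of_real (e ^ DIM('a)) * (LINT z|lborel. gauss (e *\<^sub>R z) * cis ((e *\<^sub>R z) \<bullet> (w /\<^sub>R e)))"
    by (rule lborel_integral_scale[OF _ e]) (use schwartz_measurable[OF gauss_schwartz] in measurable)
  moreover have e2: "(e *\<^sub>R z) \<bullet> (w /\<^sub>R e) = z \<bullet> w" for z using e by simp
  ultimately show ?thesis unfolding gauss_char_integral e2 by (simp only:)
qed

text \<open>Averaging over a Gaussian of width tending to 0; the value at \<open>z\<close> is multiplied by the mass of the
  Gaussian, which is not normalized here. Peetre's inequality dominates the integrands.\<close>

lemma gauss_approximate_identity: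
  fixes f :: "'a::euclidean_space \<Rightarrow> complex"
  assumes f: "tempered M f"
  shows "(\<lambda>k. LINT v|lborel. f (z + (1 / real (Suc k)) *\<^sub>R v) * gauss v) \<longlonglongrightarrow> of_real (gauss_mass TYPE('a)) * f z"
proof -
  define m where "m = \<bar>M\<bar>"
  have f: "tempered m f" by (rule tempered_mono[OF f]) (simp add: m_def)
  have m: "0 \<le> m" by (simp add: m_def)
  obtain C where C: "0 \<le> C" "\<And>z. cmod (f z) \<le> C * wt m z" using tempered_value[OF f] by metis
  obtain D where D: "0 \<le> D" "\<And>z::'a. cmod (gauss z) \<le> D * wt (- 2 * real DIM('a) - m) z"
    using tempered_value[OF schwartz_tempered[OF gauss_schwartz]] by metis
  have fm: "f \<in> borel_measurable borel" by (rule smooth_borel_measurable[OF tempered_smooth[OF f]])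
  have gm: "(gauss :: 'a \<Rightarrow> complex) \<in> borel_measurable borel" by (rule schwartz_measurable[OF gauss_schwartz])
  have "(\<lambda>k. LINT v|lborel. f (z + (1 / real (Suc k)) *\<^sub>R v) * gauss v) \<longlonglongrightarrow> (LINT v|lborel. f z * gauss (v::'a))"
  proof (rule integral_dominated_convergence)
    show "integrable lborel (\<lambda>v::'a. (C * wt m z * D) * wt (- 2 * real DIM('a)) v)"
      by (intro integrable_mult_right integrable_wt) simp
    show "AE v in lborel. (\<lambda>k. f (z + (1 / real (Suc k)) *\<^sub>R v) * gauss v) \<longlonglongrightarrow> f z * gauss v"
    proof (intro AE_I2 tendsto_mult tendsto_const)
      fix v
      have "(\<lambda>k. z + (1 / real (Suc k)) *\<^sub>R v) \<longlonglongrightarrow> z + 0 *\<^sub>R v"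
        by (intro tendsto_intros inverse_Suc_tendsto)
      moreover have "isCont f z"
        using smooth_continuous_on[OF tempered_smooth[OF f], of UNIV] by (simp add: continuous_on_eq_continuous_at)
      ultimately show "(\<lambda>k. f (z + (1 / real (Suc k)) *\<^sub>R v)) \<longlonglongrightarrow> f z"
        by (intro isCont_tendsto_compose[of z f]) auto
    qed
    fix k
    show "AE v in lborel. norm (f (z + (1 / real (Suc k)) *\<^sub>R v) * gauss v) \<le> (C * wt m z * D) * wt (- 2 * real DIM('a)) v"
    proof (rule AE_I2)
      fix v :: 'a
      have "cmod (f (z + (1 / real (Suc k)) *\<^sub>R v)) \<le> C * (wt m z * wt m v)"
      proof (rule order_trans[OF C(2)], rule mult_left_mono[OF _ C(1)])
        have "wt m (z + (1 / real (Suc k)) *\<^sub>R v) \<le> wt m z * wt m ((1 / real (Suc k)) *\<^sub>R v)"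
          using wt_peetre[of m z "(1 / real (Suc k)) *\<^sub>R v"] m by simp
        also have "\<dots> \<le> wt m z * wt m v"
        proof (intro mult_left_mono wt_norm_mono m)
          show "norm ((1 / real (Suc k)) *\<^sub>R v) \<le> norm v"
            using mult_right_mono[of "1 / real (Suc k)" 1 "norm v"] by simp
        qed simp
        finally show "wt m (z + (1 / real (Suc k)) *\<^sub>R v) \<le> wt m z * wt m v" .
      qed
      then have "norm (f (z + (1 / real (Suc k)) *\<^sub>R v) * gauss v)
          \<le> (C * (wt m z * wt m v)) * (D * wt (- 2 * real DIM('a) - m) v)"
        unfolding norm_mult by (intro mult_mono D) (use C in auto)
      also have "\<dots> = (C * wt m z * D) * (wt m v * wt (- 2 * real DIM('a) - m) v)" by (simp add: mult_ac)
      also have "wt m v * wt (- 2 * real DIM('a) - m) v = wt (- 2 * real DIM('a)) v"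
        using wt_add[of m "- 2 * real DIM('a) - m" v] by simp
      finally show "norm (f (z + (1 / real (Suc k)) *\<^sub>R v) * gauss v) \<le> (C * wt m z * D) * wt (- 2 * real DIM('a)) v" .
    qed
  qed (use fm gm in measurable)
  then show ?thesis by (simp add: gauss_integral mult.commute)
qed

text \<open>The product of the two weights is at most the weight of the same exponent on the product space, for
  which this exponent is small enough to be integrable.\<close>

lemma integrable_product_decay:
  fixes F :: "'a::euclidean_space \<times> 'b::euclidean_space \<Rightarrow> complex"
  assumes F: "F \<in> borel_measurable borel"
    and b: "\<And>u v. cmod (F (u, v)) \<le> C * (wt (- 2 * real (DIM('a) + DIM('b))) u * wt (- 2 * real (DIM('a) + DIM('b))) v)"
  shows "integrable (lborel \<Otimes>\<^sub>M lborel) F"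
proof -
  let ?r = "2 * real (DIM('a) + DIM('b))"
  have b: "cmod (F (u, v)) \<le> C * (wt (- ?r) u * wt (- ?r) v)" for u v using b by simp
  have w: "wt (- ?r) u * wt (- ?r) v \<le> wt (- ?r) (u, v)" for u :: 'a and v :: 'b
    by (rule wt_Pair_ge) simp
  have C: "0 \<le> C"
  proof -
    have "0 \<le> C * (wt (- ?r) (0::'a) * wt (- ?r) (0::'b))" by (rule order_trans[OF norm_ge_zero b[of 0 0]])
    moreover have "0 < wt (- ?r) (0::'a) * wt (- ?r) (0::'b)" by simp
    ultimately show ?thesis by (metis mult_less_0_iff not_le)
  qed
  have "cmod (F p) \<le> C * wt (- ?r) p" for p
    using order_trans[OF b mult_left_mono[OF w C]] by (cases p) auto
  then have "integrable lborel F" by (rule integrable_wt_bound[OF F]) simp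
  then show ?thesis by (simp add: lborel_prod)
qed

lemma schwartz_prod_bound:
  fixes f :: "'a::euclidean_space \<Rightarrow> complex" and g :: "'b::euclidean_space \<Rightarrow> complex"
  assumes f: "f \<in> schwartz" and g: "g \<in> schwartz" and k: "k \<in> borel_measurable borel"
    and k1: "\<And>u v. cmod (k (u, v)) \<le> 1"
  shows "integrable (lborel \<Otimes>\<^sub>M lborel) (\<lambda>(u, v). f u * (g v * k (u, v)))"
proof -
  let ?r = "- 2 * real (DIM('a) + DIM('b))"
  obtain C where C: "0 \<le> C" "\<And>z. cmod (f z) \<le> C * wt ?r z" using tempered_value[OF schwartz_tempered[OF f]] by metis
  obtain D where D: "0 \<le> D" "\<And>z. cmod (g z) \<le> D * wt ?r z" using tempered_value[OF schwartz_tempered[OF g]] by metis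
  show ?thesis
  proof (rule integrable_product_decay)
    show "(\<lambda>(u, v). f u * (g v * k (u, v))) \<in> borel_measurable borel"
      using schwartz_measurable[OF f] schwartz_measurable[OF g] k
      unfolding borel_prod[symmetric] by measurable
    fix u v
    have "cmod (f u) * (cmod (g v) * cmod (k (u, v))) \<le> (C * wt ?r u) * ((D * wt ?r v) * 1)"
      by (intro mult_mono C D k1) (use C D in auto)
    then show "cmod (case (u, v) of (u, v) \<Rightarrow> f u * (g v * k (u, v))) \<le> (C * D) * (wt ?r u * wt ?r v)"
      by (simp add: norm_mult mult_ac)
  qed
qed

text \<open>The interchange needed throughout: the kernel \<open>k\<close> carries the exponential factors.\<close>

lemma schwartz_Fubini:
  fixes f :: "'a::euclidean_space \<Rightarrow> complex" and g :: "'b::euclidean_space \<Rightarrow> complex"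
  assumes f: "f \<in> schwartz" and g: "g \<in> schwartz" and k: "k \<in> borel_measurable borel"
    and k1: "\<And>u v. cmod (k (u, v)) \<le> 1"
  shows "(LINT v|lborel. (LINT u|lborel. f u * (g v * k (u, v)))) = (LINT u|lborel. (LINT v|lborel. f u * (g v * k (u, v))))"
  using lborel_pair.Fubini_integral[of "\<lambda>u v. f u * (g v * k (u, v))"] schwartz_prod_bound[OF assms] by simp

lemma gauss_kernel_integral:
  fixes f :: "'a::euclidean_space \<Rightarrow> complex"
  assumes f: "f \<in> borel_measurable borel" and e: "0 < e"
  shows "(LINT w|lborel. f w * gauss ((z - w) /\<^sub>R e)) = of_real (e ^ DIM('a)) * (LINT v|lborel. f (z + e *\<^sub>R v) * gauss v)"
proof -
  have gm: "(gauss :: 'a \<Rightarrow> complex) \<in> borel_measurable borel" by (rule schwartz_measurable[OF gauss_schwartz])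
  have m: "(\<lambda>w. f w * gauss ((z - w) /\<^sub>R e)) \<in> borel_measurable borel" using f gm by measurable
  have "(LINT w|lborel. f w * gauss ((z - w) /\<^sub>R e)) = (LINT w|lborel. f (z + w) * gauss ((z - (z + w)) /\<^sub>R e))"
    by (rule lborel_integral_translate(1)[OF m, symmetric])
  also have "\<dots> = (LINT w|lborel. f (z + w) * gauss (w /\<^sub>R e))" by (simp add: gauss_def)
  also have "\<dots> = of_real (e ^ DIM('a)) * (LINT w|lborel. f (z + e *\<^sub>R w) * gauss ((e *\<^sub>R w) /\<^sub>R e))"
    by (rule lborel_integral_scale[OF _ e]) (use f gm in measurable)
  also have "\<dots> = of_real (e ^ DIM('a)) * (LINT w|lborel. f (z + e *\<^sub>R w) * gauss w)" using e by simp
  finally show ?thesis .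
qed

text \<open>Integrating the frequencies first turns a Gaussian cutoff in frequency into a Gaussian average in
  space. Together with \<open>gauss_approximate_identity\<close> this replaces the delta function in formal
  computations.\<close>

lemma gauss_smoothing:
  fixes f :: "'a::euclidean_space \<Rightarrow> complex"
  assumes f: "f \<in> borel_measurable borel" and e: "0 < e"
  shows "(LINT w|lborel. f w * (LINT \<zeta>|lborel. gauss (e *\<^sub>R \<zeta>) * cis (\<zeta> \<bullet> (z - w))))
    = of_real (gauss_mass TYPE('a)) * (LINT v|lborel. f (z + e *\<^sub>R v) * gauss v)"
proof -
  let ?m = "complex_of_real (gauss_mass TYPE('a))" and ?E = "complex_of_real (e ^ DIM('a))"
  have E: "?E \<noteq> 0" using e by simp
  have "(LINT \<zeta>|lborel. gauss (e *\<^sub>R \<zeta>) * cis (\<zeta> \<bullet> (z - w))) = ?m / ?E * gauss ((z - w) /\<^sub>R e)" for w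
    using gauss_scaled_char_integral[OF e, of "z - w"] E by (simp add: eq_divide_eq mult.commute del: of_real_power)
  then have "(LINT w|lborel. f w * (LINT \<zeta>|lborel. gauss (e *\<^sub>R \<zeta>) * cis (\<zeta> \<bullet> (z - w))))
    = ?m / ?E * (LINT w|lborel. f w * gauss ((z - w) /\<^sub>R e))"
    by (simp only: mult.left_commute[of "f _"] integral_mult_right_zero)
  then show ?thesis unfolding gauss_kernel_integral[OF f e] using E by simp
qed

text \<open>A Gaussian cutoff in \<open>\<zeta>\<close> makes the double integral absolutely convergent; it becomes an average of \<open>f\<close>
  around \<open>z\<close> (\<open>gauss_smoothing\<close>), which tends to \<open>f z\<close> as the cutoff is removed.\<close>

lemma ft_inversion:
  fixes f :: "'a::euclidean_space \<Rightarrow> complex"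
  assumes f: "f \<in> schwartz"
  shows "(LINT \<zeta>|lborel. ft f \<zeta> * cis (\<zeta> \<bullet> z)) = of_real ((2 * pi) ^ DIM('a)) * f z"
proof -
  let ?m = "gauss_mass TYPE('a)"
  let ?e = "\<lambda>k. 1 / real (Suc k)"
  have e: "0 < ?e k" for k by simp
  have fm: "f \<in> borel_measurable borel" "ft f \<in> borel_measurable borel" "(gauss :: 'a \<Rightarrow> complex) \<in> borel_measurable borel"
    by (intro schwartz_measurable f ft_schwartz gauss_schwartz)+
  have gs: "(\<lambda>\<zeta>::'a. gauss (?e k *\<^sub>R \<zeta>)) \<in> schwartz" for k by (rule schwartz_scale[OF gauss_schwartz]) simp
  have "(\<lambda>k. LINT \<zeta>|lborel. gauss (?e k *\<^sub>R \<zeta>) * (ft f \<zeta> * cis (\<zeta> \<bullet> z))) \<longlonglongrightarrow> (LINT \<zeta>|lborel. ft f \<zeta> * cis (\<zeta> \<bullet> z))"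
  proof (rule integral_dominated_convergence)
    show "integrable lborel (\<lambda>\<zeta>. cmod (ft f \<zeta>))" by (intro integrable_norm schwartz_integrable ft_schwartz f)
    show "AE \<zeta> in lborel. (\<lambda>k. gauss (?e k *\<^sub>R \<zeta>) * (ft f \<zeta> * cis (\<zeta> \<bullet> z))) \<longlonglongrightarrow> ft f \<zeta> * cis (\<zeta> \<bullet> z)"
    proof (rule AE_I2)
      fix \<zeta> :: 'a
      have "tconv 0 (\<lambda>k z. gauss (?e k *\<^sub>R z)) (\<lambda>z::'a. 1)"
        by (rule tconv_cutoff[OF gauss_schwartz gauss_0 inverse_Suc_tendsto])
      from tendsto_mult[OF dconv_value[OF tconv_dconv[OF this]] tendsto_const]
      show "(\<lambda>k. gauss (?e k *\<^sub>R \<zeta>) * (ft f \<zeta> * cis (\<zeta> \<bullet> z))) \<longlonglongrightarrow> ft f \<zeta> * cis (\<zeta> \<bullet> z)" by fastforce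
    qed
    show "AE \<zeta> in lborel. norm (gauss (?e k *\<^sub>R \<zeta>) * (ft f \<zeta> * cis (\<zeta> \<bullet> z))) \<le> cmod (ft f \<zeta>)" for k
      by (intro AE_I2) (simp add: norm_mult gauss_def mult_left_le_one_le)
  qed (use fm in measurable)
  moreover have "(LINT \<zeta>|lborel. gauss (?e k *\<^sub>R \<zeta>) * (ft f \<zeta> * cis (\<zeta> \<bullet> z)))
      = of_real ?m * (LINT v|lborel. f (z + ?e k *\<^sub>R v) * gauss v)" for k
  proof -
    have "(LINT \<zeta>|lborel. gauss (?e k *\<^sub>R \<zeta>) * (ft f \<zeta> * cis (\<zeta> \<bullet> z)))
      = (LINT \<zeta>|lborel. (LINT w|lborel. f w * (gauss (?e k *\<^sub>R \<zeta>) * cis (\<zeta> \<bullet> z - w \<bullet> \<zeta>))))"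
    proof (rule Bochner_Integration.integral_cong[OF refl])
      fix \<zeta> :: 'a
      have "gauss (?e k *\<^sub>R \<zeta>) * (ft f \<zeta> * cis (\<zeta> \<bullet> z))
        = (gauss (?e k *\<^sub>R \<zeta>) * cis (\<zeta> \<bullet> z)) * (LINT w|lborel. f w * cis (- (w \<bullet> \<zeta>)))" by (simp add: ft_def)
      also have "\<dots> = (LINT w|lborel. (gauss (?e k *\<^sub>R \<zeta>) * cis (\<zeta> \<bullet> z)) * (f w * cis (- (w \<bullet> \<zeta>))))" by simp
      also have "\<dots> = (LINT w|lborel. f w * (gauss (?e k *\<^sub>R \<zeta>) * cis (\<zeta> \<bullet> z - w \<bullet> \<zeta>)))"
        by (rule Bochner_Integration.integral_cong[OF refl]) (simp add: cis_mult[symmetric] diff_conv_add_uminus del: add_uminus_conv_diff)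
      finally show "gauss (?e k *\<^sub>R \<zeta>) * (ft f \<zeta> * cis (\<zeta> \<bullet> z)) = (LINT w|lborel. f w * (gauss (?e k *\<^sub>R \<zeta>) * cis (\<zeta> \<bullet> z - w \<bullet> \<zeta>)))" .
    qed
    also have "\<dots> = (LINT w|lborel. (LINT \<zeta>|lborel. f w * (gauss (?e k *\<^sub>R \<zeta>) * cis (\<zeta> \<bullet> z - w \<bullet> \<zeta>))))"
      using schwartz_Fubini[OF f gs, of "\<lambda>(w, \<zeta>). cis (\<zeta> \<bullet> z - w \<bullet> \<zeta>)" k]
      unfolding borel_prod[symmetric] by simp
    also have "\<dots> = (LINT w|lborel. f w * (LINT \<zeta>|lborel. gauss (?e k *\<^sub>R \<zeta>) * cis (\<zeta> \<bullet> (z - w))))"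
      by (simp add: inner_diff_right inner_commute)
    also have "\<dots> = of_real ?m * (LINT v|lborel. f (z + ?e k *\<^sub>R v) * gauss v)"
      by (rule gauss_smoothing[OF fm(1) e])
    finally show ?thesis .
  qed
  ultimately have "(\<lambda>k. of_real ?m * (LINT v|lborel. f (z + ?e k *\<^sub>R v) * gauss v)) \<longlonglongrightarrow> (LINT \<zeta>|lborel. ft f \<zeta> * cis (\<zeta> \<bullet> z))"
    by simp
  moreover have "(\<lambda>k. of_real ?m * (LINT v|lborel. f (z + ?e k *\<^sub>R v) * gauss v)) \<longlonglongrightarrow> of_real ?m * (of_real ?m * f z)"
    by (intro tendsto_mult tendsto_const gauss_approximate_identity[OF schwartz_tempered[OF f, of 0]])
  ultimately have "(LINT \<zeta>|lborel. ft f \<zeta> * cis (\<zeta> \<bullet> z)) = of_real ?m * (of_real ?m * f z)"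
    by (rule LIMSEQ_unique)
  then show ?thesis using gauss_mass_square[where 'a='a] by (metis mult.assoc of_real_mult)
qed

lemma ft_swap:
  fixes f g :: "'a::euclidean_space \<Rightarrow> complex"
  assumes f: "f \<in> schwartz" and g: "g \<in> schwartz"
  shows "(LINT \<zeta>|lborel. ft f \<zeta> * g \<zeta>) = (LINT z|lborel. f z * ft g z)"
proof -
  have "(LINT \<zeta>|lborel. ft f \<zeta> * g \<zeta>) = (LINT \<zeta>|lborel. (LINT z|lborel. f z * (g \<zeta> * cis (- (z \<bullet> \<zeta>)))))"
  proof (rule Bochner_Integration.integral_cong[OF refl])
    fix \<zeta> :: 'a
    have "ft f \<zeta> * g \<zeta> = (LINT z|lborel. g \<zeta> * (f z * cis (- (z \<bullet> \<zeta>))))" by (simp add: ft_def)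
    then show "ft f \<zeta> * g \<zeta> = (LINT z|lborel. f z * (g \<zeta> * cis (- (z \<bullet> \<zeta>))))" by (simp add: mult_ac)
  qed
  also have "\<dots> = (LINT z|lborel. (LINT \<zeta>|lborel. f z * (g \<zeta> * cis (- (z \<bullet> \<zeta>)))))"
    using schwartz_Fubini[OF f g, of "\<lambda>(z, \<zeta>). cis (- (z \<bullet> \<zeta>))"]
    unfolding borel_prod[symmetric] by simp
  also have "\<dots> = (LINT z|lborel. f z * ft g z)"
    by (simp add: ft_def inner_commute)
  finally show ?thesis .
qed


section \<open>Oscillatory integrals depending on parameters\<close>

text \<open>The coefficients for which \<open>f\<close> is the superposition of the exponentials (\<open>fcoeff_representation\<close>).\<close>

definition fcoeff :: "('a::euclidean_space \<Rightarrow> complex) \<Rightarrow> 'a \<Rightarrow> complex" where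
  "fcoeff f = (\<lambda>\<zeta>. of_real (1 / (2 * pi) ^ DIM('a)) * ft f \<zeta>)"

lemma fcoeff_schwartz: "f \<in> schwartz \<Longrightarrow> fcoeff f \<in> schwartz"
  unfolding fcoeff_def by (intro schwartz_cmult ft_schwartz)

lemma fcoeff_representation:
  fixes f :: "'a::euclidean_space \<Rightarrow> complex"
  assumes f: "f \<in> schwartz"
  shows "f z = (LINT \<zeta>|lborel. fcoeff f \<zeta> * exponential \<zeta> z)"
proof -
  have "(LINT \<zeta>|lborel. fcoeff f \<zeta> * exponential \<zeta> z) = of_real (1 / (2 * pi) ^ DIM('a)) * (LINT \<zeta>|lborel. ft f \<zeta> * cis (\<zeta> \<bullet> z))"
    unfolding fcoeff_def exponential_def mult.assoc by (rule integral_mult_right_zero)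
  also have "\<dots> = f z" unfolding ft_inversion[OF f] by (simp add: of_real_mult[symmetric] del: of_real_mult)
  finally show ?thesis by simp
qed

text \<open>Coefficients of superpositions. The class is stable under multiplication by bounded measurable
  functions, so that phase factors may be absorbed into the coefficients.\<close>

definition rapid :: "('a::euclidean_space \<Rightarrow> complex) \<Rightarrow> bool" where
  "rapid \<alpha> \<longleftrightarrow> \<alpha> \<in> borel_measurable borel \<and> (\<forall>L. \<exists>C\<ge>0. \<forall>\<zeta>. cmod (\<alpha> \<zeta>) \<le> C * wt L \<zeta>)"

lemma schwartz_rapid: "\<alpha> \<in> schwartz \<Longrightarrow> rapid \<alpha>"
  unfolding rapid_def using schwartz_measurable tempered_value[OF schwartz_tempered] by metis

lemma smooth_slice:
  fixes A :: "'p::euclidean_space \<times> 'a::euclidean_space \<Rightarrow> complex"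
  assumes "smooth A"
  shows "smooth (\<lambda>u. A (x, u))" "iter_deriv vs (\<lambda>u. A (x, u)) = (\<lambda>u. iter_deriv (map (Pair 0) vs) A (x, u))"
proof -
  have L: "bounded_linear (\<lambda>u::'a. (0::'p, u))" by (intro bounded_linear_intros)
  show "smooth (\<lambda>u. A (x, u))" using smooth_affine[OF L assms, of "(x, 0)"] by simp
  show "iter_deriv vs (\<lambda>u. A (x, u)) = (\<lambda>u. iter_deriv (map (Pair 0) vs) A (x, u))"
    using iter_deriv_affine[OF L assms, of vs "(x, 0)"] by simp
qed

lemma bnd_slice:
  fixes A :: "'p::euclidean_space \<times> 'a::euclidean_space \<Rightarrow> complex"
  assumes "bnd N W A" shows "bnd N (\<lambda>u. W (x, u)) (\<lambda>u. A (x, u))"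
  unfolding bnd_def
proof (intro conjI allI impI)
  show "smooth (\<lambda>u. A (x, u))" by (rule smooth_slice[OF bnd_smooth[OF assms]])
  fix vs :: "'a list" and u assume "length vs \<le> N" "\<forall>v\<in>set vs. norm v \<le> 1"
  then show "cmod (iter_deriv vs (\<lambda>u. A (x, u)) u) \<le> W (x, u)"
    unfolding smooth_slice(2)[OF bnd_smooth[OF assms]]
    by (intro bndD[OF assms]) (auto simp: norm_Pair)
qed

lemma tempered_slice:
  fixes A :: "'p::euclidean_space \<times> 'a::euclidean_space \<Rightarrow> complex"
  assumes A: "tempered M A" and M: "0 \<le> M" shows "tempered M (\<lambda>u. A (x, u))"
proof -
  have L: "bounded_linear (\<lambda>u::'a. (0::'p, u))" by (intro bounded_linear_intros)
  show ?thesis using tempered_affine[OF A L M, of "(x, 0)"] by simp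
qed

context chirp
begin

lemma osc_schwartz: "a \<in> schwartz \<Longrightarrow> osc a = (LINT u|lborel. phase u * a u)"
  using osc_integrable[OF schwartz_tempered order_refl] .

lemma phase_integrable: "a \<in> schwartz \<Longrightarrow> integrable lborel (\<lambda>u. phase u * a u)"
  using schwartz_integrable[OF schwartz_phase_mult] .

lemma gauss_cutoff_schwartz:
  fixes a :: "'a \<Rightarrow> complex"
  assumes "tempered M a" shows "(\<lambda>u. gauss ((1 / real (Suc k)) *\<^sub>R u) * a u) \<in> schwartz"
proof -
  have "(\<lambda>\<zeta>::'a. gauss ((1 / real (Suc k)) *\<^sub>R \<zeta>)) \<in> schwartz" by (rule schwartz_scale[OF gauss_schwartz]) simp
  from schwartz_mult_tempered[OF this assms] show ?thesis .
qed

lemma osc_add: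
  assumes "tempered M a" "tempered M b" shows "osc (\<lambda>u. a u + b u) = osc a + osc b"
proof -
  let ?g = "\<lambda>a k u. gauss ((1 / real (Suc k)) *\<^sub>R u) * a u"
  have "(\<lambda>k. osc (?g (\<lambda>u. a u + b u) k)) \<longlonglongrightarrow> osc (\<lambda>u. a u + b u)"
    by (rule osc_tendsto[OF gauss_cutoff[OF tempered_add[OF assms]]])
  moreover have "(\<lambda>k. osc (?g a k) + osc (?g b k)) \<longlonglongrightarrow> osc a + osc b"
    by (rule tendsto_add[OF osc_tendsto[OF gauss_cutoff[OF assms(1)]] osc_tendsto[OF gauss_cutoff[OF assms(2)]]])
  moreover have "osc (?g (\<lambda>u. a u + b u) k) = osc (?g a k) + osc (?g b k)" for k
    unfolding osc_schwartz[OF gauss_cutoff_schwartz[OF assms(1)]] osc_schwartz[OF gauss_cutoff_schwartz[OF assms(2)]]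
      osc_schwartz[OF gauss_cutoff_schwartz[OF tempered_add[OF assms]]]
    by (subst Bochner_Integration.integral_add[symmetric])
      (simp_all only: distrib_left phase_integrable gauss_cutoff_schwartz[OF assms(1)] gauss_cutoff_schwartz[OF assms(2)])
  ultimately show ?thesis using LIMSEQ_unique by auto
qed

lemma osc_cmult:
  assumes "tempered M a" shows "osc (\<lambda>u. c * a u) = c * osc a"
proof -
  let ?g = "\<lambda>a k u. gauss ((1 / real (Suc k)) *\<^sub>R u) * a u"
  have "(\<lambda>k. osc (?g (\<lambda>u. c * a u) k)) \<longlonglongrightarrow> osc (\<lambda>u. c * a u)"
    by (rule osc_tendsto[OF gauss_cutoff[OF tempered_cmult[OF assms]]])
  moreover have "(\<lambda>k. c * osc (?g a k)) \<longlonglongrightarrow> c * osc a"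
    by (rule tendsto_mult[OF tendsto_const osc_tendsto[OF gauss_cutoff[OF assms]]])
  moreover have "osc (?g (\<lambda>u. c * a u) k) = c * osc (?g a k)" for k
    unfolding osc_schwartz[OF gauss_cutoff_schwartz[OF assms(1)]]
      osc_schwartz[OF gauss_cutoff_schwartz[OF tempered_cmult[OF assms]]]
    by (subst integral_mult_right_zero[symmetric]) (simp only: mult.left_commute[of _ c])
  ultimately show ?thesis using LIMSEQ_unique by auto
qed

lemma osc_zero: "osc (\<lambda>u. 0) = 0"
  using osc_cmult[OF tempered_zero, of 0] by simp

lemma osc_diff:
  assumes "tempered M a" "tempered M b" shows "osc (\<lambda>u. a u - b u) = osc a - osc b"
  using osc_add[OF assms(1) tempered_cmult[OF assms(2), of "-1"]] osc_cmult[OF assms(2), of "-1"] by simp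

subsection \<open>Differentiation under the oscillatory integral\<close>

text \<open>The normalized remainder of the linear approximation in the parameter, as a sequence of amplitudes
  in \<open>u\<close>. Derivatives in \<open>u\<close> commute with forming the remainder, so it suffices to treat one function: it
  tends to 0 by differentiability, and the mean value inequality bounds it by the derivative of
  the amplitude over a bounded set of parameters.\<close>

lemma param_remainder_tconv:
  fixes A :: "'p::euclidean_space \<times> 'a \<Rightarrow> complex"
  assumes A: "tempered M A" and M: "0 \<le> M" and X: "\<And>k. X k \<noteq> x" "X \<longlonglongrightarrow> x"
  shows "tconv M (\<lambda>k u. of_real (1 / norm (X k - x)) * (A (X k, u) - A (x, u) - dir_deriv (X k - x, 0) A (x, u))) (\<lambda>u. 0)"
proof -
  define R where "R G k u = of_real (1 / norm (X k - x)) * (G (X k, u) - G (x, u) - dir_deriv (X k - x, 0) G (x, u))"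
    for G :: "'p \<times> 'a \<Rightarrow> complex" and k u
  have As: "smooth A" using A tempered_smooth by blast
  have Rs: "smooth (R G k)" if "smooth G" for G k
    unfolding R_def[abs_def] using that
    by (intro smooth_cmult smooth_diff smooth_slice smooth_dir_deriv)
  have Rit: "iter_deriv vs (R A k) = R (iter_deriv (map (Pair 0) vs) A) k" for vs k
  proof -
    note s = smooth_slice(1)[OF As] smooth_slice(1)[OF smooth_dir_deriv[OF As]]
    have "iter_deriv vs (\<lambda>u. c * (A (y, u) - A (x, u) - dir_deriv w A (x, u))) =
       (\<lambda>u. c * (iter_deriv (map (Pair 0) vs) A (y, u) - iter_deriv (map (Pair 0) vs) A (x, u)
          - dir_deriv w (iter_deriv (map (Pair 0) vs) A) (x, u)))" for c y w
      by (simp add: iter_deriv_cmult iter_deriv_diff smooth_diff s smooth_slice(2)[OF As]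
        smooth_slice(2)[OF smooth_dir_deriv[OF As]] iter_deriv_dir_deriv[OF As])
    then show ?thesis unfolding R_def[abs_def] by blast
  qed
  have lim: "(\<lambda>k. R G k u) \<longlonglongrightarrow> 0" if G: "smooth G" for G u
  proof -
    have "((\<lambda>y. G ((0, u) + (y, 0))) has_derivative (\<lambda>v. dir_deriv (v, 0) G ((0, u) + (x, 0)))) (at x)"
      by (rule has_derivative_affine_compose[of "\<lambda>y. (y, 0)"])
        (auto intro!: bounded_linear_intros smooth_has_derivative G)
    then have "((\<lambda>y. ((G (y, u) - G (x, u)) - dir_deriv (y - x, 0) G (x, u)) /\<^sub>R norm (y - x)) \<longlongrightarrow> 0) (at x)"
      by (simp add: has_derivative_at_within)
    then have "(\<lambda>k. ((G (X k, u) - G (x, u)) - dir_deriv (X k - x, 0) G (x, u)) /\<^sub>R norm (X k - x)) \<longlonglongrightarrow> 0"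
      using X unfolding tendsto_at_iff_sequentially by (auto simp: o_def)
    then show ?thesis by (simp add: R_def scaleR_conv_of_real divide_inverse)
  qed
  \<comment> \<open>All points of the segments from \<open>x\<close> to \<open>X k\<close> have norm at most \<open>\<rho>\<close>.\<close>
  obtain b where b: "\<And>k. norm (X k) \<le> b" using convergent_imp_Bseq[OF convergentI[OF X(2)]] by (auto simp: Bseq_def)
  define \<rho> where "\<rho> = 2 * norm x + b"
  have bound: "cmod (R G k u) \<le> 2 * (C * (1 + \<rho>) powr M) * wt M u"
    if G: "smooth G" and d: "\<And>w z. norm w \<le> 1 \<Longrightarrow> cmod (dir_deriv w G z) \<le> C * wt M z" for G C k u
  proof -
    have C: "0 \<le> C"
    proof -
      have "0 \<le> C * wt M (0::'p \<times> 'a)" by (rule order_trans[OF norm_ge_zero d[of 0 0]]) simp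
      then show ?thesis using wt_pos[of M "0::'p \<times> 'a"] by (metis mult_less_0_iff not_le)
    qed
    define r where "r = norm (X k - x)"
    have r: "0 < r" unfolding r_def using X(1)[of k] by simp
    have rb: "r \<le> norm x + b" unfolding r_def using norm_triangle_ineq4[of "X k" x] b[of k] by simp
    define w where "w = ((X k - x) /\<^sub>R r, 0::'a)"
    have w: "norm w \<le> 1" unfolding w_def r_def norm_Pair using X(1)[of k] by simp
    have rw: "r *\<^sub>R w = (X k - x, 0)" unfolding w_def using r by simp
    have pt: "cmod (dir_deriv w G ((x, u) + t *\<^sub>R w)) \<le> C * ((1 + \<rho>) powr M) * wt M u" if t: "0 \<le> t" "t \<le> r" for t
    proof -
      have 1: "(x, u) + t *\<^sub>R w = (x + t *\<^sub>R ((X k - x) /\<^sub>R r), u)" by (simp add: w_def)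
      have "norm (t *\<^sub>R ((X k - x) /\<^sub>R r)) = t * (inverse r * r)" using t r by (simp add: r_def)
      also have "\<dots> \<le> r" using t r by simp
      finally have "norm (t *\<^sub>R ((X k - x) /\<^sub>R r)) \<le> r" .
      then have "norm (x + t *\<^sub>R ((X k - x) /\<^sub>R r)) \<le> \<rho>"
        using norm_triangle_ineq[of x "t *\<^sub>R ((X k - x) /\<^sub>R r)"] rb by (simp only: \<rho>_def)
      then have 2: "wt M (x + t *\<^sub>R ((X k - x) /\<^sub>R r)) \<le> (1 + \<rho>) powr M"
        unfolding wt_def using M by (intro powr_mono2) auto
      have "cmod (dir_deriv w G ((x, u) + t *\<^sub>R w)) \<le> C * wt M (x + t *\<^sub>R ((X k - x) /\<^sub>R r), u)"
        unfolding 1 by (rule d[OF w])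
      also have "\<dots> \<le> C * (wt M (x + t *\<^sub>R ((X k - x) /\<^sub>R r)) * wt M u)"
        by (intro mult_left_mono wt_Pair_le M C)
      also have "\<dots> \<le> C * ((1 + \<rho>) powr M * wt M u)"
        by (intro mult_left_mono mult_right_mono 2 C) simp
      finally show ?thesis by (simp add: mult.assoc)
    qed
    have "cmod (G ((x, u) + r *\<^sub>R w) - G (x, u) - of_real r * dir_deriv w G (x, u)) \<le> (2 * (C * (1 + \<rho>) powr M) * wt M u) * r"
    proof (rule dir_deriv_increment_bound)
      fix t assume t: "0 \<le> t" "t \<le> r"
      show "cmod (dir_deriv w G ((x, u) + t *\<^sub>R w) - dir_deriv w G (x, u)) \<le> 2 * (C * (1 + \<rho>) powr M) * wt M u"
        using norm_triangle_ineq4[of "dir_deriv w G ((x, u) + t *\<^sub>R w)" "dir_deriv w G (x, u)"]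
          pt[OF t] pt[of 0] r by simp
    qed (use G r in \<open>auto intro: smooth_differentiable\<close>)
    moreover have "of_real r * dir_deriv w G (x, u) = dir_deriv (X k - x, 0) G (x, u)"
      using dir_deriv_scaleR[OF G, of r w] by (simp add: rw)
    moreover have "(x, u) + r *\<^sub>R w = (X k, u)" by (simp add: rw)
    ultimately have "cmod (G (X k, u) - G (x, u) - dir_deriv (X k - x, 0) G (x, u)) \<le> (2 * (C * (1 + \<rho>) powr M) * wt M u) * r"
      by simp
    then show ?thesis using r by (simp add: R_def r_def[symmetric] norm_mult norm_divide pos_divide_le_eq)
  qed
  have "tconv M (R A) (\<lambda>u. 0)"
    unfolding tconv_def dconv_def
  proof (intro conjI allI)
    show "smooth (R A k)" for k by (rule Rs[OF As])
    show "smooth (\<lambda>u::'a. 0)" by (rule smooth_const)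
    show "(\<lambda>k. iter_deriv vs (R A k) z) \<longlonglongrightarrow> iter_deriv vs (\<lambda>u. 0) z" for vs z
      unfolding Rit iter_deriv_zero by (rule lim[OF smooth_iter_deriv[OF As]])
    fix N
    obtain C where C: "bnd (Suc N) (\<lambda>z. C * wt M z) A" using temperedE[OF A] by metis
    have "bnd N (\<lambda>u. (2 * (C * (1 + \<rho>) powr M)) * wt M u) (R A k)" for k
      unfolding bnd_def
    proof (intro conjI allI impI)
      show "smooth (R A k)" by (rule Rs[OF As])
      fix vs :: "'a list" and u assume vs: "length vs \<le> N" "\<forall>v\<in>set vs. norm v \<le> 1"
      show "cmod (iter_deriv vs (R A k) u) \<le> (2 * (C * (1 + \<rho>) powr M)) * wt M u"
        unfolding Rit
      proof (rule bound[OF smooth_iter_deriv[OF As]])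
        fix w :: "'p \<times> 'a" and z assume w: "norm w \<le> 1"
        have "norm v \<le> 1" if "v \<in> set (w # map (Pair 0) vs)" for v
          using that vs w by (auto simp: norm_Pair)
        then show "cmod (dir_deriv w (iter_deriv (map (Pair 0) vs) A) z) \<le> C * wt M z"
          using bndD[OF C, of "w # map (Pair 0) vs" z] vs by simp
      qed
    qed
    then show "\<exists>K. \<forall>k. bnd N (\<lambda>z. K * wt M z) (R A k)" by blast
  qed
  then show ?thesis by (simp add: R_def[abs_def])
qed

text \<open>Continuity of the oscillatory integral (\<open>osc_tendsto\<close>) applied to the remainders of
  \<open>param_remainder_tconv\<close>.\<close>

lemma osc_param_has_derivative:
  fixes A :: "'p::euclidean_space \<times> 'a \<Rightarrow> complex"
  assumes A: "tempered M A" and M: "0 \<le> M"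
  shows "((\<lambda>x. osc (\<lambda>u. A (x, u))) has_derivative (\<lambda>v. osc (\<lambda>u. dir_deriv (v, 0) A (x, u)))) (at x)"
proof -
  have As: "smooth A" using A tempered_smooth by blast
  note t = tempered_slice[OF A M] tempered_slice[OF tempered_dir_deriv[OF A] M]
  let ?D = "\<lambda>v. osc (\<lambda>u. dir_deriv (v, 0) A (x, u))"
  have "linear ?D"
  proof
    fix v w :: 'p and r :: real
    have "dir_deriv (v + w, 0) A = (\<lambda>z. dir_deriv (v, 0) A z + dir_deriv (w, 0) A z)"
      using dir_deriv_plus[OF As, of "(v, 0)" "(w, 0)"] by simp
    then show "?D (v + w) = ?D v + ?D w" using osc_add[OF t(2) t(2)] by simp
    have "dir_deriv (r *\<^sub>R v, 0) A = (\<lambda>z. of_real r * dir_deriv (v, 0) A z)"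
      using dir_deriv_scaleR[OF As, of r "(v, 0)"] by simp
    then show "?D (r *\<^sub>R v) = r *\<^sub>R ?D v" using osc_cmult[OF t(2)] by (simp add: scaleR_conv_of_real)
  qed
  then have bl: "bounded_linear ?D" using linear_conv_bounded_linear by blast
  have "((\<lambda>y. ((osc (\<lambda>u. A (y, u)) - osc (\<lambda>u. A (x, u))) - ?D (y - x)) /\<^sub>R norm (y - x)) \<longlongrightarrow> 0) (at x)"
    unfolding tendsto_at_iff_sequentially
  proof (intro allI impI)
    fix X :: "nat \<Rightarrow> 'p" assume X0: "\<forall>i. X i \<in> UNIV - {x}" and X: "X \<longlonglongrightarrow> x"
    have "osc (\<lambda>u. of_real (1 / norm (X k - x)) * (A (X k, u) - A (x, u) - dir_deriv (X k - x, 0) A (x, u)))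
      = ((osc (\<lambda>u. A (X k, u)) - osc (\<lambda>u. A (x, u))) - ?D (X k - x)) /\<^sub>R norm (X k - x)" for k
    proof -
      have t2: "tempered M (\<lambda>u. A (X k, u) - A (x, u))"
        using tempered_add[OF t(1) tempered_cmult[OF t(1), of "-1"]] by simp
      have t3: "tempered M (\<lambda>u. A (X k, u) - A (x, u) - dir_deriv (X k - x, 0) A (x, u))"
        using tempered_add[OF t2 tempered_cmult[OF t(2), of "-1"]] by simp
      show ?thesis
        by (simp only: osc_cmult[OF t3] osc_diff[OF t2 t(2)] osc_diff[OF t(1) t(1)])
          (simp add: scaleR_conv_of_real divide_inverse)
    qed
    moreover have "(\<lambda>k. osc (\<lambda>u. of_real (1 / norm (X k - x)) * (A (X k, u) - A (x, u) - dir_deriv (X k - x, 0) A (x, u)))) \<longlonglongrightarrow> osc (\<lambda>u. 0)"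
      by (rule osc_tendsto[OF param_remainder_tconv[OF A M _ X]]) (use X0 in auto)
    ultimately show "((\<lambda>y. ((osc (\<lambda>u. A (y, u)) - osc (\<lambda>u. A (x, u))) - ?D (y - x)) /\<^sub>R norm (y - x)) \<circ> X) \<longlonglongrightarrow> 0"
      by (simp add: o_def osc_zero)
  qed
  then show ?thesis using bl by (simp add: has_derivative_at_within)
qed

lemma dir_deriv_osc_param:
  fixes A :: "'p::euclidean_space \<times> 'a \<Rightarrow> complex"
  assumes "tempered M A" "0 \<le> M"
  shows "dir_deriv v (\<lambda>x. osc (\<lambda>u. A (x, u))) = (\<lambda>x. osc (\<lambda>u. dir_deriv (v, 0) A (x, u)))"
  by (rule ext) (rule dir_deriv_eq[OF osc_param_has_derivative[OF assms]])

lemma smooth_osc_param: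
  fixes A :: "'p::euclidean_space \<times> 'a \<Rightarrow> complex"
  assumes "tempered M A" "0 \<le> M"
  shows "smooth (\<lambda>x. osc (\<lambda>u. A (x, u)))"
proof -
  have "C_k k (\<lambda>x. osc (\<lambda>u. A (x, u)))" if "tempered M A" for k and A :: "'p \<times> 'a \<Rightarrow> complex"
    using that
  proof (induction k arbitrary: A)
    case 0
    then show ?case
      using has_derivative_continuous[OF osc_param_has_derivative[OF 0 assms(2)]]
      by (simp add: continuous_on_eq_continuous_at)
  next
    case (Suc k)
    have "(\<lambda>x. osc (\<lambda>u. A (x, u))) differentiable (at x)" for x
      unfolding differentiable_def using osc_param_has_derivative[OF Suc.prems assms(2)] by blast
    then show ?case using Suc.IH[OF tempered_dir_deriv[OF Suc.prems]]
      by (simp add: dir_deriv_osc_param[OF Suc.prems assms(2)])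
  qed
  then show ?thesis using assms by (simp add: smooth_def)
qed

text \<open>Here \<open>V\<close> is an arbitrary function of the parameter: bounds that separate as \<open>V(x) (1 + |u|)\<^sup>M\<close> are
  inherited by the integral with \<open>V\<close> unchanged. For Shubin symbols \<open>V\<close> is a power of \<open>\<mu>\<close>.\<close>

lemma bnd_osc_param:
  assumes M: "0 \<le> M"
  shows "\<exists>N' c. 0 \<le> c \<and> (\<forall>(A :: 'p::euclidean_space \<times> 'a \<Rightarrow> complex) V. tempered M A \<longrightarrow>
     bnd N' (\<lambda>z. V (fst z) * wt M (snd z)) A \<longrightarrow> bnd N (\<lambda>x. c * V x) (\<lambda>x. osc (\<lambda>u. A (x, u))))"
proof -
  obtain n c where c: "0 \<le> c" "\<And>a K. tempered M a \<Longrightarrow> bnd n (\<lambda>u. K * wt M u) a \<Longrightarrow> cmod (osc a) \<le> c * K"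
    using osc_bound[of M] by metis
  have "bnd N (\<lambda>x. c * V x) (\<lambda>x. osc (\<lambda>u. A (x, u)))"
    if "tempered M A" "bnd (n + N) (\<lambda>z. V (fst z) * wt M (snd z)) A" for N V and A :: "'p \<times> 'a \<Rightarrow> complex"
    using that
  proof (induction N arbitrary: A)
    case 0
    have "cmod (osc (\<lambda>u. A (x, u))) \<le> c * V x" for x
      using c(2)[OF tempered_slice[OF 0(1) M]] bnd_slice[OF 0(2), of x] by simp
    then show ?case by (simp add: bnd_0 smooth_osc_param[OF 0(1) M])
  next
    case (Suc N)
    have le: "bnd n (\<lambda>z. V (fst z) * wt M (snd z)) A" by (rule bnd_le[OF Suc.prems(2)]) simp
    show ?case unfolding bnd_Suc
    proof (intro conjI allI impI)
      show "smooth (\<lambda>x. osc (\<lambda>u. A (x, u)))" by (rule smooth_osc_param[OF Suc.prems(1) M])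
      show "cmod (osc (\<lambda>u. A (x, u))) \<le> c * V x" for x
        using c(2)[OF tempered_slice[OF Suc.prems(1) M]] bnd_slice[OF le, of x] by simp
      fix v :: 'p assume v: "norm v \<le> 1"
      have "bnd (n + N) (\<lambda>z. V (fst z) * wt M (snd z)) (dir_deriv (v, 0) A)"
        by (rule bnd_dir_deriv) (use Suc.prems v in \<open>auto simp: norm_Pair\<close>)
      then show "bnd N (\<lambda>x. c * V x) (dir_deriv v (\<lambda>x. osc (\<lambda>u. A (x, u))))"
        unfolding dir_deriv_osc_param[OF Suc.prems(1) M] by (intro Suc.IH tempered_dir_deriv Suc.prems)
    qed
  qed
  then show ?thesis using c(1) by blast
qed

lemma bnd_osc_param_wt:
  assumes M: "0 \<le> M"
  shows "\<exists>N' c. 0 \<le> c \<and> (\<forall>(A :: 'p::euclidean_space \<times> 'a \<Rightarrow> complex) K. tempered M A \<longrightarrow>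
     bnd N' (\<lambda>z. K * wt M z) A \<longrightarrow> bnd N (\<lambda>x. (c * K) * wt M x) (\<lambda>x. osc (\<lambda>u. A (x, u))))"
proof -
  obtain N' c where c: "0 \<le> c" "\<And>(A :: 'p \<times> 'a \<Rightarrow> complex) V. tempered M A \<Longrightarrow>
     bnd N' (\<lambda>z. V (fst z) * wt M (snd z)) A \<Longrightarrow> bnd N (\<lambda>x. c * V x) (\<lambda>x. osc (\<lambda>u. A (x, u)))"
    using bnd_osc_param[OF M, of N] by blast
  show ?thesis
  proof (intro exI[of _ N'] exI[of _ c] conjI allI impI c(1))
    fix A :: "'p \<times> 'a \<Rightarrow> complex" and K assume A: "tempered M A" "bnd N' (\<lambda>z. K * wt M z) A"
    have K: "0 \<le> K" by (rule bnd_wt_nonneg[OF A(2)])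
    have "bnd N' (\<lambda>z. (\<lambda>x. K * wt M x) (fst z) * wt M (snd z)) A"
      by (rule bnd_mono[OF A(2)])
        (use wt_Pair_le[OF M] K in \<open>auto simp: mult.assoc intro!: mult_left_mono\<close>)
    from c(2)[OF A(1) this] show "bnd N (\<lambda>x. (c * K) * wt M x) (\<lambda>x. osc (\<lambda>u. A (x, u)))"
      by (simp add: mult.assoc)
  qed
qed

lemma tempered_osc_param:
  fixes A :: "'p::euclidean_space \<times> 'a \<Rightarrow> complex"
  assumes A: "tempered M A" and M: "0 \<le> M" shows "tempered M (\<lambda>x. osc (\<lambda>u. A (x, u)))"
  unfolding tempered_def
proof
  fix N
  obtain N' c where c: "\<And>(A :: 'p \<times> 'a \<Rightarrow> complex) K. tempered M A \<Longrightarrow>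
     bnd N' (\<lambda>z. K * wt M z) A \<Longrightarrow> bnd N (\<lambda>x. (c * K) * wt M x) (\<lambda>x. osc (\<lambda>u. A (x, u)))"
    using bnd_osc_param_wt[OF M, of N] by blast
  obtain K where "bnd N' (\<lambda>z. K * wt M z) A" using temperedE[OF A] by metis
  from c[OF A this] show "\<exists>C. bnd N (\<lambda>x. C * wt M x) (\<lambda>x. osc (\<lambda>u. A (x, u)))" by blast
qed

lemma iter_deriv_osc_param:
  fixes A :: "'p::euclidean_space \<times> 'a \<Rightarrow> complex"
  assumes A: "tempered M A" and M: "0 \<le> M"
  shows "iter_deriv vs (\<lambda>x. osc (\<lambda>u. A (x, u))) = (\<lambda>x. osc (\<lambda>u. iter_deriv (map (\<lambda>v. (v, 0)) vs) A (x, u)))"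
  by (induction vs) (simp_all add: dir_deriv_osc_param[OF tempered_iter_deriv[OF A] M])

lemma tconv_osc_param:
  fixes A :: "'p::euclidean_space \<times> 'a \<Rightarrow> complex"
  assumes F: "tconv M F A" and M: "0 \<le> M"
  shows "tconv M (\<lambda>k x. osc (\<lambda>u. F k (x, u))) (\<lambda>x. osc (\<lambda>u. A (x, u)))"
proof -
  note tF = tconv_tempered[OF F] and tA = tconv_tempered_limit[OF F]
  have L: "bounded_linear (\<lambda>u::'a. (0::'p, u))" by (intro bounded_linear_intros)
  have it: "tconv M (\<lambda>k. iter_deriv vs (F k)) (iter_deriv vs A)" for vs
    by (induction vs) (auto intro: tconv_dir_deriv F)
  show ?thesis unfolding tconv_def dconv_def
  proof (intro conjI allI)
    show "smooth (\<lambda>x. osc (\<lambda>u. F k (x, u)))" for k by (rule smooth_osc_param[OF tF M])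
    show "smooth (\<lambda>x. osc (\<lambda>u. A (x, u)))" by (rule smooth_osc_param[OF tA M])
    show "(\<lambda>k. iter_deriv vs (\<lambda>x. osc (\<lambda>u. F k (x, u))) z) \<longlonglongrightarrow> iter_deriv vs (\<lambda>x. osc (\<lambda>u. A (x, u))) z" for vs z
      unfolding iter_deriv_osc_param[OF tF M] iter_deriv_osc_param[OF tA M]
      using tconv_affine[OF it L M, of _ "(z, 0)"] by (intro osc_tendsto) simp
    fix N
    obtain N' c where c: "\<And>(A :: 'p \<times> 'a \<Rightarrow> complex) K. tempered M A \<Longrightarrow>
       bnd N' (\<lambda>z. K * wt M z) A \<Longrightarrow> bnd N (\<lambda>x. (c * K) * wt M x) (\<lambda>x. osc (\<lambda>u. A (x, u)))"
      using bnd_osc_param_wt[OF M, of N] by blast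
    obtain K where K: "\<And>k. bnd N' (\<lambda>z. K * wt M z) (F k)" using tconvE[OF F] by metis
    show "\<exists>K. \<forall>k. bnd N (\<lambda>z. K * wt M z) (\<lambda>x. osc (\<lambda>u. F k (x, u)))"
      using c[OF tF K] by blast
  qed
qed

subsection \<open>Superposition\<close>

text \<open>Fubini for an integral that is oscillatory in \<open>u\<close> and absolutely convergent in \<open>\<zeta>\<close>. With a Gaussian
  cutoff in \<open>u\<close> it is the classical theorem; when the cutoff is removed, \<open>osc_bound\<close> gives a
  bound polynomial in \<open>\<zeta>\<close>, which the decay of \<open>\<alpha>\<close> makes integrable.\<close>

lemma osc_superposition:
  fixes A :: "'z::euclidean_space \<times> 'a \<Rightarrow> complex"
  assumes al: "rapid \<alpha>" and Am: "A \<in> borel_measurable borel"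
    and At: "\<And>\<zeta>. tempered M (\<lambda>u. A (\<zeta>, u))"
    and Ab: "\<And>N. \<exists>C L. \<forall>\<zeta>. bnd N (\<lambda>u. (C * wt L \<zeta>) * wt M u) (\<lambda>u. A (\<zeta>, u))"
    and a: "tempered M a" "\<And>u. a u = (LINT \<zeta>|lborel. \<alpha> \<zeta> * A (\<zeta>, u))"
  shows "osc a = (LINT \<zeta>|lborel. \<alpha> \<zeta> * osc (\<lambda>u. A (\<zeta>, u)))"
proof -
  let ?g = "\<lambda>k u::'a. gauss ((1 / real (Suc k)) *\<^sub>R u)"
  have alm: "\<alpha> \<in> borel_measurable borel" using al by (simp add: rapid_def)
  have gm: "(\<lambda>u. ?g k u) \<in> borel_measurable borel" for k
    using schwartz_measurable[OF gauss_schwartz] by measurable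
  have gs: "?g k \<in> schwartz" for k
    using gauss_cutoff_schwartz[OF tempered_const, of k 1] by simp
  have gt: "tconv 0 ?g (\<lambda>u. 1)"
    by (rule tconv_cutoff[OF gauss_schwartz gauss_0 inverse_Suc_tendsto])
  obtain n c where c: "0 \<le> c" "\<And>a K. tempered M a \<Longrightarrow> bnd n (\<lambda>u. K * wt M u) a \<Longrightarrow> cmod (osc a) \<le> c * K"
    using osc_bound[of M] by metis
  obtain C0 L0 where A0: "\<And>\<zeta>. bnd 0 (\<lambda>u. (C0 * wt L0 \<zeta>) * wt M u) (\<lambda>u. A (\<zeta>, u))" using Ab by metis
  obtain Cn Ln where An: "\<And>\<zeta>. bnd n (\<lambda>u. (Cn * wt Ln \<zeta>) * wt M u) (\<lambda>u. A (\<zeta>, u))" using Ab by metis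
  obtain Kg where Kg: "0 \<le> Kg" "\<And>k. bnd n (\<lambda>u. Kg * wt 0 u) (?g k)" using tconvE[OF gt] by metis
  have tl: "tconv M (\<lambda>k u. ?g k u * A (\<zeta>, u)) (\<lambda>u. A (\<zeta>, u))" for \<zeta> by (rule gauss_cutoff[OF At])
  have sch: "(\<lambda>u. ?g k u * A (\<zeta>, u)) \<in> schwartz" for k \<zeta> by (rule gauss_cutoff_schwartz[OF At])
  have swap: "osc (\<lambda>u. ?g k u * a u) = (LINT \<zeta>|lborel. \<alpha> \<zeta> * osc (\<lambda>u. ?g k u * A (\<zeta>, u)))" for k
  proof -
    let ?F = "\<lambda>u \<zeta>. phase u * (?g k u * (\<alpha> \<zeta> * A (\<zeta>, u)))"
    let ?r = "- 2 * real (DIM('a) + DIM('z))"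
    have "integrable (lborel \<Otimes>\<^sub>M lborel) (\<lambda>(u, \<zeta>). ?F u \<zeta>)"
    proof -
      obtain C1 where C1: "0 \<le> C1" "\<And>u. cmod (?g k u) \<le> C1 * wt (?r - M) u"
        using tempered_value[OF schwartz_tempered[OF gs]] by metis
      obtain C2 where C2: "0 \<le> C2" "\<And>\<zeta>. cmod (\<alpha> \<zeta>) \<le> C2 * wt (?r - L0) \<zeta>"
        using al unfolding rapid_def by metis
      show ?thesis
      proof (rule integrable_product_decay)
        have "(\<lambda>p. A (snd p, fst p)) \<in> borel_measurable (borel \<Otimes>\<^sub>M borel)"
          using Am unfolding borel_prod[symmetric] by measurable
        then show "(\<lambda>(u, \<zeta>). ?F u \<zeta>) \<in> borel_measurable borel"
          using alm gm phase_measurable unfolding borel_prod[symmetric] split_beta by measurable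
        fix u \<zeta>
        have "cmod (?F u \<zeta>) = cmod (?g k u) * (cmod (\<alpha> \<zeta>) * cmod (A (\<zeta>, u)))" by (simp add: norm_mult)
        also have "\<dots> \<le> (C1 * wt (?r - M) u) * ((C2 * wt (?r - L0) \<zeta>) * ((C0 * wt L0 \<zeta>) * wt M u))"
          by (intro mult_mono C1 C2 bnd_value[OF A0]) (use C1 C2 in auto)
        also have "\<dots> = (C1 * C2 * C0) * ((wt (?r - M) u * wt M u) * (wt (?r - L0) \<zeta> * wt L0 \<zeta>))"
          by (simp only: mult_ac)
        also have "\<dots> = (C1 * C2 * C0) * (wt ?r u * wt ?r \<zeta>)" unfolding wt_add[symmetric] by simp
        finally show "cmod (case (u, \<zeta>) of (u, \<zeta>) \<Rightarrow> ?F u \<zeta>) \<le> (C1 * C2 * C0) * (wt ?r u * wt ?r \<zeta>)" by simp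
      qed
    qed
    from lborel_pair.Fubini_integral[OF this]
    have fub: "(LINT \<zeta>|lborel. (LINT u|lborel. ?F u \<zeta>)) = (LINT u|lborel. (LINT \<zeta>|lborel. ?F u \<zeta>))" by simp
    have "osc (\<lambda>u. ?g k u * a u) = (LINT u|lborel. phase u * (?g k u * a u))"
      by (rule osc_schwartz[OF gauss_cutoff_schwartz[OF a(1)]])
    also have "\<dots> = (LINT u|lborel. (LINT \<zeta>|lborel. ?F u \<zeta>))" unfolding a(2) by simp
    also have "\<dots> = (LINT \<zeta>|lborel. \<alpha> \<zeta> * (LINT u|lborel. phase u * (?g k u * A (\<zeta>, u))))"
      unfolding fub[symmetric] by (simp add: mult.left_commute[of _ "\<alpha> _"])
    also have "\<dots> = (LINT \<zeta>|lborel. \<alpha> \<zeta> * osc (\<lambda>u. ?g k u * A (\<zeta>, u)))" by (simp only: osc_schwartz[OF sch])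
    finally show ?thesis .
  qed
  obtain C2 where C2: "0 \<le> C2" "\<And>\<zeta>. cmod (\<alpha> \<zeta>) \<le> C2 * wt (- 2 * real DIM('z) - Ln) \<zeta>"
    using al unfolding rapid_def by metis
  define K where "K = C2 * (c * (2^n * Kg * Cn))"
  have "(\<lambda>k. LINT \<zeta>|lborel. \<alpha> \<zeta> * osc (\<lambda>u. ?g k u * A (\<zeta>, u))) \<longlonglongrightarrow> (LINT \<zeta>|lborel. \<alpha> \<zeta> * osc (\<lambda>u. A (\<zeta>, u)))"
  proof (rule integral_dominated_convergence)
    show "integrable lborel (\<lambda>\<zeta>::'z. K * wt (- 2 * real DIM('z)) \<zeta>)"
      by (intro integrable_mult_right integrable_wt) simp
    have m: "(\<lambda>\<zeta>. osc (\<lambda>u. ?g k u * A (\<zeta>, u))) \<in> borel_measurable borel" for k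
    proof -
      have "(\<lambda>p. phase (snd p) * (?g k (snd p) * A p)) \<in> borel_measurable (borel \<Otimes>\<^sub>M lborel)"
        using Am gm phase_measurable unfolding borel_prod[symmetric] by measurable
      then show ?thesis unfolding osc_schwartz[OF sch]
        by (intro lborel.borel_measurable_lebesgue_integral) (simp only: case_prod_beta' prod.collapse)
    qed
    then show "(\<lambda>\<zeta>. \<alpha> \<zeta> * osc (\<lambda>u. ?g k u * A (\<zeta>, u))) \<in> borel_measurable lborel" for k
      using alm by simp
    have "(\<lambda>\<zeta>. osc (\<lambda>u. A (\<zeta>, u))) \<in> borel_measurable borel"
      by (rule borel_measurable_LIMSEQ_metric[OF m osc_tendsto[OF tl]])
    then show "(\<lambda>\<zeta>. \<alpha> \<zeta> * osc (\<lambda>u. A (\<zeta>, u))) \<in> borel_measurable lborel" using alm by simp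
    show "AE \<zeta> in lborel. (\<lambda>k. \<alpha> \<zeta> * osc (\<lambda>u. ?g k u * A (\<zeta>, u))) \<longlonglongrightarrow> \<alpha> \<zeta> * osc (\<lambda>u. A (\<zeta>, u))"
      by (intro AE_I2 tendsto_mult tendsto_const osc_tendsto[OF tl])
    show "AE \<zeta> in lborel. norm (\<alpha> \<zeta> * osc (\<lambda>u. ?g k u * A (\<zeta>, u))) \<le> K * wt (- 2 * real DIM('z)) \<zeta>" for k
    proof (rule AE_I2)
      fix \<zeta>
      have "bnd n (\<lambda>u. (2^n * Kg * (Cn * wt Ln \<zeta>)) * wt M u) (\<lambda>u. ?g k u * A (\<zeta>, u))"
        using bnd_wt_mult[OF Kg(2) An] by simp
      from c(2)[OF tconv_tempered[OF tl] this]
      have "cmod (osc (\<lambda>u. ?g k u * A (\<zeta>, u))) \<le> c * (2^n * Kg * (Cn * wt Ln \<zeta>))" .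
      then have "norm (\<alpha> \<zeta> * osc (\<lambda>u. ?g k u * A (\<zeta>, u)))
          \<le> (C2 * wt (- 2 * real DIM('z) - Ln) \<zeta>) * (c * (2^n * Kg * (Cn * wt Ln \<zeta>)))"
        unfolding norm_mult by (intro mult_mono C2) (use C2 in auto)
      also have "\<dots> = K * (wt (- 2 * real DIM('z) - Ln) \<zeta> * wt Ln \<zeta>)" by (simp only: K_def mult_ac)
      finally show "norm (\<alpha> \<zeta> * osc (\<lambda>u. ?g k u * A (\<zeta>, u))) \<le> K * wt (- 2 * real DIM('z)) \<zeta>"
        unfolding wt_add[symmetric] by simp
    qed
  qed
  moreover have "(\<lambda>k. osc (\<lambda>u. ?g k u * a u)) \<longlonglongrightarrow> osc a" by (rule osc_tendsto[OF gauss_cutoff[OF a(1)]])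
  ultimately show ?thesis unfolding swap by (rule LIMSEQ_unique[rotated])
qed

subsection \<open>Oscillatory integrals of exponentials\<close>

text \<open>Completing the square: adding \<open>\<zeta> \<bullet> u\<close> to the phase moves its centre to \<open>- J \<zeta>\<close> and adds the constant
  \<open>- (J \<zeta> \<bullet> \<zeta>) / 2\<close>.\<close>

lemma osc_exponential: "osc (exponential \<zeta>) = cis (- (J \<zeta> \<bullet> \<zeta>) / 2) * osc (\<lambda>u. 1)"
proof -
  have eq: "phase u * exponential \<zeta> u = cis (- (J \<zeta> \<bullet> \<zeta>) / 2) * (phase (u - (- J \<zeta>)) * 1)" for u
  proof -
    have B: "B (u + J \<zeta>) = B u + \<zeta>" using linear_B B_J by (simp add: linear_add)
    have "J \<zeta> \<bullet> B u = \<zeta> \<bullet> u" using sym_B[of "J \<zeta>" u] by (simp add: B_J)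
    then have "(u \<bullet> B u) / 2 + \<zeta> \<bullet> u = - (J \<zeta> \<bullet> \<zeta>) / 2 + ((u + J \<zeta>) \<bullet> B (u + J \<zeta>)) / 2"
      unfolding B by (simp add: inner_add_left inner_add_right inner_commute field_simps)
    then show ?thesis by (simp add: phase_def exponential_def cis_mult)
  qed
  have h: "has_osc_integral (\<lambda>u. phase (u - (- J \<zeta>)) * 1) (osc (\<lambda>u. 1))"
    using has_osc_integral_osc[OF tempered_const, of "- J \<zeta>" 1] by simp
  have "has_osc_integral (\<lambda>u. phase u * exponential \<zeta> u) (cis (- (J \<zeta> \<bullet> \<zeta>) / 2) * osc (\<lambda>u. 1))"
    unfolding has_osc_integral_def eq
  proof (intro ballI impI conjI allI)
    fix \<psi> :: "'a \<Rightarrow> complex" assume psi: "\<psi> \<in> schwartz" "\<psi> 0 = 1"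
    have i: "integrable lborel (\<lambda>z. \<psi> (e *\<^sub>R z) * (phase (z - (- J \<zeta>)) * 1))" if "0 < e" for e
      using h psi that unfolding has_osc_integral_def by blast
    have lim: "((\<lambda>e. LINT z|lborel. \<psi> (e *\<^sub>R z) * (phase (z - (- J \<zeta>)) * 1)) \<longlongrightarrow> osc (\<lambda>u. 1)) (at_right 0)"
      using h psi unfolding has_osc_integral_def by blast
    show "integrable lborel (\<lambda>z. \<psi> (e *\<^sub>R z) * (cis (- (J \<zeta> \<bullet> \<zeta>) / 2) * (phase (z - (- J \<zeta>)) * 1)))" if "0 < e" for e
      using integrable_mult_right[OF i[OF that], of "cis (- (J \<zeta> \<bullet> \<zeta>) / 2)"] by (simp add: mult_ac)
    show "((\<lambda>e. LINT z|lborel. \<psi> (e *\<^sub>R z) * (cis (- (J \<zeta> \<bullet> \<zeta>) / 2) * (phase (z - (- J \<zeta>)) * 1)))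
      \<longlongrightarrow> cis (- (J \<zeta> \<bullet> \<zeta>) / 2) * osc (\<lambda>u. 1)) (at_right 0)"
      unfolding mult.left_commute[of _ "cis (- (J \<zeta> \<bullet> \<zeta>) / 2)"] integral_mult_right_zero
      by (rule tendsto_mult_left[OF lim])
  qed
  then show ?thesis unfolding osc_def by (rule has_osc_integral_unique)
qed

lemma exponential_measurable:
  "(\<lambda>p. exponential (fst p) (snd p)) \<in> borel_measurable (borel :: ('a::euclidean_space \<times> 'a) measure)"
  unfolding exponential_def by (intro borel_measurable_continuous_onI continuous_intros)

lemma osc_exponential_superposition:
  assumes al: "rapid \<alpha>" and a: "tempered 0 a" "\<And>u. a u = (LINT \<zeta>|lborel. \<alpha> \<zeta> * exponential \<zeta> u)"
  shows "osc a = (LINT \<zeta>|lborel. \<alpha> \<zeta> * cis (- (J \<zeta> \<bullet> \<zeta>) / 2)) * osc (\<lambda>u. 1)"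
proof -
  have "osc a = (LINT \<zeta>|lborel. \<alpha> \<zeta> * osc (\<lambda>u. (\<lambda>p. exponential (fst p) (snd p)) (\<zeta>, u)))"
  proof (rule osc_superposition[OF al exponential_measurable _ _ a(1)])
    show "tempered 0 (\<lambda>u. exponential (fst (\<zeta>, u)) (snd (\<zeta>, u)))" for \<zeta> using tempered_exponential by simp
    fix N show "\<exists>C L. \<forall>\<zeta>. bnd N (\<lambda>u. (C * wt L \<zeta>) * wt 0 u) (\<lambda>u. exponential (fst (\<zeta>, u)) (snd (\<zeta>, u)))"
      by (rule exI[of _ 1], rule exI[of _ "real N"]) (simp add: bnd_exponential)
  qed (simp add: a(2))
  then show ?thesis by (simp add: osc_exponential mult.assoc[symmetric])
qed

text \<open>The Fresnel constant is nonzero without being computed: if it vanished, then by superposition so would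
  the oscillatory integral of every Schwartz function. But the conjugate chirp times a
  Gaussian has as its integral that of the Gaussian.\<close>

lemma osc_one_nonzero: "osc (\<lambda>u. 1) \<noteq> 0"
proof
  assume z: "osc (\<lambda>u. 1) = 0"
  interpret neg: chirp "\<lambda>v. - B v" "\<lambda>v. - J v"
    using linear_compose_neg[OF linear_B] linear_neg[OF linear_B] sym_B B_J by (intro chirp.intro) auto
  have "neg.phase u * phase u = 1" for u
    by (simp add: neg.phase_def phase_def cis_mult)
  have F: "(\<lambda>u. neg.phase u * gauss u) \<in> schwartz" by (rule neg.schwartz_phase_mult[OF gauss_schwartz])
  from osc_exponential_superposition[OF schwartz_rapid[OF fcoeff_schwartz[OF F]] schwartz_tempered[OF F] fcoeff_representation[OF F]]
  have "osc (\<lambda>u. neg.phase u * gauss u) = 0" using z by simp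
  then have "(LINT u|lborel. phase u * (neg.phase u * gauss u)) = 0" unfolding osc_schwartz[OF F] .
  moreover have "phase u * (neg.phase u * gauss u) = gauss u" for u
    by (simp add: neg.phase_def phase_def cis_mult mult.assoc[symmetric])
  ultimately show False using gauss_integral[where 'a='a] gauss_mass_pos[where 'a='a] by simp
qed

end


section \<open>Shubin symbols through iterated directional derivatives\<close>

text \<open>The directions of an iterated partial derivative as a list. Lists of basis vectors, up to
  permutation, are the same as pairs of multi-indices, and induction on lists replaces
  induction on multi-indices.\<close>

definition dirs :: "nat^'d \<Rightarrow> nat^'d \<Rightarrow> 'd::finite phase list" where
  "dirs \<alpha> \<beta> = concat (map (\<lambda>i. replicate (\<alpha> $ i) (axis i 1, 0)) coords) @
        concat (map (\<lambda>i. replicate (\<beta> $ i) (0, axis i 1)) coords)"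

text \<open>The order that a symbol loses under one derivative: 1 in the directions of \<open>x\<close> and \<open>s\<close> in those of
  \<open>\<xi>\<close>.\<close>

definition dir_order :: "real \<Rightarrow> 'd::finite phase \<Rightarrow> real" where
  "dir_order s v = (if snd v = 0 then 1 else s)"

definition list_order :: "real \<Rightarrow> 'd::finite phase list \<Rightarrow> real" where
  "list_order s vs = sum_list (map (dir_order s) vs)"

lemma list_order_simps [simp]: "list_order s [] = 0" "list_order s (v # vs) = dir_order s v + list_order s vs"
  "list_order s (us @ vs) = list_order s us + list_order s vs"
  by (simp_all add: list_order_def)

lemma list_order_nonneg: "0 < s \<Longrightarrow> 0 \<le> list_order s vs"
  by (induction vs) (auto simp: dir_order_def)

lemma partial_dirs: "partial \<alpha> \<beta> a = iter_deriv (dirs \<alpha> \<beta>) a"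
  by (simp add: partial_def dirs_def)

lemma coords_enum: "distinct (coords :: 'd::finite list)" "set (coords :: 'd::finite list) = UNIV"
proof -
  have "\<exists>is :: 'd list. distinct is \<and> set is = UNIV" using finite_distinct_list[of "UNIV :: 'd set"] by auto
  from someI_ex[OF this] show "distinct (coords :: 'd list)" "set (coords :: 'd list) = UNIV"
    by (auto simp: coords_def)
qed

lemma sum_list_coords: "sum_list (map f coords) = (\<Sum>i\<in>(UNIV :: 'd::finite set). f i)"
  using sum.distinct_set_conv_list[OF coords_enum(1), of f] by (simp add: coords_enum(2))

lemma mset_concat_coords: "mset (concat (map f coords)) = (\<Sum>i\<in>(UNIV :: 'd::finite set). mset (f i))"
  unfolding mset_concat sum_list_coords[symmetric] by (simp add: o_def)

lemma mset_dirs: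
  "mset (dirs \<alpha> \<beta>) = (\<Sum>i\<in>UNIV. replicate_mset (\<alpha> $ i) (axis i 1, 0)) + (\<Sum>i\<in>UNIV. replicate_mset (\<beta> $ i) (0, axis i 1))"
  by (simp add: dirs_def mset_concat_coords)

lemma length_dirs: "length (dirs \<alpha> \<beta>) = mi_length \<alpha> + mi_length \<beta>"
  by (simp add: dirs_def length_concat o_def sum_list_coords mi_length_def)

lemma list_order_dirs: "list_order s (dirs \<alpha> \<beta>) = real (mi_length \<alpha>) + s * real (mi_length \<beta>)"
proof -
  have *: "list_order s (concat (map (\<lambda>i. replicate (n i) (x i)) cs)) = sum_list (map (\<lambda>i. real (n i) * dir_order s (x i)) cs)"
    for n :: "'a \<Rightarrow> nat" and x cs
  proof -
    have rep: "list_order s (replicate k y) = real k * dir_order s y" for k y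
      by (induction k) (simp_all add: algebra_simps)
    show ?thesis by (induction cs) (simp_all add: rep)
  qed
  have "axis i 1 \<noteq> (0::real^'a)" for i by (simp add: axis_eq_0_iff)
  then show ?thesis
    by (simp add: dirs_def * sum_list_coords dir_order_def mi_length_def sum_distrib_left mult.commute)
qed

lemma Basis_phase:
  assumes "v \<in> (Basis :: 'd::finite phase set)"
  obtains j where "v = (axis j 1, 0)" | j where "v = (0, axis j 1)"
  using assms by (auto simp: Basis_prod_def Basis_vec_def)

lemma dirs_in_Basis: "dirs \<alpha> \<beta> \<in> lists Basis"
proof -
  have "(axis i 1, 0) \<in> (Basis :: 'a phase set)" "(0, axis i 1) \<in> (Basis :: 'a phase set)" for i
    unfolding Basis_prod_def Basis_vec_def by auto
  then show ?thesis by (auto simp: dirs_def)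
qed

lemma ex_dirs:
  assumes "vs \<in> lists Basis" shows "\<exists>\<alpha> \<beta>. mset (dirs \<alpha> \<beta>) = mset vs"
  using assms
proof (induction vs)
  case Nil
  have "mset (dirs (0 :: nat^'a) 0) = {#}" by (simp add: mset_dirs)
  then show ?case by (intro exI[of _ 0]) simp
next
  case (Cons v vs)
  then obtain \<alpha> \<beta> where ab: "mset (dirs \<alpha> \<beta>) = mset vs" by auto
  have split: "(\<Sum>i\<in>UNIV. replicate_mset ((\<gamma> + axis j 1) $ i) (x i)) = (\<Sum>i\<in>UNIV. replicate_mset (\<gamma> $ i) (x i)) + {#x j#}"
    for \<gamma> :: "nat^'a" and j and x :: "'a \<Rightarrow> 'a phase"
  proof -
    have "replicate_mset ((\<gamma> + axis j 1) $ i) (x i) = replicate_mset (\<gamma> $ i) (x i) + (if i = j then {#x j#} else {#})" for i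
      by (auto simp: axis_def)
    then show ?thesis by (simp add: sum.distrib)
  qed
  from Cons.hyps show ?case
  proof (cases rule: Basis_phase)
    case (1 j)
    then have "mset (dirs (\<alpha> + axis j 1) \<beta>) = mset (v # vs)"
      unfolding mset_dirs split using ab by (simp add: mset_dirs)
    then show ?thesis by blast
  next
    case (2 j)
    then have "mset (dirs \<alpha> (\<beta> + axis j 1)) = mset (v # vs)"
      unfolding mset_dirs split using ab by (simp add: mset_dirs)
    then show ?thesis by blast
  qed
qed

text \<open>Counting the basis vectors in the list gives the multi-indices; the order of the list is immaterial
  because derivatives commute.\<close>

lemma iter_deriv_as_partial:
  assumes "vs \<in> lists Basis"
  shows "\<exists>\<alpha> \<beta>. (\<forall>a. smooth a \<longrightarrow> iter_deriv vs a = partial \<alpha> \<beta> a) \<and>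
    (\<forall>s. list_order s vs = real (mi_length \<alpha>) + s * real (mi_length \<beta>)) \<and> length vs = mi_length \<alpha> + mi_length \<beta>"
proof -
  obtain \<alpha> \<beta> where ab: "mset (dirs \<alpha> \<beta>) = mset vs" using ex_dirs[OF assms] by blast
  have "list_order s vs = list_order s (dirs \<alpha> \<beta>)" for s
    unfolding list_order_def sum_mset_sum_list[symmetric] mset_map ab ..
  moreover have "length vs = length (dirs \<alpha> \<beta>)" using ab by (metis size_mset)
  moreover have "smooth a \<Longrightarrow> iter_deriv vs a = partial \<alpha> \<beta> a" for a
    using iter_deriv_mset_eq[of a vs "dirs \<alpha> \<beta>"] ab by (simp add: partial_dirs)
  ultimately show ?thesis
    by (intro exI[of _ \<alpha>] exI[of _ \<beta>]) (simp add: list_order_dirs length_dirs)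
qed

subsection \<open>The weight\<close>

lemma mu_ge_1: "1 \<le> mu s z"
  by (cases z) (simp add: mu_def)

lemma mu_pos [simp]: "0 < mu s z"
  using mu_ge_1[of s z] by linarith

lemma mu_nonneg [simp]: "0 \<le> mu s z" and mu_nonzero [simp]: "mu s z \<noteq> 0"
  using mu_pos[of s z] by linarith+

lemma mu_0: "mu s 0 = 1"
  by (simp add: mu_def zero_prod_def)

lemma mu_powr_mono: "m \<le> m' \<Longrightarrow> mu s z powr m \<le> mu s z powr m'"
  by (rule powr_mono[OF _ mu_ge_1])

text \<open>For \<open>w = (y, \<eta>)\<close>, the power of \<open>1 + |w|\<close> with this exponent dominates \<open>|y|\<close> as well as
  \<open>|\<eta>|\<^sup>p\<close> with \<open>p = 1/s\<close>.\<close>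

definition mu_exp :: "real \<Rightarrow> real" where "mu_exp s = max 1 (1 / s)"

text \<open>The constant stems from \<open>|\<xi> + \<eta>|\<^sup>p \<le> 2\<^sup>p (|\<xi>|\<^sup>p + |\<eta>|\<^sup>p)\<close> with \<open>p = 1/s\<close>, and from bounding a
  sum of three terms by three times the product of the weights.\<close>

lemma mu_translate:
  assumes s: "0 < s"
  shows "mu s (z + w) \<le> (3 * 2 powr (1 / s)) * (mu s z * wt (mu_exp s) w)"
proof -
  obtain x \<xi> y \<eta> where zw: "z = (x, \<xi>)" "w = (y, \<eta>)" by (cases z, cases w) auto
  define p where "p = 1 / s"
  have p: "0 < p" using s by (simp add: p_def)
  have two: "1 \<le> 2 powr p" using p by (simp add: ge_one_powr_ge_zero)
  have "norm (\<xi> + \<eta>) powr p \<le> (2 * max (norm \<xi>) (norm \<eta>)) powr p"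
    using norm_triangle_ineq[of \<xi> \<eta>] p by (intro powr_mono2) auto
  also have "\<dots> = 2 powr p * (max (norm \<xi>) (norm \<eta>) powr p)" by (simp add: powr_mult)
  also have "\<dots> \<le> 2 powr p * (norm \<xi> powr p + norm \<eta> powr p)"
    by (intro mult_left_mono) (auto simp: max_def)
  finally have 1: "norm (\<xi> + \<eta>) powr p \<le> 2 powr p * (norm \<xi> powr p + norm \<eta> powr p)" .
  have yw: "norm y \<le> norm w" "norm \<eta> \<le> norm w" unfolding zw norm_Pair by (auto intro: real_le_rsqrt)
  have "norm y \<le> wt 1 w" using yw by (simp add: wt_1)
  also have "\<dots> \<le> wt (mu_exp s) w" by (rule wt_mono) (simp add: mu_exp_def)
  finally have 2: "norm y \<le> wt (mu_exp s) w" .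
  have "norm \<eta> powr p \<le> wt p w" unfolding wt_def using yw p by (intro powr_mono2) auto
  also have "\<dots> \<le> wt (mu_exp s) w" by (rule wt_mono) (simp add: mu_exp_def p_def)
  finally have 3: "norm \<eta> powr p \<le> wt (mu_exp s) w" .
  have 4: "norm (x + y) \<le> 2 powr p * (norm x + norm y)"
    using norm_triangle_ineq[of x y] mult_right_mono[OF two, of "norm x + norm y"] by simp
  have 5: "1 \<le> wt (mu_exp s) w" by (rule wt_ge_1) (simp add: mu_exp_def)
  have "mu s (z + w) \<le> 2 powr p * 1 + 2 powr p * (norm x + norm y) + 2 powr p * (norm \<xi> powr p + norm \<eta> powr p)"
    using 1 4 two by (simp add: mu_def zw p_def)
  also have "\<dots> = 2 powr p * (mu s z + (norm y + norm \<eta> powr p))"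
    by (simp add: mu_def zw p_def algebra_simps)
  also have "\<dots> \<le> 2 powr p * (3 * (mu s z * wt (mu_exp s) w))"
  proof (rule mult_left_mono)
    have "mu s z * 1 \<le> mu s z * wt (mu_exp s) w" using 5 mu_pos[of s z] by (intro mult_left_mono) auto
    moreover have "1 * wt (mu_exp s) w \<le> mu s z * wt (mu_exp s) w" using mu_ge_1[of s z] by (intro mult_right_mono) auto
    ultimately show "mu s z + (norm y + norm \<eta> powr p) \<le> 3 * (mu s z * wt (mu_exp s) w)"
      using 2 3 by linarith
  qed simp
  finally show ?thesis by (simp add: p_def mult_ac)
qed

text \<open>Moderateness of the weight: shifts are absorbed by a power of the isotropic weight of the shift.\<close>

lemma mu_peetre:
  assumes s: "0 < s"
  shows "mu s (z + w) powr r \<le> (3 * 2 powr (1 / s)) powr \<bar>r\<bar> * (mu s z powr r * wt (mu_exp s * \<bar>r\<bar>) w)"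
proof -
  let ?C = "3 * 2 powr (1 / s)"
  have C: "0 < ?C" by simp
  have wp: "wt (mu_exp s) w powr q = wt (mu_exp s * q) w" for q by (simp add: wt_def powr_powr)
  show ?thesis
  proof (cases "0 \<le> r")
    case True
    have "mu s (z + w) powr r \<le> (?C * (mu s z * wt (mu_exp s) w)) powr r"
      using mu_translate[OF s, of z w] True mu_pos[of s "z + w"] by (intro powr_mono2) (auto intro: less_imp_le)
    also have "\<dots> = ?C powr r * (mu s z powr r * wt (mu_exp s) w powr r)"
      using mu_pos[of s z] by (subst powr_mult | simp add: less_imp_le)+
    finally show ?thesis using True by (simp add: wp)
  next
    case False
    have "mu s z \<le> ?C * (mu s (z + w) * wt (mu_exp s) w)"
      using mu_translate[OF s, of "z + w" "- w"] by (simp add: wt_def)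
    then have "mu s z powr (-r) \<le> (?C * (mu s (z + w) * wt (mu_exp s) w)) powr (-r)"
      using False mu_pos[of s z] by (intro powr_mono2) (auto intro: less_imp_le)
    also have "\<dots> = ?C powr (-r) * (mu s (z + w) powr (-r) * wt (mu_exp s) w powr (-r))"
      using mu_pos[of s "z + w"] by (subst powr_mult | simp add: less_imp_le)+
    finally have le: "mu s z powr (-r) \<le> ?C powr \<bar>r\<bar> * (mu s (z + w) powr (-r) * wt (mu_exp s * \<bar>r\<bar>) w)"
      using False by (simp add: wp)
    have inv: "mu s x powr r * mu s x powr (-r) = 1" for x
      using mu_pos[of s x] by (simp add: powr_add[symmetric])
    have "mu s (z + w) powr r = mu s (z + w) powr r * mu s z powr r * mu s z powr (-r)"
      using inv[of z] by (simp add: mult.assoc)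
    also have "\<dots> \<le> mu s (z + w) powr r * mu s z powr r * (?C powr \<bar>r\<bar> * (mu s (z + w) powr (-r) * wt (mu_exp s * \<bar>r\<bar>) w))"
      by (intro mult_left_mono le) auto
    also have "\<dots> = (mu s (z + w) powr r * mu s (z + w) powr (-r)) * (?C powr \<bar>r\<bar> * (mu s z powr r * wt (mu_exp s * \<bar>r\<bar>) w))"
      by (simp only: mult_ac)
    finally show ?thesis unfolding inv by simp
  qed
qed

lemma mu_powr_le_wt:
  assumes s: "0 < s"
  shows "mu s z powr r \<le> (3 * 2 powr (1 / s)) powr \<bar>r\<bar> * wt (mu_exp s * \<bar>r\<bar>) z"
  using mu_peetre[OF s, of 0 z r] by (simp add: mu_0)

subsection \<open>Seminorms\<close>

lemma shubin_iff:
  "a \<in> shubin m s \<longleftrightarrow> smooth a \<and>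
    (\<forall>vs\<in>lists Basis. \<exists>C. \<forall>z. cmod (iter_deriv vs a z) \<le> C * mu s z powr (m - list_order s vs))"
proof
  assume a: "a \<in> shubin m s"
  then have sm: "smooth a" by (simp add: shubin_def)
  moreover have "\<exists>C. \<forall>z. cmod (iter_deriv vs a z) \<le> C * mu s z powr (m - list_order s vs)"
    if vs: "vs \<in> lists Basis" for vs
  proof -
    obtain \<alpha> \<beta> where p: "iter_deriv vs a = partial \<alpha> \<beta> a"
      "list_order s vs = real (mi_length \<alpha>) + s * real (mi_length \<beta>)"
      using iter_deriv_as_partial[OF vs] sm by blast
    have "\<exists>C>0. \<forall>z. cmod (partial \<alpha> \<beta> a z) \<le> C * mu s z powr (m - real (mi_length \<alpha>) - s * real (mi_length \<beta>))"
      using a unfolding shubin_def by blast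
    then show ?thesis unfolding p diff_diff_eq by blast
  qed
  ultimately show "smooth a \<and> (\<forall>vs\<in>lists Basis. \<exists>C. \<forall>z. cmod (iter_deriv vs a z) \<le> C * mu s z powr (m - list_order s vs))" by blast
next
  assume a: "smooth a \<and> (\<forall>vs\<in>lists Basis. \<exists>C. \<forall>z. cmod (iter_deriv vs a z) \<le> C * mu s z powr (m - list_order s vs))"
  have "\<exists>C>0. \<forall>z. cmod (partial \<alpha> \<beta> a z) \<le> C * mu s z powr (m - real (mi_length \<alpha>) - s * real (mi_length \<beta>))" for \<alpha> \<beta>
  proof -
    obtain C where C: "\<And>z. cmod (partial \<alpha> \<beta> a z) \<le> C * mu s z powr (m - real (mi_length \<alpha>) - s * real (mi_length \<beta>))"
      using a dirs_in_Basis[of \<alpha> \<beta>] unfolding partial_dirs diff_diff_eq list_order_dirs[symmetric] by blast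
    show ?thesis
    proof (intro exI[of _ "\<bar>C\<bar> + 1"] conjI allI)
      fix z
      show "cmod (partial \<alpha> \<beta> a z) \<le> (\<bar>C\<bar> + 1) * mu s z powr (m - real (mi_length \<alpha>) - s * real (mi_length \<beta>))"
        by (rule order_trans[OF C]) (intro mult_right_mono, auto)
    qed simp
  qed
  then show "a \<in> shubin m s" using a by (simp add: shubin_def)
qed

lemma shubin_smooth: "a \<in> shubin m s \<Longrightarrow> smooth a"
  by (simp add: shubin_def)

lemma finite_multiindices: "finite {(\<alpha> :: nat^'d::finite, \<beta> :: nat^'d). mi_length (\<alpha> + \<beta>) \<le> j}"
proof -
  have "finite {\<alpha> :: nat^'d. \<forall>i. \<alpha> $ i \<le> j}"
  proof (rule inj_on_finite[of vec_nth])
    show "inj_on vec_nth {\<alpha> :: nat^'d. \<forall>i. \<alpha> $ i \<le> j}" by (auto simp: inj_on_def vec_eq_iff)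
    show "vec_nth ` {\<alpha> :: nat^'d. \<forall>i. \<alpha> $ i \<le> j} \<subseteq> PiE UNIV (\<lambda>_. {..j})" by auto
    show "finite (PiE (UNIV :: 'd set) (\<lambda>_. {..j}))" by (intro finite_PiE) auto
  qed
  then have "finite ({\<alpha> :: nat^'d. \<forall>i. \<alpha> $ i \<le> j} \<times> {\<alpha> :: nat^'d. \<forall>i. \<alpha> $ i \<le> j})" by simp
  moreover have "{(\<alpha> :: nat^'d, \<beta> :: nat^'d). mi_length (\<alpha> + \<beta>) \<le> j} \<subseteq> {\<alpha>. \<forall>i. \<alpha> $ i \<le> j} \<times> {\<alpha>. \<forall>i. \<alpha> $ i \<le> j}"
  proof -
    have "\<alpha> $ i \<le> j \<and> \<beta> $ i \<le> j" if "mi_length (\<alpha> + \<beta>) \<le> j" for \<alpha> \<beta> :: "nat^'d" and i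
    proof -
      have "(\<alpha> + \<beta>) $ i \<le> mi_length (\<alpha> + \<beta>)" unfolding mi_length_def by (rule member_le_sum) auto
      then show ?thesis using that by simp
    qed
    then show ?thesis by auto
  qed
  ultimately show ?thesis by (rule rev_finite_subset)
qed

lemma mi_length_add: "mi_length (\<alpha> + \<beta>) = mi_length \<alpha> + mi_length \<beta>"
  by (simp add: mi_length_def sum.distrib)

lemma weighted_le_iff: "mu s z powr (- q) * x \<le> K \<longleftrightarrow> x \<le> K * mu s z powr q"
proof -
  have "mu s z powr (-q) = inverse (mu s z powr q)" by (simp add: powr_minus)
  moreover have "0 < mu s z powr q" using mu_pos[of s z] by simp
  ultimately show ?thesis by (simp add: divide_inverse[symmetric] pos_divide_le_eq mult.commute)
qed

text \<open>This lemma and \<open>shubin_seminorm_least\<close> are the two halves of the statement that the seminorm is the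
  best constant in the symbol estimates up to order \<open>j\<close>.\<close>

lemma shubin_seminorm_upper:
  assumes a: "a \<in> shubin m s" and vs: "vs \<in> lists Basis" "length vs \<le> j"
  shows "cmod (iter_deriv vs a z) \<le> shubin_seminorm m s j a * mu s z powr (m - list_order s vs)"
proof -
  obtain \<alpha> \<beta> where p: "iter_deriv vs a = partial \<alpha> \<beta> a"
    "list_order s vs = real (mi_length \<alpha>) + s * real (mi_length \<beta>)" "length vs = mi_length \<alpha> + mi_length \<beta>"
    using iter_deriv_as_partial[OF vs(1)] shubin_smooth[OF a] by blast
  let ?f = "\<lambda>(\<alpha>, \<beta>). SUP z. mu s z powr (- m + real (mi_length \<alpha>) + s * real (mi_length \<beta>)) * cmod (partial \<alpha> \<beta> a z)"
  let ?q = "m - list_order s vs"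
  have q: "- m + real (mi_length \<alpha>) + s * real (mi_length \<beta>) = - ?q" using p(2) by simp
  have "?f (\<alpha>, \<beta>) \<le> shubin_seminorm m s j a"
    unfolding shubin_seminorm_def
    by (rule Max_ge) (use finite_multiindices p(3) vs(2) in \<open>auto simp: mi_length_add intro!: image_eqI[where x = "(\<alpha>, \<beta>)"]\<close>)
  moreover have "mu s z powr (- ?q) * cmod (partial \<alpha> \<beta> a z) \<le> ?f (\<alpha>, \<beta>)"
  proof -
    obtain C where "\<And>z. cmod (partial \<alpha> \<beta> a z) \<le> C * mu s z powr ?q"
      using a vs(1) unfolding shubin_iff p(1)[symmetric] by blast
    then have "mu s z powr (- ?q) * cmod (partial \<alpha> \<beta> a z) \<le> C" for z by (simp only: weighted_le_iff)
    then have "bdd_above (range (\<lambda>z. mu s z powr (- ?q) * cmod (partial \<alpha> \<beta> a z)))" by (rule bdd_aboveI2)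
    then show ?thesis unfolding prod.case q by (rule cSUP_upper[rotated]) simp
  qed
  ultimately have "mu s z powr (- ?q) * cmod (partial \<alpha> \<beta> a z) \<le> shubin_seminorm m s j a" by linarith
  then show ?thesis unfolding weighted_le_iff p(1) .
qed

lemma shubin_seminorm_least:
  assumes "\<And>vs z. vs \<in> lists Basis \<Longrightarrow> length vs \<le> j \<Longrightarrow> cmod (iter_deriv vs a z) \<le> K * mu s z powr (m - list_order s vs)"
  shows "shubin_seminorm m s j (a :: 'd::finite phase \<Rightarrow> complex) \<le> K"
  unfolding shubin_seminorm_def
proof (rule Max.boundedI)
  show "finite ((\<lambda>(\<alpha>, \<beta>). SUP z. mu s z powr (- m + real (mi_length \<alpha>) + s * real (mi_length \<beta>)) * cmod (partial \<alpha> \<beta> a z)) `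
      {(\<alpha>, \<beta>). mi_length (\<alpha> + \<beta>) \<le> j})" by (intro finite_imageI finite_multiindices)
  have "(0, 0) \<in> {(\<alpha> :: nat^'d, \<beta> :: nat^'d). mi_length (\<alpha> + \<beta>) \<le> j}" by (simp add: mi_length_def)
  then show "((\<lambda>(\<alpha>, \<beta>). SUP z. mu s z powr (- m + real (mi_length \<alpha>) + s * real (mi_length \<beta>)) * cmod (partial \<alpha> \<beta> a z)) `
      {(\<alpha>, \<beta>). mi_length (\<alpha> + \<beta>) \<le> j}) \<noteq> {}" by blast
  fix y assume "y \<in> (\<lambda>(\<alpha>, \<beta>). SUP z. mu s z powr (- m + real (mi_length \<alpha>) + s * real (mi_length \<beta>)) * cmod (partial \<alpha> \<beta> a z)) `
      {(\<alpha>, \<beta>). mi_length (\<alpha> + \<beta>) \<le> j}"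
  then obtain \<alpha> \<beta> where ab: "mi_length (\<alpha> + \<beta>) \<le> j"
    and y: "y = (SUP z. mu s z powr (- m + real (mi_length \<alpha>) + s * real (mi_length \<beta>)) * cmod (partial \<alpha> \<beta> a z))" by auto
  let ?q = "m - list_order s (dirs \<alpha> \<beta>)"
  have q: "- m + real (mi_length \<alpha>) + s * real (mi_length \<beta>) = - ?q" by (simp add: list_order_dirs)
  show "y \<le> K" unfolding y q
  proof (rule cSUP_least)
    show "mu s z powr (- ?q) * cmod (partial \<alpha> \<beta> a z) \<le> K" for z
      unfolding weighted_le_iff partial_dirs
      by (rule assms[OF dirs_in_Basis]) (use ab in \<open>simp add: length_dirs mi_length_add\<close>)
  qed simp
qed

lemma shubin_seminorm_nonneg:
  fixes a :: "'d::finite phase \<Rightarrow> complex"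
  assumes "a \<in> shubin m s" shows "0 \<le> shubin_seminorm m s j a"
proof -
  have "0 \<le> shubin_seminorm m s j a * mu s (0::'d phase) powr m"
    using order_trans[OF norm_ge_zero shubin_seminorm_upper[OF assms, of "[]" j 0]] by simp
  then show ?thesis by (simp add: mu_0)
qed

lemma shubin_seminorm_mono:
  assumes a: "a \<in> shubin m s" and "i \<le> j" shows "shubin_seminorm m s i a \<le> shubin_seminorm m s j a"
  by (rule shubin_seminorm_least) (use assms in \<open>auto intro: shubin_seminorm_upper\<close>)

lemma shubin_add:
  assumes "a \<in> shubin m s" "b \<in> shubin m s"
  shows "(\<lambda>z. a z + b z) \<in> shubin m s" "shubin_seminorm m s j (\<lambda>z. a z + b z) \<le> shubin_seminorm m s j a + shubin_seminorm m s j b"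
proof -
  note sm = shubin_smooth[OF assms(1)] shubin_smooth[OF assms(2)]
  have *: "cmod (iter_deriv vs (\<lambda>z. a z + b z) z) \<le> (shubin_seminorm m s j a + shubin_seminorm m s j b) * mu s z powr (m - list_order s vs)"
    if "vs \<in> lists Basis" "length vs \<le> j" for vs z j
    unfolding iter_deriv_add[OF sm] distrib_right
    by (intro norm_triangle_le add_mono shubin_seminorm_upper assms that)
  show "shubin_seminorm m s j (\<lambda>z. a z + b z) \<le> shubin_seminorm m s j a + shubin_seminorm m s j b"
    by (rule shubin_seminorm_least[OF *])
  show "(\<lambda>z. a z + b z) \<in> shubin m s"
    unfolding shubin_iff using * smooth_add[OF sm] by blast
qed

lemma shubin_cmult:
  assumes "a \<in> shubin m s" shows "(\<lambda>z. c * a z) \<in> shubin m s" "shubin_seminorm m s j (\<lambda>z. c * a z) \<le> cmod c * shubin_seminorm m s j a"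
proof -
  note sm = shubin_smooth[OF assms(1)]
  have *: "cmod (iter_deriv vs (\<lambda>z. c * a z) z) \<le> (cmod c * shubin_seminorm m s j a) * mu s z powr (m - list_order s vs)"
    if "vs \<in> lists Basis" "length vs \<le> j" for vs z j
    unfolding iter_deriv_cmult[OF sm] norm_mult mult.assoc
    by (intro mult_left_mono shubin_seminorm_upper assms that) simp
  show "shubin_seminorm m s j (\<lambda>z. c * a z) \<le> cmod c * shubin_seminorm m s j a"
    by (rule shubin_seminorm_least[OF *])
  show "(\<lambda>z. c * a z) \<in> shubin m s"
    unfolding shubin_iff using * smooth_cmult[OF sm] by blast
qed

lemma shubin_diff:
  assumes "a \<in> shubin m s" "b \<in> shubin m s"
  shows "(\<lambda>z. a z - b z) \<in> shubin m s" "shubin_seminorm m s j (\<lambda>z. a z - b z) \<le> shubin_seminorm m s j a + shubin_seminorm m s j b"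
proof -
  note n = shubin_cmult[OF assms(2), where c = "-1"]
  show "(\<lambda>z. a z - b z) \<in> shubin m s" using shubin_add(1)[OF assms(1) n(1)] by simp
  show "shubin_seminorm m s j (\<lambda>z. a z - b z) \<le> shubin_seminorm m s j a + shubin_seminorm m s j b"
    using order_trans[OF shubin_add(2)[OF assms(1) n(1)] add_left_mono[OF n(2)], of j] by simp
qed

lemma shubin_dir_deriv:
  assumes a: "a \<in> shubin m s" and v: "v \<in> Basis"
  shows "dir_deriv v a \<in> shubin (m - dir_order s v) s"
    "shubin_seminorm (m - dir_order s v) s j (dir_deriv v a) \<le> shubin_seminorm m s (Suc j) a"
proof -
  have *: "cmod (iter_deriv vs (dir_deriv v a) z) \<le> shubin_seminorm m s (Suc j) a * mu s z powr (m - dir_order s v - list_order s vs)"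
    if "vs \<in> lists Basis" "length vs \<le> j" for vs z j
    using shubin_seminorm_upper[OF a, of "vs @ [v]" "Suc j" z] that v
    by (simp add: iter_deriv_append algebra_simps)
  show "shubin_seminorm (m - dir_order s v) s j (dir_deriv v a) \<le> shubin_seminorm m s (Suc j) a"
    by (rule shubin_seminorm_least[OF *])
  show "dir_deriv v a \<in> shubin (m - dir_order s v) s"
    unfolding shubin_iff using * smooth_dir_deriv[OF shubin_smooth[OF a]] by blast
qed

text \<open>Since \<open>\<mu> \<ge> 1\<close>, the gain of decay under differentiation may be forgotten.\<close>

lemma shubin_bnd:
  assumes s: "0 < s" and a: "a \<in> shubin m s"
  shows "bnd N (\<lambda>z. real DIM('d phase)^N * (shubin_seminorm m s N a * mu s z powr m)) (a :: 'd::finite phase \<Rightarrow> complex)"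
proof (rule bnd_of_basis[OF shubin_smooth[OF a]])
  fix vs :: "'d phase list" and z assume vs: "vs \<in> lists Basis" "length vs \<le> N"
  have "cmod (iter_deriv vs a z) \<le> shubin_seminorm m s N a * mu s z powr (m - list_order s vs)"
    by (rule shubin_seminorm_upper[OF a vs])
  also have "\<dots> \<le> shubin_seminorm m s N a * mu s z powr m"
    by (intro mult_left_mono mu_powr_mono shubin_seminorm_nonneg a) (use list_order_nonneg[OF s] in simp)
  finally show "cmod (iter_deriv vs a z) \<le> shubin_seminorm m s N a * mu s z powr m" .
qed

lemma shubin_tempered:
  assumes s: "0 < s" and a: "a \<in> shubin m s"
  shows "tempered (mu_exp s * \<bar>m\<bar>) (a :: 'd::finite phase \<Rightarrow> complex)"
  unfolding tempered_def
proof
  fix N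
  let ?K = "(3 * 2 powr (1 / s)) powr \<bar>m\<bar>"
  have "bnd N (\<lambda>z. (real DIM('d phase)^N * (shubin_seminorm m s N a * ?K)) * wt (mu_exp s * \<bar>m\<bar>) z) a"
    by (rule bnd_mono[OF shubin_bnd[OF s a]])
      (use mu_powr_le_wt[OF s, of _ m] shubin_seminorm_nonneg[OF a] in \<open>auto simp: mult.assoc intro!: mult_left_mono\<close>)
  then show "\<exists>C. bnd N (\<lambda>z. C * wt (mu_exp s * \<bar>m\<bar>) z) a" by blast
qed

lemma shubin_one: "0 < s \<Longrightarrow> (\<lambda>z. 1) \<in> shubin 0 s"
  unfolding shubin_iff
proof (intro conjI smooth_const ballI)
  fix vs :: "'a phase list" assume "vs \<in> lists Basis"
  show "\<exists>C. \<forall>z. cmod (iter_deriv vs (\<lambda>z. 1) z) \<le> C * mu s z powr (0 - list_order s vs)"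
  proof (cases "vs = []")
    case True
    have "cmod (iter_deriv vs (\<lambda>z. 1) z) \<le> 1 * mu s z powr (0 - list_order s vs)" for z
      using True mu_pos[of s z] by simp
    then show ?thesis by blast
  qed (auto simp: iter_deriv_const intro: exI[of _ 0])
qed

subsection \<open>Continuity criteria\<close>

lemma shubin_center: "a \<in> shubin m s \<Longrightarrow> 0 < r \<Longrightarrow> a \<in> {b \<in> shubin m s. shubin_seminorm m s j (\<lambda>z. b z - a z) < r}"
proof -
  assume a: "a \<in> shubin m s" and r: "0 < r"
  have "shubin_seminorm m s j (\<lambda>z. a z - a z) \<le> 0" by (rule shubin_seminorm_least) (simp add: iter_deriv_zero)
  then show ?thesis using a r by simp
qed

lemma topspace_shubin: "topspace (shubin_topology m s) = shubin m s"
proof -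
  have "a \<in> \<Union> {{b \<in> shubin m s. shubin_seminorm m s j (\<lambda>z. b z - a z) < r} |a j r. a \<in> shubin m s \<and> 0 < r}"
    if "a \<in> shubin m s" for a
    by (rule UnionI[OF _ shubin_center[OF that zero_less_one, of 0]]) (use that in force)
  then show ?thesis unfolding shubin_topology_def topology_generated_by_topspace by blast
qed

lemma openin_shubin_ball:
  assumes "a \<in> shubin m s" "0 < r"
  shows "openin (shubin_topology m s) {b \<in> shubin m s. shubin_seminorm m s j (\<lambda>z. b z - a z) < r}"
  unfolding shubin_topology_def by (rule topology_generated_by_Basis) (use assms in blast)

text \<open>The subbase contains balls around all centres; by the triangle inequality, balls around the value
  itself suffice to test continuity.\<close>

lemma continuous_map_shubin:
  fixes F :: "'x \<Rightarrow> 'd::finite phase \<Rightarrow> complex"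
  assumes F: "\<And>x. x \<in> topspace X \<Longrightarrow> F x \<in> shubin m s"
    and c: "\<And>x j e. x \<in> topspace X \<Longrightarrow> 0 < e \<Longrightarrow>
      \<exists>U. openin X U \<and> x \<in> U \<and> (\<forall>y\<in>U. shubin_seminorm m s j (\<lambda>z. F y z - F x z) < e)"
  shows "continuous_map X (shubin_topology m s) F"
  unfolding shubin_topology_def
proof (rule continuous_on_generated_topo)
  show "F ` topspace X \<subseteq> \<Union> {{b \<in> shubin m s. shubin_seminorm m s j (\<lambda>z. b z - a z) < r} |a j r. a \<in> shubin m s \<and> 0 < r}"
  proof -
    have eq: "\<Union> {{b \<in> shubin m s. shubin_seminorm m s j (\<lambda>z. b z - a z) < r} |a j r. a \<in> shubin m s \<and> 0 < r} = shubin m s"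
      using topspace_shubin[of m s] unfolding shubin_topology_def topology_generated_by_topspace .
    show ?thesis unfolding eq using F by (rule image_subsetI)
  qed
  fix U :: "('d phase \<Rightarrow> complex) set"
  assume "U \<in> {{b \<in> shubin m s. shubin_seminorm m s j (\<lambda>z. b z - a z) < r} |a j r. a \<in> shubin m s \<and> 0 < r}"
  then obtain a j r where U: "U = {b \<in> shubin m s. shubin_seminorm m s j (\<lambda>z. b z - a z) < r}"
    and a: "a \<in> shubin m s" and r: "0 < r" by blast
  show "openin X (F -` U \<inter> topspace X)"
  proof (subst openin_subopen, intro ballI)
    fix x assume x: "x \<in> F -` U \<inter> topspace X"
    then have Fx: "F x \<in> shubin m s" "shubin_seminorm m s j (\<lambda>z. F x z - a z) < r" using U by auto
    obtain V where V: "openin X V" "x \<in> V"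
      "\<And>y. y \<in> V \<Longrightarrow> shubin_seminorm m s j (\<lambda>z. F y z - F x z) < r - shubin_seminorm m s j (\<lambda>z. F x z - a z)"
      using c[of x "r - shubin_seminorm m s j (\<lambda>z. F x z - a z)" j] x Fx by auto
    have "V \<subseteq> F -` U \<inter> topspace X"
    proof
      fix y assume y: "y \<in> V"
      then have yX: "y \<in> topspace X" using V(1) openin_subset by blast
      have "shubin_seminorm m s j (\<lambda>z. (F y z - F x z) + (F x z - a z)) \<le>
          shubin_seminorm m s j (\<lambda>z. F y z - F x z) + shubin_seminorm m s j (\<lambda>z. F x z - a z)"
        by (intro shubin_add(2) shubin_diff(1) F yX Fx a)
      then have "shubin_seminorm m s j (\<lambda>z. F y z - a z) < r" using V(3)[OF y] by simp
      then show "y \<in> F -` U \<inter> topspace X" using U yX F by auto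
    qed
    then show "\<exists>T. openin X T \<and> x \<in> T \<and> T \<subseteq> F -` U \<inter> topspace X" using V by blast
  qed
qed

text \<open>A bilinear map is continuous as soon as each seminorm of a value is bounded by a product of
  seminorms: near \<open>(a, b)\<close> one writes \<open>P a' b' - P a b = P (a' - a) b' + P a (b' - b)\<close>.\<close>

lemma continuous_map_shubin_bilinear:
  fixes P :: "('d::finite phase \<Rightarrow> complex) \<Rightarrow> ('d phase \<Rightarrow> complex) \<Rightarrow> ('d phase \<Rightarrow> complex)"
  assumes mem: "\<And>a b. a \<in> shubin m s \<Longrightarrow> b \<in> shubin n s \<Longrightarrow> P a b \<in> shubin k s"
    and left: "\<And>a a' b z. a \<in> shubin m s \<Longrightarrow> a' \<in> shubin m s \<Longrightarrow> b \<in> shubin n s \<Longrightarrow> P (\<lambda>z. a z - a' z) b z = P a b z - P a' b z"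
    and right: "\<And>a b b' z. a \<in> shubin m s \<Longrightarrow> b \<in> shubin n s \<Longrightarrow> b' \<in> shubin n s \<Longrightarrow> P a (\<lambda>z. b z - b' z) z = P a b z - P a b' z"
    and bound: "\<And>j. \<exists>C N. \<forall>a\<in>shubin m s. \<forall>b\<in>shubin n s.
      shubin_seminorm k s j (P a b) \<le> C * (shubin_seminorm m s N a * shubin_seminorm n s N b)"
  shows "continuous_map (prod_topology (shubin_topology m s) (shubin_topology n s)) (shubin_topology k s) (\<lambda>(a, b). P a b)"
proof (rule continuous_map_shubin)
  show "(case x of (a, b) \<Rightarrow> P a b) \<in> shubin k s"
    if "x \<in> topspace (prod_topology (shubin_topology m s) (shubin_topology n s))" for x
    using that mem by (auto simp: topspace_shubin)
  fix x :: "('d phase \<Rightarrow> complex) \<times> ('d phase \<Rightarrow> complex)" and j and e :: real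
  assume x: "x \<in> topspace (prod_topology (shubin_topology m s) (shubin_topology n s))" and e: "0 < e"
  obtain a b where ab: "x = (a, b)" "a \<in> shubin m s" "b \<in> shubin n s" using x by (auto simp: topspace_shubin)
  obtain C0 N where C0: "\<And>a b. a \<in> shubin m s \<Longrightarrow> b \<in> shubin n s \<Longrightarrow>
      shubin_seminorm k s j (P a b) \<le> C0 * (shubin_seminorm m s N a * shubin_seminorm n s N b)" using bound[of j] by metis
  define C where "C = \<bar>C0\<bar>"
  have C: "shubin_seminorm k s j (P a b) \<le> C * (shubin_seminorm m s N a * shubin_seminorm n s N b)"
    if "a \<in> shubin m s" "b \<in> shubin n s" for a b
    by (rule order_trans[OF C0[OF that]])
      (intro mult_right_mono mult_nonneg_nonneg shubin_seminorm_nonneg that, simp add: C_def)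
  have Cn: "0 \<le> C" by (simp add: C_def)
  let ?na = "shubin_seminorm m s N a" and ?nb = "shubin_seminorm n s N b"
  have nn: "0 \<le> ?na" "0 \<le> ?nb" using shubin_seminorm_nonneg ab by blast+
  define D where "D = C * (?na + ?nb + 2)"
  define d where "d = min 1 (e / (D + 1))"
  have D: "0 \<le> D" unfolding D_def using Cn nn by (intro mult_nonneg_nonneg) auto
  have d: "0 < d" "d \<le> 1" unfolding d_def using e D by auto
  have De: "D * d < e"
  proof -
    have "D * d \<le> D * (e / (D + 1))" unfolding d_def by (intro mult_left_mono D) simp
    also have "\<dots> < e" using D e by (simp add: field_simps)
    finally show ?thesis .
  qed
  let ?U = "{b \<in> shubin m s. shubin_seminorm m s N (\<lambda>z. b z - a z) < d}"
  let ?V = "{c \<in> shubin n s. shubin_seminorm n s N (\<lambda>z. c z - b z) < d}"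
  have "shubin_seminorm k s j (\<lambda>z. (case y of (a, b) \<Rightarrow> P a b) z - (case x of (a, b) \<Rightarrow> P a b) z) < e" if "y \<in> ?U \<times> ?V" for y
  proof -
    obtain a' b' where y: "y = (a', b')" by (cases y)
    have m': "a' \<in> shubin m s" "b' \<in> shubin n s" using that y by auto
    have da: "(\<lambda>z. a' z - a z) \<in> shubin m s" and db: "(\<lambda>z. b' z - b z) \<in> shubin n s"
      by (intro shubin_diff ab m')+
    have sa: "shubin_seminorm m s N (\<lambda>z. a' z - a z) \<le> d" and sb: "shubin_seminorm n s N (\<lambda>z. b' z - b z) \<le> d"
      using that y by auto
    have "shubin_seminorm n s N (\<lambda>z. b z + (b' z - b z)) \<le> ?nb + shubin_seminorm n s N (\<lambda>z. b' z - b z)"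
      by (rule shubin_add(2)[OF ab(3) db])
    then have sb': "shubin_seminorm n s N b' \<le> ?nb + 1" using sb d by simp
    have "shubin_seminorm k s j (\<lambda>z. P a' b' z - P a b z)
      = shubin_seminorm k s j (\<lambda>z. P (\<lambda>z. a' z - a z) b' z + P a (\<lambda>z. b' z - b z) z)"
      by (simp add: left[OF m'(1) ab(2) m'(2)] right[OF ab(2) m'(2) ab(3)])
    also have "\<dots> \<le> shubin_seminorm k s j (P (\<lambda>z. a' z - a z) b') + shubin_seminorm k s j (P a (\<lambda>z. b' z - b z))"
      by (intro shubin_add mem da db m' ab)
    also have "\<dots> \<le> C * (shubin_seminorm m s N (\<lambda>z. a' z - a z) * shubin_seminorm n s N b') + C * (?na * shubin_seminorm n s N (\<lambda>z. b' z - b z))"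
      by (intro add_mono C da db m' ab)
    also have "\<dots> \<le> C * (d * (?nb + 1)) + C * (?na * d)"
      using nn d by (intro add_mono mult_left_mono mult_mono sa sb sb' Cn shubin_seminorm_nonneg m' ab da db) auto
    also have "\<dots> \<le> D * d"
    proof -
      have "0 \<le> C * d" using Cn d by simp
      then show ?thesis unfolding D_def by (simp add: algebra_simps)
    qed
    finally show ?thesis using De y ab by simp
  qed
  moreover have "openin (prod_topology (shubin_topology m s) (shubin_topology n s)) (?U \<times> ?V)"
    unfolding openin_prod_Times_iff using openin_shubin_ball[OF ab(2) d(1)] openin_shubin_ball[OF ab(3) d(1)] by blast
  moreover have "x \<in> ?U \<times> ?V" using shubin_center[OF ab(2) d(1)] shubin_center[OF ab(3) d(1)] ab by blast
  ultimately show "\<exists>U. openin (prod_topology (shubin_topology m s) (shubin_topology n s)) U \<and> x \<in> U \<and>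
      (\<forall>y\<in>U. shubin_seminorm k s j (\<lambda>z. (case y of (a, b) \<Rightarrow> P a b) z - (case x of (a, b) \<Rightarrow> P a b) z) < e)" by blast
qed

section \<open>Twisted products of symbols\<close>

context chirp
begin

text \<open>Dividing by the integral of the chirp alone normalizes the twist of constants and removes the
  Fresnel constant from all formulas.\<close>

definition twist :: "('a \<Rightarrow> 'p) \<Rightarrow> ('a \<Rightarrow> 'p::euclidean_space) \<Rightarrow> ('p \<Rightarrow> complex) \<Rightarrow> ('p \<Rightarrow> complex) \<Rightarrow> 'p \<Rightarrow> complex" where
  "twist L L' a b z = osc (\<lambda>u. a (z + L u) * b (z + L' u)) / osc (\<lambda>u. 1)"

lemma shift_linear:
  assumes "bounded_linear L" shows "bounded_linear (\<lambda>p :: 'p::euclidean_space \<times> 'a. fst p + L (snd p))"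
  using assms by (auto intro!: bounded_linear_add bounded_linear_fst bounded_linear_compose[OF assms bounded_linear_snd, unfolded o_def])

lemma tempered_shift:
  fixes a :: "'p::euclidean_space \<Rightarrow> complex"
  assumes a: "tempered M a" and L: "bounded_linear L" and M: "0 \<le> M"
  shows "tempered M (\<lambda>p :: 'p \<times> 'a. a (fst p + L (snd p)))"
  using tempered_affine[OF a shift_linear[OF L] M, of 0] by simp

lemma tempered_twist_amplitude:
  fixes a b :: "'p::euclidean_space \<Rightarrow> complex"
  assumes "tempered M a" "tempered M' b" "bounded_linear L" "bounded_linear L'" "0 \<le> M" "0 \<le> M'"
  shows "tempered (M + M') (\<lambda>p :: 'p \<times> 'a. a (fst p + L (snd p)) * b (fst p + L' (snd p)))"
  by (intro tempered_mult tempered_shift assms)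

lemma twist_eq:
  "twist L L' a b = (\<lambda>z. (1 / osc (\<lambda>u. 1)) * osc (\<lambda>u. (\<lambda>p. a (fst p + L (snd p)) * b (fst p + L' (snd p))) (z, u)))"
  by (simp add: twist_def fun_eq_iff)

lemma smooth_twist:
  fixes a b :: "'p::euclidean_space \<Rightarrow> complex"
  assumes "tempered M a" "tempered M' b" "bounded_linear L" "bounded_linear L'" "0 \<le> M" "0 \<le> M'"
  shows "smooth (twist L L' a b)"
  unfolding twist_eq
  by (intro smooth_cmult smooth_osc_param[OF tempered_twist_amplitude[OF assms]]) (use assms in simp)

lemma tempered_twist:
  fixes a b :: "'p::euclidean_space \<Rightarrow> complex"
  assumes "tempered M a" "tempered M' b" "bounded_linear L" "bounded_linear L'" "0 \<le> M" "0 \<le> M'"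
  shows "tempered (M + M') (twist L L' a b)"
  unfolding twist_eq
  by (intro tempered_cmult tempered_osc_param[OF tempered_twist_amplitude[OF assms]]) (use assms in simp)

lemma tconv_twist:
  fixes a b :: "'p::euclidean_space \<Rightarrow> complex"
  assumes a: "tconv M f a" and b: "tconv M' g b" and L: "bounded_linear L" "bounded_linear L'" and M: "0 \<le> M" "0 \<le> M'"
  shows "tconv (M + M') (\<lambda>k. twist L L' (f k) (g k)) (twist L L' a b)"
proof -
  have "tconv (M + M') (\<lambda>k p. f k (0 + (fst p + L (snd p))) * g k (0 + (fst p + L' (snd p))))
      (\<lambda>p :: 'p \<times> 'a. a (0 + (fst p + L (snd p))) * b (0 + (fst p + L' (snd p))))"
    by (intro tconv_mult tconv_affine[OF a shift_linear[OF L(1)] M(1)] tconv_affine[OF b shift_linear[OF L(2)] M(2)])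
  then have t: "tconv (M + M') (\<lambda>k p. f k (fst p + L (snd p)) * g k (fst p + L' (snd p)))
      (\<lambda>p :: 'p \<times> 'a. a (fst p + L (snd p)) * b (fst p + L' (snd p)))" by simp
  have c: "tconv 0 (\<lambda>k z. 1 / osc (\<lambda>u. 1)) (\<lambda>z::'p. 1 / osc (\<lambda>u. 1))" by (rule tconv_const[OF tempered_const])
  show ?thesis unfolding twist_eq
    using tconv_mult[OF c tconv_osc_param[OF t]] M by simp
qed

text \<open>The integration variable enters only through shifts, so the Leibniz rule holds under the integral.\<close>

lemma dir_deriv_twist:
  fixes a b :: "'p::euclidean_space \<Rightarrow> complex"
  assumes a: "tempered M a" and b: "tempered M' b" and L: "bounded_linear L" "bounded_linear L'" and M: "0 \<le> M" "0 \<le> M'"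
  shows "dir_deriv v (twist L L' a b) = (\<lambda>z. twist L L' (dir_deriv v a) b z + twist L L' a (dir_deriv v b) z)"
proof -
  let ?A = "\<lambda>a b. (\<lambda>p :: 'p \<times> 'a. a (fst p + L (snd p)) * b (fst p + L' (snd p)))"
  have t: "tempered (M + M') (?A a b)" "tempered (M + M') (?A (dir_deriv v a) b)" "tempered (M + M') (?A a (dir_deriv v b))"
    by (intro tempered_twist_amplitude tempered_dir_deriv a b L M)+
  have MM: "0 \<le> M + M'" using M by simp
  have sh: "dir_deriv (v, 0) (\<lambda>p :: 'p \<times> 'a. f (fst p + K (snd p))) = (\<lambda>p. dir_deriv v f (fst p + K (snd p)))"
    "smooth (\<lambda>p :: 'p \<times> 'a. f (fst p + K (snd p)))"
    if "smooth f" "bounded_linear K" for f :: "'p \<Rightarrow> complex" and K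
    using dir_deriv_affine[OF shift_linear[OF that(2)] that(1), of "(v, 0)" 0]
      smooth_affine[OF shift_linear[OF that(2)] that(1), of 0] that(2) by (simp_all add: linear_simps)
  have "dir_deriv (v, 0) (?A a b) = (\<lambda>p. ?A (dir_deriv v a) b p + ?A a (dir_deriv v b) p)"
    using tempered_smooth[OF a] tempered_smooth[OF b] L by (simp add: dir_deriv_mult sh)
  then have "dir_deriv v (\<lambda>z. osc (\<lambda>u. ?A a b (z, u)))
     = (\<lambda>z. osc (\<lambda>u. ?A (dir_deriv v a) b (z, u)) + osc (\<lambda>u. ?A a (dir_deriv v b) (z, u)))"
    using dir_deriv_osc_param[OF t(1) MM, of v] osc_add[OF tempered_slice[OF t(2) MM] tempered_slice[OF t(3) MM]] by simp
  then show ?thesis unfolding twist_eq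
    using dir_deriv_cmult[OF smooth_osc_param[OF t(1) MM], of v "1 / osc (\<lambda>u. 1)"] by (simp add: distrib_left)
qed

lemma twist_slices:
  fixes a b :: "'p::euclidean_space \<Rightarrow> complex" and L L' :: "'a \<Rightarrow> 'p"
  assumes "tempered M a" "tempered M' b" "bounded_linear L" "bounded_linear L'" "0 \<le> M" "0 \<le> M'"
  shows "tempered (M + M') (\<lambda>u. a (z + L u) * b (z + L' u))"
  using tempered_slice[OF tempered_twist_amplitude[OF assms], of z] assms(5,6) by simp

lemma twist_add_left:
  fixes a a' b :: "'p::euclidean_space \<Rightarrow> complex" and L L' :: "'a \<Rightarrow> 'p"
  assumes "tempered M a" "tempered M a'" "tempered M' b" "bounded_linear L" "bounded_linear L'" "0 \<le> M" "0 \<le> M'"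
  shows "twist L L' (\<lambda>z. a z + a' z) b z = twist L L' a b z + twist L L' a' b z"
  unfolding twist_def
  using osc_add[OF twist_slices[OF assms(1,3-7)] twist_slices[OF assms(2,3-7)]]
  by (simp add: distrib_right add_divide_distrib)

lemma twist_add_right:
  fixes a b b' :: "'p::euclidean_space \<Rightarrow> complex" and L L' :: "'a \<Rightarrow> 'p"
  assumes "tempered M a" "tempered M' b" "tempered M' b'" "bounded_linear L" "bounded_linear L'" "0 \<le> M" "0 \<le> M'"
  shows "twist L L' a (\<lambda>z. b z + b' z) z = twist L L' a b z + twist L L' a b' z"
  unfolding twist_def
  using osc_add[OF twist_slices[OF assms(1,2,4-7)] twist_slices[OF assms(1,3,4-7)]]
  by (simp add: distrib_left add_divide_distrib)

lemma twist_cmult: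
  fixes a b :: "'p::euclidean_space \<Rightarrow> complex" and L L' :: "'a \<Rightarrow> 'p"
  assumes "tempered M a" "tempered M' b" "bounded_linear L" "bounded_linear L'" "0 \<le> M" "0 \<le> M'"
  shows "twist L L' (\<lambda>z. c * a z) b z = c * twist L L' a b z" "twist L L' a (\<lambda>z. c * b z) z = c * twist L L' a b z"
  unfolding twist_def
  using osc_cmult[OF twist_slices[OF assms], of c]
  by (simp_all add: mult.assoc mult.left_commute[of _ c])

text \<open>Peetre's inequality separates the variables: the parameter keeps the symbol weight, the integration
  variable receives an isotropic one, and the constant is linear in the seminorm of \<open>a\<close>.\<close>

lemma shubin_shift_bnd:
  fixes a :: "'d::finite phase \<Rightarrow> complex"
  assumes s: "0 < s" and L: "bounded_linear L"
  shows "\<exists>c\<ge>0. \<forall>a\<in>shubin m s. bnd N (\<lambda>p :: 'd phase \<times> 'a. (c * shubin_seminorm m s N a * mu s (fst p) powr m) * wt (mu_exp s * \<bar>m\<bar>) (snd p))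
    (\<lambda>p. a (fst p + L (snd p)))"
proof -
  obtain B where B: "\<And>v :: 'd phase \<times> 'a. norm (fst v + L (snd v)) \<le> B * norm v" "1 \<le> B"
    using bounded_linear_bound[OF shift_linear[OF L]] by blast
  define M where "M = mu_exp s * \<bar>m\<bar>"
  have M: "0 \<le> M" by (simp add: M_def mu_exp_def)
  obtain B' where B': "\<And>v. norm (L v) \<le> B' * norm v" "1 \<le> B'" using bounded_linear_bound[OF L] by blast
  define c where "c = B^N * real DIM('d phase)^N * ((3 * 2 powr (1 / s)) powr \<bar>m\<bar>) * B' powr M"
  show ?thesis
  proof (intro exI[of _ c] conjI ballI)
    show c0: "0 \<le> c" unfolding c_def using B(2) by (intro mult_nonneg_nonneg) auto
    fix a :: "'d phase \<Rightarrow> complex" assume a: "a \<in> shubin m s"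
    have n0: "0 \<le> shubin_seminorm m s N a" by (rule shubin_seminorm_nonneg[OF a])
    have "bnd N (\<lambda>p :: 'd phase \<times> 'a. B^N * (real DIM('d phase)^N * (shubin_seminorm m s N a * mu s (0 + (fst p + L (snd p))) powr m)))
       (\<lambda>p. a (0 + (fst p + L (snd p))))"
      by (rule bnd_affine[OF shift_linear[OF L] B shubin_bnd[OF s a]])
    then have b: "bnd N (\<lambda>p :: 'd phase \<times> 'a. B^N * (real DIM('d phase)^N * (shubin_seminorm m s N a * mu s (fst p + L (snd p)) powr m)))
       (\<lambda>p. a (fst p + L (snd p)))" by (simp only: add_0)
    show "bnd N (\<lambda>p :: 'd phase \<times> 'a. (c * shubin_seminorm m s N a * mu s (fst p) powr m) * wt (mu_exp s * \<bar>m\<bar>) (snd p))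
      (\<lambda>p. a (fst p + L (snd p)))"
    proof (rule bnd_mono[OF b])
      fix p :: "'d phase \<times> 'a"
      have "mu s (fst p + L (snd p)) powr m \<le> (3 * 2 powr (1 / s)) powr \<bar>m\<bar> * (mu s (fst p) powr m * wt M (L (snd p)))"
        unfolding M_def by (rule mu_peetre[OF s])
      also have "\<dots> \<le> (3 * 2 powr (1 / s)) powr \<bar>m\<bar> * (mu s (fst p) powr m * (B' powr M * wt M (snd p)))"
        by (intro mult_left_mono wt_linear_le B' M) auto
      finally have "B^N * (real DIM('d phase)^N * (shubin_seminorm m s N a * mu s (fst p + L (snd p)) powr m))
          \<le> B^N * (real DIM('d phase)^N * (shubin_seminorm m s N a * ((3 * 2 powr (1 / s)) powr \<bar>m\<bar> * (mu s (fst p) powr m * (B' powr M * wt M (snd p))))))"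
        by (intro mult_left_mono n0) (use B(2) in auto)
      also have "\<dots> = (c * shubin_seminorm m s N a * mu s (fst p) powr m) * wt (mu_exp s * \<bar>m\<bar>) (snd p)"
        unfolding c_def M_def by (simp only: mult_ac)
      finally show "B^N * (real DIM('d phase)^N * (shubin_seminorm m s N a * mu s (fst p + L (snd p)) powr m))
        \<le> (c * shubin_seminorm m s N a * mu s (fst p) powr m) * wt (mu_exp s * \<bar>m\<bar>) (snd p)" .
    qed simp
  qed
qed

lemma twist_pointwise_bound:
  assumes s: "0 < s" and L: "bounded_linear L" "bounded_linear L'"
  shows "\<exists>C N. 0 \<le> C \<and> (\<forall>a\<in>(shubin m s :: ('d::finite phase \<Rightarrow> complex) set). \<forall>b\<in>shubin n s. \<forall>z.
    cmod (twist L L' a b z) \<le> C * (shubin_seminorm m s N a * shubin_seminorm n s N b) * mu s z powr (m + n))"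
proof -
  define M where "M = mu_exp s * \<bar>m\<bar>"
  define M' where "M' = mu_exp s * \<bar>n\<bar>"
  have M: "0 \<le> M" "0 \<le> M'" by (simp_all add: M_def M'_def mu_exp_def)
  have MM: "0 \<le> M + M'" using M by simp
  obtain N c where c: "0 \<le> c" "\<And>(A :: 'd phase \<times> 'a \<Rightarrow> complex) V. tempered (M + M') A \<Longrightarrow>
     bnd N (\<lambda>z. V (fst z) * wt (M + M') (snd z)) A \<Longrightarrow> bnd 0 (\<lambda>x. c * V x) (\<lambda>x. osc (\<lambda>u. A (x, u)))"
    using bnd_osc_param[OF MM, of 0] by blast
  obtain c1 where c1: "0 \<le> c1" "\<And>a. a \<in> shubin m s \<Longrightarrow> bnd N (\<lambda>p :: 'd phase \<times> 'a. (c1 * shubin_seminorm m s N a * mu s (fst p) powr m) * wt M (snd p))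
    (\<lambda>p. a (fst p + L (snd p)))" using shubin_shift_bnd[OF s L(1), of m N] unfolding M_def by blast
  obtain c2 where c2: "0 \<le> c2" "\<And>b. b \<in> shubin n s \<Longrightarrow> bnd N (\<lambda>p :: 'd phase \<times> 'a. (c2 * shubin_seminorm n s N b * mu s (fst p) powr n) * wt M' (snd p))
    (\<lambda>p. b (fst p + L' (snd p)))" using shubin_shift_bnd[OF s L(2), of n N] unfolding M'_def by blast
  define C where "C = cmod (1 / osc (\<lambda>u. 1)) * (c * (2^N * (c1 * c2)))"
  show ?thesis
  proof (intro exI[of _ C] exI[of _ N] conjI ballI allI)
    show "0 \<le> C" unfolding C_def using c c1 c2 by (intro mult_nonneg_nonneg) auto
    fix a b :: "'d phase \<Rightarrow> complex" and z
    assume a: "a \<in> shubin m s" and b: "b \<in> shubin n s"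
    let ?A = "\<lambda>p :: 'd phase \<times> 'a. a (fst p + L (snd p)) * b (fst p + L' (snd p))"
    define V where "V z = 2^N * (c1 * c2) * (shubin_seminorm m s N a * shubin_seminorm n s N b) * mu s z powr (m + n)" for z :: "'d phase"
    have t: "tempered (M + M') ?A"
      by (intro tempered_twist_amplitude L M) (use shubin_tempered[OF s a] shubin_tempered[OF s b] in \<open>auto simp: M_def M'_def\<close>)
    have "bnd N (\<lambda>z. V (fst z) * wt (M + M') (snd z)) ?A"
    proof (rule bnd_mono[OF bnd_mult[OF c1(2)[OF a] c2(2)[OF b]]])
      fix p :: "'d phase \<times> 'a"
      show "2 ^ N * (c1 * shubin_seminorm m s N a * mu s (fst p) powr m * wt M (snd p) * (c2 * shubin_seminorm n s N b * mu s (fst p) powr n * wt M' (snd p)))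
         \<le> V (fst p) * wt (M + M') (snd p)"
        unfolding V_def powr_add wt_add by (simp only: mult_ac order_refl)
    qed simp
    from bnd_value[OF c(2)[OF t this], of z]
    have "cmod (osc (\<lambda>u. a (z + L u) * b (z + L' u))) \<le> c * V z" by simp
    then have "cmod (1 / osc (\<lambda>u. 1)) * cmod (osc (\<lambda>u. a (z + L u) * b (z + L' u))) \<le> cmod (1 / osc (\<lambda>u. 1)) * (c * V z)"
      by (rule mult_left_mono) simp
    then show "cmod (twist L L' a b z) \<le> C * (shubin_seminorm m s N a * shubin_seminorm n s N b) * mu s z powr (m + n)"
      by (simp add: twist_def C_def V_def norm_divide mult_ac)
  qed
qed

text \<open>Induction on the number of derivatives, with the orders \<open>m\<close> and \<open>n\<close> arbitrary: the innermost derivative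
  turns the twist of \<open>a\<close> and \<open>b\<close> into the twists of \<open>\<partial>\<^sub>v a\<close> and \<open>b\<close> and of \<open>a\<close> and \<open>\<partial>\<^sub>v b\<close>, in which one
  order is lower by that of \<open>v\<close>.\<close>

lemma twist_deriv_bound:
  assumes s: "0 < s" and L: "bounded_linear L" "bounded_linear L'"
  shows "\<exists>C N. 0 \<le> C \<and> (\<forall>a\<in>(shubin m s :: ('d::finite phase \<Rightarrow> complex) set). \<forall>b\<in>shubin n s. \<forall>vs\<in>lists Basis. length vs = l \<longrightarrow> (\<forall>z.
    cmod (iter_deriv vs (twist L L' a b) z) \<le> C * (shubin_seminorm m s N a * shubin_seminorm n s N b) * mu s z powr (m + n - list_order s vs)))"
proof (induction l arbitrary: m n)
  case 0
  then show ?case using twist_pointwise_bound[OF s L, of m n] by simp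
next
  case (Suc l)
  \<comment> \<open>The constants may depend on the order \<open>r\<close> of the direction, which has only the two values 1 and \<open>s\<close>.\<close>
  have *: "\<exists>C N. 0 \<le> C \<and> (\<forall>a\<in>(shubin m s :: ('d phase \<Rightarrow> complex) set). \<forall>b\<in>shubin n s. \<forall>vs\<in>lists Basis. \<forall>v\<in>Basis. length vs = l \<longrightarrow> dir_order s v = r \<longrightarrow> (\<forall>z.
    cmod (iter_deriv (vs @ [v]) (twist L L' a b) z) \<le> C * (shubin_seminorm m s N a * shubin_seminorm n s N b) * mu s z powr (m + n - list_order s (vs @ [v]))))" for r
  proof -
    obtain C1 N1 where 1: "0 \<le> C1" "\<And>(a :: 'd phase \<Rightarrow> complex) b vs z. a \<in> shubin (m - r) s \<Longrightarrow> b \<in> shubin n s \<Longrightarrow> vs \<in> lists Basis \<Longrightarrow> length vs = l \<Longrightarrow>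
      cmod (iter_deriv vs (twist L L' a b) z) \<le> C1 * (shubin_seminorm (m - r) s N1 a * shubin_seminorm n s N1 b) * mu s z powr ((m - r) + n - list_order s vs)"
      using Suc.IH[of "m - r" n] by metis
    obtain C2 N2 where 2: "0 \<le> C2" "\<And>(a :: 'd phase \<Rightarrow> complex) b vs z. a \<in> shubin m s \<Longrightarrow> b \<in> shubin (n - r) s \<Longrightarrow> vs \<in> lists Basis \<Longrightarrow> length vs = l \<Longrightarrow>
      cmod (iter_deriv vs (twist L L' a b) z) \<le> C2 * (shubin_seminorm m s N2 a * shubin_seminorm (n - r) s N2 b) * mu s z powr (m + (n - r) - list_order s vs)"
      using Suc.IH[of m "n - r"] by metis
    let ?N = "Suc (max N1 N2)"
    show ?thesis
    proof (intro exI[of _ "C1 + C2"] exI[of _ ?N] conjI ballI allI impI)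
      show "0 \<le> C1 + C2" using 1 2 by simp
      fix a b :: "'d phase \<Rightarrow> complex" and vs :: "'d phase list" and v z :: "'d phase"
      assume a: "a \<in> shubin m s" and b: "b \<in> shubin n s" and vs: "vs \<in> lists Basis" "length vs = l" and v: "v \<in> Basis" "dir_order s v = r"
      define M where "M = mu_exp s * \<bar>m\<bar>"
      define M' where "M' = mu_exp s * \<bar>n\<bar>"
      have M: "0 \<le> M" "0 \<le> M'" by (simp_all add: M_def M'_def mu_exp_def)
      have ta: "tempered M a" "tempered M' b" using shubin_tempered[OF s a] shubin_tempered[OF s b] by (auto simp: M_def M'_def)
      note da = shubin_dir_deriv[OF a v(1), unfolded v(2)] and db = shubin_dir_deriv[OF b v(1), unfolded v(2)]
      let ?n = "shubin_seminorm m s ?N a * shubin_seminorm n s ?N b"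
      let ?mu = "mu s z powr (m + n - list_order s (vs @ [v]))"
      have "iter_deriv (vs @ [v]) (twist L L' a b) z
         = iter_deriv vs (twist L L' (dir_deriv v a) b) z + iter_deriv vs (twist L L' a (dir_deriv v b)) z"
        using ta by (simp add: iter_deriv_append dir_deriv_twist[OF ta L M]
          iter_deriv_add[OF smooth_twist[OF tempered_dir_deriv[OF ta(1)] ta(2) L M] smooth_twist[OF ta(1) tempered_dir_deriv[OF ta(2)] L M]])
      also have "cmod \<dots> \<le> C1 * ?n * ?mu + C2 * ?n * ?mu"
      proof (intro norm_triangle_le add_mono)
        have "cmod (iter_deriv vs (twist L L' (dir_deriv v a) b) z)
          \<le> C1 * (shubin_seminorm (m - r) s N1 (dir_deriv v a) * shubin_seminorm n s N1 b) * mu s z powr ((m - r) + n - list_order s vs)"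
          by (rule 1(2)[OF da(1) b vs])
        also have "(m - r) + n - list_order s vs = m + n - list_order s (vs @ [v])" using v by simp
        also have "C1 * (shubin_seminorm (m - r) s N1 (dir_deriv v a) * shubin_seminorm n s N1 b) * ?mu \<le> C1 * ?n * ?mu"
          by (intro mult_right_mono mult_left_mono mult_mono 1(1) order_trans[OF da(2)] shubin_seminorm_mono a b shubin_seminorm_nonneg da(1)) auto
        finally show "cmod (iter_deriv vs (twist L L' (dir_deriv v a) b) z) \<le> C1 * ?n * ?mu" .
        have "cmod (iter_deriv vs (twist L L' a (dir_deriv v b)) z)
          \<le> C2 * (shubin_seminorm m s N2 a * shubin_seminorm (n - r) s N2 (dir_deriv v b)) * mu s z powr (m + (n - r) - list_order s vs)"
          by (rule 2(2)[OF a db(1) vs])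
        also have "m + (n - r) - list_order s vs = m + n - list_order s (vs @ [v])" using v by simp
        also have "C2 * (shubin_seminorm m s N2 a * shubin_seminorm (n - r) s N2 (dir_deriv v b)) * ?mu \<le> C2 * ?n * ?mu"
          by (intro mult_right_mono mult_left_mono mult_mono 2(1) order_trans[OF db(2)] shubin_seminorm_mono a b shubin_seminorm_nonneg db(1)) auto
        finally show "cmod (iter_deriv vs (twist L L' a (dir_deriv v b)) z) \<le> C2 * ?n * ?mu" .
      qed
      also have "\<dots> = (C1 + C2) * ?n * ?mu" by (simp add: distrib_right)
      finally show "cmod (iter_deriv (vs @ [v]) (twist L L' a b) z) \<le> (C1 + C2) * ?n * ?mu" .
    qed
  qed
  obtain C1 N1 where 1: "0 \<le> C1" "\<And>(a :: 'd phase \<Rightarrow> complex) b vs v z. a \<in> shubin m s \<Longrightarrow> b \<in> shubin n s \<Longrightarrow> vs \<in> lists Basis \<Longrightarrow> v \<in> Basis \<Longrightarrow> length vs = l \<Longrightarrow> dir_order s v = 1 \<Longrightarrow>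
    cmod (iter_deriv (vs @ [v]) (twist L L' a b) z) \<le> C1 * (shubin_seminorm m s N1 a * shubin_seminorm n s N1 b) * mu s z powr (m + n - list_order s (vs @ [v]))"
    using *[of 1] by metis
  obtain C2 N2 where 2: "0 \<le> C2" "\<And>(a :: 'd phase \<Rightarrow> complex) b vs v z. a \<in> shubin m s \<Longrightarrow> b \<in> shubin n s \<Longrightarrow> vs \<in> lists Basis \<Longrightarrow> v \<in> Basis \<Longrightarrow> length vs = l \<Longrightarrow> dir_order s v = s \<Longrightarrow>
    cmod (iter_deriv (vs @ [v]) (twist L L' a b) z) \<le> C2 * (shubin_seminorm m s N2 a * shubin_seminorm n s N2 b) * mu s z powr (m + n - list_order s (vs @ [v]))"
    using *[of s] by metis
  let ?N = "max N1 N2"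
  show ?case
  proof (intro exI[of _ "C1 + C2"] exI[of _ ?N] conjI ballI allI impI)
    show "0 \<le> C1 + C2" using 1 2 by simp
    fix a b :: "'d phase \<Rightarrow> complex" and vs :: "'d phase list" and z :: "'d phase"
    assume a: "a \<in> shubin m s" and b: "b \<in> shubin n s" and vs: "vs \<in> lists Basis" "length vs = Suc l"
    obtain us v where us: "vs = us @ [v]" using vs(2) by (metis length_Suc_conv_rev)
    have usv: "us \<in> lists Basis" "v \<in> Basis" "length us = l" using vs us by auto
    let ?mu = "mu s z powr (m + n - list_order s vs)"
    have up: "C * (shubin_seminorm m s K a * shubin_seminorm n s K b) * ?mu \<le> (C1 + C2) * (shubin_seminorm m s ?N a * shubin_seminorm n s ?N b) * ?mu"
      if "0 \<le> C" "C \<le> C1 + C2" "K \<le> ?N" for C K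
      by (intro mult_right_mono mult_mono that shubin_seminorm_mono shubin_seminorm_nonneg a b mult_nonneg_nonneg)
        (use 1 2 in auto)
    have "dir_order s v = 1 \<or> dir_order s v = s" by (auto simp: dir_order_def)
    then show "cmod (iter_deriv vs (twist L L' a b) z) \<le> (C1 + C2) * (shubin_seminorm m s ?N a * shubin_seminorm n s ?N b) * ?mu"
      using order_trans[OF 1(2)[OF a b usv, folded us] up[of C1 N1]] order_trans[OF 2(2)[OF a b usv, folded us] up[of C2 N2]] 1(1) 2(1) by auto
  qed
qed

theorem twist_shubin:
  assumes s: "0 < s" and L: "bounded_linear L" "bounded_linear L'"
  shows "\<And>a b. a \<in> (shubin m s :: ('d::finite phase \<Rightarrow> complex) set) \<Longrightarrow> b \<in> shubin n s \<Longrightarrow> twist L L' a b \<in> shubin (m + n) s"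
    and "\<exists>C N. \<forall>a\<in>(shubin m s :: ('d phase \<Rightarrow> complex) set). \<forall>b\<in>shubin n s.
      shubin_seminorm (m + n) s j (twist L L' a b) \<le> C * (shubin_seminorm m s N a * shubin_seminorm n s N b)"
proof -
  have "\<forall>l. \<exists>C N. 0 \<le> C \<and> (\<forall>a\<in>(shubin m s :: ('d phase \<Rightarrow> complex) set). \<forall>b\<in>shubin n s. \<forall>vs\<in>lists Basis. length vs = l \<longrightarrow> (\<forall>z.
    cmod (iter_deriv vs (twist L L' a b) z) \<le> C * (shubin_seminorm m s N a * shubin_seminorm n s N b) * mu s z powr (m + n - list_order s vs)))"
    using twist_deriv_bound[OF s L] by blast
  then obtain C N where C0: "\<And>l. 0 \<le> C l" and C: "\<And>(a :: 'd phase \<Rightarrow> complex) b vs z. a \<in> shubin m s \<Longrightarrow> b \<in> shubin n s \<Longrightarrow> vs \<in> lists Basis \<Longrightarrow>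
    cmod (iter_deriv vs (twist L L' a b) z) \<le> C (length vs) * (shubin_seminorm m s (N (length vs)) a * shubin_seminorm n s (N (length vs)) b) * mu s z powr (m + n - list_order s vs)"
    by metis
  show mem: "twist L L' a b \<in> shubin (m + n) s" if a: "a \<in> shubin m s" and b: "b \<in> shubin n s" for a b :: "'d phase \<Rightarrow> complex"
    unfolding shubin_iff
  proof (intro conjI ballI)
    show "smooth (twist L L' a b)"
      by (rule smooth_twist[OF shubin_tempered[OF s a] shubin_tempered[OF s b] L]) (simp_all add: mu_exp_def)
    show "\<exists>C. \<forall>z. cmod (iter_deriv vs (twist L L' a b) z) \<le> C * mu s z powr (m + n - list_order s vs)"
      if "vs \<in> lists Basis" for vs using C[OF a b that] by blast
  qed
  define N' where "N' = Max (N ` {..j})"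
  define C' where "C' = (\<Sum>l\<le>j. C l)"
  have le: "C l \<le> C'" "N l \<le> N'" if "l \<le> j" for l
    unfolding C'_def N'_def using that C0 by (auto intro!: member_le_sum Max_ge)
  have "shubin_seminorm (m + n) s j (twist L L' a b) \<le> C' * (shubin_seminorm m s N' a * shubin_seminorm n s N' b)"
    if a: "a \<in> shubin m s" and b: "b \<in> shubin n s" for a b :: "'d phase \<Rightarrow> complex"
  proof (rule shubin_seminorm_least, rule order_trans[OF C[OF a b]])
    fix vs :: "'d phase list" and z assume vs: "vs \<in> lists Basis" "length vs \<le> j"
    have "0 \<le> C'" using C0 by (simp add: C'_def sum_nonneg)
    then show "C (length vs) * (shubin_seminorm m s (N (length vs)) a * shubin_seminorm n s (N (length vs)) b) * mu s z powr (m + n - list_order s vs)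
       \<le> C' * (shubin_seminorm m s N' a * shubin_seminorm n s N' b) * mu s z powr (m + n - list_order s vs)"
      by (intro mult_right_mono mult_mono le vs shubin_seminorm_mono shubin_seminorm_nonneg a b mult_nonneg_nonneg) auto
  qed
  then show "\<exists>C N. \<forall>a\<in>(shubin m s :: ('d phase \<Rightarrow> complex) set). \<forall>b\<in>shubin n s.
      shubin_seminorm (m + n) s j (twist L L' a b) \<le> C * (shubin_seminorm m s N a * shubin_seminorm n s N b)" by blast
qed

end


section \<open>Fourier multipliers with a quadratic phase\<close>

text \<open>The hyperbolic form: the chirp of this map is \<open>exp (i c (y \<bullet> \<eta>))\<close>.\<close>

definition hyp_form :: "real \<Rightarrow> 'd::finite phase \<Rightarrow> 'd phase" where
  "hyp_form c = (\<lambda>(y, \<eta>). (c *\<^sub>R \<eta>, c *\<^sub>R y))"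

lemma chirp_hyp: "c \<noteq> 0 \<Longrightarrow> chirp (hyp_form c :: 'd::finite phase \<Rightarrow> 'd phase) (hyp_form (1 / c))"
  by unfold_locales (auto simp: hyp_form_def split_beta linear_iff inner_prod_def scaleR_add_right inner_commute)

lemma hyp_form_inner: "hyp_form c (x, \<xi>) \<bullet> (x, \<xi>) = 2 * c * (x \<bullet> \<xi>)"
  by (simp add: hyp_form_def inner_commute)

lemma phase_hyp: "c \<noteq> 0 \<Longrightarrow> chirp.phase (hyp_form c) = (\<lambda>(x, \<xi>). cis (c * (x \<bullet> \<xi>)))"
proof (rule ext, clarify)
  fix x \<xi> :: "real^'d" assume c: "c \<noteq> 0"
  show "chirp.phase (hyp_form c) (x, \<xi>) = cis (c * (x \<bullet> \<xi>))"
    unfolding chirp.phase_def[OF chirp_hyp[OF c]] inner_commute[of "(x, \<xi>)"] hyp_form_inner by simp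
qed

lemma lborel_integral_reflect:
  fixes f :: "'a::euclidean_space \<Rightarrow> complex"
  assumes "f \<in> borel_measurable borel"
  shows "(LINT z|lborel. f (- z)) = (LINT z|lborel. f z)"
proof -
  have "(LINT z|lborel. f z) = (LINT z|density (distr lborel borel (\<lambda>x::'a. 0 + (-1) *\<^sub>R x)) (\<lambda>_. ennreal (\<bar>-1\<bar>^DIM('a))). f z)"
    using lborel_affine[of "-1" "0::'a"] by simp
  also have "\<dots> = (LINT z|distr lborel borel (\<lambda>x::'a. 0 + (-1) *\<^sub>R x). f z)"
    by (simp add: density_1)
  also have "\<dots> = (LINT z|lborel. f (- z))"
    using assms by (subst integral_distr) auto
  finally show ?thesis by simp
qed

lemma schwartz_reflect:
  assumes "f \<in> schwartz" shows "(\<lambda>z. f (- z)) \<in> schwartz"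
proof -
  have "bounded_linear (\<lambda>z::'a. - z)" by (intro bounded_linear_minus bounded_linear_ident)
  from schwartz_affine_iso[OF assms this, of 1 0] show ?thesis by simp
qed

lemma ft_reflect:
  assumes "f \<in> schwartz" shows "ft (\<lambda>z. f (- z)) \<zeta> = ft f (- \<zeta>)"
proof -
  have "(\<lambda>z. f z * cis (- (z \<bullet> - \<zeta>))) \<in> borel_measurable borel" using schwartz_measurable[OF assms] by measurable
  from lborel_integral_reflect[OF this] show ?thesis by (simp add: ft_def)
qed

text \<open>The normalization of the Fourier transform on phase space and of the Weyl quantization.\<close>

definition phase_mass :: "'d::finite itself \<Rightarrow> complex" where
  "phase_mass _ = of_real (1 / (2 * pi) ^ CARD('d))"

lemma phase_mass_square: "phase_mass TYPE('d::finite) * phase_mass TYPE('d) * of_real ((2 * pi) ^ DIM('d phase)) = 1"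
proof -
  have "(1 / (2 * pi) ^ CARD('d)) * (1 / (2 * pi) ^ CARD('d)) * (2 * pi) ^ (CARD('d) + CARD('d)) = 1"
    by (simp add: power_add)
  then show ?thesis unfolding phase_mass_def of_real_mult[symmetric] by simp
qed

lemma fourier_ft: "fourier f = (\<lambda>\<zeta>. phase_mass TYPE('d) * ft (f :: 'd::finite phase \<Rightarrow> complex) \<zeta>)"
  by (simp add: fourier_def ft_def phase_mass_def fun_eq_iff)

lemma inv_fourier_ft: "inv_fourier f = (\<lambda>\<zeta>. phase_mass TYPE('d) * ft (f :: 'd::finite phase \<Rightarrow> complex) (- \<zeta>))"
  by (simp add: inv_fourier_def ft_def phase_mass_def fun_eq_iff inner_commute)

lemma fourier_schwartz: "f \<in> schwartz \<Longrightarrow> fourier f \<in> schwartz"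
  unfolding fourier_ft by (intro schwartz_cmult ft_schwartz)

lemma inv_fourier_schwartz: "f \<in> schwartz \<Longrightarrow> inv_fourier f \<in> schwartz"
  unfolding inv_fourier_ft by (intro schwartz_cmult schwartz_reflect ft_schwartz)

lemma fourier_inv_fourier: "f \<in> schwartz \<Longrightarrow> fourier (inv_fourier f) = (f :: 'd::finite phase \<Rightarrow> complex)"
proof
  fix z assume f: "f \<in> schwartz"
  have "fourier (inv_fourier f) z = phase_mass TYPE('d) * (phase_mass TYPE('d) * ft (\<lambda>\<zeta>. ft f (- \<zeta>)) z)"
    unfolding fourier_ft inv_fourier_ft ft_cmult ..
  also have "ft (\<lambda>\<zeta>. ft f (- \<zeta>)) z = (LINT \<zeta>|lborel. ft f \<zeta> * cis (\<zeta> \<bullet> z))"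
    unfolding ft_reflect[OF ft_schwartz[OF f]] by (simp add: ft_def)
  also have "\<dots> = of_real ((2 * pi) ^ DIM('d phase)) * f z" by (rule ft_inversion[OF f])
  finally show "fourier (inv_fourier f) z = f z"
    using phase_mass_square[where 'd='d] by (metis mult.assoc mult_1)
qed

lemma multiplier_schwartz:
  assumes f: "f \<in> schwartz" shows "(\<lambda>z. (case z of (x, \<xi>) \<Rightarrow> cis (t * (x \<bullet> \<xi>))) * f z) \<in> (schwartz :: ('d::finite phase \<Rightarrow> complex) set)"
proof (cases "t = 0")
  case True
  then show ?thesis using f by (simp add: split_beta)
next
  case False
  from chirp.schwartz_phase_mult[OF chirp_hyp[OF False] f] show ?thesis by (simp add: phase_hyp[OF False])
qed

text \<open>The three transposes in the definition of the multiplier act on the test function in reverse order,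
  and each of them preserves Schwartz functions.\<close>

lemma exp_itD_distr_of:
  "exp_itD t (distr_of a) = (\<lambda>\<phi>\<in>schwartz. LINT z|lborel. a z *
     fourier (\<lambda>z. (case z of (x, \<xi>) \<Rightarrow> cis (t * (x \<bullet> \<xi>))) * inv_fourier \<phi> z) z)"
  unfolding exp_itD_def inv_fourier_distr_def mult_distr_def fourier_distr_def distr_of_def
  by (auto simp: fun_eq_iff restrict_def inv_fourier_schwartz multiplier_schwartz fourier_schwartz)

lemma integral_schwartz_tendsto:
  assumes f: "tconv M f g" and p: "\<phi> \<in> schwartz"
  shows "(\<lambda>k. LINT z|lborel. f k z * \<phi> z) \<longlonglongrightarrow> (LINT z|lborel. g z * \<phi> (z::'a::euclidean_space))"
proof -
  obtain K where K: "0 \<le> K" "\<And>k. bnd 0 (\<lambda>z. K * wt M z) (f k)" using tconvE[OF f] by metis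
  obtain C where C: "0 \<le> C" "\<And>z. cmod (\<phi> z) \<le> C * wt (- 2 * real DIM('a) - M) z"
    using tempered_value[OF schwartz_tempered[OF p]] by metis
  show ?thesis
  proof (rule integral_dominated_convergence)
    show "integrable lborel (\<lambda>z::'a. (K * C) * wt (- 2 * real DIM('a)) z)"
      by (intro integrable_mult_right integrable_wt) simp
    show "AE z in lborel. (\<lambda>k. f k z * \<phi> z) \<longlonglongrightarrow> g z * \<phi> z"
      by (intro AE_I2 tendsto_mult tendsto_const dconv_value[OF tconv_dconv[OF f]])
    show "AE z in lborel. norm (f k z * \<phi> z) \<le> (K * C) * wt (- 2 * real DIM('a)) z" for k
    proof (rule AE_I2)
      fix z
      have "norm (f k z * \<phi> z) \<le> (K * wt M z) * (C * wt (- 2 * real DIM('a) - M) z)"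
        unfolding norm_mult by (intro mult_mono bnd_value[OF K(2)] C) (use K in auto)
      also have "\<dots> = (K * C) * (wt M z * wt (- 2 * real DIM('a) - M) z)" by (simp only: mult_ac)
      finally show "norm (f k z * \<phi> z) \<le> (K * C) * wt (- 2 * real DIM('a)) z" unfolding wt_add[symmetric] by simp
    qed
  qed (use smooth_borel_measurable[OF tempered_smooth[OF tconv_tempered[OF f]]]
      smooth_borel_measurable[OF tempered_smooth[OF tconv_tempered_limit[OF f]]] schwartz_measurable[OF p] in measurable)
qed

context chirp
begin

text \<open>Convolution with a chirp multiplies Fourier coefficients by the conjugate chirp of the inverse
  form.\<close>

lemma twist_Fourier:
  fixes a :: "'a \<Rightarrow> complex"
  assumes al: "rapid \<alpha>" and a: "tempered 0 a" "\<And>u. a u = (LINT \<zeta>|lborel. \<alpha> \<zeta> * exponential \<zeta> u)"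
  shows "twist (\<lambda>u. u) (\<lambda>u. 0) a (\<lambda>z. 1) z = (LINT \<zeta>|lborel. \<alpha> \<zeta> * cis (- (J \<zeta> \<bullet> \<zeta>) / 2) * exponential \<zeta> z)"
proof -
  have ex: "exponential \<zeta> (z + u) = exponential \<zeta> z * exponential \<zeta> u" for \<zeta> u
    by (simp add: exponential_def inner_add_right cis_mult)
  have em: "(\<lambda>\<zeta>. exponential \<zeta> z) \<in> borel_measurable borel"
    unfolding exponential_def by (intro borel_measurable_continuous_onI continuous_intros)
  have r: "rapid (\<lambda>\<zeta>. \<alpha> \<zeta> * exponential \<zeta> z)"
    using al em by (auto simp: rapid_def norm_mult)
  have "osc (\<lambda>u. a (z + u)) = (LINT \<zeta>|lborel. (\<alpha> \<zeta> * exponential \<zeta> z) * cis (- (J \<zeta> \<bullet> \<zeta>) / 2)) * osc (\<lambda>u. 1)"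
    by (rule osc_exponential_superposition[OF r tempered_translate[OF a(1)]]) (simp add: a(2) ex mult.assoc)
  then show ?thesis using osc_one_nonzero by (simp add: twist_def mult_ac)
qed

end

(* The second parameter fixes the type of phase space, on which the chirp is interpreted. *)
context
  fixes t :: real and dummy :: "'d::finite itself"
  assumes t: "t \<noteq> 0"
begin

interpretation C: chirp "hyp_form (- 1 / t) :: 'd phase \<Rightarrow> 'd phase" "hyp_form (- t)"
  using chirp_hyp[of "- 1 / t", where 'd='d] t by simp

text \<open>By \<open>twist_Fourier\<close> the twist multiplies the Fourier coefficients by \<open>exp (i t (x \<bullet> \<xi>))\<close>: the phase
  \<open>- (x \<bullet> \<xi>) / t\<close> has the inverse form \<open>hyp_form (- t)\<close>. What remains is to move the transform from the
  symbol to the test function (\<open>ft_swap\<close>), where the reflections of the forward and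
  inverse transforms cancel.\<close>

lemma multiplier_schwartz_symbol:
  fixes a \<phi> :: "'d phase \<Rightarrow> complex"
  assumes a: "a \<in> schwartz" and p: "\<phi> \<in> schwartz"
  shows "(LINT z|lborel. C.twist (\<lambda>u. u) (\<lambda>u. 0) a (\<lambda>z. 1) z * \<phi> z) =
    (LINT z|lborel. a z * fourier (\<lambda>z. (case z of (x, \<xi>) \<Rightarrow> cis (t * (x \<bullet> \<xi>))) * inv_fourier \<phi> z) z)"
proof -
  let ?g = "\<lambda>z :: 'd phase. case z of (x, \<xi>) \<Rightarrow> cis (t * (x \<bullet> \<xi>))"
  let ?m = "phase_mass TYPE('d)"
  have m2: "of_real (1 / (2 * pi) ^ DIM('d phase)) = ?m * ?m"
  proof -
    have "DIM('d phase) = CARD('d) + CARD('d)" by simp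
    then show ?thesis
      unfolding phase_mass_def of_real_mult[symmetric] by (simp only: power_add times_divide_times_eq mult_1_left)
  qed
  have g: "cis (- (hyp_form (- t) \<zeta> \<bullet> \<zeta>) / 2) = ?g \<zeta>" for \<zeta> :: "'d phase"
    by (cases \<zeta>) (simp add: hyp_form_inner)
  define h where "h \<zeta> = ?g \<zeta> * ft a \<zeta>" for \<zeta>
  have h: "h \<in> schwartz" unfolding h_def by (rule multiplier_schwartz[OF ft_schwartz[OF a]])
  have tw: "C.twist (\<lambda>u. u) (\<lambda>u. 0) a (\<lambda>z. 1) z = ?m * ?m * ft h (- z)" for z
  proof -
    have "C.twist (\<lambda>u. u) (\<lambda>u. 0) a (\<lambda>z. 1) z = (LINT \<zeta>|lborel. fcoeff a \<zeta> * cis (- (hyp_form (- t) \<zeta> \<bullet> \<zeta>) / 2) * exponential \<zeta> z)"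
      by (rule C.twist_Fourier[OF schwartz_rapid[OF fcoeff_schwartz[OF a]] schwartz_tempered[OF a] fcoeff_representation[OF a]])
    also have "\<dots> = (LINT \<zeta>|lborel. (?m * ?m) * (h \<zeta> * cis (- (\<zeta> \<bullet> - z))))"
      unfolding fcoeff_def m2 g by (simp add: h_def exponential_def mult_ac)
    finally show ?thesis by (simp add: ft_def)
  qed
  have pr: "(\<lambda>z. \<phi> (- z)) \<in> schwartz" by (rule schwartz_reflect[OF p])
  have sm: "(\<lambda>z. ft h z * \<phi> (- z)) \<in> borel_measurable borel"
    using schwartz_measurable[OF ft_schwartz[OF h]] schwartz_measurable[OF pr] by measurable
  have "(LINT z|lborel. C.twist (\<lambda>u. u) (\<lambda>u. 0) a (\<lambda>z. 1) z * \<phi> z) = ?m * ?m * (LINT z|lborel. ft h (- z) * \<phi> (- (- z)))"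
    unfolding tw by (simp only: minus_minus mult.assoc integral_mult_right_zero)
  also have "(LINT z|lborel. ft h (- z) * \<phi> (- (- z))) = (LINT z|lborel. ft h z * \<phi> (- z))"
    by (rule lborel_integral_reflect[OF sm])
  also have "\<dots> = (LINT \<zeta>|lborel. h \<zeta> * ft (\<lambda>z. \<phi> (- z)) \<zeta>)" by (rule ft_swap[OF h pr])
  also have "\<dots> = (LINT \<zeta>|lborel. ft a \<zeta> * (?g \<zeta> * ft \<phi> (- \<zeta>)))"
    by (simp add: ft_reflect[OF p] h_def mult_ac)
  also have "\<dots> = (LINT z|lborel. a z * ft (\<lambda>\<zeta>. ?g \<zeta> * ft \<phi> (- \<zeta>)) z)"
    by (rule ft_swap[OF a multiplier_schwartz[OF schwartz_reflect[OF ft_schwartz[OF p]]]])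
  also have "?m * ?m * \<dots> = (LINT z|lborel. a z * (?m * (?m * ft (\<lambda>\<zeta>. ?g \<zeta> * ft \<phi> (- \<zeta>)) z)))"
    by (simp only: mult.left_commute[of "a _" ?m] mult.assoc integral_mult_right_zero)
  also have "\<dots> = (LINT z|lborel. a z * fourier (\<lambda>z. ?g z * inv_fourier \<phi> z) z)"
    unfolding fourier_ft inv_fourier_ft mult.left_commute[of "?g _"] ft_cmult ..
  finally show ?thesis .
qed

text \<open>Both sides are continuous when \<open>a\<close> is approximated by Gaussian cutoffs: the left one because twists are
  continuous for \<open>tconv\<close>, the right one because \<open>a\<close> is integrated against a Schwartz function.\<close>

lemma multiplier_tempered_symbol:
  fixes a :: "'d phase \<Rightarrow> complex"
  assumes a: "tempered M a" and M: "0 \<le> M"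
  shows "distr_of (C.twist (\<lambda>u. u) (\<lambda>u. 0) a (\<lambda>z. 1)) = exp_itD t (distr_of a)"
proof -
  have "(LINT z|lborel. C.twist (\<lambda>u. u) (\<lambda>u. 0) a (\<lambda>z. 1) z * \<phi> z) =
    (LINT z|lborel. a z * fourier (\<lambda>z. (case z of (x, \<xi>) \<Rightarrow> cis (t * (x \<bullet> \<xi>))) * inv_fourier \<phi> z) z)"
    if p: "\<phi> \<in> schwartz" for \<phi>
  proof -
    let ?a = "\<lambda>k u. gauss ((1 / real (Suc k)) *\<^sub>R u) * a u"
    have ta: "tconv M ?a a" by (rule C.gauss_cutoff[OF a])
    have "tconv (M + 0) (\<lambda>k. C.twist (\<lambda>u. u) (\<lambda>u. 0) (?a k) (\<lambda>z. 1)) (C.twist (\<lambda>u. u) (\<lambda>u. 0) a (\<lambda>z. 1))"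
      by (rule C.tconv_twist[OF ta tconv_const[OF tempered_const]]) (simp_all add: M bounded_linear_ident bounded_linear_zero)
    note 1 = integral_schwartz_tendsto[OF this p]
    have "fourier (\<lambda>z. (case z of (x, \<xi>) \<Rightarrow> cis (t * (x \<bullet> \<xi>))) * inv_fourier \<phi> z) \<in> schwartz"
      by (intro fourier_schwartz multiplier_schwartz inv_fourier_schwartz p)
    note 2 = integral_schwartz_tendsto[OF ta this]
    show ?thesis
      using LIMSEQ_unique[OF 1 2[folded multiplier_schwartz_symbol[OF C.gauss_cutoff_schwartz[OF a] p]]] .
  qed
  then show ?thesis unfolding exp_itD_distr_of by (auto simp: distr_of_def fun_eq_iff restrict_def)
qed

end

text \<open>For \<open>t = 0\<close>, where the chirp degenerates, the operator is the identity. Otherwise it is the twist with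
  second factor 1, a symbol of order 0.\<close>

theorem multiplier_continuous:
  fixes s m t :: real
  assumes s: "0 < s"
  shows "\<exists>T :: ('d::finite phase \<Rightarrow> complex) \<Rightarrow> ('d phase \<Rightarrow> complex).
    (\<forall>a \<in> shubin m s. T a \<in> shubin m s \<and> distr_of (T a) = exp_itD t (distr_of a)) \<and>
    continuous_map (shubin_topology m s) (shubin_topology m s) T"
proof (cases "t = 0")
  case True
  have "distr_of a = exp_itD t (distr_of a)" for a :: "'d phase \<Rightarrow> complex"
    unfolding exp_itD_distr_of True by (simp add: distr_of_def split_beta fourier_inv_fourier cong: restrict_cong)
  then show ?thesis by (intro exI[of _ "\<lambda>a. a"]) simp
next
  case False
  interpret C: chirp "hyp_form (- 1 / t) :: 'd phase \<Rightarrow> 'd phase" "hyp_form (- t)"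
    using chirp_hyp[of "- 1 / t", where 'd='d] False by simp
  let ?L = "\<lambda>u::'d phase. u" and ?L' = "\<lambda>u::'d phase. 0::'d phase"
  have L: "bounded_linear ?L" "bounded_linear ?L'" by (simp_all add: bounded_linear_ident bounded_linear_zero)
  let ?P = "C.twist ?L ?L'"
  have M: "0 \<le> mu_exp s * \<bar>q\<bar>" for q by (simp add: mu_exp_def)
  note st = shubin_tempered[OF s]
  have sub: "C.twist ?L ?L' (\<lambda>z. a z - a' z) b z = C.twist ?L ?L' a b z - C.twist ?L ?L' a' b z"
    "C.twist ?L ?L' b (\<lambda>z. a z - a' z) z = C.twist ?L ?L' b a z - C.twist ?L ?L' b a' z"
    if "a \<in> shubin q s" "a' \<in> shubin q s" "b \<in> shubin q' s" for a a' b :: "'d phase \<Rightarrow> complex" and q q' z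
    using C.twist_add_left[OF st[OF that(1)] tempered_cmult[OF st[OF that(2)], of "-1"] st[OF that(3)] L M M, of z]
      C.twist_cmult(1)[OF st[OF that(2)] st[OF that(3)] L M M, of "-1" z]
      C.twist_add_right[OF st[OF that(3)] st[OF that(1)] tempered_cmult[OF st[OF that(2)], of "-1"] L M M, of z]
      C.twist_cmult(2)[OF st[OF that(3)] st[OF that(2)] L M M, of "-1" z] by simp_all
  have cont: "continuous_map (prod_topology (shubin_topology m s) (shubin_topology 0 s)) (shubin_topology (m + 0) s) (\<lambda>(a, b). ?P a b)"
    by (rule continuous_map_shubin_bilinear[OF C.twist_shubin(1)[OF s L] sub(1) sub(2) C.twist_shubin(2)[OF s L]])
  have "continuous_map (shubin_topology m s) (prod_topology (shubin_topology m s) (shubin_topology 0 s)) (\<lambda>a. (a, \<lambda>z. 1))"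
    by (intro continuous_map_pairedI) (auto simp: topspace_shubin shubin_one[OF s])
  from continuous_map_compose[OF this cont]
  have "continuous_map (shubin_topology m s) (shubin_topology m s) (\<lambda>a. ?P a (\<lambda>z. 1))" by (simp add: o_def)
  moreover have "\<forall>a\<in>shubin m s. ?P a (\<lambda>z. 1) \<in> shubin m s \<and> distr_of (?P a (\<lambda>z. 1)) = exp_itD t (distr_of a)"
  proof (intro ballI conjI)
    fix a :: "'d phase \<Rightarrow> complex" assume a: "a \<in> shubin m s"
    show "?P a (\<lambda>z. 1) \<in> shubin m s" using C.twist_shubin(1)[OF s L a shubin_one[OF s]] by (simp only: add_0_right)
    show "distr_of (?P a (\<lambda>z. 1)) = exp_itD t (distr_of a)"
      by (rule multiplier_tempered_symbol[OF False st[OF a] M])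
  qed
  ultimately show ?thesis by (intro exI[of _ "\<lambda>a. ?P a (\<lambda>z. 1)"] conjI)
qed


section \<open>Weyl quantization as an oscillatory integral\<close>

interpretation W: chirp "hyp_form (- 1) :: 'd::finite phase \<Rightarrow> 'd phase" "hyp_form (- 1)"
  using chirp_hyp[of "- 1"] by simp

lemma W_phase: "W.phase u = cis (- (fst u \<bullet> snd u))"
  using fun_cong[OF phase_hyp[of "- 1"], of u] by (simp add: split_beta)

text \<open>In the Weyl integral the substitution \<open>y = x + v\<close> turns the phase into \<open>- (v \<bullet> \<xi>)\<close>, independent
  of \<open>x\<close>, and the midpoint \<open>(x + y) / 2\<close> into \<open>x + v / 2\<close>. The arguments are \<open>(x, (v, \<xi>))\<close>.\<close>

definition midpoint_map :: "(real^'d) \<times> 'd::finite phase \<Rightarrow> 'd phase" where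
  "midpoint_map p = (fst p + (1/2) *\<^sub>R fst (snd p), snd (snd p))"

definition endpoint_map :: "(real^'d) \<times> 'd::finite phase \<Rightarrow> real^'d" where
  "endpoint_map p = fst p + fst (snd p)"

definition weyl_amplitude :: "('d::finite phase \<Rightarrow> complex) \<Rightarrow> (real^'d \<Rightarrow> complex) \<Rightarrow> (real^'d) \<times> 'd phase \<Rightarrow> complex" where
  "weyl_amplitude a f p = a (midpoint_map p) * f (endpoint_map p)"

lemma linear_midpoint: "bounded_linear midpoint_map"
  unfolding midpoint_map_def linear_conv_bounded_linear[symmetric]
  by (auto simp: linear_iff scaleR_add_right)

lemma linear_endpoint: "bounded_linear endpoint_map"
  unfolding endpoint_map_def linear_conv_bounded_linear[symmetric]
  by (auto simp: linear_iff scaleR_add_right)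

lemma tempered_linear:
  assumes "tempered M f" "bounded_linear L" "0 \<le> M" shows "tempered M (\<lambda>z. f (L z))"
  using tempered_affine[OF assms, of 0] by simp

lemma tconv_linear:
  assumes "tconv M f g" "bounded_linear L" "0 \<le> M" shows "tconv M (\<lambda>k z. f k (L z)) (\<lambda>z. g (L z))"
  using tconv_affine[OF assms, of 0] by simp

lemma tempered_weyl_amplitude:
  assumes "tempered M a" "tempered M' f" "0 \<le> M" "0 \<le> M'"
  shows "tempered (M + M') (weyl_amplitude a f)"
  unfolding weyl_amplitude_def[abs_def]
  by (intro tempered_mult tempered_linear[OF _ linear_midpoint] tempered_linear[OF _ linear_endpoint] assms)

lemma tconv_weyl_amplitude:
  assumes "tconv M a a'" "tconv M' f f'" "0 \<le> M" "0 \<le> M'"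
  shows "tconv (M + M') (\<lambda>k. weyl_amplitude (a k) (f k)) (weyl_amplitude a' f')"
  unfolding weyl_amplitude_def[abs_def]
  by (intro tconv_mult tconv_linear[OF _ linear_midpoint] tconv_linear[OF _ linear_endpoint] assms)

text \<open>The cutoff in the definition of the Weyl integral is centred at \<open>y = 0\<close>, the phase at \<open>y = x\<close>; the
  translation is legitimate by \<open>has_osc_integral_osc\<close>.\<close>

lemma weyl_osc:
  fixes a :: "'d::finite phase \<Rightarrow> complex"
  assumes a: "tempered M a" "0 \<le> M" and f: "tempered M' f" "0 \<le> M'"
  shows "weyl a f x = phase_mass TYPE('d) * W.osc (\<lambda>u. weyl_amplitude a f (x, u))"
proof -
  define A where "A u = a ((1/2) *\<^sub>R (x + fst u), snd u) * f (fst u)" for u :: "'d phase"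
  have L: "bounded_linear (\<lambda>u :: 'd phase. ((1/2) *\<^sub>R fst u, snd u))"
    unfolding linear_conv_bounded_linear[symmetric] by (auto simp: linear_iff scaleR_add_right)
  have "tempered (M + M') (\<lambda>u. a (((1/2) *\<^sub>R x, 0) + ((1/2) *\<^sub>R fst u, snd u)) * f (fst u))"
    by (intro tempered_mult tempered_affine[OF a(1) L a(2)] tempered_linear[OF f(1) bounded_linear_fst f(2)])
  then have A: "tempered (M + M') A" by (simp add: A_def[abs_def] scaleR_add_right)
  have eq: "A ((x, 0) + u) = weyl_amplitude a f (x, u)" for u
  proof -
    have "(1/2) *\<^sub>R (x + (x + fst u)) = x + (1/2) *\<^sub>R fst u"
      by (simp add: scaleR_add_right add.assoc[symmetric] scaleR_left_distrib[symmetric])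
    then show ?thesis by (simp add: A_def weyl_amplitude_def midpoint_map_def endpoint_map_def)
  qed
  have "has_osc_integral (\<lambda>u. W.phase (u - (x, 0)) * A u) (W.osc (\<lambda>u. A ((x, 0) + u)))"
    by (rule W.has_osc_integral_osc[OF A])
  then have "has_osc_integral (\<lambda>(y, \<xi>). cis ((x - y) \<bullet> \<xi>) * a ((1 / 2) *\<^sub>R (x + y), \<xi>) * f y) (W.osc (\<lambda>u. weyl_amplitude a f (x, u)))"
    unfolding eq W_phase by (simp add: A_def case_prod_beta' mult.assoc inner_diff_left)
  from has_osc_integral_unique[OF this] show ?thesis by (simp add: weyl_def phase_mass_def)
qed

lemma tconv_weyl:
  fixes a :: "nat \<Rightarrow> 'd::finite phase \<Rightarrow> complex"
  assumes a: "tconv M a a'" "0 \<le> M" and f: "tconv M' f f'" "0 \<le> M'"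
  shows "tconv (M + M') (\<lambda>k. weyl (a k) (f k)) (weyl a' f')"
proof -
  have "weyl (a k) (f k) = (\<lambda>x. phase_mass TYPE('d) * W.osc (\<lambda>u. weyl_amplitude (a k) (f k) (x, u)))" for k
    by (rule ext) (rule weyl_osc[OF tconv_tempered[OF a(1)] a(2) tconv_tempered[OF f(1)] f(2)])
  moreover have "weyl a' f' = (\<lambda>x. phase_mass TYPE('d) * W.osc (\<lambda>u. weyl_amplitude a' f' (x, u)))"
    by (rule ext) (rule weyl_osc[OF tconv_tempered_limit[OF a(1)] a(2) tconv_tempered_limit[OF f(1)] f(2)])
  moreover have "tconv (0 + (M + M')) (\<lambda>k x. phase_mass TYPE('d) * W.osc (\<lambda>u. weyl_amplitude (a k) (f k) (x, u)))
    (\<lambda>x. phase_mass TYPE('d) * W.osc (\<lambda>u. weyl_amplitude a' f' (x, u)))"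
    by (intro tconv_mult[OF tconv_const[OF tempered_const]] W.tconv_osc_param tconv_weyl_amplitude a f) (use a f in simp)
  ultimately show ?thesis by simp
qed

lemma tempered_weyl:
  assumes "tempered M a" "0 \<le> M" "tempered M' f" "0 \<le> M'"
  shows "tempered (M + M') (weyl a f)"
  using tconv_tempered_limit[OF tconv_weyl[OF tconv_const[OF assms(1)] assms(2) tconv_const[OF assms(3)] assms(4)]] .

lemma weyl_diff:
  fixes a b :: "'d::finite phase \<Rightarrow> complex"
  assumes a: "tempered M a" and b: "tempered M b" and M: "0 \<le> M" and f: "tempered M' f" "0 \<le> M'"
  shows "weyl (\<lambda>z. a z - b z) f x = weyl a f x - weyl b f x"
proof -
  have "tempered M (\<lambda>z. a z - b z)" using tempered_add[OF a tempered_cmult[OF b, of "-1"]] by simp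
  note d = weyl_osc[OF this M f, of x]
  have MM: "0 \<le> M + M'" using M f by simp
  have "W.osc (\<lambda>u. weyl_amplitude (\<lambda>z. a z - b z) f (x, u)) = W.osc (\<lambda>u. weyl_amplitude a f (x, u)) - W.osc (\<lambda>u. weyl_amplitude b f (x, u))"
    using W.osc_diff[OF tempered_slice[OF tempered_weyl_amplitude[OF a f(1) M f(2)] MM] tempered_slice[OF tempered_weyl_amplitude[OF b f(1) M f(2)] MM], of x x]
    by (simp add: weyl_amplitude_def left_diff_distrib)
  then show ?thesis unfolding d weyl_osc[OF a M f] weyl_osc[OF b M f] by (simp add: right_diff_distrib)
qed

subsection \<open>Exponential symbols\<close>

lemma schwartz_tensor:
  fixes f :: "'a::euclidean_space \<Rightarrow> complex" and g :: "'b::euclidean_space \<Rightarrow> complex"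
  assumes f: "f \<in> schwartz" and g: "g \<in> schwartz"
  shows "(\<lambda>p. f (fst p) * g (snd p)) \<in> schwartz"
proof -
  have "\<exists>C. bnd N (\<lambda>z. C * wt M z) (\<lambda>p :: 'a \<times> 'b. f (fst p) * g (snd p))" for N M
  proof -
    define r where "r = \<bar>M\<bar>"
    obtain C where C: "0 \<le> C" "bnd N (\<lambda>z. C * wt (- r) z) f" using temperedE[OF schwartz_tempered[OF f]] by metis
    obtain D where D: "0 \<le> D" "bnd N (\<lambda>z. D * wt (- r) z) g" using temperedE[OF schwartz_tempered[OF g]] by metis
    have "bnd N (\<lambda>p :: 'a \<times> 'b. 1^N * (C * wt (- r) (0 + fst p))) (\<lambda>p. f (0 + fst p))"
      by (rule bnd_affine[OF bounded_linear_fst _ _ C(2)]) (auto simp: norm_fst_le)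
    then have 1: "bnd N (\<lambda>p :: 'a \<times> 'b. C * wt (- r) (fst p)) (\<lambda>p. f (fst p))" by simp
    have "bnd N (\<lambda>p :: 'a \<times> 'b. 1^N * (D * wt (- r) (0 + snd p))) (\<lambda>p. g (0 + snd p))"
      by (rule bnd_affine[OF bounded_linear_snd _ _ D(2)]) (auto simp: norm_snd_le)
    then have 2: "bnd N (\<lambda>p :: 'a \<times> 'b. D * wt (- r) (snd p)) (\<lambda>p. g (snd p))" by simp
    have w: "wt (- r) u * wt (- r) v \<le> wt M (u, v)" for u :: 'a and v :: 'b
    proof -
      have "wt (- r) u * wt (- r) v \<le> wt (- r) (u, v)" by (rule wt_Pair_ge) (simp add: r_def)
      also have "\<dots> \<le> wt M (u, v)" by (rule wt_mono) (simp add: r_def)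
      finally show ?thesis .
    qed
    have "bnd N (\<lambda>z. (2^N * C * D) * wt M z) (\<lambda>p :: 'a \<times> 'b. f (fst p) * g (snd p))"
    proof (rule bnd_mono[OF bnd_mult[OF 1 2]])
      fix p :: "'a \<times> 'b"
      show "2 ^ N * (C * wt (- r) (fst p) * (D * wt (- r) (snd p))) \<le> (2^N * C * D) * wt M p"
        using mult_left_mono[OF w[of "fst p" "snd p"], of "2^N * C * D"] C D by (simp add: mult_ac)
    qed simp
    then show ?thesis by blast
  qed
  then show ?thesis by (simp add: schwartz_iff tempered_def)
qed

text \<open>The rigorous form of \<open>\<integral> exp (i (q - y) \<bullet> \<xi>) d\<xi> = (2 \<pi>)\<^sup>d \<delta>(y - q)\<close>, by a Gaussian cutoff in \<open>\<xi>\<close>.\<close>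

lemma weyl_delta_schwartz:
  fixes g :: "real^'d::finite \<Rightarrow> complex"
  assumes g: "g \<in> schwartz"
  shows "W.osc (\<lambda>u. g (fst u) * exponential q (snd u)) = of_real ((2 * pi) ^ CARD('d)) * g q"
proof -
  let ?e = "\<lambda>k. 1 / real (Suc k)"
  let ?m = "complex_of_real (gauss_mass TYPE(real^'d))"
  have e: "0 < ?e k" for k by simp
  have gs: "(\<lambda>\<xi>::real^'d. gauss (?e k *\<^sub>R \<xi>)) \<in> schwartz" for k by (rule schwartz_scale[OF gauss_schwartz]) simp
  define h where "h k \<xi> = gauss (?e k *\<^sub>R \<xi>) * exponential q \<xi>" for k \<xi>
  have hs: "h k \<in> schwartz" for k
    unfolding h_def by (rule schwartz_mult_tempered[OF gs tempered_exponential])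
  have gm: "g \<in> borel_measurable borel" by (rule schwartz_measurable[OF g])
  have F: "(\<lambda>u. g (fst u) * h k (snd u)) \<in> schwartz" for k by (rule schwartz_tensor[OF g hs])
  have tc: "tconv 0 (\<lambda>k \<xi>. h k \<xi>) (exponential q)"
    using tconv_mult[OF tconv_cutoff[OF gauss_schwartz gauss_0 inverse_Suc_tendsto] tconv_const[OF tempered_exponential[of q]]] by (simp add: h_def[abs_def])
  have "tconv (0 + 0) (\<lambda>k u. g (fst u) * h k (snd u)) (\<lambda>u :: 'd phase. g (fst u) * exponential q (snd u))"
    by (intro tconv_mult tconv_linear[OF tc bounded_linear_snd] tconv_const tempered_linear[OF schwartz_tempered[OF g] bounded_linear_fst]) simp_all
  from W.osc_tendsto[OF this]
  have "(\<lambda>k. W.osc (\<lambda>u. g (fst u) * h k (snd u))) \<longlonglongrightarrow> W.osc (\<lambda>u. g (fst u) * exponential q (snd u))" .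
  moreover have "W.osc (\<lambda>u. g (fst u) * h k (snd u)) = ?m * (LINT v|lborel. g (q + ?e k *\<^sub>R v) * gauss v)" for k
  proof -
    have i: "integrable (lborel \<Otimes>\<^sub>M lborel) (\<lambda>u :: 'd phase. W.phase u * (g (fst u) * h k (snd u)))"
      unfolding lborel_prod by (rule W.phase_integrable[OF F])
    have "W.osc (\<lambda>u. g (fst u) * h k (snd u)) = (LINT u|(lborel \<Otimes>\<^sub>M lborel). W.phase u * (g (fst u) * h k (snd u)))"
      unfolding lborel_prod by (rule W.osc_schwartz[OF F])
    also have "\<dots> = (LINT y|lborel. (LINT \<xi>|lborel. W.phase (y, \<xi>) * (g y * h k \<xi>)))"
      using lborel_pair.integral_fst'[OF i] by simp
    also have "\<dots> = (LINT y|lborel. g y * (LINT \<xi>|lborel. gauss (?e k *\<^sub>R \<xi>) * cis (\<xi> \<bullet> (q - y))))"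
    proof (rule Bochner_Integration.integral_cong[OF refl])
      fix y
      have "W.phase (y, \<xi>) * (g y * h k \<xi>) = g y * (gauss (?e k *\<^sub>R \<xi>) * cis (\<xi> \<bullet> (q - y)))" for \<xi>
      proof -
        have "cis (- (y \<bullet> \<xi>)) * cis (q \<bullet> \<xi>) = cis (\<xi> \<bullet> (q - y))"
          by (simp add: cis_mult inner_diff_right inner_commute)
        then have "W.phase (y, \<xi>) * exponential q \<xi> = cis (\<xi> \<bullet> (q - y))" by (simp only: W_phase fst_conv snd_conv exponential_def)
        moreover have "W.phase (y, \<xi>) * (g y * h k \<xi>) = g y * (gauss (?e k *\<^sub>R \<xi>) * (W.phase (y, \<xi>) * exponential q \<xi>))"
          unfolding h_def by (simp only: mult_ac)
        ultimately show ?thesis by (simp only:)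
      qed
      then show "(LINT \<xi>|lborel. W.phase (y, \<xi>) * (g y * h k \<xi>)) = g y * (LINT \<xi>|lborel. gauss (?e k *\<^sub>R \<xi>) * cis (\<xi> \<bullet> (q - y)))"
        by (simp only: integral_mult_right_zero)
    qed
    also have "\<dots> = ?m * (LINT v|lborel. g (q + ?e k *\<^sub>R v) * gauss v)" by (rule gauss_smoothing[OF gm e])
    finally show ?thesis .
  qed
  ultimately have "(\<lambda>k. ?m * (LINT v|lborel. g (q + ?e k *\<^sub>R v) * gauss v)) \<longlonglongrightarrow> W.osc (\<lambda>u. g (fst u) * exponential q (snd u))"
    by (simp only:)
  moreover have "(\<lambda>k. ?m * (LINT v|lborel. g (q + ?e k *\<^sub>R v) * gauss v)) \<longlonglongrightarrow> ?m * (?m * g q)"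
    by (intro tendsto_mult tendsto_const gauss_approximate_identity[OF schwartz_tempered[OF g, of 0]])
  ultimately have "W.osc (\<lambda>u. g (fst u) * exponential q (snd u)) = ?m * (?m * g q)" by (rule LIMSEQ_unique)
  moreover have "?m * ?m = of_real ((2 * pi) ^ CARD('d))"
    using gauss_mass_square[where 'a="real^'d"] by (simp only: of_real_mult[symmetric]) simp
  ultimately show ?thesis by (simp only: mult.assoc[symmetric])
qed

lemma weyl_delta:
  fixes g :: "real^'d::finite \<Rightarrow> complex"
  assumes g: "tempered M g" and M: "0 \<le> M"
  shows "W.osc (\<lambda>u. g (fst u) * exponential q (snd u)) = of_real ((2 * pi) ^ CARD('d)) * g q"
proof -
  let ?g = "\<lambda>k y. gauss ((1 / real (Suc k)) *\<^sub>R y) * g y"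
  have gs: "?g k \<in> schwartz" for k
    by (rule schwartz_mult_tempered[OF schwartz_scale[OF gauss_schwartz] g]) simp
  have tc: "tconv M ?g g"
    using tconv_mult[OF tconv_cutoff[OF gauss_schwartz gauss_0 inverse_Suc_tendsto] tconv_const[OF g]] by (simp del: of_nat_Suc)
  have "tconv (M + 0) (\<lambda>k u. ?g k (fst u) * exponential q (snd u)) (\<lambda>u :: 'd phase. g (fst u) * exponential q (snd u))"
    by (intro tconv_mult tconv_linear[OF tc bounded_linear_fst M] tconv_const tempered_linear[OF tempered_exponential bounded_linear_snd]) simp
  from W.osc_tendsto[OF this]
  have "(\<lambda>k. of_real ((2 * pi) ^ CARD('d)) * ?g k q) \<longlonglongrightarrow> W.osc (\<lambda>u. g (fst u) * exponential q (snd u))"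
    unfolding weyl_delta_schwartz[OF gs] .
  moreover have "(\<lambda>k. of_real ((2 * pi) ^ CARD('d)) * ?g k q) \<longlonglongrightarrow> of_real ((2 * pi) ^ CARD('d)) * g q"
    by (intro tendsto_mult tendsto_const dconv_value[OF tconv_dconv[OF tc]])
  ultimately show ?thesis by (rule LIMSEQ_unique)
qed

text \<open>The Weyl operator with symbol \<open>exponential \<zeta>\<close>: for \<open>\<zeta> = (p, q)\<close> it is \<open>exp (i (p \<bullet> x + q \<bullet> D))\<close>, a translation
  by \<open>q\<close> and a modulation by \<open>p\<close>.\<close>

definition weyl_shift :: "'d::finite phase \<Rightarrow> (real^'d \<Rightarrow> complex) \<Rightarrow> real^'d \<Rightarrow> complex" where
  "weyl_shift \<zeta> f x = cis (fst \<zeta> \<bullet> (x + (1/2) *\<^sub>R snd \<zeta>)) * f (x + snd \<zeta>)"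

lemma osc_weyl_amplitude_exponential:
  fixes f :: "real^'d::finite \<Rightarrow> complex"
  assumes f: "tempered M f" "0 \<le> M"
  shows "phase_mass TYPE('d) * W.osc (\<lambda>u. weyl_amplitude (exponential \<zeta>) f (x, u)) = weyl_shift \<zeta> f x"
proof -
  define g where "g y = exponential (fst \<zeta>) (x + (1/2) *\<^sub>R y) * f (x + y)" for y
  have "tempered (0 + M) g" unfolding g_def
    by (intro tempered_mult tempered_affine[OF tempered_exponential bounded_linear_scaleR_right] tempered_translate f) simp
  then have g: "tempered M g" by simp
  have "weyl_amplitude (exponential \<zeta>) f (x, u) = g (fst u) * exponential (snd \<zeta>) (snd u)" for u
    by (cases \<zeta>) (simp add: weyl_amplitude_def midpoint_map_def endpoint_map_def exponential_def g_def cis_mult mult_ac add.commute)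
  then have "W.osc (\<lambda>u. weyl_amplitude (exponential \<zeta>) f (x, u)) = of_real ((2 * pi) ^ CARD('d)) * g (snd \<zeta>)"
    using weyl_delta[OF g f(2), of "snd \<zeta>"] by simp
  moreover have "phase_mass TYPE('d) * of_real ((2 * pi) ^ CARD('d)) = 1"
    unfolding phase_mass_def of_real_mult[symmetric] by simp
  ultimately have "phase_mass TYPE('d) * W.osc (\<lambda>u. weyl_amplitude (exponential \<zeta>) f (x, u)) = g (snd \<zeta>)"
    by (simp only: mult.assoc[symmetric] mult_1_left)
  then show ?thesis by (simp add: g_def weyl_shift_def exponential_def)
qed

text \<open>The frequencies \<open>K z\<close> depend linearly on the variable of integration: with \<open>K = id\<close> this is the Fourier
  representation of one symbol, with \<open>K (\<zeta>, \<zeta>') = \<zeta> + \<zeta>'\<close> that of the Moyal product.\<close>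

lemma weyl_superposition:
  fixes a :: "'d::finite phase \<Rightarrow> complex" and \<alpha> :: "'z::euclidean_space \<Rightarrow> complex"
  assumes al: "rapid \<alpha>" and K: "bounded_linear K"
    and a: "tempered M a" "0 \<le> M" "\<And>w. a w = (LINT z|lborel. \<alpha> z * exponential (K z) w)"
    and f: "tempered M' f" "0 \<le> M'"
  shows "weyl a f x = (LINT z|lborel. \<alpha> z * weyl_shift (K z) f x)"
proof -
  let ?A = "\<lambda>p :: 'z \<times> 'd phase. weyl_amplitude (exponential (K (fst p))) f (x, snd p)"
  have MM: "0 \<le> M + M'" using a f by simp
  have fc: "continuous_on UNIV f" by (rule smooth_continuous_on[OF tempered_smooth[OF f(1)]])
  have "continuous_on UNIV ?A"
    unfolding weyl_amplitude_def exponential_def midpoint_map_def endpoint_map_def fst_conv snd_conv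
    by (intro continuous_intros continuous_on_compose2[OF fc] bounded_linear.continuous_on[OF K]) auto
  then have Am: "?A \<in> borel_measurable borel" by (rule borel_measurable_continuous_onI)
  have sl: "tempered (M + M') (\<lambda>u. weyl_amplitude b f (x, u))" if "tempered M b" for b
    by (rule tempered_slice[OF tempered_weyl_amplitude[OF that f(1) a(2) f(2)] MM])
  have "W.osc (\<lambda>u. weyl_amplitude a f (x, u)) = (LINT z|lborel. \<alpha> z * W.osc (\<lambda>u. ?A (z, u)))"
  proof (rule W.osc_superposition[OF al Am _ _ sl[OF a(1)]])
    show "tempered (M + M') (\<lambda>u. ?A (z, u))" for z
      using sl[OF tempered_mono[OF tempered_exponential a(2)]] by simp
    show "weyl_amplitude a f (x, u) = (LINT z|lborel. \<alpha> z * ?A (z, u))" for u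
      by (simp add: weyl_amplitude_def a(3) mult.assoc[symmetric])
    fix N
    obtain Bm where Bm: "1 \<le> Bm" "\<And>p. norm (midpoint_map p :: 'd phase) \<le> Bm * norm p"
      using bounded_linear_bound[OF linear_midpoint] by blast
    obtain BK where BK: "1 \<le> BK" "\<And>z. norm (K z) \<le> BK * norm z" using bounded_linear_bound[OF K] by blast
    obtain Cf where Cf: "0 \<le> Cf" "bnd N (\<lambda>u. Cf * wt (M + M') u) (\<lambda>p. f (endpoint_map p))"
      using temperedE[OF tempered_mono[OF tempered_linear[OF f(1) linear_endpoint f(2)], of "M + M'"]] a(2) by auto
    show "\<exists>C L. \<forall>z. bnd N (\<lambda>u. (C * wt L z) * wt (M + M') u) (\<lambda>u. ?A (z, u))"
    proof (intro exI allI)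
      fix z
      have "bnd N (\<lambda>p. Bm^N * wt (real N) (K z)) (\<lambda>p. exponential (K z) (0 + midpoint_map p))"
        by (rule bnd_affine[OF linear_midpoint Bm(2,1) bnd_exponential])
      then have e: "bnd N (\<lambda>p. (Bm^N * wt (real N) (K z)) * wt 0 p) (\<lambda>p. exponential (K z) (midpoint_map p))" by simp
      from bnd_wt_mult[OF e Cf(2)]
      have "bnd N (\<lambda>p. (2^N * (Bm^N * wt (real N) (K z)) * Cf) * wt (M + M') p) (weyl_amplitude (exponential (K z)) f)"
        by (simp add: weyl_amplitude_def[abs_def])
      then have sl: "bnd N (\<lambda>u. (2^N * (Bm^N * wt (real N) (K z)) * Cf) * wt (M + M') (x, u)) (\<lambda>u. weyl_amplitude (exponential (K z)) f (x, u))"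
        by (rule bnd_slice)
      have "bnd N (\<lambda>u. ((2^N * Bm^N * BK powr real N * Cf * wt (M + M') x) * wt (real N) z) * wt (M + M') u)
        (\<lambda>u. weyl_amplitude (exponential (K z)) f (x, u))"
      proof (rule bnd_mono[OF sl])
        fix u :: "'d phase"
        have "(2^N * (Bm^N * wt (real N) (K z)) * Cf) * wt (M + M') (x, u)
          \<le> (2^N * (Bm^N * (BK powr real N * wt (real N) z)) * Cf) * (wt (M + M') x * wt (M + M') u)"
          by (intro mult_mono wt_Pair_le MM mult_left_mono mult_right_mono wt_linear_le BK) (use Cf Bm in auto)
        then show "(2^N * (Bm^N * wt (real N) (K z)) * Cf) * wt (M + M') (x, u)
          \<le> ((2^N * Bm^N * BK powr real N * Cf * wt (M + M') x) * wt (real N) z) * wt (M + M') u"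
          by (simp only: mult_ac)
      qed simp
      then show "bnd N (\<lambda>u. ((2^N * Bm^N * BK powr real N * Cf * wt (M + M') x) * wt (real N) z) * wt (M + M') u) (\<lambda>u. ?A (z, u))"
        by (simp only: fst_conv snd_conv)
    qed
  qed
  then have "weyl a f x = phase_mass TYPE('d) * (LINT z|lborel. \<alpha> z * W.osc (\<lambda>u. weyl_amplitude (exponential (K z)) f (x, u)))"
    unfolding weyl_osc[OF a(1,2) f] by simp
  also have "\<dots> = (LINT z|lborel. \<alpha> z * (phase_mass TYPE('d) * W.osc (\<lambda>u. weyl_amplitude (exponential (K z)) f (x, u))))"
    by (simp only: integral_mult_right_zero[symmetric] mult.left_commute)
  finally show ?thesis unfolding osc_weyl_amplitude_exponential[OF f] .
qed


section \<open>The Moyal product\<close>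

text \<open>The form for which the chirp at \<open>((y, \<eta>), (y', \<eta>'))\<close> is \<open>exp (2 i (y \<bullet> \<eta>' - y' \<bullet> \<eta>))\<close>, the kernel of the
  Moyal product.\<close>

definition sympl :: "'d::finite phase \<times> 'd phase \<Rightarrow> 'd phase \<times> 'd phase" where
  "sympl w = ((2 *\<^sub>R snd (snd w), - 2 *\<^sub>R fst (snd w)), (- 2 *\<^sub>R snd (fst w), 2 *\<^sub>R fst (fst w)))"

definition sympl_inv :: "'d::finite phase \<times> 'd phase \<Rightarrow> 'd phase \<times> 'd phase" where
  "sympl_inv w = (((1/2) *\<^sub>R snd (snd w), - (1/2) *\<^sub>R fst (snd w)), (- (1/2) *\<^sub>R snd (fst w), (1/2) *\<^sub>R fst (fst w)))"

interpretation S: chirp "sympl :: 'd::finite phase \<times> 'd phase \<Rightarrow> 'd phase \<times> 'd phase" sympl_inv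
  by unfold_locales
    (auto simp: sympl_def sympl_inv_def linear_iff inner_prod_def scaleR_add_right inner_commute)

definition moyal :: "('d::finite phase \<Rightarrow> complex) \<Rightarrow> ('d phase \<Rightarrow> complex) \<Rightarrow> 'd phase \<Rightarrow> complex" where
  "moyal = S.twist fst snd"

text \<open>The failure of the phase space shifts to form a group (\<open>weyl_shift_compose\<close>). It is also the factor by
  which the chirp of \<open>sympl\<close> multiplies Fourier coefficients (\<open>sympl_inv_inner\<close>); this
  coincidence is the reason why the Moyal product is operator composition.\<close>

definition cocycle :: "'d::finite phase \<Rightarrow> 'd phase \<Rightarrow> complex" where
  "cocycle \<zeta> \<zeta>' = cis ((fst \<zeta>' \<bullet> snd \<zeta> - fst \<zeta> \<bullet> snd \<zeta>') / 2)"

lemma sympl_inv_inner: "cis (- (sympl_inv w \<bullet> w) / 2) = cocycle (fst w) (snd w)"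
proof -
  have "- (sympl_inv w \<bullet> w) / 2 = (fst (snd w) \<bullet> snd (fst w) - fst (fst w) \<bullet> snd (snd w)) / 2"
    by (simp add: sympl_inv_def inner_prod_def inner_commute field_simps)
  then show ?thesis by (simp add: cocycle_def)
qed

lemma weyl_shift_compose:
  "weyl_shift \<zeta> (\<lambda>y. c * weyl_shift \<zeta>' f y) x = c * (cocycle \<zeta> \<zeta>' * weyl_shift (\<zeta> + \<zeta>') f x)"
proof -
  have "fst \<zeta> \<bullet> (x + (1/2) *\<^sub>R snd \<zeta>) + fst \<zeta>' \<bullet> (x + snd \<zeta> + (1/2) *\<^sub>R snd \<zeta>')
    = (fst \<zeta>' \<bullet> snd \<zeta> - fst \<zeta> \<bullet> snd \<zeta>') / 2 + fst (\<zeta> + \<zeta>') \<bullet> (x + (1/2) *\<^sub>R snd (\<zeta> + \<zeta>'))"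
    by (simp add: inner_add_left inner_add_right scaleR_add_right field_simps)
  then have "cis (fst \<zeta> \<bullet> (x + (1/2) *\<^sub>R snd \<zeta>)) * cis (fst \<zeta>' \<bullet> (x + snd \<zeta> + (1/2) *\<^sub>R snd \<zeta>'))
    = cocycle \<zeta> \<zeta>' * cis (fst (\<zeta> + \<zeta>') \<bullet> (x + (1/2) *\<^sub>R snd (\<zeta> + \<zeta>')))"
    by (simp only: cis_mult cocycle_def)
  moreover have "x + snd \<zeta> + snd \<zeta>' = x + snd (\<zeta> + \<zeta>')" by (simp add: add.assoc)
  ultimately show ?thesis unfolding weyl_shift_def by (simp only: mult_ac)
qed

lemma schwartz_bounded: "f \<in> schwartz \<Longrightarrow> \<exists>C\<ge>0. \<forall>x. cmod (f x) \<le> C"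
  using tempered_value[OF schwartz_tempered, of f 0] by (metis mult.right_neutral wt_0)

lemma rapid_tensor:
  assumes "f \<in> schwartz" "g \<in> schwartz" "k \<in> borel_measurable borel" "\<And>z. cmod (k z) \<le> 1"
  shows "rapid (\<lambda>z. f (fst z) * g (snd z) * k z)"
  unfolding rapid_def
proof (intro conjI allI)
  have s: "(\<lambda>z. f (fst z) * g (snd z)) \<in> schwartz" by (rule schwartz_tensor[OF assms(1,2)])
  show "(\<lambda>z. f (fst z) * g (snd z) * k z) \<in> borel_measurable borel"
    using borel_measurable_times[OF schwartz_measurable[OF s] assms(3)] .
  fix L
  obtain C where C: "0 \<le> C" "\<And>z. cmod (f (fst z) * g (snd z)) \<le> C * wt L z"
    using tempered_value[OF schwartz_tempered[OF s]] by metis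
  have "cmod (f (fst z) * g (snd z) * k z) \<le> C * wt L z" for z
    using mult_mono[OF C(2)[of z] assms(4)[of z]] C(1) by (simp add: norm_mult)
  then show "\<exists>C\<ge>0. \<forall>z. cmod (f (fst z) * g (snd z) * k z) \<le> C * wt L z" using C(1) by blast
qed

lemma cocycle_continuous: "continuous_on UNIV (\<lambda>z. cocycle (fst z) (snd z))"
  unfolding cocycle_def by (intro continuous_intros) auto

lemma exponential_continuous: "continuous_on UNIV (\<lambda>z. exponential (fst z + snd z) w)"
  unfolding exponential_def by (intro continuous_intros)

text \<open>The amplitude is a function on pairs of phase space points whose Fourier coefficients are products of
  those of \<open>a\<close> and \<open>b\<close>; each exponential contributes its cocycle.\<close>

lemma moyal_Fourier:
  fixes a b :: "'d::finite phase \<Rightarrow> complex"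
  assumes a: "a \<in> schwartz" and b: "b \<in> schwartz"
  shows "moyal a b w = (LINT z|lborel. (fcoeff a (fst z) * fcoeff b (snd z) * cocycle (fst z) (snd z)) * exponential (fst z + snd z) w)"
proof -
  let ?\<alpha> = "fcoeff a" and ?\<beta> = "fcoeff b"
  have al: "?\<alpha> \<in> schwartz" "?\<beta> \<in> schwartz" by (intro fcoeff_schwartz a b)+
  have em: "(\<lambda>z :: 'd phase \<times> 'd phase. exponential (fst z + snd z) w) \<in> borel_measurable borel"
    by (rule borel_measurable_continuous_onI[OF exponential_continuous])
  have r: "rapid (\<lambda>z. ?\<alpha> (fst z) * ?\<beta> (snd z) * exponential (fst z + snd z) w)"
    by (rule rapid_tensor[OF al em]) simp
  have t: "tempered 0 (\<lambda>u :: 'd phase \<times> 'd phase. a (w + fst u) * b (w + snd u))"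
    using tempered_mult[OF tempered_affine[OF schwartz_tempered[OF a, of 0] bounded_linear_fst] tempered_affine[OF schwartz_tempered[OF b, of 0] bounded_linear_snd], of w w] by simp
  have rep: "a (w + fst u) * b (w + snd u) = (LINT z|lborel. (?\<alpha> (fst z) * ?\<beta> (snd z) * exponential (fst z + snd z) w) * exponential z u)"
    for u :: "'d phase \<times> 'd phase"
  proof -
    let ?F = "\<lambda>z. (?\<alpha> (fst z) * ?\<beta> (snd z) * exponential (fst z + snd z) w) * exponential z u"
    have F: "?F (\<zeta>, \<zeta>') = (?\<alpha> \<zeta> * exponential \<zeta> (w + fst u)) * (?\<beta> \<zeta>' * exponential \<zeta>' (w + snd u))" for \<zeta> \<zeta>'
    proof -
      have "exponential (\<zeta> + \<zeta>') w * exponential (\<zeta>, \<zeta>') u = exponential \<zeta> (w + fst u) * exponential \<zeta>' (w + snd u)"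
        by (simp add: exponential_def cis_mult inner_add_left inner_add_right inner_prod_def algebra_simps)
      then show ?thesis by (simp add: mult_ac)
    qed
    have i: "integrable (lborel \<Otimes>\<^sub>M lborel) ?F"
    proof -
      have m: "(\<lambda>z. exponential (fst z + snd z) w * exponential z u) \<in> borel_measurable borel"
        unfolding exponential_def by (intro borel_measurable_continuous_onI continuous_intros)
      have "integrable (lborel \<Otimes>\<^sub>M lborel) (\<lambda>(x, y). ?\<alpha> x * (?\<beta> y * (\<lambda>z. exponential (fst z + snd z) w * exponential z u) (x, y)))"
        by (rule schwartz_prod_bound[OF al m]) (simp add: norm_mult)
      then show ?thesis by (simp add: case_prod_beta' mult.assoc)
    qed
    have "(LINT z|lborel. ?F z) = (LINT z|(lborel \<Otimes>\<^sub>M lborel). ?F z)" by (simp only: lborel_prod)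
    also have "\<dots> = (LINT \<zeta>|lborel. (LINT \<zeta>'|lborel. ?F (\<zeta>, \<zeta>')))"
      using lborel_pair.integral_fst'[OF i] by (simp only:)
    also have "\<dots> = (LINT \<zeta>|lborel. ?\<alpha> \<zeta> * exponential \<zeta> (w + fst u)) * (LINT \<zeta>'|lborel. ?\<beta> \<zeta>' * exponential \<zeta>' (w + snd u))"
      unfolding F integral_mult_right_zero integral_mult_left_zero ..
    finally show ?thesis using fcoeff_representation[OF a, of "w + fst u"] fcoeff_representation[OF b, of "w + snd u"] by simp
  qed
  have "S.osc (\<lambda>u. a (w + fst u) * b (w + snd u))
    = (LINT z|lborel. (?\<alpha> (fst z) * ?\<beta> (snd z) * exponential (fst z + snd z) w) * cis (- (sympl_inv z \<bullet> z) / 2)) * S.osc (\<lambda>u :: 'd phase \<times> 'd phase. 1)"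
    using S.osc_exponential_superposition[OF r t rep] .
  moreover have "S.osc (\<lambda>u :: 'd phase \<times> 'd phase. 1) \<noteq> 0" by (rule S.osc_one_nonzero)
  ultimately show ?thesis unfolding moyal_def S.twist_def sympl_inv_inner by (simp add: mult_ac)
qed

lemma tempered_moyal:
  assumes "tempered M a" "tempered M' b" "0 \<le> M" "0 \<le> M'" shows "tempered (M + M') (moyal a b)"
  unfolding moyal_def by (intro S.tempered_twist assms bounded_linear_fst bounded_linear_snd)

text \<open>Both sides are the double integral of the coefficients of \<open>a\<close> and \<open>b\<close> against
  \<open>cocycle \<zeta> \<zeta>'\<close> and the shift by \<open>\<zeta> + \<zeta>'\<close>.\<close>

lemma weyl_moyal_schwartz:
  fixes a b :: "'d::finite phase \<Rightarrow> complex"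
  assumes a: "a \<in> schwartz" and b: "b \<in> schwartz" and f: "f \<in> schwartz"
  shows "weyl (moyal a b) f x = weyl a (weyl b f) x"
proof -
  let ?\<alpha> = "fcoeff a" and ?\<beta> = "fcoeff b"
  have al: "?\<alpha> \<in> schwartz" "?\<beta> \<in> schwartz" by (intro fcoeff_schwartz a b)+
  note t0 = schwartz_tempered[of _ 0]
  let ?\<gamma> = "\<lambda>z. ?\<alpha> (fst z) * ?\<beta> (snd z) * cocycle (fst z) (snd z)"
  have g: "rapid ?\<gamma>"
    by (rule rapid_tensor[OF al borel_measurable_continuous_onI[OF cocycle_continuous]]) (simp add: cocycle_def)
  have K: "bounded_linear (\<lambda>z :: 'd phase \<times> 'd phase. fst z + snd z)"
    by (intro bounded_linear_add bounded_linear_fst bounded_linear_snd)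
  have mt: "tempered 0 (moyal a b)" using tempered_moyal[OF t0[OF a] t0[OF b]] by simp
  have "weyl (moyal a b) f x = (LINT z|lborel. ?\<gamma> z * weyl_shift (fst z + snd z) f x)"
    by (rule weyl_superposition[OF g K mt _ moyal_Fourier[OF a b] t0[OF f]]) simp_all
  also have "\<dots> = (LINT z|(lborel \<Otimes>\<^sub>M lborel). ?\<gamma> z * weyl_shift (fst z + snd z) f x)" by (simp only: lborel_prod)
  also have "\<dots> = (LINT \<zeta>|lborel. (LINT \<zeta>'|lborel. ?\<alpha> \<zeta> * ?\<beta> \<zeta>' * cocycle \<zeta> \<zeta>' * weyl_shift (\<zeta> + \<zeta>') f x))"
  proof -
    obtain C where C: "0 \<le> C" "\<And>x. cmod (f x) \<le> C" using schwartz_bounded[OF f] by blast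
    have fc: "continuous_on UNIV f" by (rule smooth_continuous_on[OF schwartz_smooth[OF f]])
    have Cp: "0 < C + 1" using C by simp
    have nz: "complex_of_real (C + 1) \<noteq> 0" using Cp by (metis of_real_eq_0_iff less_irrefl)
    \<comment> \<open>Normalized so as to be bounded by 1, as the product estimate requires.\<close>
    define k where "k z = cocycle (fst z) (snd z) * weyl_shift (fst z + snd z) f x / of_real (C + 1)" for z
    have km: "k \<in> borel_measurable borel"
      unfolding k_def[abs_def] weyl_shift_def cocycle_def
      by (intro borel_measurable_continuous_onI continuous_intros continuous_on_compose2[OF fc]) (use nz in \<open>auto simp del: of_real_add\<close>)
    have k1: "cmod (k (u, v)) \<le> 1" for u v
      using C(2)[of "x + snd (u + v)"] Cp
      by (simp add: k_def weyl_shift_def cocycle_def norm_mult norm_divide del: of_real_add)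
    have "integrable (lborel \<Otimes>\<^sub>M lborel) (\<lambda>(u, v). ?\<alpha> u * (?\<beta> v * k (u, v)))"
      by (rule schwartz_prod_bound[OF al km k1])
    then have "integrable (lborel \<Otimes>\<^sub>M lborel) (\<lambda>z. of_real (C + 1) * (case z of (u, v) \<Rightarrow> ?\<alpha> u * (?\<beta> v * k (u, v))))"
      by (rule integrable_mult_right)
    moreover have "of_real (C + 1) * (case z of (u, v) \<Rightarrow> ?\<alpha> u * (?\<beta> v * k (u, v))) = ?\<gamma> z * weyl_shift (fst z + snd z) f x" for z
      using nz by (cases z) (simp add: k_def mult_ac del: of_real_add)
    ultimately have i: "integrable (lborel \<Otimes>\<^sub>M lborel) (\<lambda>z. ?\<gamma> z * weyl_shift (fst z + snd z) f x)" by (simp only:)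
    show ?thesis using lborel_pair.integral_fst'[OF i] by simp
  qed
  also have "\<dots> = (LINT \<zeta>|lborel. ?\<alpha> \<zeta> * weyl_shift \<zeta> (weyl b f) x)"
  proof (rule Bochner_Integration.integral_cong[OF refl])
    fix \<zeta> :: "'d phase"
    have wb: "weyl b f y = (LINT \<zeta>'|lborel. ?\<beta> \<zeta>' * weyl_shift \<zeta>' f y)" for y
      by (rule weyl_superposition[OF schwartz_rapid[OF al(2)] bounded_linear_ident t0[OF b] order_refl fcoeff_representation[OF b] t0[OF f] order_refl])
    have "weyl_shift \<zeta> (weyl b f) x = (LINT \<zeta>'|lborel. weyl_shift \<zeta> (\<lambda>y. ?\<beta> \<zeta>' * weyl_shift \<zeta>' f y) x)"
      unfolding weyl_shift_def[of \<zeta>] wb integral_mult_right_zero ..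
    also have "\<dots> = (LINT \<zeta>'|lborel. ?\<beta> \<zeta>' * (cocycle \<zeta> \<zeta>' * weyl_shift (\<zeta> + \<zeta>') f x))"
      unfolding weyl_shift_compose ..
    finally show "(LINT \<zeta>'|lborel. ?\<alpha> \<zeta> * ?\<beta> \<zeta>' * cocycle \<zeta> \<zeta>' * weyl_shift (\<zeta> + \<zeta>') f x) = ?\<alpha> \<zeta> * weyl_shift \<zeta> (weyl b f) x"
      by (simp add: mult.assoc)
  qed
  also have "\<dots> = weyl a (weyl b f) x"
    by (rule weyl_superposition[symmetric, OF schwartz_rapid[OF al(1)] bounded_linear_ident t0[OF a] order_refl fcoeff_representation[OF a]])
      (use tempered_weyl[OF t0[OF b] order_refl t0[OF f] order_refl] in auto)
  finally show ?thesis .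
qed

text \<open>Gaussian cutoffs of both symbols; the Weyl operators on the right are composed, which is why
  quantization has to be continuous in the symbol and in the function simultaneously (\<open>tconv_weyl\<close>).\<close>

theorem weyl_moyal:
  fixes a b :: "'d::finite phase \<Rightarrow> complex"
  assumes a: "tempered M a" "0 \<le> M" and b: "tempered M' b" "0 \<le> M'" and f: "f \<in> schwartz"
  shows "weyl (moyal a b) f = weyl a (weyl b f)"
proof
  fix x
  let ?g = "\<lambda>a k (u :: 'd phase). gauss ((1 / real (Suc k)) *\<^sub>R u) * a u"
  note ta = W.gauss_cutoff[OF a(1)] and tb = W.gauss_cutoff[OF b(1)]
  note sa = W.gauss_cutoff_schwartz[OF a(1)] and sb = W.gauss_cutoff_schwartz[OF b(1)]
  have tf: "tconv 0 (\<lambda>k. f) f" by (rule tconv_const[OF schwartz_tempered[OF f]])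
  have MM: "0 \<le> M + M'" using a b by simp
  have "tconv (M + M') (\<lambda>k. moyal (?g a k) (?g b k)) (moyal a b)"
    unfolding moyal_def by (rule S.tconv_twist[OF ta tb bounded_linear_fst bounded_linear_snd a(2) b(2)])
  from tconv_weyl[OF this MM tf]
  have 1: "(\<lambda>k. weyl (moyal (?g a k) (?g b k)) f x) \<longlonglongrightarrow> weyl (moyal a b) f x"
    by (intro dconv_value[OF tconv_dconv]) simp
  have M0: "0 \<le> M' + 0" using b by simp
  have 2: "(\<lambda>k. weyl (?g a k) (weyl (?g b k) f) x) \<longlonglongrightarrow> weyl a (weyl b f) x"
    by (rule dconv_value[OF tconv_dconv[OF tconv_weyl[OF ta a(2) tconv_weyl[OF tb b(2) tf order_refl] M0]]])
  show "weyl (moyal a b) f x = weyl a (weyl b f) x"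
    using LIMSEQ_unique[OF 1[unfolded weyl_moyal_schwartz[OF sa sb f]] 2] .
qed

section \<open>The symbol is determined by the operator\<close>

lemma ft_injective:
  fixes f :: "'a::euclidean_space \<Rightarrow> complex"
  assumes f: "f \<in> schwartz" and z: "\<And>\<zeta>. ft f \<zeta> = 0" shows "f x = 0"
  using ft_inversion[OF f, of x] by (simp add: z)

lemma gauss_scale: "gauss (sqrt 2 *\<^sub>R z) = of_real (exp (- (z \<bullet> z)))"
  by (simp add: gauss_def)

lemma gauss_scale_inv: "gauss (z /\<^sub>R sqrt 2) = of_real (exp (- (z \<bullet> z) / 4))"
  by (simp add: gauss_def field_simps)

text \<open>The test functions are Gaussians centred at \<open>h\<close> and \<open>-h\<close>, both modulated by \<open>k\<close>: their
  cross ambiguity function is then a translated Gaussian without oscillating factor.\<close>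

definition packet :: "real^'d \<Rightarrow> real^'d \<Rightarrow> real^'d::finite \<Rightarrow> complex" where
  "packet k h x = exponential k x * gauss (x - h)"

lemma packet_schwartz: "packet k h \<in> schwartz"
proof -
  have "(\<lambda>x. gauss (- h + x)) \<in> schwartz" by (rule schwartz_translate[OF gauss_schwartz])
  from schwartz_mult_tempered[OF this tempered_exponential[of k]] show ?thesis
    by (simp add: packet_def[abs_def] mult.commute)
qed

lemma packet_le_1: "cmod (packet k h x) \<le> 1"
  by (simp add: packet_def norm_mult gauss_def)

text \<open>Centring the variable at \<open>- q / 2\<close> makes the two Gaussians combine into one in \<open>s\<close> and one in
  \<open>h - q / 2\<close>; the modulations by \<open>k\<close> add up, since the packets are paired bilinearly, and
  the terms containing \<open>k \<bullet> q\<close> cancel.\<close>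

lemma packet_ambiguity:
  fixes k h :: "real^'d::finite"
  shows "\<exists>c\<noteq>0. \<forall>\<zeta>. (LINT x|lborel. packet k (- h) x * weyl_shift \<zeta> (packet k h) x)
    = c * gauss ((\<zeta> - (- 2 *\<^sub>R k, 2 *\<^sub>R h)) /\<^sub>R sqrt 2)"
proof (intro exI conjI allI)
  let ?m = "complex_of_real (gauss_mass TYPE(real^'d)) / of_real (sqrt 2 ^ CARD('d))"
  show "?m \<noteq> 0" using gauss_mass_pos[where 'a="real^'d"] by simp
  fix \<zeta> :: "'d phase"
  obtain p q where z: "\<zeta> = (p, q)" by (cases \<zeta>)
  define r where "r = (1/2) *\<^sub>R q"
  have q: "q = 2 *\<^sub>R r" by (simp add: r_def)
  let ?F = "\<lambda>x. packet k (- h) x * weyl_shift \<zeta> (packet k h) x"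
  have Fm: "?F \<in> borel_measurable borel"
  proof -
    have pc: "continuous_on UNIV (packet k' h')" for k' h' :: "real^'d"
      by (rule smooth_continuous_on[OF schwartz_smooth[OF packet_schwartz]])
    show ?thesis unfolding weyl_shift_def
      by (intro borel_measurable_continuous_onI continuous_intros continuous_on_compose2[OF pc]) auto
  qed
  have "?F (- r + s) = of_real (exp (- ((h - r) \<bullet> (h - r)))) * (gauss (sqrt 2 *\<^sub>R s) * cis (s \<bullet> (p + 2 *\<^sub>R k)))" for s
  proof -
    have g: "gauss (- r + s - - h) * gauss (- r + s + q - h) = of_real (exp (- ((h - r) \<bullet> (h - r)))) * gauss (sqrt 2 *\<^sub>R s)"
      unfolding gauss_scale gauss_def of_real_mult[symmetric] exp_add[symmetric]
      by (simp add: q scaleR_2 inner_add_left inner_add_right inner_diff_left inner_diff_right inner_commute field_simps)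
    have c: "exponential k (- r + s) * cis (p \<bullet> (- r + s + (1/2) *\<^sub>R q)) * exponential k (- r + s + q) = cis (s \<bullet> (p + 2 *\<^sub>R k))"
    proof -
      have e: "- r + s + (1/2) *\<^sub>R q = s" "- r + s + q = s + r" by (simp_all add: q scaleR_2)
      have "k \<bullet> (- r + s) + p \<bullet> s + k \<bullet> (s + r) = s \<bullet> (p + 2 *\<^sub>R k)"
        by (simp only: inner_add_right inner_minus_right inner_scaleR_right) (simp add: inner_commute)
      then show ?thesis unfolding exponential_def cis_mult e by (simp only:)
    qed
    have "?F (- r + s) = (exponential k (- r + s) * cis (p \<bullet> (- r + s + (1/2) *\<^sub>R q)) * exponential k (- r + s + q))
        * (gauss (- r + s - - h) * gauss (- r + s + q - h))"
      by (simp add: packet_def weyl_shift_def z mult_ac)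
    then show ?thesis unfolding g c by (simp only: mult_ac)
  qed
  then have "(LINT x|lborel. ?F x) = of_real (exp (- ((h - r) \<bullet> (h - r)))) * (LINT s|lborel. gauss (sqrt 2 *\<^sub>R s) * cis (s \<bullet> (p + 2 *\<^sub>R k)))"
    unfolding lborel_integral_translate(1)[OF Fm, of "- r", symmetric] by (simp only: integral_mult_right_zero)
  also have "(LINT s|lborel. gauss (sqrt 2 *\<^sub>R s) * cis (s \<bullet> (p + 2 *\<^sub>R k))) = ?m * gauss ((p + 2 *\<^sub>R k) /\<^sub>R sqrt 2)"
    using gauss_scaled_char_integral[of "sqrt 2" "p + 2 *\<^sub>R k"] by (simp add: field_simps)
  also have "of_real (exp (- ((h - r) \<bullet> (h - r)))) * (?m * gauss ((p + 2 *\<^sub>R k) /\<^sub>R sqrt 2))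
     = ?m * gauss ((\<zeta> - (- 2 *\<^sub>R k, 2 *\<^sub>R h)) /\<^sub>R sqrt 2)"
  proof -
    have "of_real (exp (- ((h - r) \<bullet> (h - r)))) * gauss ((p + 2 *\<^sub>R k) /\<^sub>R sqrt 2) = gauss ((\<zeta> - (- 2 *\<^sub>R k, 2 *\<^sub>R h)) /\<^sub>R sqrt 2)"
    proof -
      have e: "\<zeta> - (- 2 *\<^sub>R k, 2 *\<^sub>R h) = (p + 2 *\<^sub>R k, 2 *\<^sub>R (r - h))" by (simp add: z q scaleR_diff_right)
      have i: "(2 *\<^sub>R (r - h)) \<bullet> (2 *\<^sub>R (r - h)) = 4 * ((h - r) \<bullet> (h - r))"
        unfolding inner_scaleR_left inner_scaleR_right by (simp add: inner_diff_left inner_diff_right)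
      show ?thesis
        unfolding gauss_scale_inv of_real_mult[symmetric] exp_add[symmetric] e inner_prod_def fst_conv snd_conv i
        by (simp add: field_simps)
    qed
    then show ?thesis by (simp only: mult.left_commute[of "of_real _"])
  qed
  finally show "(LINT x|lborel. ?F x) = ?m * gauss ((\<zeta> - (- 2 *\<^sub>R k, 2 *\<^sub>R h)) /\<^sub>R sqrt 2)" .
qed

lemma gauss_shifted_schwartz: "(\<lambda>\<zeta>::'a::euclidean_space. gauss ((\<zeta> - \<zeta>0) /\<^sub>R sqrt 2)) \<in> schwartz"
proof -
  have "(\<lambda>\<zeta>::'a. gauss (inverse (sqrt 2) *\<^sub>R (- \<zeta>0 + \<zeta>))) \<in> schwartz"
    by (rule schwartz_translate[OF schwartz_scale[OF gauss_schwartz]]) simp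
  then show ?thesis by simp
qed

lemma ft_gauss_shifted:
  fixes z :: "'a::euclidean_space"
  shows "\<exists>c\<noteq>0. \<forall>z. ft (\<lambda>\<zeta>. gauss ((\<zeta> - \<zeta>0) /\<^sub>R sqrt 2)) z = c * (cis (- (\<zeta>0 \<bullet> z)) * gauss (sqrt 2 *\<^sub>R (z::'a)))"
proof (intro exI conjI allI)
  let ?e = "inverse (sqrt 2)"
  let ?m = "complex_of_real (gauss_mass TYPE('a)) / of_real (?e ^ DIM('a))"
  show "?m \<noteq> 0" using gauss_mass_pos[where 'a='a] by simp
  fix z :: 'a
  let ?F = "\<lambda>\<zeta>. gauss ((\<zeta> - \<zeta>0) /\<^sub>R sqrt 2) * cis (- (\<zeta> \<bullet> z))"
  have Fm: "?F \<in> borel_measurable borel"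
    using schwartz_measurable[OF gauss_shifted_schwartz[of \<zeta>0]] by measurable
  have "?F (\<zeta>0 + \<zeta>) = cis (- (\<zeta>0 \<bullet> z)) * (gauss (?e *\<^sub>R \<zeta>) * cis (\<zeta> \<bullet> - z))" for \<zeta>
  proof -
    have "cis (- ((\<zeta>0 + \<zeta>) \<bullet> z)) = cis (- (\<zeta>0 \<bullet> z)) * cis (\<zeta> \<bullet> - z)" unfolding cis_mult by (simp add: inner_add_left)
    then show ?thesis by (simp only: add_diff_cancel_left' mult_ac)
  qed
  then have "ft (\<lambda>\<zeta>. gauss ((\<zeta> - \<zeta>0) /\<^sub>R sqrt 2)) z = cis (- (\<zeta>0 \<bullet> z)) * (LINT \<zeta>|lborel. gauss (?e *\<^sub>R \<zeta>) * cis (\<zeta> \<bullet> - z))"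
    unfolding ft_def lborel_integral_translate(1)[OF Fm, of \<zeta>0, symmetric] by (simp only: integral_mult_right_zero)
  also have "(LINT \<zeta>|lborel. gauss (?e *\<^sub>R \<zeta>) * cis (\<zeta> \<bullet> - z)) = ?m * gauss ((- z) /\<^sub>R ?e)"
    using gauss_scaled_char_integral[of ?e "- z"] by (simp add: field_simps)
  also have "gauss ((- z) /\<^sub>R ?e) = gauss (sqrt 2 *\<^sub>R z)" by (simp add: gauss_def)
  finally show "ft (\<lambda>\<zeta>. gauss ((\<zeta> - \<zeta>0) /\<^sub>R sqrt 2)) z = ?m * (cis (- (\<zeta>0 \<bullet> z)) * gauss (sqrt 2 *\<^sub>R z))"
    by (simp only: mult.left_commute)
qed

text \<open>Pairing the operator with two packets gives an integral of the Fourier transform of \<open>d\<close> against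
  their ambiguity function, that is, of \<open>d\<close> against the transform of a Gaussian centred at \<open>\<zeta>\<^sub>0\<close>. This is the
  value at \<open>\<zeta>\<^sub>0\<close> of the Fourier transform of \<open>d\<close> times a Gaussian, up to a nonzero factor. The
  computation is done for Gaussian cutoffs of \<open>d\<close>, which are Schwartz functions.\<close>

theorem weyl_symbol_unique:
  fixes d :: "'d::finite phase \<Rightarrow> complex"
  assumes d: "tempered M d" and M: "0 \<le> M" and z: "\<And>f x. f \<in> schwartz \<Longrightarrow> weyl d f x = 0"
  shows "d w = 0"
proof -
  let ?d = "\<lambda>k (u :: 'd phase). gauss ((1 / real (Suc k)) *\<^sub>R u) * d u"
  let ?D = "\<lambda>z. gauss (sqrt 2 *\<^sub>R z) * d z"
  note td = W.gauss_cutoff[OF d] and sd = W.gauss_cutoff_schwartz[OF d]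
  have gs: "(\<lambda>z::'d phase. gauss (sqrt 2 *\<^sub>R z)) \<in> schwartz" by (rule schwartz_scale[OF gauss_schwartz]) simp
  have D: "?D \<in> schwartz" by (rule schwartz_mult_tempered[OF gs d])
  have "ft ?D \<zeta>0 = 0" for \<zeta>0 :: "'d phase"
  proof -
    \<comment> \<open>The packets whose ambiguity function is centred at \<open>\<zeta>0\<close>.\<close>
    define k where "k = (- 1/2) *\<^sub>R fst \<zeta>0"
    define h where "h = (1/2) *\<^sub>R snd \<zeta>0"
    have kh: "(- 2 *\<^sub>R k, 2 *\<^sub>R h) = \<zeta>0" by (simp add: k_def h_def)
    let ?f = "packet k h" and ?g = "packet k (- h)"
    obtain c where c: "c \<noteq> 0" "\<And>\<zeta>. (LINT x|lborel. ?g x * weyl_shift \<zeta> ?f x) = c * gauss ((\<zeta> - \<zeta>0) /\<^sub>R sqrt 2)"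
      using packet_ambiguity[of k h] unfolding kh by blast
    obtain c' where c': "c' \<noteq> 0" "\<And>z. ft (\<lambda>\<zeta>. gauss ((\<zeta> - \<zeta>0) /\<^sub>R sqrt 2)) z = c' * (cis (- (\<zeta>0 \<bullet> z)) * gauss (sqrt 2 *\<^sub>R z))"
      using ft_gauss_shifted[of \<zeta>0] by blast
    let ?G = "\<lambda>\<zeta>::'d phase. gauss ((\<zeta> - \<zeta>0) /\<^sub>R sqrt 2)"
    let ?\<kappa> = "complex_of_real (1 / (2 * pi) ^ DIM('d phase))"
    have G: "?G \<in> schwartz" by (rule gauss_shifted_schwartz)
    have pair: "(LINT x|lborel. weyl (?d n) ?f x * ?g x) = (?\<kappa> * c) * (LINT z|lborel. ?d n z * ft ?G z)" for n
    proof -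
      let ?\<delta> = "fcoeff (?d n)"
      have dl: "?\<delta> \<in> schwartz" by (rule fcoeff_schwartz[OF sd])
      have km: "(\<lambda>p. weyl_shift (fst p) ?f (snd p)) \<in> borel_measurable borel"
      proof -
        have pc: "continuous_on UNIV ?f" by (rule smooth_continuous_on[OF schwartz_smooth[OF packet_schwartz]])
        show ?thesis unfolding weyl_shift_def
          by (intro borel_measurable_continuous_onI continuous_intros continuous_on_compose2[OF pc]) auto
      qed
      have w: "weyl (?d n) ?f x = (LINT \<zeta>|lborel. ?\<delta> \<zeta> * weyl_shift \<zeta> ?f x)" for x
        by (rule weyl_superposition[OF schwartz_rapid[OF dl] bounded_linear_ident schwartz_tempered[OF sd] order_refl
          fcoeff_representation[OF sd] schwartz_tempered[OF packet_schwartz] order_refl])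
      have "(LINT x|lborel. weyl (?d n) ?f x * ?g x) = (LINT x|lborel. (LINT \<zeta>|lborel. ?\<delta> \<zeta> * (?g x * weyl_shift \<zeta> ?f x)))"
        unfolding w by (simp only: integral_mult_left_zero[symmetric] mult.assoc mult.commute[of "weyl_shift _ _ _"])
      also have "\<dots> = (LINT \<zeta>|lborel. (LINT x|lborel. ?\<delta> \<zeta> * (?g x * weyl_shift \<zeta> ?f x)))"
      proof -
        have "cmod ((\<lambda>p. weyl_shift (fst p) ?f (snd p)) (\<zeta>, x)) \<le> 1" for \<zeta> x
          using packet_le_1 by (simp add: weyl_shift_def norm_mult)
        from schwartz_Fubini[OF dl packet_schwartz[of k "- h"] km this] show ?thesis by (simp only: fst_conv snd_conv)
      qed
      also have "\<dots> = (LINT \<zeta>|lborel. (?\<kappa> * c) * (ft (?d n) \<zeta> * ?G \<zeta>))"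
        unfolding integral_mult_right_zero c(2) fcoeff_def by (simp only: mult_ac integral_mult_right_zero[symmetric])
      also have "\<dots> = (?\<kappa> * c) * (LINT z|lborel. ?d n z * ft ?G z)"
        unfolding integral_mult_right_zero ft_swap[OF sd G] ..
      finally show ?thesis .
    qed
    have M0: "0 \<le> (0::real)" by simp
    have "tconv (M + 0) (\<lambda>n. weyl (?d n) ?f) (weyl d ?f)"
      by (rule tconv_weyl[OF td M tconv_const[OF schwartz_tempered[OF packet_schwartz]] M0])
    from integral_schwartz_tendsto[OF this packet_schwartz[of k "- h"]]
    have "(\<lambda>n. (?\<kappa> * c) * (LINT z|lborel. ?d n z * ft ?G z)) \<longlonglongrightarrow> 0"
      unfolding pair by (simp add: z[OF packet_schwartz])
    moreover have "(\<lambda>n. (?\<kappa> * c) * (LINT z|lborel. ?d n z * ft ?G z)) \<longlonglongrightarrow> (?\<kappa> * c) * (LINT z|lborel. d z * ft ?G z)"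
      by (intro tendsto_mult tendsto_const integral_schwartz_tendsto[OF td ft_schwartz[OF G]])
    ultimately have "(?\<kappa> * c) * (LINT z|lborel. d z * ft ?G z) = 0" using LIMSEQ_unique by blast
    then have "(LINT z|lborel. d z * ft ?G z) = 0" using c(1) by simp
    moreover have "d z * ft ?G z = c' * (?D z * cis (- (z \<bullet> \<zeta>0)))" for z
      unfolding c'(2) by (simp only: inner_commute[of \<zeta>0] mult_ac)
    ultimately have "c' * (LINT z|lborel. ?D z * cis (- (z \<bullet> \<zeta>0))) = 0" by (simp only: integral_mult_right_zero)
    then show ?thesis using c'(1) by (simp add: ft_def)
  qed
  from ft_injective[OF D this, of w] show ?thesis by (simp add: gauss_def)
qed

section \<open>Continuity of the Weyl product\<close>

lemma moyal_shubin:
  assumes s: "0 < s" and a: "a \<in> shubin m s" and b: "b \<in> shubin n s"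
  shows "moyal a b \<in> shubin (m + n) s"
  unfolding moyal_def by (rule S.twist_shubin(1)[OF s bounded_linear_fst bounded_linear_snd a b])

lemma shubin_moderate:
  assumes "0 < s" "a \<in> shubin m s" shows "tempered (mu_exp s * \<bar>m\<bar>) a" "0 \<le> mu_exp s * \<bar>m\<bar>"
  using shubin_tempered[OF assms] by (simp_all add: mu_exp_def)

text \<open>The definite description ranges over symbols of all orders and anisotropies; any two of them are
  tempered with a common exponent, so that uniqueness applies to their difference.\<close>

lemma weyl_product_eq_moyal:
  fixes a b :: "'d::finite phase \<Rightarrow> complex"
  assumes s: "0 < s" and a: "a \<in> shubin m s" and b: "b \<in> shubin n s"
  shows "weyl_product a b = moyal a b"
proof -
  have comp: "weyl (moyal a b) f = weyl a (weyl b f)" if "f \<in> schwartz" for f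
    by (rule weyl_moyal[OF shubin_moderate[OF s a] shubin_moderate[OF s b] that])
  show ?thesis unfolding weyl_product_def
  proof (rule the_equality)
    show "(\<exists>k r. 0 < r \<and> moyal a b \<in> shubin k r) \<and> (\<forall>f\<in>schwartz. weyl (moyal a b) f = weyl a (weyl b f))"
      using comp moyal_shubin[OF s a b] s by blast
    fix c assume c: "(\<exists>k r. 0 < r \<and> c \<in> shubin k r) \<and> (\<forall>f\<in>schwartz. weyl c f = weyl a (weyl b f))"
    then obtain k r where kr: "0 < r" "c \<in> shubin k r" by blast
    define M where "M = mu_exp r * \<bar>k\<bar> + mu_exp s * \<bar>m + n\<bar>"
    have M: "0 \<le> M" by (simp add: M_def mu_exp_def)
    have tc: "tempered M c" by (rule tempered_mono[OF shubin_moderate(1)[OF kr]]) (simp add: M_def mu_exp_def)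
    have tm: "tempered M (moyal a b)" by (rule tempered_mono[OF shubin_moderate(1)[OF s moyal_shubin[OF s a b]]]) (simp add: M_def mu_exp_def)
    have td: "tempered M (\<lambda>z. c z - moyal a b z)" using tempered_add[OF tc tempered_cmult[OF tm, of "-1"]] by simp
    have "weyl (\<lambda>z. c z - moyal a b z) f x = 0" if f: "f \<in> schwartz" for f x
      unfolding weyl_diff[OF tc tm M schwartz_tempered[OF f] order_refl] using c comp[OF f] f by simp
    from weyl_symbol_unique[OF td M this] show "c = moyal a b" by (simp add: fun_eq_iff)
  qed
qed

lemma moyal_linear:
  fixes a a' b b' :: "'d::finite phase \<Rightarrow> complex"
  assumes s: "0 < s" and a: "a \<in> shubin m s" "a' \<in> shubin m s" and b: "b \<in> shubin n s" "b' \<in> shubin n s"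
  shows "moyal (\<lambda>z. a z + a' z) b = (\<lambda>z. moyal a b z + moyal a' b z)"
    "moyal a (\<lambda>z. b z + b' z) = (\<lambda>z. moyal a b z + moyal a b' z)"
    "moyal (\<lambda>z. c * a z) b = (\<lambda>z. c * moyal a b z)"
    "moyal a (\<lambda>z. c * b z) = (\<lambda>z. c * moyal a b z)"
proof -
  note L = bounded_linear_fst bounded_linear_snd
  note ta = shubin_moderate[OF s a(1)] shubin_moderate(1)[OF s a(2)] and tb = shubin_moderate[OF s b(1)] shubin_moderate(1)[OF s b(2)]
  show "moyal (\<lambda>z. a z + a' z) b = (\<lambda>z. moyal a b z + moyal a' b z)"
    unfolding moyal_def by (rule ext) (rule S.twist_add_left[OF ta(1) ta(3) tb(1) L ta(2) tb(2)])
  show "moyal a (\<lambda>z. b z + b' z) = (\<lambda>z. moyal a b z + moyal a b' z)"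
    unfolding moyal_def by (rule ext) (rule S.twist_add_right[OF ta(1) tb(1) tb(3) L ta(2) tb(2)])
  show "moyal (\<lambda>z. c * a z) b = (\<lambda>z. c * moyal a b z)"
    unfolding moyal_def by (rule ext) (rule S.twist_cmult(1)[OF ta(1) tb(1) L ta(2) tb(2)])
  show "moyal a (\<lambda>z. c * b z) = (\<lambda>z. c * moyal a b z)"
    unfolding moyal_def by (rule ext) (rule S.twist_cmult(2)[OF ta(1) tb(1) L ta(2) tb(2)])
qed

theorem moyal_continuous:
  assumes s: "0 < s"
  shows "continuous_map (prod_topology (shubin_topology m s :: ('d::finite phase \<Rightarrow> complex) topology) (shubin_topology n s))
    (shubin_topology (m + n) s) (\<lambda>(a, b). moyal a b)"
proof (rule continuous_map_shubin_bilinear)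
  fix a a' b b' :: "'d phase \<Rightarrow> complex" and z
  assume a: "a \<in> shubin m s" and b: "b \<in> shubin n s"
  show "moyal a b \<in> shubin (m + n) s" by (rule moyal_shubin[OF s a b])
  show "moyal (\<lambda>z. a z - a' z) b z = moyal a b z - moyal a' b z" if "a' \<in> shubin m s"
    using moyal_linear(1)[OF s a shubin_cmult(1)[OF that, of "-1"] b b] moyal_linear(3)[OF s that that b b, of "-1"] by simp
  show "moyal a (\<lambda>z. b z - b' z) z = moyal a b z - moyal a b' z" if "b' \<in> shubin n s"
    using moyal_linear(2)[OF s a a b shubin_cmult(1)[OF that, of "-1"]] moyal_linear(4)[OF s a a that that, of "-1"] by simp
next
  fix j
  show "\<exists>C N. \<forall>a\<in>shubin m s. \<forall>b\<in>shubin n s. shubin_seminorm (m + n) s j (moyal a b :: 'd phase \<Rightarrow> complex)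
      \<le> C * (shubin_seminorm m s N a * shubin_seminorm n s N b)"
    unfolding moyal_def by (rule S.twist_shubin(2)[OF s bounded_linear_fst bounded_linear_snd])
qed

theorem proposition3p3:
  fixes s m n :: real
  assumes "s > 0"
  shows "(\<forall>t::real. \<exists>T :: ('d::finite phase \<Rightarrow> complex) \<Rightarrow> ('d phase \<Rightarrow> complex).
            (\<forall>a \<in> shubin m s. T a \<in> shubin m s \<and> distr_of (T a) = exp_itD t (distr_of a)) \<and>
            continuous_map (shubin_topology m s) (shubin_topology m s) T)
       \<and> ((\<forall>a \<in> (shubin m s :: ('d phase \<Rightarrow> complex) set). \<forall>b \<in> shubin n s.
             weyl_product a b \<in> shubin (m + n) s \<and>
             (\<forall>f \<in> schwartz. weyl (weyl_product a b) f = weyl a (weyl b f))) \<and>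
          bilinear_on (shubin m s :: ('d phase \<Rightarrow> complex) set) (shubin n s) weyl_product \<and>
          continuous_map
            (prod_topology (shubin_topology m s :: ('d phase \<Rightarrow> complex) topology) (shubin_topology n s))
            (shubin_topology (m + n) s)
            (\<lambda>(a, b). weyl_product a b))"
proof (intro conjI allI ballI)
  show "\<exists>T :: ('d phase \<Rightarrow> complex) \<Rightarrow> ('d phase \<Rightarrow> complex).
            (\<forall>a \<in> shubin m s. T a \<in> shubin m s \<and> distr_of (T a) = exp_itD t (distr_of a)) \<and>
            continuous_map (shubin_topology m s) (shubin_topology m s) T" for t
    by (rule multiplier_continuous[OF assms])
  note eq = weyl_product_eq_moyal[OF assms, where m = m and n = n]
  fix a b :: "'d phase \<Rightarrow> complex" assume a: "a \<in> shubin m s" and b: "b \<in> shubin n s"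
  show "weyl_product a b \<in> shubin (m + n) s" unfolding eq[OF a b] by (rule moyal_shubin[OF assms a b])
  show "weyl (weyl_product a b) f = weyl a (weyl b f)" if "f \<in> schwartz" for f
    unfolding eq[OF a b] by (rule weyl_moyal[OF shubin_moderate[OF assms a] shubin_moderate[OF assms b] that])
next
  note eq = weyl_product_eq_moyal[OF assms, where m = m and n = n]
  show "bilinear_on (shubin m s :: ('d phase \<Rightarrow> complex) set) (shubin n s) weyl_product"
    unfolding bilinear_on_def
    by (intro conjI ballI allI) (simp_all add: eq moyal_linear[OF assms] shubin_add(1) shubin_cmult(1))
  show "continuous_map (prod_topology (shubin_topology m s :: ('d phase \<Rightarrow> complex) topology) (shubin_topology n s))
            (shubin_topology (m + n) s) (\<lambda>(a, b). weyl_product a b)"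
    by (rule continuous_map_eq[OF moyal_continuous[OF assms]]) (auto simp: topspace_shubin eq)
qed

end
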